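(* Let $1<p<\infty$ and $\alpha>-1$. There are constants depending only on $n$, $p$ and $\alpha$ such that for every $S\in\mathcal{T}_{p,\alpha}$, $$\mathfrak{a}_S\approx\mathfrak{b}_S\approx\mathfrak{c}_S\approx\|S\|_e,$$ that is, each of these four quantities is bounded by such a constant times each of the others.
   Context: Let $n\ge 1$, let $\mathbb{B}_n$ be the open unit ball of $\mathbb{C}^n$. For $z,w\in\mathbb{C}^n$, $\overline{w}z=z\overline{w}$ denotes $\sum_i z_i\overline{w_i}$. Let $v$ be Lebesgue measure on $\mathbb{B}_n$ normalized by $v(\mathbb{B}_n)=1$, and $dv_\alpha(z)=c_\alpha(1-|z|^2)^\alpha\,dv(z)$ with $c_\alpha=\frac{\Gamma(n+\alpha+1)}{n!\,\Gamma(\alpha+1)}$. $L^p_\alpha=L^p(\mathbb{B}_n,v_\alpha)$, and $A^p_\alpha$ is the closed subspace of holomorphic functions in $L^p_\alpha$. $\mathcal{L}(X,Y)$ is the space of bounded linear operators $X\to Y$. For $a\in L^\infty(\mathbb{B}_n)$, $T_af=P_\alpha(af)$ where $P_\alpha f(z)=\int_{\mathbb{B}_n}\frac{f(w)}{(1-z\overline{w})^{n+1+\alpha}}\,dv_\alpha(w)$. The Toeplitz algebra $\mathcal{T}_{p,\alpha}$ is the norm-closed subalgebra of $\mathcal{L}(A^p_\alpha,A^p_\alpha)$ generated by $\{T_a:a\in L^\infty(\mathbb{B}_n)\}$. For a measure $\nu$ on $\mathbb{B}_n$, $T_\nu f(z)=\int_{\mathbb{B}_n}\frac{f(w)}{(1-\overline{w}z)^{n+1+\alpha}}\,d\nu(w)$;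 $1_E$ is the indicator function of $E$, $\nu1_E$ is the restriction of $\nu$ to $E$, and $M_a$ is multiplication by $a$. $\varphi_z$ is the involutive automorphism of $\mathbb{B}_n$ with $\varphi_z(0)=z$, $\rho(z,w)=|\varphi_z(w)|$, $\beta(z,w)=\frac12\log\frac{1+\rho(z,w)}{1-\rho(z,w)}$, and $D(z,r)=\{w\in\mathbb{B}_n:\beta(z,w)\le r\}$ for $r>0$. Choice of $\mu$: for each $\varrho>0$ there are Borel sets $D_m\subset\mathbb{B}_n$ and points $w_m$ $(m\ge1)$ such that $D(w_m,\varrho/4)\subset D_m\subset D(w_m,\varrho)$ for all $m$, the $D_m$ are pairwise disjoint, and $\bigcup_mD_m=\mathbb{B}_n$. Put $\mu_\varrho=\sum_{m}v_\alpha(D_m)\delta_{w_m}$. One has $T_{\mu_\varrho}\to \mathrm{Id}_{A^p_\alpha}$ in operator norm as $\varrho\to0$. Fix $0<\varrho\le1$ with $\|T_{\mu_\varrho}-\mathrm{Id}_{A^p_\alpha}\|_{\mathcal{L}(A^p_\alpha,A^p_\alpha)}<\frac14$ and set $\mu=\mu_\varrho$. For $S\in\mathcal{L}(A^p_\alpha,A^p_\alpha)$ and $r>0$ let $$\mathfrak{a}_S(r)=\limsup_{|z|\to1}\,\sup\{\|Sf\|_{A^p_\alpha}:f\in T_{\mu1_{D(z,r)}}(A^p_\alpha),\ \|f\|_{A^p_\alpha}\le1\},\qquad \mathfrak{a}_S=\lim_{r\to\infty}\mathfrak{a}_S(r)$$ (the limit exists since $\mathfrak{a}_S(r)$ is nondecreasing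 in $r$ and bounded by $\|S\|$), $$\mathfrak{b}_S=\sup_{r>0}\,\limsup_{|z|\to1}\|M_{1_{D(z,r)}}S\|_{\mathcal{L}(A^p_\alpha,L^p_\alpha)},\qquad \mathfrak{c}_S=\lim_{r\to1}\|M_{1_{\mathbb{B}_n\setminus r\mathbb{B}_n}}S\|_{\mathcal{L}(A^p_\alpha,L^p_\alpha)},$$ and $\|S\|_e=\inf\{\|S-Q\|_{\mathcal{L}(A^p_\alpha,A^p_\alpha)}:Q\text{ compact}\}$. *)

theory Defs
  imports "HOL-Analysis.Analysis"
begin

definition herm :: "complex^'n \<Rightarrow> complex^'n \<Rightarrow> complex" where
  "herm z w = (\<Sum>i\<in>UNIV. z $ i * cnj (w $ i))"

(* Functions on the unit ball are represented by total functions on \<complex>\<^sup>n; since the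
   measure is carried by the ball, values elsewhere are irrelevant for the L\<^sup>p spaces. *)
definition bergman_measure :: "real \<Rightarrow> (complex^'n) measure" where
  "bergman_measure \<alpha> = density (uniform_measure lborel (ball 0 1))
     (\<lambda>z. ennreal (Gamma (real CARD('n) + \<alpha> + 1) / (fact CARD('n) * Gamma (\<alpha> + 1))
                   * (1 - (norm z)\<^sup>2) powr \<alpha>))"

definition Lp :: "real \<Rightarrow> real \<Rightarrow> (complex^'n \<Rightarrow> complex) set" where
  "Lp p \<alpha> = {f. f \<in> borel_measurable (bergman_measure \<alpha>)
             \<and> integrable (bergman_measure \<alpha>) (\<lambda>z. norm (f z) powr p)}"

definition Lp_norm :: "real \<Rightarrow> real \<Rightarrow> (complex^'n \<Rightarrow> complex) \<Rightarrow> ereal" where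
  "Lp_norm p \<alpha> f = (if f \<in> Lp p \<alpha>
     then ereal ((\<integral>z. norm (f z) powr p \<partial>bergman_measure \<alpha>) powr (1 / p)) else \<infinity>)"

definition Linf :: "(complex^'n \<Rightarrow> complex) set" where
  "Linf = {a. a \<in> borel_measurable (uniform_measure lborel (ball 0 1))
            \<and> (\<exists>K. AE z in uniform_measure lborel (ball 0 1). norm (a z) \<le> K)}"

(* Complex differentiability: the real derivative exists and is complex linear. *)
definition holomorphic_several :: "(complex^'n \<Rightarrow> complex) \<Rightarrow> (complex^'n) set \<Rightarrow> bool" where
  "holomorphic_several f U \<longleftrightarrow>
     (\<forall>z\<in>U. \<exists>L. (f has_derivative L) (at z) \<and> (\<forall>c h. L (c *s h) = c * L h))"

(* Extension by zero gives each element of the space exactly one representative. *)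
definition bergman_space :: "real \<Rightarrow> real \<Rightarrow> (complex^'n \<Rightarrow> complex) set" where
  "bergman_space p \<alpha> = {f \<in> Lp p \<alpha>. holomorphic_several f (ball 0 1) \<and> (\<forall>z. z \<notin> ball 0 1 \<longrightarrow> f z = 0)}"

(* The norm of an operator from the Bergman space to L\<^sup>p (or to the Bergman space, which
   carries the same norm). Only the values of T on the Bergman space matter; operators are
   never compared by equality of HOL functions. *)
definition op_norm ::
  "real \<Rightarrow> real \<Rightarrow> ((complex^'n \<Rightarrow> complex) \<Rightarrow> (complex^'n \<Rightarrow> complex)) \<Rightarrow> ereal" where
  "op_norm p \<alpha> T = (SUP f\<in>{f \<in> bergman_space p \<alpha>. Lp_norm p \<alpha> f \<le> 1}. Lp_norm p \<alpha> (T f))"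

definition bounded_ops ::
  "real \<Rightarrow> real \<Rightarrow> ((complex^'n \<Rightarrow> complex) \<Rightarrow> (complex^'n \<Rightarrow> complex)) set" where
  "bounded_ops p \<alpha> = {T.
     (\<forall>f\<in>bergman_space p \<alpha>. T f \<in> bergman_space p \<alpha>) \<and>
     (\<forall>f\<in>bergman_space p \<alpha>. \<forall>g\<in>bergman_space p \<alpha>. \<forall>c.
        T (\<lambda>z. c * f z + g z) = (\<lambda>z. c * T f z + T g z)) \<and>
     op_norm p \<alpha> T < \<infinity>}"

definition compact_ops ::
  "real \<Rightarrow> real \<Rightarrow> ((complex^'n \<Rightarrow> complex) \<Rightarrow> (complex^'n \<Rightarrow> complex)) set" where
  "compact_ops p \<alpha> = {Q \<in> bounded_ops p \<alpha>.
     \<forall>f :: nat \<Rightarrow> complex^'n \<Rightarrow> complex.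
       (\<forall>k. f k \<in> bergman_space p \<alpha> \<and> Lp_norm p \<alpha> (f k) \<le> 1) \<longrightarrow>
       (\<exists>s g. strict_mono s \<and> g \<in> bergman_space p \<alpha> \<and>
          (\<lambda>k. Lp_norm p \<alpha> (\<lambda>z. Q (f (s k)) z - g z)) \<longlonglongrightarrow> 0)}"

(* The integral operator with symbol the measure nu. The complex power is the principal
   branch, which is the intended one as Re (1 - herm z w) > 0 for z, w in the ball. *)
definition toeplitz_measure ::
  "real \<Rightarrow> (complex^'n) measure \<Rightarrow> (complex^'n \<Rightarrow> complex) \<Rightarrow> (complex^'n \<Rightarrow> complex)" where
  "toeplitz_measure \<alpha> \<nu> f = (\<lambda>z. if z \<in> ball 0 1
     then \<integral>w. f w / (1 - herm z w) powr of_real (real CARD('n) + 1 + \<alpha>) \<partial>\<nu> else 0)"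

definition bergman_projection ::
  "real \<Rightarrow> (complex^'n \<Rightarrow> complex) \<Rightarrow> (complex^'n \<Rightarrow> complex)" where
  "bergman_projection \<alpha> = toeplitz_measure \<alpha> (bergman_measure \<alpha>)"

definition mult_op ::
  "(complex^'n \<Rightarrow> complex) \<Rightarrow> (complex^'n \<Rightarrow> complex) \<Rightarrow> (complex^'n \<Rightarrow> complex)" where
  "mult_op a f = (\<lambda>z. a z * f z)"

definition toeplitz ::
  "real \<Rightarrow> (complex^'n \<Rightarrow> complex) \<Rightarrow> (complex^'n \<Rightarrow> complex) \<Rightarrow> (complex^'n \<Rightarrow> complex)" where
  "toeplitz \<alpha> a f = bergman_projection \<alpha> (mult_op a f)"

inductive_set toeplitz_algebra ::
  "real \<Rightarrow> real \<Rightarrow> ((complex^'n \<Rightarrow> complex) \<Rightarrow> (complex^'n \<Rightarrow> complex)) set"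
  for p \<alpha> :: real where
  generator: "a \<in> Linf \<Longrightarrow> toeplitz \<alpha> a \<in> toeplitz_algebra p \<alpha>"
| add: "S \<in> toeplitz_algebra p \<alpha> \<Longrightarrow> T \<in> toeplitz_algebra p \<alpha> \<Longrightarrow>
    (\<lambda>f z. S f z + T f z) \<in> toeplitz_algebra p \<alpha>"
| scale: "S \<in> toeplitz_algebra p \<alpha> \<Longrightarrow> (\<lambda>f z. c * S f z) \<in> toeplitz_algebra p \<alpha>"
| compose: "S \<in> toeplitz_algebra p \<alpha> \<Longrightarrow> T \<in> toeplitz_algebra p \<alpha> \<Longrightarrow>
    S \<circ> T \<in> toeplitz_algebra p \<alpha>"
| limit: "(\<And>m :: nat. T m \<in> toeplitz_algebra p \<alpha>) \<Longrightarrow> S \<in> bounded_ops p \<alpha> \<Longrightarrow>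
    (\<lambda>m. op_norm p \<alpha> (\<lambda>f z. T m f z - S f z)) \<longlonglongrightarrow> 0 \<Longrightarrow> S \<in> toeplitz_algebra p \<alpha>"

(* The usual formula (z - P w - sqrt (1 - |z|^2) Q w) / (1 - <w,z>), where P is the orthogonal
   projection onto the line spanned by z and Q = I - P. For z = 0 the convention x / 0 = 0
   makes P = 0, so that the map is w \<mapsto> -w. *)
definition ball_aut :: "complex^'n \<Rightarrow> complex^'n \<Rightarrow> complex^'n" where
  "ball_aut z w = (let Pw = (herm w z / herm z z) *s z; Qw = w - Pw in
     (1 / (1 - herm w z)) *s (z - Pw - of_real (sqrt (1 - (norm z)\<^sup>2)) *s Qw))"

definition pseudo_hyp :: "complex^'n \<Rightarrow> complex^'n \<Rightarrow> real" where
  "pseudo_hyp z w = norm (ball_aut z w)"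

definition bergman_metric :: "complex^'n \<Rightarrow> complex^'n \<Rightarrow> real" where
  "bergman_metric z w = 1 / 2 * ln ((1 + pseudo_hyp z w) / (1 - pseudo_hyp z w))"

definition bergman_ball :: "complex^'n \<Rightarrow> real \<Rightarrow> (complex^'n) set" where
  "bergman_ball z r = {w \<in> ball 0 1. bergman_metric z w \<le> r}"

(* The sum over m of v\<^sub>\<alpha>(D m) times the unit point mass at w m, written as the image under w
   of a weighted counting measure on the index set. *)
definition lattice_measure ::
  "real \<Rightarrow> (nat \<Rightarrow> (complex^'n) set) \<Rightarrow> (nat \<Rightarrow> complex^'n) \<Rightarrow> (complex^'n) measure" where
  "lattice_measure \<alpha> D w =
     distr (density (count_space UNIV) (\<lambda>m. emeasure (bergman_measure \<alpha>) (D m))) borel w"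

definition admissible_lattice ::
  "real \<Rightarrow> real \<Rightarrow> real \<Rightarrow> (nat \<Rightarrow> (complex^'n) set) \<Rightarrow> (nat \<Rightarrow> complex^'n) \<Rightarrow> bool" where
  "admissible_lattice p \<alpha> \<rho> D w \<longleftrightarrow>
     0 < \<rho> \<and> \<rho> \<le> 1 \<and>
     (\<forall>m. D m \<in> sets borel \<and> w m \<in> ball 0 1 \<and>
          bergman_ball (w m) (\<rho> / 4) \<subseteq> D m \<and> D m \<subseteq> bergman_ball (w m) \<rho>) \<and>
     disjoint_family D \<and> (\<Union>m. D m) = ball 0 1 \<and>
     op_norm p \<alpha> (\<lambda>f z. toeplitz_measure \<alpha> (lattice_measure \<alpha> D w) f z - f z) < 1 / 4"

(* The filter "|z| tends to 1 with z in the ball". *)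
definition to_sphere :: "(complex^'n) filter" where
  "to_sphere = filtercomap norm (at_left 1)"

definition a_radius ::
  "real \<Rightarrow> real \<Rightarrow> (complex^'n) measure \<Rightarrow>
   ((complex^'n \<Rightarrow> complex) \<Rightarrow> (complex^'n \<Rightarrow> complex)) \<Rightarrow> real \<Rightarrow> ereal" where
  "a_radius p \<alpha> \<mu> S r = Limsup to_sphere (\<lambda>z.
     SUP f\<in>{f \<in> toeplitz_measure \<alpha> (density \<mu> (indicator (bergman_ball z r))) ` bergman_space p \<alpha>.
            Lp_norm p \<alpha> f \<le> 1}. Lp_norm p \<alpha> (S f))"

definition a_quantity ::
  "real \<Rightarrow> real \<Rightarrow> (complex^'n) measure \<Rightarrow>
   ((complex^'n \<Rightarrow> complex) \<Rightarrow> (complex^'n \<Rightarrow> complex)) \<Rightarrow> ereal" where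
  "a_quantity p \<alpha> \<mu> S = Lim at_top (a_radius p \<alpha> \<mu> S)"

definition b_quantity ::
  "real \<Rightarrow> real \<Rightarrow> ((complex^'n \<Rightarrow> complex) \<Rightarrow> (complex^'n \<Rightarrow> complex)) \<Rightarrow> ereal" where
  "b_quantity p \<alpha> S = (SUP r\<in>{0<..}.
     Limsup to_sphere (\<lambda>z. op_norm p \<alpha> (mult_op (indicator (bergman_ball z r)) \<circ> S)))"

definition c_quantity ::
  "real \<Rightarrow> real \<Rightarrow> ((complex^'n \<Rightarrow> complex) \<Rightarrow> (complex^'n \<Rightarrow> complex)) \<Rightarrow> ereal" where
  "c_quantity p \<alpha> S =
     Lim (at_left 1) (\<lambda>r. op_norm p \<alpha> (mult_op (indicator (ball 0 1 - ball 0 r)) \<circ> S))"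

definition ess_norm ::
  "real \<Rightarrow> real \<Rightarrow> ((complex^'n \<Rightarrow> complex) \<Rightarrow> (complex^'n \<Rightarrow> complex)) \<Rightarrow> ereal" where
  "ess_norm p \<alpha> S = (INF Q\<in>compact_ops p \<alpha>. op_norm p \<alpha> (\<lambda>f z. S f z - Q f z))"

end

theory Submission
 imports Defs "HOL-Complex_Analysis.Complex_Analysis"
begin

text \<open>
 Everything is compared with \<open>c\<close>. By a weighted Schur test, the Bergman projection, and with it \<open>S P\<close> for
 every \<open>S\<close> in the Toeplitz algebra, almost commutes with a family of weights \<open>\<phi>\<^sub>j\<close> on the ball such that
 \<open>\<Sum>\<^sub>j \<phi>\<^sub>j\<^sup>p\<close> is comparable to 1, provided the family varies slowly in the Bergman metric. There are such
 families whose members have supports of uniformly bounded hyperbolic diameter. Summing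
 \<open>\<parallel>\<phi>\<^sub>j S f\<parallel>\<^sup>p \<approx> \<parallel>S P \<phi>\<^sub>j f\<parallel>\<^sup>p\<close> over the weights supported near the sphere bounds \<open>c\<close> by \<open>b\<close>; the same with
 \<open>f\<close> replaced by \<open>T\<^sub>\<mu> f\<close> bounds \<open>c\<close> by \<open>a\<close>, as \<open>T\<^sub>\<mu> (\<phi>\<^sub>j f)\<close> lies in the range of a localized \<open>T\<^sub>\<mu>\<close> and
 \<open>\<parallel>T\<^sub>\<mu> - Id\<parallel> < 1/4\<close>. Conversely \<open>b \<le> c\<close> is clear, and \<open>a\<close> is bounded by \<open>c\<close> because unit vectors in the ranges
 of the localized \<open>T\<^sub>\<mu>\<close> tend to 0 on compact subsets of the ball, a property that \<open>S\<close> preserves. Finally \<open>c\<close> vanishes on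
 compact operators, while \<open>S\<close> differs from the compact operator \<open>P 1\<^sub>r\<^sub>B S\<close> by at most \<open>\<parallel>P\<parallel>\<close> times the norm
 defining \<open>c\<close>.
\<close>

text \<open>Two kinds of constants must be kept apart. Those of the theorem may come only from the
  projection and the kernels, with bounds uniform over all lattices; whatever depends on S must go
  into an error. Each comparison fixes t > 0 above the larger side and makes the error small
  relative to t. The price is supports whose diameter depends on S and t, which the suprema over r
  in a and b absorb.

  Slowly varying weights with bounded supports exist because the Bergman metric has what is known as
  property A. As for trees, a point x is replaced by an average over a long stretch of the path from
  x to a base point, since neighbours share most of that path. Here the path is a radius and its
  points are blurred by Berezin kernels.

  Infinitely many weights occur, so commutators are estimated as sums of p-th powers over the
  family, and its variation is measured in the same way. Weights destroy holomorphy, so S is studied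
  through S P on L^p. Where a function in the range of a localized \<open>toeplitz_measure\<close>
  is required, finitely many values at lattice points are interpolated by a polynomial.\<close>

no_notation fps_nth (infixl "$" 75)

section \<open>The Bergman metric\<close>

lemma herm_add_left: "herm (x + y) w = herm x w + herm y w"
 by (simp add: herm_def sum.distrib distrib_right)

lemma herm_diff_left: "herm (x - y) w = herm x w - herm y w"
 by (simp add: herm_def sum_subtractf left_diff_distrib)

lemma herm_scale_left: "herm (c *s x) w = c * herm x w"
 by (simp add: herm_def sum_distrib_left mult.assoc)

lemma cnj_herm: "cnj (herm z w) = herm w z"
 by (simp add: herm_def mult.commute)

lemma herm_diff_right: "herm w (x - y) = herm w x - herm w y"
 by (simp add: herm_def sum_subtractf right_diff_distrib)

lemma herm_scale_right: "herm w (c *s x) = cnj c * herm w x"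
 by (simp add: herm_def sum_distrib_left mult_ac)

lemma herm_zero [simp]: "herm 0 w = 0" "herm w 0 = 0"
 by (simp_all add: herm_def)

lemma Re_herm: "Re (herm z w) = z \<bullet> w"
 by (simp add: herm_def inner_vec_def inner_complex_def)

lemma Im_herm_self: "Im (herm z z) = 0"
 by (simp add: herm_def mult.commute)

lemma herm_self: "herm z z = of_real ((norm z)\<^sup>2)"
 by (simp add: complex_eq_iff Re_herm Im_herm_self power2_norm_eq_inner)

lemma herm_scaleR: "herm (r *\<^sub>R z) w = of_real r * herm z w" "herm z (r *\<^sub>R w) = of_real r * herm z w"
 by (simp_all add: herm_def sum_distrib_left scaleR_conv_of_real[symmetric] mult_ac scaleR_sum_right)

lemma norm_vector_smult: "norm (c *s (x :: complex^'n)) = cmod c * norm x"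
 by (simp add: norm_vec_def norm_mult L2_set_right_distrib)

lemma norm_herm_le: "cmod (herm z w) \<le> norm z * norm w"
proof (cases "herm z w = 0")
 case False
 define c where "c = cnj (herm z w) / cmod (herm z w)"
 have c: "cmod c = 1" using False by (simp add: c_def norm_divide)
 have "of_real (cmod (herm z w)) = c * herm z w"
  using False by (simp add: c_def field_simps complex_norm_square[symmetric] power2_eq_square)
 then have "cmod (herm z w) = Re (herm (c *s z) w)" by (metis Re_complex_of_real herm_scale_left)
 also have "\<dots> \<le> norm (c *s z) * norm w" unfolding Re_herm by (rule norm_cauchy_schwarz)
 finally show ?thesis by (simp add: norm_vector_smult c)
qed simp

lemma norm_diff_sqr: "(norm (z - w))\<^sup>2 = (norm z)\<^sup>2 + (norm w)\<^sup>2 - 2 * Re (herm z w)"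
 unfolding Re_herm power2_norm_eq_inner by (simp add: inner_diff_left inner_diff_right inner_commute)

lemma norm_one_minus_herm_commute: "cmod (1 - herm z w) = cmod (1 - herm w z)"
 by (metis cnj_herm complex_cnj_diff complex_cnj_one complex_mod_cnj)

abbreviation borel_fun :: "('a::topological_space => 'b::topological_space) set" where "borel_fun \<equiv> borel_measurable borel"

text \<open>\<open>xr z w\<close> is \<open>cosh\<^sup>2\<close> of the Bergman distance of \<open>z\<close> and \<open>w\<close>.\<close>

definition hgt :: "complex^'n => real" where "hgt z = 1 - (norm z)\<^sup>2"

text \<open>Its square root is the nonisotropic distance on the sphere. Inside the ball it is only a
  quasi-distance, with the value \<open>hgt z\<close> on the diagonal.\<close>

definition dst :: "complex^'n => complex^'n => real" where "dst z w = cmod (1 - herm z w)"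

definition xr :: "complex^'n => complex^'n => real" where "xr z w = (dst z w)\<^sup>2 / (hgt z * hgt w)"

lemma dst_commute: "dst z w = dst w z"
 by (simp add: dst_def norm_one_minus_herm_commute)

lemma dst_nonneg [simp]: "0 \<le> dst z w" by (simp add: dst_def)

lemma xr_commute: "xr z w = xr w z"
 by (simp add: xr_def dst_commute mult.commute)

lemma hgt_pos: "norm z < 1 ==> 0 < hgt z"
 by (simp add: hgt_def power_less_one_iff)

lemma hgt_nonneg: "norm z \<le> 1 ==> 0 \<le> hgt z"
 by (simp add: hgt_def power_le_one)

lemma hgt_le_dst: assumes "norm z \<le> 1" "norm w \<le> 1" shows "hgt z \<le> 2 * dst z w"
proof -
 have "1 - norm z \<le> 1 - norm z * norm w"
  using assms by (simp add: mult_left_le)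
 also have "\<dots> \<le> dst z w"
  unfolding dst_def using norm_herm_le[of z w] norm_triangle_ineq2[of 1 "herm z w"] by simp
 finally have "1 - norm z \<le> dst z w" .
 moreover have "hgt z = (1 - norm z) * (1 + norm z)" by (simp add: hgt_def power2_eq_square algebra_simps)
 moreover have "\<dots> \<le> (1 - norm z) * 2" using assms by (intro mult_left_mono) auto
 ultimately show ?thesis by simp
qed

lemma hgt_le_dst': assumes "norm z \<le> 1" "norm w \<le> 1" shows "hgt w \<le> 2 * dst z w"
 using hgt_le_dst[OF assms(2,1)] by (simp add: dst_commute)

lemma dst_pos: assumes "norm z < 1" "norm w \<le> 1" shows "0 < dst z w"
 using hgt_le_dst[of z w] hgt_pos[of z] assms by simp

lemma dst_le_2: assumes "norm z \<le> 1" "norm w \<le> 1" shows "dst z w \<le> 2"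
proof -
 have "dst z w \<le> 1 + cmod (herm z w)" unfolding dst_def by (metis norm_one norm_triangle_ineq4)
 also have "cmod (herm z w) \<le> 1" using norm_herm_le[of z w] assms
  by (smt (verit) mult_le_one norm_ge_zero)
 finally show ?thesis by simp
qed

lemma norm_diff_le_dst: assumes "norm z \<le> 1" "norm w \<le> 1" shows "(norm (z - w))\<^sup>2 \<le> 2 * dst z w"
proof -
 have "(norm (z - w))\<^sup>2 \<le> 1 + 1 - 2 * Re (herm z w)"
  unfolding norm_diff_sqr using assms by (intro diff_right_mono add_mono) (auto simp: power_le_one)
 also have "\<dots> = 2 * Re (1 - herm z w)" by simp
 also have "\<dots> \<le> 2 * dst z w" unfolding dst_def by (intro mult_left_mono complex_Re_le_cmod) auto
 finally show ?thesis .
qed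

text \<open>\<open>z\<close> and \<open>w\<close> may be as far apart as the square root of
  \<open>dst z w\<close>, but mostly in directions orthogonal to \<open>w\<close>. Splitting off
  \<open>herm w (u - v)\<close> isolates the component that is of first order.\<close>

lemma dst_diff_le:
 assumes "norm z \<le> 1" "norm w \<le> 1"
 shows "cmod (herm z (u - v)) \<le> sqrt (2 * dst z w) * norm (u - v) + cmod (herm w (u - v))"
proof -
 have "herm z (u - v) = herm (z - w) (u - v) + herm w (u - v)" by (simp add: herm_diff_left)
 then have "cmod (herm z (u - v)) \<le> cmod (herm (z - w) (u - v)) + cmod (herm w (u - v))"
  by (metis norm_triangle_ineq)
 also have "cmod (herm (z - w) (u - v)) \<le> norm (z - w) * norm (u - v)" by (rule norm_herm_le)
 also have "norm (z - w) \<le> sqrt (2 * dst z w)"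
  using norm_diff_le_dst[OF assms] by (simp add: real_le_rsqrt)
 finally show ?thesis by (simp add: mult_right_mono)
qed

lemma herm_self_diff: "cmod (herm w (w - u)) \<le> hgt w + dst w u" if "norm w \<le> 1"
proof -
 have "herm w (w - u) = (1 - herm w u) - of_real (hgt w)"
  by (simp add: herm_diff_right herm_self hgt_def)
 then have "cmod (herm w (w - u)) \<le> dst w u + cmod (of_real (hgt w))"
  unfolding dst_def by (metis norm_triangle_ineq4)
 then show ?thesis using hgt_nonneg[OF that] by simp
qed

text \<open>The mixed term of \<open>dst_diff_le\<close> is a product of two square roots; the
  inequality between geometric and arithmetic mean gives one more \<open>dst z w\<close> and one
  more \<open>dst w u\<close>. The remaining \<open>3 * dst w u\<close> contains the height of
  \<open>w\<close>, which is at most \<open>2 * dst w u\<close>.\<close>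

lemma dst_quasi_triangle:
 assumes "norm z \<le> 1" "norm w \<le> 1" "norm u \<le> 1"
 shows "dst z u \<le> 2 * dst z w + 4 * dst w u"
proof -
 define a where "a = sqrt (dst z w)"
 define b where "b = sqrt (dst w u)"
 have "1 - herm z u = (1 - herm z w) + herm z (w - u)" by (simp add: herm_diff_right)
 then have "dst z u \<le> dst z w + cmod (herm z (w - u))" unfolding dst_def by (metis norm_triangle_ineq)
 also have "cmod (herm z (w - u)) \<le> sqrt (2 * dst z w) * norm (w - u) + cmod (herm w (w - u))"
  by (rule dst_diff_le) (use assms in auto)
 also have "norm (w - u) \<le> sqrt (2 * dst w u)"
  using norm_diff_le_dst[of w u] assms by (simp add: real_le_rsqrt)
 also have "cmod (herm w (w - u)) \<le> 3 * dst w u"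
  using herm_self_diff[of w u] hgt_le_dst[of w u] assms by simp
 finally have "dst z u \<le> dst z w + (sqrt (2 * dst z w) * sqrt (2 * dst w u) + 3 * dst w u)"
  by (simp add: mult_left_mono)
 also have "sqrt (2 * dst z w) * sqrt (2 * dst w u) = 2 * (a * b)"
  by (simp add: a_def b_def real_sqrt_mult)
 also have "2 * (a * b) \<le> a\<^sup>2 + b\<^sup>2" using sum_squares_bound[of a b] by (simp add: mult_ac)
 also have "\<dots> = dst z w + dst w u" by (simp add: a_def b_def)
 finally show ?thesis by simp
qed

lemma xr_le_iff: assumes "norm z < 1" "norm w < 1"
 shows "xr z w \<le> M \<longleftrightarrow> (dst z w)\<^sup>2 \<le> M * hgt z * hgt w"
 using hgt_pos[of z] hgt_pos[of w] assms by (simp add: xr_def pos_divide_le_eq mult.assoc)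

lemma xr_pos: assumes "norm z < 1" "norm w < 1" shows "0 < xr z w"
 using assms dst_pos[of z w] hgt_pos[of z] hgt_pos[of w] by (simp add: xr_def)

lemma xr_hgt: assumes "norm z < 1" "norm w < 1" "xr z w \<le> M" shows "hgt w \<le> 4 * M * hgt z"
proof -
 have h: "0 < hgt z" "0 < hgt w" using assms hgt_pos by auto
 have "(hgt w)\<^sup>2 \<le> (2 * dst z w)\<^sup>2"
  using hgt_le_dst'[of z w] assms h by (intro power_mono) auto
 also have "\<dots> \<le> 4 * (M * hgt z * hgt w)" using assms by (simp add: xr_le_iff power_mult_distrib)
 finally have "hgt w * hgt w \<le> (4 * M * hgt z) * hgt w" by (simp add: power2_eq_square mult_ac)
 then show ?thesis using h by simp
qed

lemma xr_dst: assumes "norm z < 1" "norm w < 1" "xr z w \<le> M" shows "dst z w \<le> 2 * M * hgt z"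
proof -
 have h: "0 < hgt z" "0 < hgt w" using assms hgt_pos by auto
 have M: "0 < M" using xr_pos[OF assms(1,2)] assms(3) by simp
 have "(dst z w)\<^sup>2 \<le> M * hgt z * hgt w" using assms by (simp add: xr_le_iff)
 also have "\<dots> \<le> M * hgt z * (4 * M * hgt z)"
  using xr_hgt[OF assms] h M by (intro mult_left_mono) auto
 also have "\<dots> = (2 * M * hgt z)\<^sup>2" by (simp add: power2_eq_square)
 finally show ?thesis using h M by (simp add: power2_le_iff_abs_le)
qed

lemma xr_dst_trans:
 assumes "norm z \<le> 1" "norm w < 1" "norm u < 1" "xr w u \<le> M"
 shows "dst z u \<le> (2 + 16 * M) * dst z w"
proof -
 have M: "0 < M" using xr_pos[OF assms(2,3)] assms(4) by simp
 have "dst z u \<le> 2 * dst z w + 4 * dst w u" using assms by (intro dst_quasi_triangle) auto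
 also have "dst w u \<le> 2 * M * hgt w" using assms by (intro xr_dst) auto
 also have "hgt w \<le> 2 * dst z w" using assms by (intro hgt_le_dst') auto
 finally show ?thesis using M by (simp add: algebra_simps)
qed

text \<open>This replaces the triangle inequality of the Bergman metric. Moving one argument by a
  bounded distance changes \<open>dst\<close> and \<open>hgt\<close> by bounded factors, hence also
  \<open>xr\<close>, and multiplicative constants suffice throughout.\<close>

lemma xr_trans:
 assumes "norm z < 1" "norm w < 1" "norm u < 1" "xr w u \<le> M"
 shows "xr z u \<le> (2 + 16 * M)\<^sup>2 * (4 * M) * xr z w"
proof -
 have M: "0 < M" using xr_pos[OF assms(2,3)] assms(4) by simp
 have h: "0 < hgt z" "0 < hgt w" "0 < hgt u" using assms hgt_pos by auto
 have "hgt w \<le> 4 * M * hgt u" using xr_hgt[of u w M] assms by (simp add: xr_commute)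
 then have *: "1 / hgt u \<le> 4 * M / hgt w" using h by (simp add: field_simps)
 have "xr z u = (dst z u)\<^sup>2 * (1 / hgt u) / hgt z" by (simp add: xr_def)
 also have "\<dots> \<le> ((2 + 16 * M) * dst z w)\<^sup>2 * (4 * M / hgt w) / hgt z"
  using assms h M * by (intro divide_right_mono mult_mono power_mono xr_dst_trans) auto
 also have "\<dots> = (2 + 16 * M)\<^sup>2 * (4 * M) * xr z w" by (simp add: xr_def power_mult_distrib mult_ac)
 finally show ?thesis .
qed

lemma ball_aut_zero: "ball_aut 0 w = - w"
 by (simp add: ball_aut_def Let_def vector_sneg_minus1[symmetric])

lemma ball_aut_herm:
 assumes z: "norm z < 1" and w: "norm w < 1" and w': "norm w' < 1"
 shows "1 - herm (ball_aut z w) (ball_aut z w') =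
  of_real (hgt z) * (1 - herm w w') / ((1 - herm w z) * (1 - herm z w'))"
proof (cases "z = 0")
 case True
 then show ?thesis
  by (simp add: ball_aut_zero herm_def hgt_def)
next
 case False
 define r where "r = herm z z"
 define a where "a = herm w z"
 define b where "b = herm z w'"
 define c where "c = herm w w'"
 define s where "s = complex_of_real (sqrt (1 - (norm z)\<^sup>2))"
 \<comment> \<open>The components along \<open>z\<close> and orthogonal to it are merged: with this
   \<open>k\<close> the automorphism sends \<open>u\<close> to a multiple of
   \<open>(1 - k * herm u z) *s z - s *s u\<close>. Since \<open>s\<^sup>2 = 1 - r\<close>, the
   relations \<open>kr\<close> and \<open>kk\<close> reduce the expanded product to the claimed
   quotient.\<close>
 define k where "k = (1 - s) / r"
 have r0: "r \<noteq> 0" using False by (simp add: r_def herm_self)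
 have s2: "s\<^sup>2 = 1 - r"
 proof -
  have "s\<^sup>2 = of_real ((sqrt (1 - (norm z)\<^sup>2))\<^sup>2)" unfolding s_def by (simp only: of_real_power)
  also have "(sqrt (1 - (norm z)\<^sup>2))\<^sup>2 = 1 - (norm z)\<^sup>2"
   using z by (simp add: power_le_one)
  finally show ?thesis by (simp add: r_def herm_self)
 qed
 have cs: "cnj s = s" "cnj r = r" by (simp_all add: s_def r_def herm_self)
 have nz: "1 - a \<noteq> 0" "1 - b \<noteq> 0"
  using dst_pos[of w z] dst_pos[of z w'] z w w' by (auto simp: dst_def a_def b_def)
 have kr: "k * r = 1 - s" using r0 by (simp add: k_def)
 have kk: "k * (1 + s) = 1"
  using r0 s2 by (simp add: k_def field_simps power2_eq_square)
 have aut: "ball_aut z u = (1 / (1 - herm u z)) *s ((1 - k * herm u z) *s z - s *s u)" for u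
  unfolding ball_aut_def Let_def s_def[symmetric] r_def[symmetric] k_def
 proof -
  have "z - (herm u z / r) *s z - s *s (u - (herm u z / r) *s z) = (1 - (1 - s) / r * herm u z) *s z - s *s u"
   using r0 by (simp add: vec_eq_iff field_simps)
  then show "(1 / (1 - herm u z)) *s (z - (herm u z / r) *s z - s *s (u - (herm u z / r) *s z)) =
   (1 / (1 - herm u z)) *s ((1 - (1 - s) / r * herm u z) *s z - s *s u)" by (rule arg_cong)
 qed
 have "cnj k = k" by (simp add: k_def cs)
 have "herm (ball_aut z w) (ball_aut z w') =
  (1 / (1 - a)) * (1 / (1 - b)) * herm ((1 - k * a) *s z - s *s w) ((1 - k * herm w' z) *s z - s *s w')"
  unfolding aut herm_scale_left[of "1 / _"] herm_scale_right[of _ "1 / _"]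
  by (simp add: cnj_herm a_def b_def)
 also have "herm ((1 - k * a) *s z - s *s w) ((1 - k * herm w' z) *s z - s *s w') =
  (1 - k * a) * (1 - k * b) * r - s * (1 - k * a) * b - s * (1 - k * b) * a + s\<^sup>2 * c"
  by (simp add: herm_scale_left herm_scale_right herm_diff_left herm_diff_right cnj_herm cs
    \<open>cnj k = k\<close> a_def[symmetric] b_def[symmetric] c_def[symmetric] r_def[symmetric])
   (simp add: algebra_simps power2_eq_square)
 also have "(1 - k * a) * (1 - k * b) * r - s * (1 - k * a) * b - s * (1 - k * b) * a + s\<^sup>2 * c
  = r - (k * r) * (a + b) - s * (a + b) + a * b * k * (k * r + 2 * s) + s\<^sup>2 * c"
  by (simp add: algebra_simps power2_eq_square)
 also have "\<dots> = r - (a + b) + a * b * (k * (1 + s)) + s\<^sup>2 * c" unfolding kr by (simp add: algebra_simps)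
 also have "\<dots> = r - a - b + a * b + (1 - r) * c" unfolding kk s2 by simp
 also have "r - a - b + a * b + (1 - r) * c = (1 - a) * (1 - b) - (1 - r) * (1 - c)"
  by (simp add: algebra_simps)
 finally have "1 - herm (ball_aut z w) (ball_aut z w') = (1 - r) * (1 - c) / ((1 - a) * (1 - b))"
  using nz by (simp add: diff_divide_distrib)
 then show ?thesis by (simp add: hgt_def a_def b_def c_def r_def herm_self)
qed

lemma hgt_ball_aut:
 assumes "norm z < 1" "norm w < 1"
 shows "hgt (ball_aut z w) = hgt z * hgt w / (dst z w)\<^sup>2"
proof -
 have "complex_of_real (hgt (ball_aut z w)) = 1 - herm (ball_aut z w) (ball_aut z w)"
  by (simp add: hgt_def herm_self)
 also have "\<dots> = of_real (hgt z) * of_real (hgt w) / ((1 - herm w z) * cnj (1 - herm w z))"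
  unfolding ball_aut_herm[OF assms assms(2)] by (simp add: cnj_herm herm_self hgt_def)
 also have "\<dots> = complex_of_real (hgt z * hgt w / (dst z w)\<^sup>2)"
  unfolding dst_def norm_one_minus_herm_commute[of z w]
  by (simp only: of_real_divide of_real_mult complex_norm_square)
 finally show ?thesis using of_real_eq_iff by blast
qed

lemma norm_ball_aut_less: assumes "norm z < 1" "norm w < 1" shows "norm (ball_aut z w) < 1"
proof -
 have "0 < hgt (ball_aut z w)"
  using hgt_ball_aut[OF assms] hgt_pos[of z] hgt_pos[of w] dst_pos[of z w] assms by simp
 then show ?thesis by (simp add: hgt_def power_less_one_iff abs_square_less_1)
qed

lemma xr_eq_hgt: assumes "norm z < 1" "norm w < 1" shows "xr z w = 1 / hgt (ball_aut z w)"
 by (simp add: xr_def hgt_ball_aut[OF assms])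

text \<open>Invariance under automorphisms moves the centre of a hyperbolic ball to the origin,
  where \<open>lattice_count\<close> can use Euclidean compactness.\<close>

lemma xr_ball_aut:
 assumes z: "norm z < 1" and w: "norm w < 1" and u: "norm u < 1"
 shows "xr (ball_aut z w) (ball_aut z u) = xr w u"
proof -
 have p: "0 < hgt z" "0 < hgt w" "0 < hgt u" "0 < dst z w" "0 < dst z u"
  using assms hgt_pos dst_pos[of z w] dst_pos[of z u] by auto
 have *: "dst (ball_aut z w) (ball_aut z u) = hgt z * dst w u / (dst z w * dst z u)"
  unfolding dst_def ball_aut_herm[OF assms]
  using p by (simp add: norm_divide norm_mult norm_one_minus_herm_commute[of w z])
 then show ?thesis
  unfolding xr_def hgt_ball_aut[OF z w] hgt_ball_aut[OF z u] *
  using p by (simp add: field_simps power2_eq_square)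
qed

text \<open>Turns hyperbolic separation into Euclidean separation, as long as the heights stay away
  from 0.\<close>

lemma xr_sub_1:
 assumes "norm z < 1" "norm w < 1"
 shows "(xr z w - 1) * (hgt z * hgt w) \<le> (norm (z - w))\<^sup>2"
proof -
 have p: "0 < hgt z" "0 < hgt w" using assms hgt_pos by auto
 have "(xr z w - 1) * (hgt z * hgt w) = (dst z w)\<^sup>2 - hgt z * hgt w"
  using p by (simp add: xr_def field_simps)
 also have "(dst z w)\<^sup>2 = 1 - 2 * Re (herm z w) + (cmod (herm z w))\<^sup>2"
  unfolding dst_def cmod_power2 by (simp add: power2_eq_square algebra_simps)
 also have "(cmod (herm z w))\<^sup>2 \<le> (norm z)\<^sup>2 * (norm w)\<^sup>2"
  using norm_herm_le[of z w] by (metis norm_ge_zero power_mono power_mult_distrib)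
 also have "1 - 2 * Re (herm z w) + (norm z)\<^sup>2 * (norm w)\<^sup>2 - hgt z * hgt w = (norm (z - w))\<^sup>2"
  by (simp add: norm_diff_sqr hgt_def algebra_simps)
 finally show ?thesis by simp
qed

text \<open>With q the pseudohyperbolic distance, \<open>xr z w\<close> is 1 / (1 - q^2), and the
  metric is the inverse hyperbolic tangent of q. The two descriptions of a ball are linked by 1 -
  tanh^2 = 1 / cosh^2.\<close>

lemma bergman_metric_le_iff:
 assumes "norm z < 1" "norm w < 1" "0 \<le> r"
 shows "bergman_metric z w \<le> r \<longleftrightarrow> xr z w \<le> (cosh r)\<^sup>2"
proof -
 define q where "q = norm (ball_aut z w)"
 have q: "0 \<le> q" "q < 1" using norm_ball_aut_less[OF assms(1,2)] by (auto simp: q_def)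
 have t: "0 \<le> tanh r" "tanh r < 1" using assms by (auto simp: tanh_real_lt_1)
 have "bergman_metric z w \<le> r \<longleftrightarrow> ln ((1 + q) / (1 - q)) \<le> 2 * r"
  by (simp add: bergman_metric_def pseudo_hyp_def q_def mult.commute)
 also have "\<dots> \<longleftrightarrow> (1 + q) / (1 - q) \<le> exp (2 * r)"
  using q ln_ge_iff[of "(1 + q) / (1 - q)" "2 * r"]
  by (smt (verit) divide_pos_pos exp_gt_zero ln_exp ln_le_cancel_iff)
 also have "\<dots> \<longleftrightarrow> q * (exp (2*r) + 1) \<le> exp (2 * r) - 1" using q by (simp add: field_simps)
 also have "\<dots> \<longleftrightarrow> q \<le> tanh r"
 proof -
  have "tanh r = (exp (2 * r) - 1) / (exp (2 * r) + 1)"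
  proof -
   have "tanh r = (exp r * (exp r - exp (- r))) / (exp r * (exp r + exp (- r)))"
    by (simp add: tanh_altdef)
   also have "\<dots> = (exp (2 * r) - 1) / (exp (2 * r) + 1)"
    by (simp add: distrib_left right_diff_distrib flip: exp_add)
   finally show ?thesis .
  qed
  moreover have "exp (2 * r) + 1 > 0" by (simp add: add_pos_pos)
  ultimately show ?thesis by (simp add: pos_le_divide_eq)
 qed
 also have "\<dots> \<longleftrightarrow> q\<^sup>2 \<le> (tanh r)\<^sup>2" using q t by (simp add: power_mono_iff)
 also have "(tanh r)\<^sup>2 = 1 - 1 / (cosh r)\<^sup>2"
  using cosh_real_pos[of r] by (simp add: tanh_def power_divide sinh_square_eq diff_divide_distrib)
 also have "q\<^sup>2 \<le> 1 - 1 / (cosh r)\<^sup>2 \<longleftrightarrow> 1 / (cosh r)\<^sup>2 \<le> hgt (ball_aut z w)"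
  by (auto simp: hgt_def q_def)
 also have "\<dots> \<longleftrightarrow> xr z w \<le> (cosh r)\<^sup>2"
  unfolding xr_eq_hgt[OF assms(1,2)]
  using hgt_pos[OF norm_ball_aut_less[OF assms(1,2)]] cosh_real_pos[of r] by (auto simp: field_simps)
 finally show ?thesis .
qed

lemma bergman_ball_eq:
 assumes "norm z < 1" "0 \<le> r"
 shows "bergman_ball z r = {w \<in> ball 0 1. xr z w \<le> (cosh r)\<^sup>2}"
 using bergman_metric_le_iff[OF assms(1) _ assms(2)] by (auto simp: bergman_ball_def)

section \<open>Moments of the weighted measures\<close>

lemma ball_in_borel [measurable]: "ball c r \<in> sets (borel :: 'a::metric_space measure)"
 by simp

lemma measurable_vec_nth [measurable]:
 "(f :: _ => complex^'n) \<in> borel_measurable M ==> (\<lambda>x. f x $ i) \<in> borel_measurable M"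
 by (rule measurable_compose[where N=borel]) (auto intro!: borel_measurable_continuous_onI continuous_intros)

lemma measurable_cnj [measurable]:
 "f \<in> borel_measurable M ==> (\<lambda>x. cnj (f x)) \<in> borel_measurable M"
 by (rule measurable_compose[where N=borel]) (auto intro!: borel_measurable_continuous_onI continuous_intros)

lemma measurable_herm [measurable]:
 "f \<in> borel_measurable M ==> g \<in> borel_measurable M ==> (\<lambda>x. herm (f x) (g x)) \<in> borel_measurable M"
 unfolding herm_def by (intro borel_measurable_sum borel_measurable_times measurable_cnj measurable_vec_nth)

section \<open>Invariance of Lebesgue measure under linear isometries\<close>

lemma nn_integral_lborel_translate:
 fixes f :: "'a::euclidean_space => ennreal"
 assumes [measurable]: "f \<in> borel_fun"
 shows "(\<integral>\<^sup>+x. f (c + x) \<partial>lborel) = (\<integral>\<^sup>+x. f x \<partial>lborel)"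
proof -
 have "(\<integral>\<^sup>+x. f x \<partial>lborel) = (\<integral>\<^sup>+x. f x \<partial>distr lborel borel ((+) c))"
  by (simp add: lborel_distr_plus)
 also have "\<dots> = (\<integral>\<^sup>+x. f (c + x) \<partial>lborel)" by (subst nn_integral_distr) auto
 finally show ?thesis by simp
qed

text \<open>The argument for uniqueness of Haar measure: the image measure of A times the volume of
  the unit ball B is a double integral, which two translations and two applications of Fubini turn
  into the volume of A times that of B. The isometry enters where the preimage of a translate of B
  is recognized as a ball of radius 1.\<close>

lemma lborel_distr_isometry:
 fixes U :: "'a::euclidean_space => 'a"
 assumes lin: "linear U" and norm: "\<And>x. norm (U x) = norm x"
 shows "distr lborel borel U = lborel"
proof (rule measure_eqI)
 have [measurable]: "U \<in> borel_fun"
  using lin by (intro borel_measurable_continuous_onI linear_continuous_on)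
   (simp add: linear_conv_bounded_linear)
 have inj: "inj U" using lin norm by (metis linear_injective_0 norm_eq_zero)
 then obtain V where V: "\<And>y. U (V y) = y"
  using linear_injective_imp_surjective[OF lin] by (metis surjD)
 define B where "B = (ball 0 1 :: 'a set)"
 have [measurable]: "B \<in> sets borel" by (simp add: B_def)
 have B: "emeasure lborel B \<noteq> 0" "emeasure lborel B \<noteq> \<infinity>"
  using emeasure_lborel_ball_finite[of "0::'a" 1] unit_ball_vol_pos[of "real DIM('a)"] by (auto simp: B_def emeasure_ball simp del: unit_ball_vol_pos)
 fix A :: "_ set" assume "A \<in> sets (distr lborel borel U)"
 then have [measurable]: "A \<in> sets borel" by simp
 have "emeasure (distr lborel borel U) A * emeasure lborel B =
   (\<integral>\<^sup>+x. indicator A (U x) \<partial>lborel) * emeasure lborel B"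
  by (subst nn_integral_indicator[symmetric], simp, subst nn_integral_distr) auto
 also have "\<dots> = (\<integral>\<^sup>+y. (\<integral>\<^sup>+x. indicator A (U x) * indicator B y \<partial>lborel) \<partial>lborel)"
  by (simp add: nn_integral_multc nn_integral_cmult)
 also have "\<dots> = (\<integral>\<^sup>+y. (\<integral>\<^sup>+x. indicator A (U x + y) * indicator B y \<partial>lborel) \<partial>lborel)"
 proof (rule nn_integral_cong)
  fix y
  have "U (V y + x) = U x + y" for x using V lin by (simp add: linear_add add.commute)
  then show "(\<integral>\<^sup>+x. indicator A (U x) * indicator B y \<partial>lborel) =
    (\<integral>\<^sup>+x. indicator A (U x + y) * indicator B y \<partial>lborel :: ennreal)"
   using nn_integral_lborel_translate[of "\<lambda>x. indicator A (U x) * indicator B y" "V y"] by simp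
 qed
 also have "\<dots> = (\<integral>\<^sup>+x. (\<integral>\<^sup>+y. indicator A (U x + y) * indicator B y \<partial>lborel) \<partial>lborel)"
  by (intro lborel_pair.Fubini') measurable
 also have "\<dots> = (\<integral>\<^sup>+x. (\<integral>\<^sup>+y. indicator A y * indicator B (y - U x) \<partial>lborel) \<partial>lborel)"
 proof (rule nn_integral_cong)
  fix x
  show "(\<integral>\<^sup>+y. indicator A (U x + y) * indicator B y \<partial>lborel) =
    (\<integral>\<^sup>+y. indicator A y * indicator B (y - U x) \<partial>lborel :: ennreal)"
   using nn_integral_lborel_translate[of "\<lambda>y. indicator A y * indicator B (y - U x)" "U x"] by simp
 qed
 also have "\<dots> = (\<integral>\<^sup>+y. (\<integral>\<^sup>+x. indicator A y * indicator B (y - U x) \<partial>lborel) \<partial>lborel)"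
  by (intro lborel_pair.Fubini') measurable
 also have "\<dots> = (\<integral>\<^sup>+y. indicator A y * emeasure lborel B \<partial>lborel)"
 proof (rule nn_integral_cong)
  fix y
  have "norm (y - U x) = norm (V y - x)" for x
   using V norm lin by (metis linear_diff)
  then have "indicator B (y - U x) = (indicator (ball (V y) 1) x :: ennreal)" for x
   unfolding B_def indicator_def by (simp only: mem_ball dist_norm diff_0 norm_minus_cancel)
  then have "(\<integral>\<^sup>+x. indicator B (y - U x) \<partial>lborel) = emeasure lborel (ball (V y) 1)" by simp
  also have "\<dots> = emeasure lborel B" by (simp add: B_def emeasure_ball)
  finally show "(\<integral>\<^sup>+x. indicator A y * indicator B (y - U x) \<partial>lborel) =
    indicator A y * emeasure lborel B"
   by (subst nn_integral_cmult) auto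
 qed
 also have "\<dots> = emeasure lborel A * emeasure lborel B" by (subst nn_integral_multc) auto
 finally show "emeasure (distr lborel borel U) A = emeasure lborel A"
  using B by (simp add: ennreal_mult_cancel_left mult.commute[of _ "emeasure lborel B"])
qed simp

lemma linear_isometry_measurable:
 "linear (U :: 'a::euclidean_space => 'a) ==> U \<in> borel_fun"
 by (intro borel_measurable_continuous_onI linear_continuous_on)
   (simp add: linear_conv_bounded_linear)

section \<open>The weighted measures as densities\<close>

definition bvol :: "'n::finite itself => real" where
 "bvol _ = measure lborel (ball (0::complex^'n) 1)"

lemma bvol_pos: "0 < bvol TYPE('n::finite)"
 by (simp add: content_ball bvol_def)

lemma emeasure_bvol: "emeasure lborel (ball (0::complex^'n) 1) = ennreal (bvol TYPE('n))"
 using emeasure_lborel_ball_finite[of "0::complex^'n" 1] by (simp add: emeasure_eq_ennreal_measure bvol_def)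

definition bconst :: "'n::finite itself => real => real" where
 "bconst _ t = Gamma (real CARD('n) + t + 1) / (fact CARD('n) * Gamma (t + 1))"

lemma bconst_pos: "-1 < t ==> 0 < bconst TYPE('n::finite) t"
 by (auto simp: bconst_def intro!: divide_pos_pos mult_pos_pos Gamma_real_pos)

lemma sets_bergman [simp, measurable_cong]: "sets (bergman_measure t) = sets borel"
 by (simp add: bergman_measure_def uniform_measure_def)

lemma space_bergman [simp]: "space (bergman_measure t) = UNIV"
 by (simp add: bergman_measure_def uniform_measure_def)

lemma measurable_hgt [measurable]: "f \<in> borel_measurable M ==> (\<lambda>x. hgt (f x)) \<in> borel_measurable M"
 unfolding hgt_def by measurable

lemma nn_integral_bergman:
 fixes g :: "complex^'n => ennreal"
 assumes "-1 < t" and [measurable]: "g \<in> borel_fun"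
 shows "(\<integral>\<^sup>+z. g z \<partial>bergman_measure t) =
  (\<integral>\<^sup>+z. ennreal (indicator (ball 0 1) z * (bconst TYPE('n) t / bvol TYPE('n) * hgt z powr t)) * g z \<partial>lborel)"
proof -
 have "(\<integral>\<^sup>+z. g z \<partial>bergman_measure t) =
  (\<integral>\<^sup>+z. ennreal (bconst TYPE('n) t * hgt z powr t) * g z \<partial>uniform_measure lborel (ball 0 1))"
  unfolding bergman_measure_def bconst_def[of "TYPE('n)", symmetric] hgt_def[symmetric]
  by (subst nn_integral_density) auto
 also have "\<dots> = (\<integral>\<^sup>+z. ennreal (bconst TYPE('n) t * hgt z powr t) * g z * indicator (ball 0 1) z \<partial>lborel)
   / ennreal (bvol TYPE('n))"
  by (subst nn_integral_uniform_measure) (auto simp: emeasure_bvol)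
 also have "\<dots> = (\<integral>\<^sup>+z. ennreal (bconst TYPE('n) t * hgt z powr t) * g z * indicator (ball 0 1) z
   / ennreal (bvol TYPE('n)) \<partial>lborel)"
  by (subst nn_integral_divide) auto
 also have "\<dots> = (\<integral>\<^sup>+z. ennreal (indicator (ball 0 1) z * (bconst TYPE('n) t / bvol TYPE('n) * hgt z powr t)) * g z \<partial>lborel)"
 proof (rule nn_integral_cong)
  fix z :: "complex^'n"
  have "ennreal (bconst TYPE('n) t * hgt z powr t) / ennreal (bvol TYPE('n))
   = ennreal (bconst TYPE('n) t / bvol TYPE('n) * hgt z powr t)"
   using bvol_pos[where 'n='n] bconst_pos[OF assms(1), where 'n='n] by (subst divide_ennreal) auto
  then show "ennreal (bconst TYPE('n) t * hgt z powr t) * g z * indicator (ball 0 1) z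
   / ennreal (bvol TYPE('n)) = ennreal (indicator (ball 0 1) z * (bconst TYPE('n) t / bvol TYPE('n) * hgt z powr t)) * g z"
   by (auto simp: indicator_def divide_ennreal_def mult_ac)
 qed
 finally show ?thesis .
qed

lemma bergman_measure_density:
 assumes "-1 < t"
 shows "(bergman_measure t :: (complex^'n) measure) =
  density lborel (\<lambda>z. ennreal (indicator (ball 0 1) z * (bconst TYPE('n) t / bvol TYPE('n) * hgt z powr t)))"
  (is "_ = density lborel ?k")
proof (rule measure_eqI)
 fix A :: "(complex^'n) set" assume "A \<in> sets (bergman_measure t)"
 then have [measurable]: "A \<in> sets borel" by simp
 have "emeasure (bergman_measure t) A = (\<integral>\<^sup>+z. indicator A z \<partial>bergman_measure t)" by simp
 also have "\<dots> = (\<integral>\<^sup>+z. ?k z * indicator A z \<partial>lborel)"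
  by (rule nn_integral_bergman[OF assms]) measurable
 also have "\<dots> = emeasure (density lborel ?k) A"
  by (subst emeasure_density) (simp_all del: times_divide_eq_left times_divide_eq_right)
 finally show "emeasure (bergman_measure t) A = emeasure (density lborel ?k) A" .
qed simp

lemma bergman_distr_isometry:
 fixes U :: "complex^'n => complex^'n"
 assumes t: "-1 < t" and lin: "linear U" and norm: "\<And>x. norm (U x) = norm x"
 shows "distr (bergman_measure t) borel U = bergman_measure t"
proof (rule measure_eqI)
 have [measurable]: "U \<in> borel_fun" using lin by (rule linear_isometry_measurable)
 fix A :: "(complex^'n) set" assume "A \<in> sets (distr (bergman_measure t) borel U)"
 then have [measurable]: "A \<in> sets borel" by simp
 let ?k = "\<lambda>z::complex^'n. ennreal (indicator (ball 0 1) z * (bconst TYPE('n) t / bvol TYPE('n) * hgt z powr t))"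
 have k: "?k (U z) = ?k z" for z by (simp add: hgt_def norm indicator_def)
 have "emeasure (distr (bergman_measure t) borel U) A = (\<integral>\<^sup>+z. indicator A z \<partial>distr (bergman_measure t) borel U)"
  by simp
 also have "\<dots> = (\<integral>\<^sup>+z. ?k z * indicator A (U z) \<partial>lborel)"
  by (subst nn_integral_distr) (auto simp: nn_integral_bergman[OF t])
 also have "\<dots> = (\<integral>\<^sup>+z. ?k (U z) * indicator A (U z) \<partial>lborel)" by (simp only: k)
 also have "\<dots> = (\<integral>\<^sup>+z. ?k z * indicator A z \<partial>distr lborel borel U)"
  by (subst nn_integral_distr) auto
 also have "\<dots> = (\<integral>\<^sup>+z. indicator A z \<partial>bergman_measure t)"
  unfolding lborel_distr_isometry[OF lin norm] by (subst nn_integral_bergman[OF t]) auto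
 finally show "emeasure (distr (bergman_measure t) borel U) A = emeasure (bergman_measure t) A"
  by simp
qed simp

section \<open>Radial integration and moments of one coordinate\<close>

definition coord_mass :: "'n::finite => nat => ennreal" where
 "coord_mass i k = (\<integral>\<^sup>+x. ennreal (cmod ((x::complex^'n) $ i) ^ (2 * k)) * indicator (ball 0 1) x \<partial>lborel)"

lemma coord_mass_finite: "coord_mass (i::'n::finite) k < \<infinity>"
proof -
 have "coord_mass i k \<le> (\<integral>\<^sup>+x. indicator (ball (0::complex^'n) 1) x \<partial>lborel)"
  unfolding coord_mass_def
 proof (intro nn_integral_mono)
  fix x :: "complex^'n"
  have "cmod (x $ i) \<le> norm x" by (rule Finite_Cartesian_Product.norm_nth_le)
  then show "ennreal (cmod (x $ i) ^ (2 * k)) * indicator (ball 0 1) x \<le> indicator (ball 0 1) x"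
   by (auto simp: indicator_def intro!: power_le_one)
 qed
 also have "\<dots> < \<infinity>" using emeasure_lborel_ball_finite[of "0::complex^'n" 1] by simp
 finally show ?thesis .
qed

lemma nn_integral_power_mono:
 assumes "0 < m" "0 \<le> a"
 shows "(\<integral>\<^sup>+t. indicator {0..a} t * ennreal (real m * t ^ (m - 1)) \<partial>lborel) = ennreal (a ^ m)"
proof -
 have "((\<lambda>t. real m * t ^ (m - 1)) has_integral (a ^ m - 0 ^ m)) {0..a}"
  using assms by (intro fundamental_theorem_of_calculus)
   (auto simp: has_real_derivative_iff_has_vector_derivative[symmetric] intro!: derivative_eq_intros)
 then have "((\<lambda>t. real m * t ^ (m - 1)) has_integral a ^ m) {0..a}"
  using assms by (simp only: zero_power diff_zero)
 from nn_integral_has_integral_lebesgue[OF _ this]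
 have "(\<integral>\<^sup>+t. ennreal (indicator {0..a} t * (real m * t ^ (m - 1))) \<partial>lborel) = ennreal (a ^ m)" by simp
 moreover have "ennreal (indicator {0..a} t * (real m * t ^ (m - 1))) = indicator {0..a} t * ennreal (real m * t ^ (m - 1))" for t
  by (simp add: indicator_def)
 ultimately show ?thesis by simp
qed

text \<open>Dilation by the square root of \<open>a\<close> contributes \<open>a ^ CARD('n)\<close>
  through the volume and \<open>a ^ k\<close> through the coordinate.\<close>

lemma coord_mass_scale:
 fixes i :: "'n::finite"
 assumes a: "0 < a"
 shows "(\<integral>\<^sup>+x. ennreal (cmod ((x::complex^'n) $ i) ^ (2 * k)) * indicator {..<a} ((norm x)\<^sup>2) \<partial>lborel)
  = ennreal (a ^ (CARD('n) + k)) * coord_mass i k"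
proof -
 let ?c = "sqrt a"
 have lb: "(lborel :: (complex^'n) measure) = density (distr lborel borel (\<lambda>x. 0 + ?c *\<^sub>R x)) (\<lambda>_. ennreal (\<bar>?c\<bar> ^ DIM(complex^'n)))"
  using a by (intro lborel_affine) auto
 have c2: "?c ^ (2 * j) = a ^ j" for j using a by (simp add: power_mult)
 have "(\<integral>\<^sup>+x. ennreal (cmod ((x::complex^'n) $ i) ^ (2 * k)) * indicator {..<a} ((norm x)\<^sup>2) \<partial>lborel)
  = (\<integral>\<^sup>+x. ennreal (\<bar>?c\<bar> ^ DIM(complex^'n)) * (ennreal (cmod ((?c *\<^sub>R (x::complex^'n)) $ i) ^ (2 * k))
    * indicator {..<a} ((norm (?c *\<^sub>R x))\<^sup>2)) \<partial>lborel)"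
  by (subst lb, subst nn_integral_density, simp, measurable, subst nn_integral_distr) auto
 also have "\<dots> = (\<integral>\<^sup>+x. ennreal (a ^ (CARD('n) + k)) * (ennreal (cmod (x $ i) ^ (2 * k)) * indicator (ball 0 1) x) \<partial>lborel)"
 proof (intro nn_integral_cong)
  fix x :: "complex^'n"
  have ind: "indicator {..<a} ((norm (?c *\<^sub>R x))\<^sup>2) = (indicator (ball 0 1) x :: ennreal)"
   using a by (auto simp: indicator_def power_mult_distrib power_less_one_iff abs_square_less_1)
  have "ennreal (\<bar>?c\<bar> ^ DIM(complex^'n)) * ennreal (cmod ((?c *\<^sub>R x) $ i) ^ (2 * k)) =
   ennreal (?c ^ (2 * CARD('n)) * (?c ^ (2 * k) * cmod (x $ i) ^ (2 * k)))"
   using a by (subst ennreal_mult'[symmetric]) (auto simp: power_mult_distrib mult.commute)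
  also have "\<dots> = ennreal (a ^ (CARD('n) + k)) * ennreal (cmod (x $ i) ^ (2 * k))"
   unfolding c2 using a by (subst ennreal_mult'[symmetric]) (auto simp: power_add mult_ac)
  finally show "ennreal (\<bar>?c\<bar> ^ DIM(complex^'n)) * (ennreal (cmod ((?c *\<^sub>R x) $ i) ^ (2 * k))
    * indicator {..<a} ((norm (?c *\<^sub>R x))\<^sup>2)) =
    ennreal (a ^ (CARD('n) + k)) * (ennreal (cmod (x $ i) ^ (2 * k)) * indicator (ball 0 1) x)"
   unfolding ind by (simp only: mult.assoc[symmetric])
 qed
 also have "\<dots> = ennreal (a ^ (CARD('n) + k)) * coord_mass i k"
  unfolding coord_mass_def by (subst nn_integral_cmult) auto
 finally show ?thesis .
qed

text \<open>Both sides integrate \<open>g\<close> against a measure on the line. By the homogeneity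
  in \<open>coord_mass_scale\<close> the two measures agree on all half-lines \<open>{..<a}\<close>,
  hence everywhere. This gives polar integration without a surface measure on spheres.\<close>

lemma nn_integral_radial:
 fixes i :: "'n::finite" and g :: "real => ennreal" and k :: nat
 assumes [measurable]: "g \<in> borel_fun"
 defines "m \<equiv> CARD('n) + k"
 shows "(\<integral>\<^sup>+x. ennreal (cmod ((x::complex^'n) $ i) ^ (2 * k)) * g ((norm x)\<^sup>2) \<partial>lborel)
  = coord_mass i k * (\<integral>\<^sup>+t. indicator {0..} t * ennreal (real m * t ^ (m - 1)) * g t \<partial>lborel)"
proof -
 have m: "0 < m" by (simp add: m_def)
 define M1 where "M1 = distr (density lborel (\<lambda>x::complex^'n. ennreal (cmod (x $ i) ^ (2 * k)))) borel (\<lambda>x. (norm x)\<^sup>2)"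
 define M2 where "M2 = density lborel (\<lambda>t. coord_mass i k * (indicator {0..} t * ennreal (real m * t ^ (m - 1))))"
 have 1: "emeasure M1 {..<a} = (if a \<le> 0 then 0 else ennreal (a ^ m) * coord_mass i k)" for a
 proof -
  have "emeasure M1 {..<a} = (\<integral>\<^sup>+x. indicator {..<a} x \<partial>M1)" by (simp add: M1_def)
  also have "\<dots> = (\<integral>\<^sup>+x. ennreal (cmod ((x::complex^'n) $ i) ^ (2 * k)) * indicator {..<a} ((norm x)\<^sup>2) \<partial>lborel)"
   unfolding M1_def by (subst nn_integral_distr, simp, simp, subst nn_integral_density) auto
  also have "\<dots> = (if a \<le> 0 then 0 else ennreal (a ^ m) * coord_mass i k)"
  proof (cases "a \<le> 0")
   case True
   then have "indicator {..<a} ((norm x)\<^sup>2) = (0::ennreal)" for x :: "complex^'n"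
    by (auto simp: indicator_def) (smt (verit) zero_le_power2)
   then show ?thesis using True by simp
  next
   case False then show ?thesis using coord_mass_scale[of a i k] by (simp add: m_def)
  qed
  finally show ?thesis .
 qed
 have 2: "emeasure M2 {..<a} = (if a \<le> 0 then 0 else ennreal (a ^ m) * coord_mass i k)" for a
 proof -
  have "emeasure M2 {..<a} = (\<integral>\<^sup>+t. coord_mass i k * (indicator {0..} t * ennreal (real m * t ^ (m - 1))) * indicator {..<a} t \<partial>lborel)"
   unfolding M2_def by (subst emeasure_density) auto
  also have "\<dots> = (\<integral>\<^sup>+t. coord_mass i k * (indicator {0..a} t * ennreal (real m * t ^ (m - 1))) \<partial>lborel)"
   by (intro nn_integral_cong_AE eventually_mono[OF AE_lborel_singleton[of a]]) (auto simp: indicator_def)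
  also have "\<dots> = coord_mass i k * (\<integral>\<^sup>+t. indicator {0..a} t * ennreal (real m * t ^ (m - 1)) \<partial>lborel)"
   by (subst nn_integral_cmult) auto
  also have "\<dots> = (if a \<le> 0 then 0 else ennreal (a ^ m) * coord_mass i k)"
  proof (cases "a \<le> 0")
   case True
   have "(\<integral>\<^sup>+t. indicator {0..a} t * ennreal (real m * t ^ (m - 1)) \<partial>lborel) = (\<integral>\<^sup>+t. (0::ennreal) \<partial>(lborel :: real measure))"
    using True by (intro nn_integral_cong_AE eventually_mono[OF AE_lborel_singleton[of a]]) (auto simp: indicator_def)
   then show ?thesis using True by simp
  next
   case False then show ?thesis
    by (subst nn_integral_power_mono[OF m]) (auto simp: mult.commute)
  qed
  finally show ?thesis .
 qed
 have "M1 = M2"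
 proof (rule measure_eqI_generator_eq[where E="range lessThan" and \<Omega>=UNIV and A="\<lambda>n. {..<real n}"])
  show "Int_stable (range lessThan :: real set set)"
  proof (unfold Int_stable_def, safe)
   fix a b :: real
   have "{..<a} \<inter> {..<b} = {..<min a b}" by auto
   then show "{..<a} \<inter> {..<b} \<in> range lessThan" by blast
  qed
  show "sets M1 = sigma_sets UNIV (range lessThan)" "sets M2 = sigma_sets UNIV (range lessThan)"
   unfolding M1_def M2_def by (simp_all add: borel_Iio)
  show "(\<Union>n. {..<real n}) = UNIV"
   using reals_Archimedean2 by auto
  show "emeasure M1 X = emeasure M2 X" if "X \<in> range lessThan" for X
   using that by (auto simp: 1 2)
  show "emeasure M1 {..<real n} \<noteq> \<infinity>" for n
   unfolding 1 using coord_mass_finite[of i k] by (auto simp: ennreal_mult_eq_top_iff)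
 qed auto
 have "(\<integral>\<^sup>+x. ennreal (cmod ((x::complex^'n) $ i) ^ (2 * k)) * g ((norm x)\<^sup>2) \<partial>lborel) = (\<integral>\<^sup>+t. g t \<partial>M1)"
  unfolding M1_def by (subst nn_integral_distr, simp, simp, subst nn_integral_density) auto
 also have "\<dots> = (\<integral>\<^sup>+t. coord_mass i k * (indicator {0..} t * ennreal (real m * t ^ (m - 1)) * g t) \<partial>lborel)"
  unfolding \<open>M1 = M2\<close> M2_def by (subst nn_integral_density) (auto simp: mult.assoc)
 also have "\<dots> = coord_mass i k * (\<integral>\<^sup>+t. indicator {0..} t * ennreal (real m * t ^ (m - 1)) * g t \<partial>lborel)"
  by (subst nn_integral_cmult) auto
 finally show ?thesis .
qed

text \<open>Integrating over spheres relates the moments of the ball to Gaussian ones, and the latter follow from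
 scaling a single coordinate.\<close>

definition gauss_mass :: "'n::finite => nat => ennreal" where
 "gauss_mass i k = (\<integral>\<^sup>+x. ennreal (cmod ((x::complex^'n) $ i) ^ (2 * k)) * ennreal (exp (- (norm x)\<^sup>2)) \<partial>lborel)"

lemma gauss_mass_eq: "gauss_mass (i::'n::finite) k = coord_mass i k * ennreal (fact (CARD('n) + k))"
proof -
 define m where "m = CARD('n) + k"
 have m: "0 < m" by (simp add: m_def)
 have "gauss_mass i k = coord_mass i k *
   (\<integral>\<^sup>+t. indicator {0..} t * ennreal (real m * t ^ (m - 1)) * ennreal (exp (- t)) \<partial>lborel)"
  unfolding gauss_mass_def m_def by (subst nn_integral_radial) auto
 also have "(\<integral>\<^sup>+t. indicator {0..} t * ennreal (real m * t ^ (m - 1)) * ennreal (exp (- t)) \<partial>lborel)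
   = (\<integral>\<^sup>+t. ennreal (real m) * ennreal (indicator {0..} t * t powr (real m - 1) / exp t) \<partial>lborel)"
 proof (intro nn_integral_cong_AE eventually_mono[OF AE_lborel_singleton[of 0]])
  fix t :: real assume t: "t \<noteq> 0"
  show "indicator {0..} t * ennreal (real m * t ^ (m - 1)) * ennreal (exp (- t))
   = ennreal (real m) * ennreal (indicator {0..} t * t powr (real m - 1) / exp t)"
  proof (cases "0 < t")
   case True
   have "t powr (real m - 1) = t ^ (m - 1)" using True m by (simp add: powr_realpow[symmetric] of_nat_diff)
   then show ?thesis using True m
    by (simp add: indicator_def exp_minus divide_inverse mult.assoc flip: ennreal_mult'')
  qed (use t in \<open>auto simp: indicator_def\<close>)
 qed
 also have "\<dots> = ennreal (real m) * ennreal (Gamma (real m))"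
  using m by (subst nn_integral_cmult) (auto simp: Gamma_conv_nn_integral_real)
 also have "\<dots> = ennreal (fact m)"
  using m Gamma_fact[of "m - 1", where 'a=real]
  by (simp add: fact_reduce of_nat_diff flip: ennreal_mult'')
 finally show ?thesis by (simp add: m_def)
qed

lemma gauss_mass_finite: "gauss_mass (i::'n::finite) k < \<infinity>"
 using coord_mass_finite[of i k] by (simp add: gauss_mass_eq ennreal_mult_less_top)

lemma gauss_scale:
 fixes i :: "'n::finite"
 assumes s: "0 \<le> s" "s < 1"
 shows "(\<integral>\<^sup>+x. ennreal (exp (- (norm (x::complex^'n))\<^sup>2 + s * (cmod (x $ i))\<^sup>2)) \<partial>lborel)
  = ennreal (1 / (1 - s)) * gauss_mass i 0"
proof -
 \<comment> \<open>Stretching coordinate \<open>i\<close> by this factor, that is two real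
   directions, turns the perturbed exponent into the plain Gaussian one. The Jacobian is
   \<open>r\<^sup>2\<close>, which is \<open>1 / (1 - s)\<close>.\<close>
 define r where "r = 1 / sqrt (1 - s)"
 have r: "0 < r" using s by (simp add: r_def)
 have r2: "r\<^sup>2 = 1 / (1 - s)" using s by (simp add: r_def power_divide)
 define c where "c j = (if j \<in> {axis i 1, axis i \<i>} then r else 1)" for j :: "complex^'n"
 define T where "T x = 0 + (\<Sum>j\<in>Basis. (c j * (x \<bullet> j)) *\<^sub>R j)" for x :: "complex^'n"
 have T: "T x = (\<chi> k. (if k = i then r else 1) *\<^sub>R x $ k)" for x
 proof (rule euclidean_eqI)
  fix j :: "complex^'n" assume j: "j \<in> Basis"
  then obtain k u where ku: "j = axis k u" "u = 1 \<or> u = \<i>"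
   by (auto simp: Basis_vec_def Basis_complex_def)
  have cj: "c j = (if k = i then r else 1)" using ku by (auto simp: c_def axis_eq_axis)
  have "T x \<bullet> j = c j * (x \<bullet> j)"
   using j by (simp add: T_def inner_sum_left inner_Basis if_distrib sum.delta cong: if_cong)
  moreover have "(\<chi> k. (if k = i then r else 1) *\<^sub>R x $ k) \<bullet> j = (if k = i then r else 1) * (x \<bullet> j)"
   by (simp add: ku inner_axis)
  ultimately show "T x \<bullet> j = (\<chi> k. (if k = i then r else 1) *\<^sub>R x $ k) \<bullet> j"
   by (simp add: cj)
 qed
 have [measurable]: "T \<in> borel_fun" unfolding T_def by measurable
 have sub: "{axis i 1, axis i \<i>} \<subseteq> (Basis :: (complex^'n) set)"
  by (auto simp: Basis_vec_def Basis_complex_def)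
 have "(\<Prod>j\<in>Basis. \<bar>c j\<bar>) = (\<Prod>j\<in>{axis i 1, axis i \<i>}. \<bar>c j\<bar>)"
  by (rule prod.mono_neutral_right) (use sub in \<open>auto simp: c_def\<close>)
 also have "\<dots> = r\<^sup>2" using r by (simp add: c_def axis_eq_axis power2_eq_square)
 finally have prod: "(\<Prod>j\<in>Basis. \<bar>c j\<bar>) = 1 / (1 - s)" by (simp add: r2)
 have lb: "lborel = density (distr lborel borel T) (\<lambda>_. ennreal (1 / (1 - s)))"
  unfolding prod[symmetric] T_def using r by (intro lborel_affine_euclidean) (auto simp: c_def)
 have T_norm: "- (norm (T x))\<^sup>2 + s * (cmod (T x $ i))\<^sup>2 = - (norm x)\<^sup>2" for x
 proof -
  have nrm: "(norm y)\<^sup>2 = (cmod (y $ i))\<^sup>2 + (\<Sum>k\<in>UNIV - {i}. (cmod (y $ k))\<^sup>2)" for y :: "complex^'n"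
   unfolding norm_vec_def L2_set_def by (subst real_sqrt_pow2) (auto simp: sum_nonneg sum.remove[of UNIV i])
  have "(\<Sum>k\<in>UNIV - {i}. (cmod (T x $ k))\<^sup>2) = (\<Sum>k\<in>UNIV - {i}. (cmod (x $ k))\<^sup>2)"
   by (intro sum.cong) (auto simp: T)
  moreover have "(cmod (T x $ i))\<^sup>2 = (cmod (x $ i))\<^sup>2 / (1 - s)"
   using r r2 by (simp add: T power_mult_distrib norm_mult)
  ultimately show ?thesis using s by (simp add: nrm[of "T x"] nrm[of x] field_simps)
 qed
 have "(\<integral>\<^sup>+x. ennreal (exp (- (norm (x::complex^'n))\<^sup>2 + s * (cmod (x $ i))\<^sup>2)) \<partial>lborel)
  = (\<integral>\<^sup>+x. ennreal (1 / (1 - s)) * ennreal (exp (- (norm (T x))\<^sup>2 + s * (cmod (T x $ i))\<^sup>2)) \<partial>lborel)"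
 proof -
  let ?f = "\<lambda>x::complex^'n. ennreal (exp (- (norm x)\<^sup>2 + s * (cmod (x $ i))\<^sup>2))"
  have "(\<integral>\<^sup>+x. ?f x \<partial>lborel) = (\<integral>\<^sup>+x. ?f x \<partial>density (distr lborel borel T) (\<lambda>_. ennreal (1 / (1 - s))))"
   by (subst lb[symmetric]) (rule refl)
  also have "\<dots> = (\<integral>\<^sup>+x. ennreal (1 / (1 - s)) * ?f x \<partial>distr lborel borel T)"
   by (subst nn_integral_density) auto
  also have "\<dots> = (\<integral>\<^sup>+x. ennreal (1 / (1 - s)) * ?f (T x) \<partial>lborel)"
   by (subst nn_integral_distr) auto
  finally show ?thesis .
 qed
 also have "\<dots> = ennreal (1 / (1 - s)) * (\<integral>\<^sup>+x. ennreal (exp (- (norm (x::complex^'n))\<^sup>2)) \<partial>lborel)"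
  unfolding T_norm by (subst nn_integral_cmult) auto
 finally show ?thesis by (simp add: gauss_mass_def)
qed

text \<open>Expanding the exponential of \<open>s\<close> times the squared coordinate in
  \<open>gauss_scale\<close> shows that the masses divided by \<open>fact k\<close> are the
  coefficients of a multiple of the geometric series in \<open>s\<close>.\<close>

lemma gauss_mass_fact: "gauss_mass (i::'n::finite) k = ennreal (fact k) * gauss_mass i 0"
proof -
 define \<gamma> where "\<gamma> k = enn2real (gauss_mass i k)" for k
 have \<gamma>: "gauss_mass i k = ennreal (\<gamma> k)" "0 \<le> \<gamma> k" for k
  using gauss_mass_finite[of i k] by (simp_all add: \<gamma>_def less_top)
 have sm: "(\<lambda>k. s ^ k / fact k * \<gamma> k) sums (\<gamma> 0 / (1 - s))" if s: "0 \<le> s" "s < 1" for s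
 proof -
  have "(\<Sum>k. ennreal (s ^ k / fact k * \<gamma> k)) = (\<Sum>k. ennreal (s ^ k / fact k) * gauss_mass i k)"
   using s by (intro suminf_cong) (simp add: \<gamma> flip: ennreal_mult'')
  also have "\<dots> = (\<Sum>k. \<integral>\<^sup>+x. ennreal (s ^ k / fact k) * (ennreal (cmod ((x::complex^'n) $ i) ^ (2 * k)) * ennreal (exp (- (norm x)\<^sup>2))) \<partial>lborel)"
   unfolding gauss_mass_def by (subst nn_integral_cmult) auto
  also have "\<dots> = (\<integral>\<^sup>+x. (\<Sum>k. ennreal (s ^ k / fact k) * (ennreal (cmod ((x::complex^'n) $ i) ^ (2 * k)) * ennreal (exp (- (norm x)\<^sup>2)))) \<partial>lborel)"
   by (subst nn_integral_suminf) auto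
  also have "\<dots> = (\<integral>\<^sup>+x. ennreal (exp (- (norm (x::complex^'n))\<^sup>2 + s * (cmod (x $ i))\<^sup>2)) \<partial>lborel)"
  proof (intro nn_integral_cong)
   fix x :: "complex^'n"
   let ?a = "s * (cmod (x $ i))\<^sup>2"
   have e: "(\<lambda>k. ?a ^ k / fact k * exp (- (norm x)\<^sup>2)) sums (exp ?a * exp (- (norm x)\<^sup>2))"
    using exp_converges[of ?a] by (intro sums_mult2) (simp add: divide_inverse mult.commute)
   have "ennreal (s ^ k / fact k) * (ennreal (cmod (x $ i) ^ (2 * k)) * ennreal (exp (- (norm x)\<^sup>2)))
    = ennreal (?a ^ k / fact k * exp (- (norm x)\<^sup>2))" for k
    unfolding power_mult[of _ 2 k] using s by (simp add: power_mult_distrib mult_ac flip: ennreal_mult'')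
   then show "(\<Sum>k. ennreal (s ^ k / fact k) * (ennreal (cmod (x $ i) ^ (2 * k)) * ennreal (exp (- (norm x)\<^sup>2))))
     = ennreal (exp (- (norm x)\<^sup>2 + ?a))"
    unfolding exp_add mult.commute[of "exp (- (norm x)\<^sup>2)"]
    by (simp only:) (rule suminf_ennreal_eq[OF _ e], use s in simp)
  qed
  also have "\<dots> = ennreal (\<gamma> 0 / (1 - s))"
   unfolding gauss_scale[OF s] \<gamma>(1)
   using s \<gamma>(2)[of 0] by (simp add: divide_inverse mult.commute flip: ennreal_mult'')
  finally have eq: "(\<Sum>k. ennreal (s ^ k / fact k * \<gamma> k)) = ennreal (\<gamma> 0 / (1 - s))" .
  have "(\<lambda>k. ennreal (s ^ k / fact k * \<gamma> k)) sums (\<Sum>k. ennreal (s ^ k / fact k * \<gamma> k))"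
   by (intro summable_sums) auto
  then show ?thesis unfolding eq using s \<gamma>(2) by (subst (asm) sums_ennreal) simp_all
 qed
 define a where "a k = \<gamma> k / fact k - \<gamma> 0" for k
 have asm: "(\<lambda>k. a k * s ^ k) sums 0" if s: "0 \<le> s" "s < 1" for s
 proof -
  have "(\<lambda>k. s ^ k / fact k * \<gamma> k - \<gamma> 0 * s ^ k) sums (\<gamma> 0 / (1 - s) - \<gamma> 0 * (1 / (1 - s)))"
   using s by (intro sums_diff sm sums_mult geometric_sums) auto
  then show ?thesis by (simp add: a_def algebra_simps)
 qed
 \<comment> \<open>The series is known to vanish only for \<open>s\<close> in [0,1). A nonzero
   coefficient would make 0 an isolated zero, which is incompatible with that.\<close>
 have "a k = 0" for k
 proof (rule ccontr)
  assume ak: "a k \<noteq> 0"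
  have "k > 0" using ak by (cases k) (auto simp: a_def)
  have absb: "summable (\<lambda>k. a k * s ^ k)" if "norm (s - 0) < 1" for s :: real
  proof (rule summable_rabs_cancel)
   have "summable (\<lambda>k. \<bar>s\<bar> ^ k / fact k * \<gamma> k + \<gamma> 0 * \<bar>s\<bar> ^ k)"
    using that by (intro summable_add summable_mult summable_geometric sums_summable[OF sm]) auto
   then show "summable (\<lambda>k. \<bar>a k * s ^ k\<bar>)"
   proof (rule summable_comparison_test'[where N=0])
    fix k
    have "\<bar>a k\<bar> \<le> \<gamma> k / fact k + \<gamma> 0"
     unfolding a_def using \<gamma>(2)[of k] \<gamma>(2)[of 0] by (simp add: abs_le_iff)
    then have "\<bar>a k\<bar> * \<bar>s\<bar> ^ k \<le> (\<gamma> k / fact k + \<gamma> 0) * \<bar>s\<bar> ^ k" by (intro mult_right_mono) auto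
    then show "norm \<bar>a k * s ^ k\<bar> \<le> \<bar>s\<bar> ^ k / fact k * \<gamma> k + \<gamma> 0 * \<bar>s\<bar> ^ k"
     by (simp add: abs_mult power_abs algebra_simps)
   qed
  qed
  obtain s where s: "0 < s" "\<And>z. z \<in> cball 0 s - {0} ==> (\<Sum>k. a k * z ^ k) \<noteq> 0"
  proof (rule powser_0_nonzero[where r=1 and a=a and \<xi>=0 and f="\<lambda>s. \<Sum>k. a k * s ^ k" and m=k])
   show "(\<lambda>n. a n * (x - 0) ^ n) sums (\<Sum>k. a k * x ^ k)" if "norm (x - 0) < 1" for x
    using absb[OF that] by (simp add: summable_sums)
   show "(\<Sum>k. a k * 0 ^ k) = 0" using asm[of 0] by (simp add: sums_iff)
  qed (use ak \<open>k > 0\<close> in auto)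
  define z where "z = min s (1/2)"
  have "(\<Sum>k. a k * z ^ k) \<noteq> 0" using s(1) by (intro s(2)) (auto simp: z_def)
  moreover have "(\<Sum>k. a k * z ^ k) = 0" using asm[of z] s(1) by (simp add: z_def sums_iff)
  ultimately show False by simp
 qed
 then have "\<gamma> k / fact k - \<gamma> 0 = 0" by (simp only: a_def)
 then have "\<gamma> k = fact k * \<gamma> 0" by (simp add: field_simps)
 then show ?thesis unfolding \<gamma>(1) using \<gamma>(2)[of 0] by (simp flip: ennreal_mult'')
qed

lemma coord_mass_eq:
 "coord_mass (i::'n::finite) k = ennreal (fact k * fact CARD('n) * bvol TYPE('n) / fact (CARD('n) + k))"
proof -
 have 0: "coord_mass i 0 = ennreal (bvol TYPE('n))" by (simp add: coord_mass_def emeasure_bvol)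
 have "coord_mass i k * ennreal (fact (CARD('n) + k)) = ennreal (fact k * fact CARD('n) * bvol TYPE('n))"
  using gauss_mass_fact[of i k] bvol_pos[where 'n='n]
  by (simp add: gauss_mass_eq 0 mult_ac flip: ennreal_mult'')
 also have "\<dots> = ennreal (fact k * fact CARD('n) * bvol TYPE('n) / fact (CARD('n) + k)) * ennreal (fact (CARD('n) + k))"
  using bvol_pos[where 'n='n] by (subst ennreal_mult'[symmetric]) auto
 finally show ?thesis
  by (subst (asm) (1 2) mult.commute, subst (asm) ennreal_mult_cancel_left) auto
qed

text \<open>Radial integration leaves a Beta integral, whose Gamma factors combine with the
  normalizing constant into a Pochhammer symbol.\<close>

lemma bergman_moment_axis:
 fixes i :: "'n::finite"
 assumes t: "-1 < t"
 shows "(\<integral>\<^sup>+w. ennreal (cmod ((w::complex^'n) $ i) ^ (2 * k)) \<partial>bergman_measure t)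
  = ennreal (fact k / pochhammer (real CARD('n) + t + 1) k)"
proof -
 define m where "m = CARD('n) + k"
 have m: "0 < m" by (simp add: m_def)
 have V: "0 < bvol TYPE('n)" and c: "0 < bconst TYPE('n) t" using bvol_pos bconst_pos[OF t] by blast+
 let ?d = "bconst TYPE('n) t / bvol TYPE('n)"
 have "(\<integral>\<^sup>+w. ennreal (cmod ((w::complex^'n) $ i) ^ (2 * k)) \<partial>bergman_measure t) =
  (\<integral>\<^sup>+w. ennreal ?d * (ennreal (cmod (w $ i) ^ (2 * k)) * ennreal (indicator {..<1} ((norm w)\<^sup>2) * (1 - (norm w)\<^sup>2) powr t)) \<partial>lborel)"
  using V c by (subst nn_integral_bergman[OF t])
   (auto intro!: nn_integral_cong simp: indicator_def hgt_def power_less_one_iff abs_square_less_1 mult_ac simp flip: ennreal_mult'')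
 also have "\<dots> = ennreal ?d * (coord_mass i k *
   (\<integral>\<^sup>+\<tau>. indicator {0..} \<tau> * ennreal (real m * \<tau> ^ (m - 1)) * ennreal (indicator {..<1} \<tau> * (1 - \<tau>) powr t) \<partial>lborel))"
  unfolding m_def by (subst nn_integral_cmult, simp, subst nn_integral_radial[symmetric]) auto
 also have "(\<integral>\<^sup>+\<tau>. indicator {0..} \<tau> * ennreal (real m * \<tau> ^ (m - 1)) * ennreal (indicator {..<1} \<tau> * (1 - \<tau>) powr t) \<partial>lborel)
   = (\<integral>\<^sup>+\<tau>. ennreal (real m) * ennreal (indicator {0..1} \<tau> * (\<tau> powr (real m - 1) * (1 - \<tau>) powr (t + 1 - 1))) \<partial>lborel)"
 proof (intro nn_integral_cong_AE eventually_mono[OF eventually_conj[OF AE_lborel_singleton[of 0] AE_lborel_singleton[of 1]]])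
  fix \<tau> :: real assume \<tau>: "\<tau> \<noteq> 0 \<and> \<tau> \<noteq> 1"
  have "\<tau> powr (real m - 1) = \<tau> ^ (m - 1)" if "0 < \<tau>" using that m by (simp add: powr_realpow[symmetric] of_nat_diff)
  then show "indicator {0..} \<tau> * ennreal (real m * \<tau> ^ (m - 1)) * ennreal (indicator {..<1} \<tau> * (1 - \<tau>) powr t)
   = ennreal (real m) * ennreal (indicator {0..1} \<tau> * (\<tau> powr (real m - 1) * (1 - \<tau>) powr (t + 1 - 1)))"
   using \<tau> by (auto simp: indicator_def mult.assoc simp flip: ennreal_mult'')
 qed
 also have "\<dots> = ennreal (real m) * ennreal (Beta (real m) (t + 1))"
  using m t nn_integral_has_integral_lebesgue[OF _ has_integral_Beta_real[of "real m" "t + 1"]]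
  by (subst nn_integral_cmult) auto
 also have "ennreal ?d * (coord_mass i k * (ennreal (real m) * ennreal (Beta (real m) (t + 1)))) =
  ennreal (?d * ((fact k * fact CARD('n) * bvol TYPE('n) / fact m) * (real m * Beta (real m) (t + 1))))"
 proof -
  have "0 \<le> Beta (real m) (t + 1)" unfolding Beta_def using m t
   by (intro divide_nonneg_nonneg mult_nonneg_nonneg) (auto intro!: less_imp_le[OF Gamma_real_pos])
  then show ?thesis using V c unfolding coord_mass_eq m_def[symmetric] by (simp flip: ennreal_mult'')
 qed
 also have "?d * ((fact k * fact CARD('n) * bvol TYPE('n) / fact m) * (real m * Beta (real m) (t + 1)))
  = fact k / pochhammer (real CARD('n) + t + 1) k"
 proof -
  have fm: "fact m = real m * Gamma (real m)"
   using m Gamma_fact[of "m - 1", where 'a=real] by (simp add: fact_reduce of_nat_diff)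
  have G: "0 < Gamma (t + 1)" "0 < Gamma (real CARD('n) + t + 1)" "0 < Gamma (real m)" "0 < Gamma (real m + t + 1)"
   using t m by (auto intro!: Gamma_real_pos)
  have nz: "real CARD('n) + t + 1 \<notin> \<int>\<^sub>\<le>\<^sub>0" using t by (intro notI) (auto dest: nonpos_Ints_nonpos)
  have poch: "pochhammer (real CARD('n) + t + 1) k = Gamma (real m + t + 1) / Gamma (real CARD('n) + t + 1)"
   by (subst pochhammer_Gamma[OF nz]) (simp add: m_def add_ac)
  have gen: "B / (fn * A) / V * (fk * fn * V / (mm * g) * (mm * (g * A / Q))) = fk / (Q / B)"
   if "A \<noteq> 0" "B \<noteq> 0" "g \<noteq> 0" "Q \<noteq> 0" "V \<noteq> 0" "fn \<noteq> 0" "mm \<noteq> 0"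
   for A B g Q V fk fn mm :: real
   using that by (simp add: field_simps)
  have "real m + (t + 1) = real m + t + 1" by simp
  then show ?thesis
   unfolding poch fm Beta_def bconst_def \<open>real m + (t + 1) = real m + t + 1\<close>
   using less_imp_neq[OF G(1)] less_imp_neq[OF G(2)] less_imp_neq[OF G(3)] less_imp_neq[OF G(4)] V m
   by (intro gen) auto
 qed
 finally show ?thesis .
qed

text \<open>The reflection along \<open>z - e\<close>. Its adjoint relation between \<open>z\<close>
  and \<open>e\<close> holds only if the inner product of \<open>z - e\<close> with \<open>z\<close>
  is half the squared norm of \<open>z - e\<close>, and that is what a real \<open>herm z e\<close>
  guarantees.\<close>

lemma householder_exists:
 fixes z e :: "complex^'n"
 assumes "norm z = 1" "norm e = 1" "Im (herm z e) = 0"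
 obtains H where "linear H" "\<And>w. norm (H w) = norm w" "\<And>w. herm (H w) z = herm w e"
proof (cases "z = e")
 case True
 then show ?thesis using that[of "\<lambda>w. w"] by (simp add: linear_id[unfolded id_def])
next
 case False
 define v where "v = z - e"
 define r where "r = 2 / (norm v)\<^sup>2"
 define H where "H w = w - (of_real r * herm w v) *s v" for w
 have v: "v \<noteq> 0" using False by (simp add: v_def)
 have rv: "r * (norm v)\<^sup>2 = 2" using v by (simp add: r_def)
 have ze: "herm z e = of_real (Re (herm z e))" "herm e z = of_real (Re (herm z e))"
  using assms(3) arg_cong[OF cnj_herm[of z e], of Im] by (auto simp: complex_eq_iff Re_herm inner_commute)
 have v2: "(norm v)\<^sup>2 = 2 - 2 * Re (herm z e)" unfolding v_def norm_diff_sqr using assms by simp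
 have 1: "linear H"
  unfolding H_def by (intro linearI) (auto simp: herm_add_left herm_scaleR vec_eq_iff, simp_all add: algebra_simps scaleR_conv_of_real)
 have 2: "norm (H w) = norm w" for w
 proof -
  have "(norm (H w))\<^sup>2 = (norm w)\<^sup>2 + (norm ((of_real r * herm w v) *s v))\<^sup>2 - 2 * Re (herm w ((of_real r * herm w v) *s v))"
   unfolding H_def norm_diff_sqr by simp
  also have "herm w ((of_real r * herm w v) *s v) = of_real (r * (cmod (herm w v))\<^sup>2)"
   unfolding of_real_mult complex_norm_square by (simp add: herm_scale_right mult_ac)
  also have "(norm ((of_real r * herm w v) *s v))\<^sup>2 = r * (cmod (herm w v))\<^sup>2 * (r * (norm v)\<^sup>2)"
   by (simp add: norm_vector_smult norm_mult power_mult_distrib power2_eq_square)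
  also have "(norm w)\<^sup>2 + r * (cmod (herm w v))\<^sup>2 * (r * (norm v)\<^sup>2) - 2 * Re (of_real (r * (cmod (herm w v))\<^sup>2)) = (norm w)\<^sup>2"
   unfolding rv by simp
  finally show ?thesis by (simp add: power2_eq_iff_nonneg)
 qed
 have 3: "herm (H w) z = herm w e" for w
 proof -
  have "herm v z = of_real ((norm v)\<^sup>2 / 2)"
   unfolding v2 unfolding v_def using assms ze by (simp add: herm_diff_left herm_self)
  then have "of_real r * herm v z = 1" using rv by (simp flip: of_real_mult of_real_divide)
  then have "herm (H w) z = herm w z - herm w v"
   unfolding H_def by (simp add: herm_diff_left herm_scale_left mult.assoc mult.left_commute[of "of_real r"])
  then show ?thesis by (simp add: v_def herm_diff_right)
 qed
 show ?thesis using that 1 2 3 by blast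
qed

lemma herm_axis: "herm w (axis i 1) = w $ i"
 by (simp add: herm_def axis_def if_distrib[of cnj] if_distrib[of "(*) _"] cong: if_cong)

lemma bergman_moment:
 fixes z :: "complex^'n"
 assumes t: "-1 < t"
 shows "(\<integral>\<^sup>+w. ennreal (cmod (herm w z) ^ (2 * k)) \<partial>bergman_measure t)
  = ennreal (norm z ^ (2 * k) * (fact k / pochhammer (real CARD('n) + t + 1) k))"
proof -
 obtain i :: 'n where True by blast
 define e where "e = (axis i 1 :: complex^'n)"
 have e: "norm e = 1" by (simp add: e_def)
 obtain z' where z': "norm z' = 1" "Im (herm z' e) = 0" "\<And>w. cmod (herm w z) = norm z * cmod (herm w z')"
 proof (cases "z = 0")
  case True
  then show ?thesis using that[of e] e by (simp add: Im_herm_self)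
 next
  case False
  \<comment> \<open>A phase that makes \<open>herm z e\<close> real, so that the reflection applies;
    it does not change the modulus of \<open>herm w z\<close>.\<close>
  define c where "c = (if herm z e = 0 then 1 else cnj (herm z e) / cmod (herm z e))"
  have c: "cmod c = 1" by (simp add: c_def norm_divide)
  define z' where "z' = (c / norm z) *s z"
  have "norm z' = 1" using False c by (simp add: z'_def norm_vector_smult norm_divide)
  moreover have "Im (herm z' e) = 0"
  proof -
   have "c * herm z e = of_real (cmod (herm z e))"
    by (simp add: c_def complex_norm_square[symmetric] power2_eq_square mult.commute)
   then show ?thesis by (simp add: z'_def herm_scale_left)
  qed
  moreover have "cmod (herm w z) = norm z * cmod (herm w z')" for w
   using False c by (simp add: z'_def herm_scale_right norm_mult norm_divide)
  ultimately show ?thesis by (rule that)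
 qed
 obtain H where H: "linear H" "\<And>w. norm (H w) = norm w" "\<And>w. herm (H w) z' = herm w e"
  using householder_exists[OF z'(1) e z'(2)] by blast
 have [measurable]: "H \<in> borel_fun" using H(1) by (rule linear_isometry_measurable)

 have "(\<integral>\<^sup>+w. ennreal (cmod (herm w z) ^ (2 * k)) \<partial>bergman_measure t) =
   (\<integral>\<^sup>+w. ennreal (norm z ^ (2 * k)) * ennreal (cmod (herm w z') ^ (2 * k)) \<partial>bergman_measure t)"
  by (simp add: z'(3) power_mult_distrib flip: ennreal_mult'')
 also have "\<dots> = ennreal (norm z ^ (2 * k)) * (\<integral>\<^sup>+w. ennreal (cmod (herm w z') ^ (2 * k)) \<partial>bergman_measure t)"
  by (subst nn_integral_cmult) auto
 also have "(\<integral>\<^sup>+w. ennreal (cmod (herm w z') ^ (2 * k)) \<partial>bergman_measure t) =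
   (\<integral>\<^sup>+w. ennreal (cmod (herm w z') ^ (2 * k)) \<partial>distr (bergman_measure t) borel H)"
  by (simp only: bergman_distr_isometry[OF t H(1,2)])
 also have "\<dots> = (\<integral>\<^sup>+w. ennreal (cmod (w $ i) ^ (2 * k)) \<partial>bergman_measure t)"
  by (subst nn_integral_distr) (auto simp: H(3) e_def herm_axis)
 also have "\<dots> = ennreal (fact k / pochhammer (real CARD('n) + t + 1) k)"
  by (rule bergman_moment_axis[OF t])
 finally show ?thesis by (simp flip: ennreal_mult')
qed

lemma norm_add_sqr: "(norm (z + w))\<^sup>2 = (norm z)\<^sup>2 + (norm w)\<^sup>2 + 2 * Re (herm z w)"
 unfolding Re_herm power2_norm_eq_inner by (simp add: inner_add_left inner_add_right inner_commute)

lemma emeasure_bergman_UNIV: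
 assumes "-1 < t" shows "emeasure (bergman_measure t :: (complex^'n) measure) UNIV = 1"
 using bergman_moment[OF assms, of "0 :: complex^'n" 0] by simp

lemma finite_measure_bergman: "-1 < t ==> finite_measure (bergman_measure t :: (complex^'n) measure)"
 by (rule finite_measureI) (simp add: emeasure_bergman_UNIV)

lemma AE_bergman:
 assumes "-1 < t" shows "AE w in (bergman_measure t :: (complex^'n) measure). norm w < 1"
 unfolding bergman_measure_density[OF assms] by (subst AE_density) (auto simp: indicator_def)

section \<open>Reproducing formula and Forelli--Rudin estimates\<close>

text \<open>The exponent is a parameter because besides that of the Bergman kernel other exponents
  occur: half exponents in the Forelli--Rudin integrals and the exponent 1 in
  \<open>span_point_bound\<close>.\<close>

definition bkern :: "real => complex^'n => complex^'n => complex" where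
 "bkern \<mu> z w = 1 / (1 - herm z w) powr of_real \<mu>"

lemma measurable_bkern [measurable]:
 "f \<in> borel_measurable M ==> g \<in> borel_measurable M ==> (\<lambda>x. bkern \<mu> (f x) (g x)) \<in> borel_measurable M"
 unfolding bkern_def by measurable

lemma measurable_dst [measurable]:
 "f \<in> borel_measurable M ==> g \<in> borel_measurable M ==> (\<lambda>x. dst (f x) (g x)) \<in> borel_measurable M"
 unfolding dst_def by measurable

lemma norm_herm_less_1:
 assumes "norm z < 1" "norm w \<le> 1" shows "cmod (herm z w) < 1"
 using norm_herm_le[of z w] assms
 by (smt (verit) mult_left_le norm_ge_zero)

lemma Re_one_minus_herm_pos:
 assumes "norm z < 1" "norm w \<le> 1" shows "0 < Re (1 - herm z w)"
 using norm_herm_less_1[OF assms] abs_Re_le_cmod[of "herm z w"] by simp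

lemma norm_bkern:
 assumes "norm z < 1" "norm w \<le> 1" shows "norm (bkern \<mu> z w) = dst z w powr (-\<mu>)"
proof -
 have "1 - herm z w \<noteq> 0" using Re_one_minus_herm_pos[OF assms] by auto
 then have "norm ((1 - herm z w) powr of_real \<mu>) = dst z w powr \<mu>"
  unfolding dst_def by (simp add: norm_powr_real_powr')
 then show ?thesis by (simp add: bkern_def norm_divide powr_minus_divide)
qed

lemma cnj_bkern:
 assumes "norm z < 1" "norm w \<le> 1" shows "cnj (bkern \<mu> z w) = bkern \<mu> w z"
proof -
 have "cnj ((1 - herm z w) powr of_real \<mu>) = (1 - herm w z) powr of_real \<mu>"
  using Re_one_minus_herm_pos[OF assms] by (subst cnj_powr) (auto simp: cnj_herm)
 then show ?thesis by (simp add: bkern_def)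
qed

lemma bkern_series:
 assumes "cmod u < 1"
 shows "(\<lambda>k. of_real (pochhammer \<mu> k / fact k) * u ^ k) sums (1 / (1 - u) powr of_real \<mu>)"
proof -
 have "(\<lambda>k. ((- of_real \<mu>) gchoose k) * (- u) ^ k) sums (1 + - u) powr (- of_real \<mu>)"
  using assms by (intro gen_binomial_complex) simp
 moreover have "((- of_real \<mu>) gchoose k) * (- u) ^ k = of_real (pochhammer \<mu> k / fact k) * u ^ k" for k
 proof -
  have "((- complex_of_real \<mu>) gchoose k) * (- u) ^ k = ((-1) ^ k * (-1) ^ k) * (pochhammer (of_real \<mu>) k / fact k) * u ^ k"
   by (simp add: gbinomial_pochhammer power_minus[of u])
  also have "(-1) ^ k * (-1) ^ k = (1::complex)" by (simp flip: power_mult_distrib)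
  finally show ?thesis by (simp add: pochhammer_of_real)
 qed
 ultimately show ?thesis by (simp add: powr_minus_divide)
qed

lemma holomorphic_slice:
 assumes f: "holomorphic_several f (ball 0 1)" and S: "\<And>\<zeta>. \<zeta> \<in> S ==> norm (a + \<zeta> *s b) < 1"
 shows "(\<lambda>\<zeta>. f (a + \<zeta> *s b)) holomorphic_on S"
 unfolding holomorphic_on_def
proof
 fix \<zeta> assume "\<zeta> \<in> S"
 then have "a + \<zeta> *s b \<in> ball 0 1" using S by simp
 then obtain L where L: "(f has_derivative L) (at (a + \<zeta> *s b))" "\<And>c h. L (c *s h) = c * L h"
  using f unfolding holomorphic_several_def by blast
 have lin: "bounded_linear (\<lambda>h. h *s b)"
  by (rule linear_conv_bounded_linear[THEN iffD1], rule linearI) (auto simp: vec_eq_iff algebra_simps scaleR_conv_of_real[where 'a=complex])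
 have "((\<lambda>\<zeta>. a + \<zeta> *s b) has_derivative (\<lambda>h. h *s b)) (at \<zeta> within S)"
  by (rule has_derivative_eq_rhs[OF has_derivative_add[OF has_derivative_const bounded_linear_imp_has_derivative[OF lin]]]) simp
 from has_derivative_compose[OF this L(1)]
 have "((\<lambda>\<zeta>. f (a + \<zeta> *s b)) has_derivative (\<lambda>h. h * L b)) (at \<zeta> within S)" by (simp add: L(2))
 then have "((\<lambda>\<zeta>. f (a + \<zeta> *s b)) has_field_derivative L b) (at \<zeta> within S)"
  unfolding has_field_derivative_def by (simp add: mult.commute[of _ "L b"])
 then show "(\<lambda>\<zeta>. f (a + \<zeta> *s b)) field_differentiable at \<zeta> within S"
  unfolding field_differentiable_def by blast
qed

section \<open>Averages over circles and Taylor coefficients of slices\<close>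

definition unit_meas :: "real measure" where "unit_meas = density lborel (indicator {0..1})"

lemma sets_unit_meas [simp, measurable_cong]: "sets unit_meas = sets borel"
 by (simp add: unit_meas_def)

lemma space_unit_meas [simp]: "space unit_meas = UNIV" by (simp add: unit_meas_def)

lemma emeasure_unit_meas: "emeasure unit_meas UNIV = 1"
 unfolding unit_meas_def by (subst emeasure_density) auto

lemma finite_measure_unit_meas: "finite_measure unit_meas"
 by (rule finite_measureI) (simp add: emeasure_unit_meas)

lemma integral_unit_meas:
 fixes g :: "real => complex"
 assumes [measurable]: "g \<in> borel_fun" and "continuous_on {0..1} g" "(g has_integral I) {0..1}"
 shows "(\<integral>x. g x \<partial>unit_meas) = I"
proof -
 have "(\<integral>x. g x \<partial>unit_meas) = (\<integral>x. indicator {0..1} x *\<^sub>R g x \<partial>lborel)"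
 proof -
  have e: "(\<lambda>x. indicator {0..1::real} x :: ennreal) = (\<lambda>x. ennreal (indicator {0..1} x))"
   by (auto simp: indicator_def)
  show ?thesis unfolding unit_meas_def e by (subst integral_density) auto
 qed
 also have "\<dots> = integral {0..1} g"
  using set_borel_integral_eq_integral(2)[OF borel_integrable_atLeastAtMost'[OF assms(2)]]
  by (simp add: set_lebesgue_integral_def)
 also have "\<dots> = I" using assms(3) by (rule integral_unique)
 finally show ?thesis .
qed

text \<open>Each isometry preserves the measure, so by Fubini a function may be replaced by its
  average over a measurable one-parameter family. The average has to be computed only inside the
  ball, which carries the measure.\<close>

lemma integral_rotation_average:
 fixes F :: "complex^'n => complex" and U :: "real => complex^'n => complex^'n"
 assumes t: "-1 < t"
  and U: "\<And>x. linear (U x)" "\<And>x w. norm (U x w) = norm w"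
  and meas: "(\<lambda>(x, w). U x w) \<in> borel_measurable (borel \<Otimes>\<^sub>M borel)"
  and F: "integrable (bergman_measure t) F"
  and A: "\<And>w. norm w < 1 ==> (\<integral>x. F (U x w) \<partial>unit_meas) = A w"
  and Am: "A \<in> borel_fun"
 shows "integrable (bergman_measure t) A" "(\<integral>w. F w \<partial>bergman_measure t) = (\<integral>w. A w \<partial>bergman_measure t)"
proof -
 let ?v = "bergman_measure t :: (complex^'n) measure"
 interpret R: finite_measure unit_meas by (rule finite_measure_unit_meas)
 interpret V: finite_measure ?v by (rule finite_measure_bergman[OF t])
 interpret P: pair_sigma_finite unit_meas ?v ..
 have [measurable]: "F \<in> borel_fun" using borel_measurable_integrable[OF F]
  by simp
 have Um [measurable]: "(\<lambda>p. U (fst p) (snd p)) \<in> borel_measurable (unit_meas \<Otimes>\<^sub>M ?v)"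
  using meas by (simp add: case_prod_beta' cong: measurable_cong_sets sets_pair_measure_cong)
 have Ux [measurable]: "U x \<in> borel_fun" for x using U(1) by (rule linear_isometry_measurable)
 have inv: "(\<integral>w. G (U x w) \<partial>?v) = (\<integral>w. G w \<partial>?v)" if "G \<in> borel_fun"
  for G :: "_ => 'b::{banach,second_countable_topology}" and x
  using integral_distr[of "U x" ?v borel G] that bergman_distr_isometry[OF t U(1) U(2), of x]
  by simp
 have invi: "integrable ?v (\<lambda>w. F (U x w))" for x
  using F integrable_distr_eq[of "U x" ?v borel F] bergman_distr_isometry[OF t U(1) U(2), of x] by simp
 have int: "integrable (unit_meas \<Otimes>\<^sub>M ?v) (\<lambda>p. F (U (fst p) (snd p)))"
 proof (rule P.Fubini_integrable)
  have "(\<integral>w. norm (F (U x w)) \<partial>?v) = (\<integral>w. norm (F w) \<partial>?v)" for x by (rule inv) simp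
  then show "integrable unit_meas (\<lambda>x. \<integral>w. norm (F (U (fst (x, w)) (snd (x, w)))) \<partial>?v)" by simp
  show "AE x in unit_meas. integrable ?v (\<lambda>w. F (U (fst (x, w)) (snd (x, w))))" using invi by simp
 qed measurable
 have int': "integrable (unit_meas \<Otimes>\<^sub>M ?v) (\<lambda>(x, w). F (U x w))" using int by (simp add: case_prod_beta')
 have ae: "AE w in ?v. (\<integral>x. F (U x w) \<partial>unit_meas) = A w"
  using AE_bergman[OF t] by eventually_elim (rule A)
 have "integrable ?v (\<lambda>w. \<integral>x. F (U x w) \<partial>unit_meas)" using P.integrable_snd[OF int'] .
 then show "integrable ?v A" by (rule integrable_cong_AE_imp) (use ae Am in auto)
 have "(\<integral>w. F w \<partial>?v) = (\<integral>x. (\<integral>w. F (U x w) \<partial>?v) \<partial>unit_meas)"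
  using inv[of F] by (simp add: measure_def emeasure_unit_meas)
 also have "\<dots> = (\<integral>w. (\<integral>x. F (U x w) \<partial>unit_meas) \<partial>?v)" using P.Fubini_integral[OF int'] by simp
 also have "\<dots> = (\<integral>w. A w \<partial>?v)"
  by (rule integral_cong_AE) (use ae Am borel_measurable_integrable[OF P.integrable_snd[OF int']] in auto)
 finally show "(\<integral>w. F w \<partial>?v) = (\<integral>w. A w \<partial>?v)" .
qed

text \<open>Cauchy's formula for derivatives on the unit circle, where conjugation is
  inversion.\<close>

lemma circle_coefficient:
 assumes "open S" "cball 0 1 \<subseteq> S" and g: "g holomorphic_on S"
 shows "(\<integral>x. g (cis (2 * pi * x)) * cnj (cis (2 * pi * x)) ^ k \<partial>unit_meas) = (deriv ^^ k) g 0 / fact k"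
proof (rule integral_unit_meas)
 have cg: "continuous_on (cball 0 1) g"
  using g assms(2) by (meson holomorphic_on_imp_continuous_on continuous_on_subset)
 have "((\<lambda>u. g u / (u - 0) ^ (Suc k)) has_contour_integral ((2 * pi * \<i>) / (fact k) * (deriv ^^ k) g 0)) (circlepath 0 1)"
  using g assms(2) by (intro Cauchy_has_contour_integral_higher_derivative_circlepath cg)
   (auto elim!: holomorphic_on_subset)
 then have "((\<lambda>x. g (circlepath 0 1 x) / (circlepath 0 1 x) ^ (Suc k) * vector_derivative (circlepath 0 1) (at x within {0..1}))
   has_integral ((2 * pi * \<i>) / (fact k) * (deriv ^^ k) g 0)) {0..1}"
  by (simp add: has_contour_integral_def)
 then have "((\<lambda>x. (2 * pi * \<i>) * (g (cis (2 * pi * x)) * cnj (cis (2 * pi * x)) ^ k))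
   has_integral ((2 * pi * \<i>) * ((deriv ^^ k) g 0 / fact k))) {0..1}"
 proof (rule has_integral_eq[rotated, THEN has_integral_eq_rhs])
  fix x :: real assume x: "x \<in> {0..1}"
  have c: "circlepath 0 1 x = cis (2 * pi * x)"
   by (simp add: circlepath cis_conv_exp mult_ac)
  have v: "vector_derivative (circlepath 0 1) (at x within {0..1}) = 2 * pi * \<i> * cis (2 * pi * x)"
   using x by (simp add: vector_derivative_circlepath01 cis_conv_exp mult_ac)
  have "cnj (cis (2 * pi * x)) ^ k = 1 / cis (2 * pi * x) ^ k"
   by (simp add: cis_cnj divide_inverse cis_inverse power_inverse flip: power_inverse)
  then show "g (circlepath 0 1 x) / (circlepath 0 1 x) ^ (Suc k) * vector_derivative (circlepath 0 1) (at x within {0..1})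
   = (2 * pi * \<i>) * (g (cis (2 * pi * x)) * cnj (cis (2 * pi * x)) ^ k)"
   unfolding c v by (simp add: field_simps)
 qed simp
 then show "((\<lambda>x. g (cis (2 * pi * x)) * cnj (cis (2 * pi * x)) ^ k) has_integral (deriv ^^ k) g 0 / fact k) {0..1}"
  by (drule_tac c="1 / (2 * pi * \<i>)" in has_integral_mult_right) (simp add: field_simps)
 have *: "continuous_on UNIV (\<lambda>x. g (cis (2 * pi * x)) * cnj (cis (2 * pi * x)) ^ k)"
  by (intro continuous_intros continuous_on_compose2[OF cg]) (auto simp: norm_cis)
 then show "continuous_on {0..1} (\<lambda>x. g (cis (2 * pi * x)) * cnj (cis (2 * pi * x)) ^ k)"
  by (rule continuous_on_subset) simp
 show "(\<lambda>x. g (cis (2 * pi * x)) * cnj (cis (2 * pi * x)) ^ k) \<in> borel_fun"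
  using * by (rule borel_measurable_continuous_onI)
qed

text \<open>For holomorphic \<open>f\<close> this is the homogeneous part of degree \<open>k\<close>
  of its expansion at the origin, evaluated at \<open>z\<close>.\<close>

definition slice_coeff :: "(complex^'n => complex) => complex^'n => nat => complex" where
 "slice_coeff f z k = (deriv ^^ k) (\<lambda>\<zeta>. f (\<zeta> *s z)) 0 / fact k"

lemma slice_coeff_sums:
 assumes f: "holomorphic_several f (ball 0 1)" and z: "norm z < 1"
 shows "(\<lambda>k. slice_coeff f z k) sums f z"
proof -
 define r where "r = (if z = 0 then 2 else 1 / norm z)"
 have r: "1 < r" using z by (auto simp: r_def)
 have "norm (0 + \<zeta> *s z) < 1" if "\<zeta> \<in> ball 0 r" for \<zeta>
  using that by (cases "z = 0") (auto simp: r_def norm_vector_smult pos_less_divide_eq)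
 then have "(\<lambda>\<zeta>. f (0 + \<zeta> *s z)) holomorphic_on ball 0 r" by (intro holomorphic_slice[OF f]) auto
 then have "(\<lambda>\<zeta>. f (\<zeta> *s z)) holomorphic_on ball 0 r" by simp
 from holomorphic_power_series[OF this, of 1] show ?thesis
  using r by (simp add: slice_coeff_def)
qed

lemma slice_coeff_unique:
 assumes z: "norm z < 1" and a: "\<And>\<zeta>. cmod \<zeta> < 1 ==> (\<lambda>k. a k * \<zeta> ^ k) sums f (\<zeta> *s z)"
 shows "slice_coeff f z k = a k"
proof -
 define F where "F = Abs_fps a"
 have conv: "fps_conv_radius F \<ge> 1"
  unfolding fps_conv_radius_def F_def
 proof (rule conv_radius_geI_ex)
  fix r :: real assume r: "0 < r" "ereal r < 1"
  have "summable (\<lambda>n. a n * of_real r ^ n)" using a[of "of_real r"] r by (auto simp: sums_iff)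
  then show "\<exists>z. norm z = r \<and> summable (\<lambda>n. fps_nth (Abs_fps a) n * z ^ n)"
   using r by (intro exI[of _ "of_real r"]) auto
 qed
 have "(\<lambda>\<zeta>. f (\<zeta> *s z)) has_fps_expansion F"
  unfolding has_fps_expansion_def
 proof
  show "0 < fps_conv_radius F" using conv by (rule order.strict_trans2[rotated]) simp
  have "eventually (\<lambda>\<zeta>::complex. \<zeta> \<in> ball 0 1) (nhds 0)" by (intro eventually_nhds_in_open) auto
  then show "\<forall>\<^sub>F \<zeta> in nhds 0. eval_fps F \<zeta> = f (\<zeta> *s z)"
   by eventually_elim (use a in \<open>auto simp: eval_fps_def F_def sums_iff\<close>)
 qed
 from fps_nth_fps_expansion[OF this, of k] show ?thesis by (simp add: F_def slice_coeff_def)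
qed

lemma borel_measurable_slice_line:
 assumes f: "holomorphic_several f (ball 0 1)"
 shows "(\<lambda>\<zeta>. indicator (ball 0 1) (\<zeta> *s z) * f (\<zeta> *s z)) \<in> borel_fun"
proof -
 have eq: "(\<lambda>\<zeta>. indicator (ball 0 1) (\<zeta> *s z) * f (\<zeta> *s z)) =
   (\<lambda>\<zeta>. indicator {\<zeta>. norm (\<zeta> *s z) < 1} \<zeta> *\<^sub>R f (\<zeta> *s z))"
  by (auto simp: indicator_def)
 have op: "open {\<zeta>. norm (\<zeta> *s z) < 1}"
  unfolding norm_vector_smult by (intro open_Collect_less continuous_intros)
 have "(\<lambda>\<zeta>. f (0 + \<zeta> *s z)) holomorphic_on {\<zeta>. norm (\<zeta> *s z) < 1}"
  by (rule holomorphic_slice[OF f]) auto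
 then have "continuous_on {\<zeta>. norm (\<zeta> *s z) < 1} (\<lambda>\<zeta>. f (\<zeta> *s z))"
  by (auto dest: holomorphic_on_imp_continuous_on)
 then show ?thesis unfolding eq
  using op by (intro borel_measurable_continuous_on_indicator) auto
qed

text \<open>Averaging over the unitary maps that rotate the orthogonal complement of \<open>z\<close> reduces \<open>f\<close> to the slice
 through \<open>z\<close>, and averaging over the circle then extracts one Taylor coefficient.\<close>

lemma integral_herm_power:
 fixes f :: "complex^'n => complex"
 assumes t: "-1 < t" and f: "holomorphic_several f (ball 0 1)" and int: "integrable (bergman_measure t) f"
  and z: "norm z < 1"
 shows "(\<integral>w. f w * herm z w ^ k \<partial>bergman_measure t) =
  of_real (fact k / pochhammer (real CARD('n) + t + 1) k) * slice_coeff f z k"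
proof -
 let ?v = "bergman_measure t :: (complex^'n) measure"
 have fm [measurable]: "f \<in> borel_fun" using borel_measurable_integrable[OF int] by simp
 define P where "P w = (herm w z / herm z z) *s z" for w
 define U where "U x w = P w + cis (2 * pi * x) *s (w - P w)" for x :: real and w
 define V where "V x w = cis (2 * pi * x) *s w" for x :: real and w :: "complex^'n"
 define s where "s w = herm w z / herm z z" for w
 have hz: "herm (P w) z = herm w z" for w
  by (cases "z = 0") (auto simp: P_def herm_scale_left herm_self)
 have Pz: "herm x (P w) = cnj (herm w z / herm z z) * herm x z" for x w
  by (simp add: P_def herm_scale_right)
 have perp: "herm (w - P w) (P w) = 0" for w by (simp add: Pz herm_diff_left hz)
 have perp': "herm (P w) (w - P w) = 0" for w using perp[of w] cnj_herm[of "w - P w" "P w"] by simp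
 have pyth: "(norm (P w + c *s (w - P w)))\<^sup>2 = (norm (P w))\<^sup>2 + (cmod c)\<^sup>2 * (norm (w - P w))\<^sup>2" for w c
  unfolding norm_add_sqr herm_scale_right perp' norm_vector_smult by (simp add: power_mult_distrib)
 have pyth1: "(norm w)\<^sup>2 = (norm (P w))\<^sup>2 + (norm (w - P w))\<^sup>2" for w using pyth[of w 1] by simp
 have Plin: "P (x + y) = P x + P y" "P (r *\<^sub>R x) = r *\<^sub>R P x" for x y r
  by (auto simp: P_def herm_add_left herm_scaleR vec_eq_iff add_divide_distrib distrib_right scaleR_conv_of_real[where 'a=complex])
 have Ulin: "linear (U x)" for x
  by (rule linearI) (auto simp: U_def Plin vec_eq_iff algebra_simps)
 have Unorm: "norm (U x w) = norm w" for x w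
  by (rule power2_eq_imp_eq) (use pyth[of w "cis (2 * pi * x)"] pyth1[of w] in \<open>simp_all add: U_def\<close>)
 have Vlin: "linear (V x)" for x
  by (rule linearI) (auto simp: V_def vec_eq_iff algebra_simps)
 have Vnorm: "norm (V x w) = norm w" for x w by (simp add: V_def norm_vector_smult)
 have cont_cis: "continuous_on UNIV (\<lambda>x. cis (2 * pi * x))" by (intro continuous_intros)
 have Pcont: "continuous_on UNIV P"
  using Plin by (intro linear_continuous_on) (auto simp: linear_conv_bounded_linear[symmetric] intro: linearI)
 have Um: "(\<lambda>(x, w). U x w) \<in> borel_measurable (borel \<Otimes>\<^sub>M borel)"
  unfolding borel_prod U_def case_prod_beta'
  by (intro borel_measurable_continuous_onI)
   (auto simp: vector_scalar_mult_def intro!: continuous_intros continuous_on_compose2[OF cont_cis] continuous_on_compose2[OF Pcont])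
 have Vm: "(\<lambda>(x, w). V x w) \<in> borel_measurable (borel \<Otimes>\<^sub>M borel)"
  unfolding borel_prod V_def case_prod_beta'
  by (intro borel_measurable_continuous_onI)
   (auto simp: vector_scalar_mult_def intro!: continuous_intros continuous_on_compose2[OF cont_cis])
 have Pnorm: "norm (P w) \<le> norm w" for w
  using pyth1[of w] by (simp add: power2_le_imp_le)
 have [measurable]: "P \<in> borel_fun" using Pcont by (rule borel_measurable_continuous_onI)
 have [measurable]: "(\<lambda>w. s w) \<in> borel_fun" unfolding s_def by measurable
 define A where "A w = indicator (ball 0 1) (P w) * f (P w) * herm z w ^ k" for w
 have mA: "A \<in> borel_fun"
 proof -
  have "(\<lambda>w. indicator (ball 0 1) (s w *s z) * f (s w *s z)) \<in> borel_fun"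
   by (rule measurable_compose[OF _ borel_measurable_slice_line[OF f]]) simp
  then show ?thesis unfolding A_def P_def s_def[symmetric] by measurable
 qed
 have F1: "integrable ?v (\<lambda>w. f w * herm z w ^ k)"
 proof (rule Bochner_Integration.integrable_bound[OF int])
  show "AE w in ?v. norm (f w * herm z w ^ k) \<le> norm (f w)"
   using AE_bergman[OF t]
  proof eventually_elim
   case (elim w)
   then have "cmod (herm z w) ^ k \<le> 1" using norm_herm_less_1[of z w] z by (intro power_le_one) auto
   then show ?case by (simp add: norm_mult norm_power mult_left_le)
  qed
 qed measurable
 have avg1: "(\<integral>x. f (U x w) * herm z (U x w) ^ k \<partial>unit_meas) = A w" if w: "norm w < 1" for w
 proof -
  have hU: "herm z (U x w) = herm z w" for x
  proof -
   have "herm (w - P w) z = 0" by (simp add: herm_diff_left hz)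
   then have "herm (U x w) z = herm w z" unfolding U_def herm_add_left herm_scale_left hz by simp
   then show ?thesis by (metis cnj_herm)
  qed
  define S where "S = {\<zeta>. norm (P w + \<zeta> *s (w - P w)) < 1}"
  have "open S" unfolding S_def vector_scalar_mult_def
   by (intro open_Collect_less continuous_intros)
  moreover have "cball 0 1 \<subseteq> S"
  proof
   fix \<zeta> :: complex assume "\<zeta> \<in> cball 0 1"
   then have "(cmod \<zeta>)\<^sup>2 \<le> 1" by (simp add: power_le_one)
   then have "(cmod \<zeta>)\<^sup>2 * (norm (w - P w))\<^sup>2 \<le> 1 * (norm (w - P w))\<^sup>2" by (intro mult_right_mono) auto
   then have "(norm (P w + \<zeta> *s (w - P w)))\<^sup>2 \<le> (norm w)\<^sup>2" unfolding pyth pyth1[of w] by simp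
   then have "norm (P w + \<zeta> *s (w - P w)) \<le> norm w" by (rule power2_le_imp_le) simp
   then show "\<zeta> \<in> S" using w by (simp add: S_def)
  qed
  moreover have "(\<lambda>\<zeta>. f (P w + \<zeta> *s (w - P w))) holomorphic_on S"
   by (rule holomorphic_slice[OF f]) (simp add: S_def)
  ultimately have "(\<integral>x. f (U x w) * cnj (cis (2 * pi * x)) ^ 0 \<partial>unit_meas) =
    (deriv ^^ 0) (\<lambda>\<zeta>. f (P w + \<zeta> *s (w - P w))) 0 / fact 0"
   unfolding U_def by (rule circle_coefficient)
  then have "(\<integral>x. f (U x w) \<partial>unit_meas) = f (P w)" by simp
  then show ?thesis using w Pnorm[of w] unfolding hU A_def by simp
 qed
 note step1 = integral_rotation_average[OF t Ulin Unorm Um F1 avg1 mA]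
 define B where "B w = slice_coeff f z k * (s w * herm z w) ^ k" for w
 have sh: "s w * herm z w = of_real ((cmod (herm w z))\<^sup>2 / (norm z)\<^sup>2)" for w
  unfolding s_def herm_self cnj_herm[of w z, symmetric] of_real_divide complex_norm_square by simp
 have mB: "B \<in> borel_fun" unfolding B_def by measurable
 have avg2: "(\<integral>x. A (V x w) \<partial>unit_meas) = B w" if w: "norm w < 1" for w
 proof -
  \<comment> \<open>Rotating \<open>w\<close> by the full circle rotates its coordinate
    \<open>s w\<close> along \<open>z\<close>, while \<open>herm z w ^ k\<close> supplies the
    \<open>k\<close>-th power of the conjugate parameter. This is the combination from which
    \<open>circle_coefficient\<close> extracts a coefficient.\<close>
  have sV: "s (V x w) = s w * cis (2 * pi * x)" for x by (simp add: s_def V_def herm_scale_left)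
  have hV: "herm z (V x w) = cnj (cis (2 * pi * x)) * herm z w" for x by (simp add: V_def herm_scale_right)
  define S where "S = {\<zeta>. norm ((s w * \<zeta>) *s z) < 1}"
  have S: "open S" "cball 0 1 \<subseteq> S"
  proof -
   show "open S" unfolding S_def vector_scalar_mult_def by (intro open_Collect_less continuous_intros)
   show "cball 0 1 \<subseteq> S"
   proof
    fix \<zeta> :: complex assume "\<zeta> \<in> cball 0 1"
    then have "cmod \<zeta> * norm (P w) \<le> 1 * norm (P w)" by (intro mult_right_mono) auto
    also have "\<dots> < 1" using Pnorm[of w] w by simp
    finally show "\<zeta> \<in> S" unfolding S_def P_def s_def norm_vector_smult norm_mult by (simp add: mult_ac)
   qed
  qed
  have hol: "(\<lambda>\<zeta>. f (0 + \<zeta> *s (s w *s z))) holomorphic_on S"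
   by (rule holomorphic_slice[OF f]) (auto simp: S_def mult.commute)
  have slice_hol: "(\<lambda>\<zeta>. f (0 + \<zeta> *s z)) holomorphic_on {\<zeta>. norm (\<zeta> *s z) < 1}"
   by (rule holomorphic_slice[OF f]) auto
  have op: "open {\<zeta>. norm (\<zeta> *s z) < 1}"
   unfolding norm_vector_smult by (intro open_Collect_less continuous_intros)
  have co: "(deriv ^^ k) (\<lambda>\<zeta>. f ((s w * \<zeta>) *s z)) 0 = s w ^ k * (deriv ^^ k) (\<lambda>\<zeta>. f (\<zeta> *s z)) (s w * 0)"
   using slice_hol op S by (intro higher_deriv_compose_linear[where S=S]) (auto simp: S_def)
  have inb: "V x w \<in> ball 0 1" "P (V x w) \<in> ball 0 1" for x
   using w Pnorm[of "V x w"] by (auto simp: Vnorm)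
  have "A (V x w) = herm z w ^ k * (f ((s w * cis (2 * pi * x)) *s z) * cnj (cis (2 * pi * x)) ^ k)" for x
   using inb[of x] unfolding A_def P_def s_def[symmetric] sV hV by (simp add: power_mult_distrib mult_ac)
  then have "(\<integral>x. A (V x w) \<partial>unit_meas) = herm z w ^ k *
    (\<integral>x. f ((s w * cis (2 * pi * x)) *s z) * cnj (cis (2 * pi * x)) ^ k \<partial>unit_meas)"
   by (simp only: integral_mult_right_zero)
  also have "(\<integral>x. f ((s w * cis (2 * pi * x)) *s z) * cnj (cis (2 * pi * x)) ^ k \<partial>unit_meas)
   = (deriv ^^ k) (\<lambda>\<zeta>. f ((s w * \<zeta>) *s z)) 0 / fact k"
   using circle_coefficient[OF S hol, of k] by (simp add: mult.commute)
  finally show ?thesis unfolding co B_def slice_coeff_def by (simp add: power_mult_distrib mult_ac)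
 qed
 note step2 = integral_rotation_average[OF t Vlin Vnorm Vm step1(1) avg2 mB]
 have "(\<integral>w. f w * herm z w ^ k \<partial>?v) = (\<integral>w. B w \<partial>?v)" using step1(2) step2(2) by simp
 also have "\<dots> = slice_coeff f z k * (\<integral>w. (s w * herm z w) ^ k \<partial>?v)"
  unfolding B_def by (rule integral_mult_right_zero)
 also have "slice_coeff f z k * (\<integral>w. (s w * herm z w) ^ k \<partial>?v) =
   slice_coeff f z k * of_real (fact k / pochhammer (real CARD('n) + t + 1) k)"
 \<comment> \<open>For \<open>z = 0\<close> the convention x / 0 = 0 makes \<open>s\<close> vanish.
   For \<open>k = 0\<close> what remains is the total mass 1, and for positive \<open>k\<close> the
   coefficient of the constant slice is 0.\<close>
 proof (cases "z = 0")
  case True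
  have c0: "slice_coeff f z k = 0" if "k > 0"
   using slice_coeff_unique[of z "\<lambda>k. if k = 0 then f 0 else 0" f k] True that
   by (simp add: sums_If_finite_set'[where A="{0}", simplified] sums_single[of 0 "\<lambda>_. f 0"]
     if_distrib[of "\<lambda>x. x * _"] cong: if_cong)
  show ?thesis
  proof (cases k)
   case 0 then show ?thesis by (simp add: measure_def emeasure_bergman_UNIV[OF t])
  qed (use c0 in auto)
 next
  case False
  have "(\<integral>w. (s w * herm z w) ^ k \<partial>?v) = (\<integral>w. complex_of_real (1 / norm z ^ (2 * k) * cmod (herm w z) ^ (2 * k)) \<partial>?v)"
   unfolding sh by (simp add: power_divide flip: power_mult)
  also have "\<dots> = of_real (1 / norm z ^ (2 * k) * (\<integral>w. cmod (herm w z) ^ (2 * k) \<partial>?v))"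
   by (simp only: integral_complex_of_real integral_mult_right_zero)
  also have "(\<integral>w. cmod (herm w z) ^ (2 * k) \<partial>?v) = norm z ^ (2 * k) * (fact k / pochhammer (real CARD('n) + t + 1) k)"
  proof -
   have "0 < pochhammer (real CARD('n) + t + 1) k" using t by (intro pochhammer_pos) simp
   then show ?thesis by (subst integral_eq_nn_integral) (auto simp: bergman_moment[OF t])
  qed
  finally show ?thesis using False by simp
 qed
 finally show ?thesis by (simp add: mult.commute)
qed

text \<open>The kernel is expanded in powers of \<open>herm z w\<close> and integrated termwise,
  dominated by the binomial series at \<open>norm z\<close>. The exponents of kernel and measure are
  independent, so that the operator multiplies the part of degree \<open>k\<close> by a quotient of
  Pochhammer symbols.\<close>

lemma integral_bkern_sums:
 fixes f :: "complex^'n => complex"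
 assumes t: "-1 < t" and f: "holomorphic_several f (ball 0 1)" and int: "integrable (bergman_measure t) f"
  and z: "norm z < 1"
 shows "(\<lambda>k. of_real (pochhammer \<mu> k / pochhammer (real CARD('n) + t + 1) k) * slice_coeff f z k) sums
  (\<integral>w. f w * bkern \<mu> z w \<partial>bergman_measure t)"
proof -
 let ?v = "bergman_measure t :: (complex^'n) measure"
 let ?c = "\<lambda>k. complex_of_real (pochhammer \<mu> k / fact k)"
 have fm [measurable]: "f \<in> borel_fun" using borel_measurable_integrable[OF int] by simp
 have bd: "norm (?c k * (f w * herm z w ^ k)) \<le> norm (?c k * of_real (norm z) ^ k) * norm (f w)" if "norm w < 1" for k w
 proof -
  have "cmod (herm z w) \<le> norm z"
   using norm_herm_le[of z w] that by (smt (verit) mult_left_le norm_ge_zero)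
  then have "cmod (herm z w) ^ k \<le> norm z ^ k" by (intro power_mono) auto
  then have "cmod (?c k) * cmod (f w) * cmod (herm z w) ^ k \<le> cmod (?c k) * cmod (f w) * norm z ^ k"
   by (intro mult_left_mono) auto
  then show ?thesis by (simp only: norm_mult norm_power norm_of_real abs_norm_cancel) (simp add: mult_ac)
 qed
 have sm: "summable (\<lambda>k. norm (?c k * of_real (norm z) ^ k))"
 proof -
  have "1 \<le> conv_radius ?c"
  proof (rule conv_radius_geI_ex)
   fix r :: real assume "0 < r" "ereal r < 1"
   then show "\<exists>z. norm z = r \<and> summable (\<lambda>n. ?c n * z ^ n)"
    using bkern_series[of "of_real r" \<mu>] by (intro exI[of _ "of_real r"]) (auto simp: sums_iff)
  qed
  moreover have "ereal (norm (complex_of_real (norm z))) < 1" using z by simp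
  ultimately show ?thesis by (intro abs_summable_in_conv_radius) (rule less_le_trans)
 qed
 have intk: "integrable ?v (\<lambda>w. ?c k * (f w * herm z w ^ k))" for k
 proof (rule Bochner_Integration.integrable_bound)
  show "integrable ?v (\<lambda>w. norm (?c k * of_real (norm z) ^ k) * norm (f w))" using int by simp
  show "AE w in ?v. norm (?c k * (f w * herm z w ^ k)) \<le> norm (norm (?c k * of_real (norm z) ^ k) * norm (f w))"
   using AE_bergman[OF t] by eventually_elim (use bd in auto)
 qed measurable
 have "(\<lambda>k. \<integral>w. ?c k * (f w * herm z w ^ k) \<partial>?v) sums (\<integral>w. (\<Sum>k. ?c k * (f w * herm z w ^ k)) \<partial>?v)"
 proof (rule sums_integral[OF intk])
  show "AE w in ?v. summable (\<lambda>k. norm (?c k * (f w * herm z w ^ k)))"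
   using AE_bergman[OF t]
  proof eventually_elim
   case (elim w)
   show ?case by (rule summable_comparison_test'[OF summable_mult2[OF sm, of "norm (f w)"], of 0]) (use bd elim in simp)
  qed
  show "summable (\<lambda>k. \<integral>w. norm (?c k * (f w * herm z w ^ k)) \<partial>?v)"
  proof (rule summable_comparison_test'[OF summable_mult2[OF sm, of "\<integral>w. norm (f w) \<partial>?v"], of 0])
   fix k
   have "(\<integral>w. norm (?c k * (f w * herm z w ^ k)) \<partial>?v) \<le> (\<integral>w. norm (?c k * of_real (norm z) ^ k) * norm (f w) \<partial>?v)"
   proof (rule integral_mono_AE)
    show "AE w in ?v. norm (?c k * (f w * herm z w ^ k)) \<le> norm (?c k * of_real (norm z) ^ k) * norm (f w)"
     using AE_bergman[OF t] by eventually_elim (rule bd)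
    show "integrable ?v (\<lambda>w. norm (?c k * (f w * herm z w ^ k)))" by (rule integrable_norm[OF intk])
    show "integrable ?v (\<lambda>w. norm (?c k * of_real (norm z) ^ k) * norm (f w))" using int by simp
   qed
   then show "norm (\<integral>w. norm (?c k * (f w * herm z w ^ k)) \<partial>?v) \<le> norm (?c k * of_real (norm z) ^ k) * (\<integral>w. norm (f w) \<partial>?v)"
    by (simp add: integral_nonneg_AE)
  qed
 qed
 also have "(\<integral>w. (\<Sum>k. ?c k * (f w * herm z w ^ k)) \<partial>?v) = (\<integral>w. f w * bkern \<mu> z w \<partial>?v)"
 proof (rule integral_cong_AE)
  show "AE w in ?v. (\<Sum>k. ?c k * (f w * herm z w ^ k)) = f w * bkern \<mu> z w"
   using AE_bergman[OF t]
  proof eventually_elim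
   case (elim w)
   then have "(\<lambda>k. f w * (?c k * herm z w ^ k)) sums (f w * bkern \<mu> z w)"
    unfolding bkern_def using z by (intro sums_mult bkern_series norm_herm_less_1) auto
   then show ?case by (simp add: sums_iff mult_ac)
  qed
 qed measurable
 finally have "(\<lambda>k. \<integral>w. ?c k * (f w * herm z w ^ k) \<partial>?v) sums (\<integral>w. f w * bkern \<mu> z w \<partial>?v)" .
 moreover have "(\<integral>w. ?c k * (f w * herm z w ^ k) \<partial>?v) =
   of_real (pochhammer \<mu> k / pochhammer (real CARD('n) + t + 1) k) * slice_coeff f z k" for k
  unfolding integral_mult_right_zero integral_herm_power[OF t f int z] by simp
 ultimately show ?thesis by simp
qed

text \<open>For this exponent the Pochhammer quotient in \<open>integral_bkern_sums\<close> is 1 and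
  the series is the expansion of \<open>f\<close> along its slice.\<close>

lemma bergman_reproducing:
 fixes f :: "complex^'n => complex"
 assumes t: "-1 < t" and f: "holomorphic_several f (ball 0 1)" and int: "integrable (bergman_measure t) f"
  and z: "norm z < 1"
 shows "(\<integral>w. f w * bkern (real CARD('n) + 1 + t) z w \<partial>bergman_measure t) = f z"
proof -
 have "0 < pochhammer (real CARD('n) + t + 1) k" for k using t by (intro pochhammer_pos) simp
 then have "pochhammer (real CARD('n) + t + 1) k \<noteq> 0" for k by (metis less_irrefl)
 then have "(\<lambda>k. slice_coeff f z k) sums (\<integral>w. f w * bkern (real CARD('n) + 1 + t) z w \<partial>bergman_measure t)"
  using integral_bkern_sums[OF assms, of "real CARD('n) + t + 1"] by (simp add: add_ac)
 then show ?thesis using slice_coeff_sums[OF f z] by (rule sums_unique2)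
qed

lemma holomorphic_several_compose_herm:
 assumes F: "F holomorphic_on S" "open S" and S: "\<And>w. w \<in> U ==> herm w z \<in> S"
 shows "holomorphic_several (\<lambda>w. F (herm w z)) U"
 unfolding holomorphic_several_def
proof
 fix w assume w: "w \<in> U"
 have lin: "bounded_linear (\<lambda>h. herm h z)"
  by (rule linear_conv_bounded_linear[THEN iffD1], rule linearI)
   (auto simp: herm_add_left herm_scaleR scaleR_conv_of_real[where 'a=complex])
 have "(F has_field_derivative deriv F (herm w z)) (at (herm w z))"
  using F S[OF w] by (rule holomorphic_derivI)
 from has_derivative_compose[OF bounded_linear_imp_has_derivative[OF lin] this[unfolded has_field_derivative_def]]
 have "((\<lambda>w. F (herm w z)) has_derivative (\<lambda>h. deriv F (herm w z) * herm h z)) (at w)" .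
 then show "\<exists>L. ((\<lambda>w. F (herm w z)) has_derivative L) (at w) \<and> (\<forall>c h. L (c *s h) = c * L h)"
  by (intro exI[of _ "\<lambda>h. deriv F (herm w z) * herm h z"]) (auto simp: herm_scale_left)
qed

lemma holomorphic_several_bkern:
 assumes "norm z \<le> 1"
 shows "holomorphic_several (\<lambda>w. bkern \<mu> w z) (ball 0 1)"
proof -
 have re: "1 - u \<notin> \<real>\<^sub>\<le>\<^sub>0" if "cmod u < 1" for u
  using that abs_Re_le_cmod[of u] by (auto simp: complex_nonpos_Reals_iff)
 have "(\<lambda>u. 1 / (1 - u) powr of_real \<mu>) holomorphic_on ball 0 1"
  using re by (intro holomorphic_intros) (auto dest: re)
 then show ?thesis
  unfolding bkern_def using assms norm_herm_less_1
  by (intro holomorphic_several_compose_herm[where S="ball 0 1"]) auto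
qed

lemma norm_bkern_le:
 assumes z: "norm z < 1" and w: "norm w \<le> 1" and mu: "0 \<le> \<mu>"
 shows "norm (bkern \<mu> z w) \<le> (hgt z / 2) powr (-\<mu>)"
 unfolding norm_bkern[OF z w] using hgt_pos[OF z] hgt_le_dst[of z w] assms
 by (intro powr_mono2') auto

section \<open>Integrals of powers of the kernel\<close>

lemma integrable_bergman_bounded:
 fixes f :: "complex^'n => 'b::{banach,second_countable_topology}"
 assumes t: "-1 < t" and [measurable]: "f \<in> borel_fun" and bd: "\<And>w. norm w < 1 ==> norm (f w) \<le> B"
 shows "integrable (bergman_measure t) f"
proof -
 interpret finite_measure "bergman_measure t :: (complex^'n) measure" by (rule finite_measure_bergman[OF t])
 show ?thesis
  by (rule integrable_const_bound[where B=B]) (use AE_bergman[OF t] bd in \<open>auto elim: eventually_mono\<close>)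
qed

text \<open>The integrand is the squared modulus of \<open>bkern \<mu> z w\<close>, so the previous
  expansion applies to the function \<open>bkern \<mu> w z\<close> of \<open>w\<close>, whose slice
  through \<open>z\<close> is again a binomial series.\<close>

lemma dst_integral_sums:
 fixes z :: "complex^'n"
 assumes t: "-1 < t" and z: "norm z < 1" and mu: "0 \<le> \<mu>"
 shows "(\<lambda>k. pochhammer \<mu> k ^ 2 / (pochhammer (real CARD('n) + 1 + t) k * fact k) * norm z ^ (2 * k)) sums
  (\<integral>w. dst z w powr (- (2 * \<mu>)) \<partial>bergman_measure t)"
proof -
 let ?v = "bergman_measure t :: (complex^'n) measure"
 define f where "f w = bkern \<mu> w z" for w
 have f: "holomorphic_several f (ball 0 1)"
  unfolding f_def using z by (intro holomorphic_several_bkern) auto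
 have fm [measurable]: "f \<in> borel_fun" unfolding f_def by measurable
 have cf: "f w = cnj (bkern \<mu> z w)" if "norm w < 1" for w
  unfolding f_def using z that by (subst cnj_bkern) auto
 have int: "integrable ?v f"
  by (rule integrable_bergman_bounded[OF t, where B="(hgt z / 2) powr (-\<mu>)"])
   (use norm_bkern_le[OF z _ mu] cf in auto)
 have co: "slice_coeff f z k = of_real (pochhammer \<mu> k / fact k * norm z ^ (2 * k))" for k
 proof (rule slice_coeff_unique[OF z])
  fix \<zeta> :: complex assume \<zeta>: "cmod \<zeta> < 1"
  have "cmod (\<zeta> * of_real ((norm z)\<^sup>2)) < 1"
  proof -
   have "(norm z)\<^sup>2 \<le> 1" using z by (simp add: power_le_one)
   then have "cmod \<zeta> * (norm z)\<^sup>2 \<le> cmod \<zeta>" by (simp add: mult_left_le)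
   then show ?thesis using \<zeta> by (simp add: norm_mult norm_power)
  qed
  from bkern_series[OF this, of \<mu>]
  show "(\<lambda>k. of_real (pochhammer \<mu> k / fact k * norm z ^ (2 * k)) * \<zeta> ^ k) sums f (\<zeta> *s z)"
   unfolding power_mult by (simp add: f_def bkern_def herm_scale_left herm_self power_mult_distrib mult_ac)
 qed
 have "(\<lambda>k. complex_of_real (pochhammer \<mu> k / pochhammer (real CARD('n) + t + 1) k * (pochhammer \<mu> k / fact k * norm z ^ (2 * k))))
   sums (\<integral>w. f w * bkern \<mu> z w \<partial>?v)"
  using integral_bkern_sums[OF t f int z, of \<mu>] unfolding co of_real_mult .
 also have "(\<integral>w. f w * bkern \<mu> z w \<partial>?v) = (\<integral>w. complex_of_real (dst z w powr (- (2 * \<mu>))) \<partial>?v)"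
 proof (rule integral_cong_AE)
  show "AE w in ?v. f w * bkern \<mu> z w = complex_of_real (dst z w powr (- (2 * \<mu>)))"
   using AE_bergman[OF t]
  proof eventually_elim
   case (elim w)
   have "f w * bkern \<mu> z w = of_real ((norm (bkern \<mu> z w))\<^sup>2)"
    unfolding complex_norm_square using cf elim by (simp add: mult.commute)
   also have "(norm (bkern \<mu> z w))\<^sup>2 = dst z w powr (- (2 * \<mu>))"
    using z elim by (simp add: norm_bkern power2_eq_square flip: powr_add)
   finally show ?case .
  qed
 qed measurable
 also have "\<dots> = of_real (\<integral>w. dst z w powr (- (2 * \<mu>)) \<partial>?v)" by (rule integral_complex_of_real)
 finally show ?thesis
  unfolding sums_of_real_iff by (simp add: power2_eq_square add_ac mult_ac)
qed

lemma integrable_dst_powr: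
 fixes z :: "complex^'n"
 assumes t: "-1 < t" and z: "norm z < 1"
 shows "integrable (bergman_measure t) (\<lambda>w. dst z w powr a)"
proof (rule integrable_bergman_bounded[OF t, where B="(hgt z / 2) powr a + 2 powr a"])
 fix w :: "complex^'n" assume w: "norm w < 1"
 have d: "hgt z / 2 \<le> dst z w" "dst z w \<le> 2" "0 < hgt z"
  using hgt_le_dst[of z w] dst_le_2[of z w] hgt_pos[of z] z w by auto
 have "dst z w powr a \<le> (hgt z / 2) powr a \<or> dst z w powr a \<le> 2 powr a"
  using d by (cases "a \<ge> 0") (auto intro: powr_mono2 powr_mono2')
 then show "norm (dst z w powr a) \<le> (hgt z / 2) powr a + 2 powr a"
  by (auto simp: add_increasing add_increasing2)
qed measurable

text \<open>At this exponent one Pochhammer factor cancels and the series is the binomial series of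
  a power of the height.\<close>

lemma berezin_mass:
 fixes z :: "complex^'n"
 assumes t: "-1 < t" and z: "norm z < 1"
 shows "(\<integral>w. dst z w powr (- (2 * (real CARD('n) + 1 + t))) \<partial>bergman_measure t) = hgt z powr (- (real CARD('n) + 1 + t))"
proof -
 define \<mu> where "\<mu> = real CARD('n) + 1 + t"
 have mu: "0 < \<mu>" using t by (simp add: \<mu>_def)
 have "pochhammer \<mu> k \<noteq> 0" for k using pochhammer_pos[OF mu, of k] by simp
 then have "(\<lambda>k. pochhammer \<mu> k / fact k * norm z ^ (2 * k)) sums (\<integral>w. dst z w powr (- (2 * \<mu>)) \<partial>bergman_measure t)"
  using dst_integral_sums[OF t z, of \<mu>] mu by (simp add: \<mu>_def[symmetric] power2_eq_square)
 moreover have "(\<lambda>k. complex_of_real (pochhammer \<mu> k / fact k * norm z ^ (2 * k))) sums of_real (hgt z powr (- \<mu>))"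
 proof -
  have "(norm z)\<^sup>2 < 1" using z by (simp add: power_less_one_iff abs_square_less_1)
  then have "cmod (of_real ((norm z)\<^sup>2)) < 1" by (simp add: norm_power)
  from bkern_series[OF this, of \<mu>]
  have "(\<lambda>k. complex_of_real (pochhammer \<mu> k / fact k * norm z ^ (2 * k))) sums (1 / (of_real (hgt z)) powr of_real \<mu>)"
   by (simp add: hgt_def power_mult)
  also have "(1 / (of_real (hgt z)) powr of_real \<mu>) = complex_of_real (hgt z powr (- \<mu>))"
   using hgt_pos[OF z] by (simp add: powr_of_real powr_minus_divide)
  finally show ?thesis .
 qed
 ultimately show ?thesis
  unfolding sums_of_real_iff \<mu>_def[symmetric] by (rule sums_unique2)
qed

text \<open>Midpoint log-convexity of Gamma, written for Pochhammer symbols. It takes the place of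
  Stirling asymptotics in the Forelli--Rudin estimate.\<close>

lemma pochhammer_log_convex:
 fixes a b :: real
 assumes a: "0 < a" and b: "0 < b"
 shows "pochhammer ((a + b) / 2) k ^ 2 \<le> Gamma a * Gamma b / (Gamma ((a + b) / 2))\<^sup>2 * (pochhammer a k * pochhammer b k)"
proof -
 have G: "0 < Gamma (x + real k)" "0 < Gamma x" if "0 < x" for x :: real
  using that by (auto intro!: Gamma_real_pos)
 have ph: "pochhammer x k = Gamma (x + real k) / Gamma x" if "0 < x" for x :: real
  using that by (intro pochhammer_Gamma) (auto dest: nonpos_Ints_nonpos)
 have "(ln \<circ> Gamma) ((1 - 1/2) *\<^sub>R (a + real k) + (1/2) *\<^sub>R (b + real k)) \<le>
   (1 - 1/2) * (ln \<circ> Gamma) (a + real k) + (1/2) * (ln \<circ> Gamma) (b + real k)"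
  using a b by (intro convex_onD[OF log_convex_Gamma_real]) auto
 moreover have "(1 - 1/2) *\<^sub>R (a + real k) + (1/2) *\<^sub>R (b + real k) = (a + b) / 2 + real k"
  by (simp add: field_simps)
 ultimately have "2 * ln (Gamma ((a + b) / 2 + real k)) \<le> ln (Gamma (a + real k)) + ln (Gamma (b + real k))"
  by simp
 then have "ln ((Gamma ((a + b) / 2 + real k))\<^sup>2) \<le> ln (Gamma (a + real k) * Gamma (b + real k))"
  using G(1)[OF a] G(1)[OF b] G(1)[of "(a + b) / 2"] G(1)[OF a, THEN less_imp_neq] G(1)[OF b, THEN less_imp_neq] a b
  by (simp add: ln_mult ln_realpow)
 then have le: "(Gamma ((a + b) / 2 + real k))\<^sup>2 \<le> Gamma (a + real k) * Gamma (b + real k)"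
  using G(1)[OF a] G(1)[OF b] G(1)[of "(a + b) / 2"] a b
  by (subst (asm) ln_le_cancel_iff) (auto intro!: mult_pos_pos zero_less_power)
 have gen: "Ga * Gb / G2 * (x / Ga * (y / Gb)) = x * y / G2" if "Ga \<noteq> 0" "Gb \<noteq> 0" for Ga Gb G2 x y :: real
  using that by simp
 have "Gamma a \<noteq> 0" "Gamma b \<noteq> 0" using G(2)[OF a] G(2)[OF b] by auto
 note gen' = gen[OF this]
 show ?thesis
  unfolding ph[OF a] ph[OF b] gen' using ph[of "(a + b) / 2"] a b le G(2)[of "(a + b) / 2"]
  by (simp add: power_divide divide_right_mono)
qed

text \<open>The integral is a power series in the squared norm of \<open>z\<close> with coefficients
  involving the Pochhammer symbol of \<open>(l + c) / 2\<close>. Log-convexity bounds them one by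
  one by multiples of the binomial coefficients of \<open>hgt z powr (- c)\<close>.\<close>

lemma forelli_rudin:
 assumes t: "-1 < t" and c: "0 < c"
 shows "\<exists>C>0. \<forall>z::complex^'n. norm z < 1 -->
  (\<integral>\<^sup>+w. ennreal (dst z w powr (- (real CARD('n) + 1 + t + c))) \<partial>bergman_measure t) \<le> ennreal (C * hgt z powr (- c))"
proof (intro exI conjI allI impI)
 define l where "l = real CARD('n) + 1 + t"
 have l: "0 < l" using t by (simp add: l_def)
 define C where "C = Gamma l * Gamma c / (Gamma ((l + c) / 2))\<^sup>2"
 have "0 < Gamma ((l + c) / 2)" using l c by (intro Gamma_real_pos) simp
 then show C: "0 < C" unfolding C_def using l c
  by (intro divide_pos_pos mult_pos_pos zero_less_power Gamma_real_pos) auto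
 fix z :: "complex^'n" assume z: "norm z < 1"
 have z2: "cmod (of_real ((norm z)\<^sup>2)) < 1" using z by (simp add: norm_power power_less_one_iff abs_square_less_1)
 have s1: "(\<lambda>k. pochhammer ((l + c) / 2) k ^ 2 / (pochhammer l k * fact k) * norm z ^ (2 * k)) sums
  (\<integral>w. dst z w powr (- (l + c)) \<partial>bergman_measure t)"
  using dst_integral_sums[OF t z, of "(l + c) / 2"] l c unfolding l_def[symmetric] by (simp only: mult_2 field_sum_of_halves) simp
 have s2: "(\<lambda>k. C * (pochhammer c k / fact k * norm z ^ (2 * k))) sums (C * hgt z powr (- c))"
 proof (rule sums_mult)
  have "(\<lambda>k. complex_of_real (pochhammer c k / fact k * norm z ^ (2 * k))) sums (1 / (of_real (hgt z)) powr of_real c)"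
   using bkern_series[OF z2, of c] by (simp add: hgt_def power_mult)
  also have "(1 / (of_real (hgt z)) powr of_real c) = complex_of_real (hgt z powr (- c))"
   using hgt_pos[OF z] by (simp add: powr_of_real powr_minus_divide)
  finally show "(\<lambda>k. pochhammer c k / fact k * norm z ^ (2 * k)) sums (hgt z powr (- c))"
   unfolding sums_of_real_iff .
 qed
 have "(\<integral>w. dst z w powr (- (l + c)) \<partial>bergman_measure t) \<le> C * hgt z powr (- c)"
 proof (rule sums_le[OF _ s1 s2])
  fix k
  have pl: "0 < pochhammer l k" using l by (rule pochhammer_pos)
  have "pochhammer ((l + c) / 2) k ^ 2 \<le> C * (pochhammer l k * pochhammer c k)"
   unfolding C_def using l c by (rule pochhammer_log_convex)
  then have "pochhammer ((l + c) / 2) k ^ 2 / (pochhammer l k * fact k) \<le> C * (pochhammer l k * pochhammer c k) / (pochhammer l k * fact k)"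
   using pl by (intro divide_right_mono) auto
  also have "\<dots> = C * (pochhammer c k / fact k)" using pl by simp
  finally have "pochhammer ((l + c) / 2) k ^ 2 / (pochhammer l k * fact k) * norm z ^ (2 * k) \<le> C * (pochhammer c k / fact k) * norm z ^ (2 * k)"
   by (rule mult_right_mono) simp
  then show "pochhammer ((l + c) / 2) k ^ 2 / (pochhammer l k * fact k) * norm z ^ (2 * k) \<le> C * (pochhammer c k / fact k * norm z ^ (2 * k))"
   by (simp only: mult.assoc)
 qed
 then show "(\<integral>\<^sup>+w. ennreal (dst z w powr (- (real CARD('n) + 1 + t + c))) \<partial>bergman_measure t) \<le> ennreal (C * hgt z powr (- c))"
  using integrable_dst_powr[OF t z, of "- (l + c)"] unfolding l_def[symmetric]
  by (subst nn_integral_eq_integral) (auto intro: ennreal_leI)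
qed

text \<open>A power of the height only changes the exponent of the measure and its normalization.
  Thus the Forelli--Rudin estimate for another exponent becomes a weighted estimate on one fixed
  measure space, as the Schur test requires.\<close>

lemma nn_integral_bergman_weight:
 fixes g :: "complex^'n => ennreal"
 assumes \<alpha>: "-1 < \<alpha>" and s: "-1 < \<alpha> - s" and [measurable]: "g \<in> borel_fun"
 shows "(\<integral>\<^sup>+w. g w * ennreal (hgt w powr (- s)) \<partial>bergman_measure \<alpha>) =
  ennreal (bconst TYPE('n) \<alpha> / bconst TYPE('n) (\<alpha> - s)) * (\<integral>\<^sup>+w. g w \<partial>bergman_measure (\<alpha> - s))"
proof -
 note b = bconst_pos[OF \<alpha>, where 'n='n] bconst_pos[OF s, where 'n='n] bvol_pos[where 'n='n]
 have "(\<integral>\<^sup>+w. g w * ennreal (hgt w powr (- s)) \<partial>bergman_measure \<alpha>) =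
  (\<integral>\<^sup>+z. ennreal (indicator (ball 0 1) z * (bconst TYPE('n) \<alpha> / bvol TYPE('n) * hgt z powr \<alpha>)) * (g z * ennreal (hgt z powr (- s))) \<partial>lborel)"
  by (rule nn_integral_bergman[OF \<alpha>]) measurable
 also have "\<dots> = (\<integral>\<^sup>+z. ennreal (bconst TYPE('n) \<alpha> / bconst TYPE('n) (\<alpha> - s)) *
   (ennreal (indicator (ball 0 1) z * (bconst TYPE('n) (\<alpha> - s) / bvol TYPE('n) * hgt z powr (\<alpha> - s))) * g z) \<partial>lborel)"
 proof (intro nn_integral_cong)
  fix z :: "complex^'n"
  have "ennreal (indicator (ball 0 1) z * (bconst TYPE('n) \<alpha> / bvol TYPE('n) * hgt z powr \<alpha>)) * ennreal (hgt z powr (- s))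
   = ennreal (bconst TYPE('n) \<alpha> / bconst TYPE('n) (\<alpha> - s)) *
   ennreal (indicator (ball 0 1) z * (bconst TYPE('n) (\<alpha> - s) / bvol TYPE('n) * hgt z powr (\<alpha> - s)))"
   using b by (auto simp: indicator_def powr_diff powr_minus_divide simp flip: ennreal_mult'')
  then show "ennreal (indicator (ball 0 1) z * (bconst TYPE('n) \<alpha> / bvol TYPE('n) * hgt z powr \<alpha>)) * (g z * ennreal (hgt z powr (- s)))
   = ennreal (bconst TYPE('n) \<alpha> / bconst TYPE('n) (\<alpha> - s)) *
   (ennreal (indicator (ball 0 1) z * (bconst TYPE('n) (\<alpha> - s) / bvol TYPE('n) * hgt z powr (\<alpha> - s))) * g z)"
   by (simp only: mult.assoc[symmetric] mult.commute[of "g z"])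
 qed
 also have "\<dots> = ennreal (bconst TYPE('n) \<alpha> / bconst TYPE('n) (\<alpha> - s)) *
   (\<integral>\<^sup>+z. ennreal (indicator (ball 0 1) z * (bconst TYPE('n) (\<alpha> - s) / bvol TYPE('n) * hgt z powr (\<alpha> - s))) * g z \<partial>lborel)"
  by (rule nn_integral_cmult) measurable
 also have "(\<integral>\<^sup>+z. ennreal (indicator (ball 0 1) z * (bconst TYPE('n) (\<alpha> - s) / bvol TYPE('n) * hgt z powr (\<alpha> - s))) * g z \<partial>lborel)
   = (\<integral>\<^sup>+w. g w \<partial>bergman_measure (\<alpha> - s))"
  by (rule nn_integral_bergman[OF s, symmetric]) measurable
 finally show ?thesis .
qed

lemma forelli_rudin_weighted:
 assumes \<alpha>: "-1 < \<alpha>" and s: "-1 < \<alpha> - s" and c: "0 < a - (real CARD('n) + 1 + \<alpha>) + s"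
 shows "\<exists>C>0. \<forall>z::complex^'n. norm z < 1 -->
  (\<integral>\<^sup>+w. ennreal (dst z w powr (- a)) * ennreal (hgt w powr (- s)) \<partial>bergman_measure \<alpha>)
   \<le> ennreal (C * hgt z powr (- (a - (real CARD('n) + 1 + \<alpha>) + s)))"
proof -
 define c where "c = a - (real CARD('n) + 1 + \<alpha>) + s"
 obtain C where C: "0 < C" "\<And>z::complex^'n. norm z < 1 ==>
  (\<integral>\<^sup>+w. ennreal (dst z w powr (- (real CARD('n) + 1 + (\<alpha> - s) + c))) \<partial>bergman_measure (\<alpha> - s)) \<le> ennreal (C * hgt z powr (- c))"
  using forelli_rudin[OF s, of c, where 'n='n] assms(3) by (auto simp: c_def)
 have a: "real CARD('n) + 1 + (\<alpha> - s) + c = a" by (simp add: c_def)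
 define D where "D = bconst TYPE('n) \<alpha> / bconst TYPE('n) (\<alpha> - s)"
 have D: "0 < D" unfolding D_def using bconst_pos[OF \<alpha>, where 'n='n] bconst_pos[OF s, where 'n='n] by simp
 show ?thesis
 proof (intro exI[of _ "D * C"] conjI allI impI)
  show "0 < D * C" using C(1) D by simp
  fix z :: "complex^'n" assume z: "norm z < 1"
  have "(\<integral>\<^sup>+w. ennreal (dst z w powr (- a)) * ennreal (hgt w powr (- s)) \<partial>bergman_measure \<alpha>) =
    ennreal D * (\<integral>\<^sup>+w. ennreal (dst z w powr (- a)) \<partial>bergman_measure (\<alpha> - s))"
   unfolding D_def by (rule nn_integral_bergman_weight[OF \<alpha> s]) measurable
  also have "\<dots> \<le> ennreal D * ennreal (C * hgt z powr (- c))"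
   using C(2)[OF z] unfolding a by (rule mult_left_mono) simp
  also have "\<dots> = ennreal (D * C * hgt z powr (- c))" using D by (simp add: mult.assoc flip: ennreal_mult')
  finally show "(\<integral>\<^sup>+w. ennreal (dst z w powr (- a)) * ennreal (hgt w powr (- s)) \<partial>bergman_measure \<alpha>)
   \<le> ennreal (D * C * hgt z powr (- (a - (real CARD('n) + 1 + \<alpha>) + s)))" unfolding c_def .
 qed
qed

section \<open>Bergman kernel operators\<close>

lemma nn_integral_Holder:
 fixes a b :: "'a => real"
 assumes pq: "1 < p" "1 < q" "1 / p + 1 / q = 1"
  and [measurable]: "a \<in> borel_measurable M" "b \<in> borel_measurable M"
  and nn: "\<And>x. 0 \<le> a x" "\<And>x. 0 \<le> b x"
  and A: "0 < A" "(\<integral>\<^sup>+x. ennreal (a x powr q) \<partial>M) \<le> ennreal A"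
  and B: "0 < B" "(\<integral>\<^sup>+x. ennreal (b x powr p) \<partial>M) \<le> ennreal B"
 shows "(\<integral>\<^sup>+x. ennreal (a x * b x) \<partial>M) \<le> ennreal (A powr (1/q) * B powr (1/p))"
proof -
 let ?a = "A powr (1/q)" and ?b = "B powr (1/p)"
 have pos: "0 < ?a" "0 < ?b" using A B by auto
 have "(\<integral>\<^sup>+x. ennreal (a x * b x) \<partial>M) \<le> (\<integral>\<^sup>+x. ennreal (?a * ?b / (q * A)) * ennreal (a x powr q) + ennreal (?a * ?b / (p * B)) * ennreal (b x powr p) \<partial>M)"
 proof (intro nn_integral_mono)
  fix x
  have "(a x / ?a) * (b x / ?b) \<le> (a x / ?a) powr q / q + (b x / ?b) powr p / p"
   using Youngs_inequality[of q p "a x / ?a" "b x / ?b"] pq nn[of x] pos by (simp add: add.commute)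
  also have "(a x / ?a) powr q = a x powr q / A" using A nn[of x] pq by (simp add: powr_divide powr_powr)
  also have "(b x / ?b) powr p = b x powr p / B" using B nn[of x] pq by (simp add: powr_divide powr_powr)
  finally have "a x * b x \<le> ?a * ?b * (a x powr q / A / q + b x powr p / B / p)"
   using pos by (simp add: field_simps)
  also have "\<dots> = ?a * ?b / (q * A) * a x powr q + ?a * ?b / (p * B) * b x powr p"
   by (simp add: field_simps)
  finally have "ennreal (a x * b x) \<le> ennreal (?a * ?b / (q * A) * a x powr q + ?a * ?b / (p * B) * b x powr p)"
   by (rule ennreal_leI)
  also have "\<dots> = ennreal (?a * ?b / (q * A)) * ennreal (a x powr q) + ennreal (?a * ?b / (p * B)) * ennreal (b x powr p)"
   using pos A B pq by (subst ennreal_plus) (auto simp flip: ennreal_mult'')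
  finally show "ennreal (a x * b x) \<le> ennreal (?a * ?b / (q * A)) * ennreal (a x powr q) + ennreal (?a * ?b / (p * B)) * ennreal (b x powr p)" .
 qed
 also have "\<dots> = ennreal (?a * ?b / (q * A)) * (\<integral>\<^sup>+x. ennreal (a x powr q) \<partial>M) + ennreal (?a * ?b / (p * B)) * (\<integral>\<^sup>+x. ennreal (b x powr p) \<partial>M)"
  by (subst nn_integral_add) (auto simp: nn_integral_cmult)
 also have "\<dots> \<le> ennreal (?a * ?b / (q * A)) * ennreal A + ennreal (?a * ?b / (p * B)) * ennreal B"
  by (intro add_mono mult_left_mono A B) auto
 also have "\<dots> = ennreal (?a * ?b * (1 / q) + ?a * ?b * (1 / p))"
  using pos A B pq by (simp flip: ennreal_mult'' ennreal_plus)
 also have "?a * ?b * (1 / q) + ?a * ?b * (1 / p) = ?a * ?b * (1 / p + 1 / q)" by (simp only: distrib_left add.commute)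
 finally show ?thesis using pq by simp
qed

lemma norm_integral_Holder:
 fixes a b :: "'a => real" and F :: "'a => complex"
 assumes pq: "1 < p" "1 < q" "1 / p + 1 / q = 1"
  and meas [measurable]: "a \<in> borel_measurable M" "b \<in> borel_measurable M"
  and nn: "\<And>x. 0 \<le> a x" "\<And>x. 0 \<le> b x" and F: "AE x in M. norm (F x) \<le> a x * b x"
  and A: "0 < A" "(\<integral>\<^sup>+x. ennreal (a x powr q) \<partial>M) \<le> ennreal A"
 shows "ennreal (norm (\<integral>x. F x \<partial>M) powr p) \<le> ennreal (A powr (p / q)) * (\<integral>\<^sup>+x. ennreal (b x powr p) \<partial>M)"
\<comment> \<open>With an infinite right-hand side the bound is trivial, as the first factor is
  positive. A nonintegrable \<open>F\<close> has Bochner integral 0 by convention.\<close>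
proof (cases "(\<integral>\<^sup>+x. ennreal (b x powr p) \<partial>M) = \<infinity> \<or> \<not> integrable M F")
 case True
 then show ?thesis using A by (auto simp: ennreal_mult_top not_integrable_integral_eq)
next
 case False
 then obtain B where B: "0 \<le> B" "(\<integral>\<^sup>+x. ennreal (b x powr p) \<partial>M) = ennreal B" and i: "integrable M F"
  by (cases "\<integral>\<^sup>+x. ennreal (b x powr p) \<partial>M") auto
 have bound: "norm (\<integral>x. F x \<partial>M) \<le> A powr (1/q) * B powr (1/p)"
 proof (cases "B = 0")
  case True
  then have "AE x in M. ennreal (b x powr p) = 0"
   using B nn_integral_0_iff_AE[of "\<lambda>x. ennreal (b x powr p)" M] by simp
  then have "AE x in M. F x = 0" using F by eventually_elim (use nn in \<open>auto simp: powr_eq_0_iff\<close>)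
  then show ?thesis by (simp add: integral_eq_zero_AE)
 next
  case False
  have "ennreal (norm (\<integral>x. F x \<partial>M)) \<le> (\<integral>\<^sup>+x. ennreal (norm (F x)) \<partial>M)" by (rule integral_norm_bound_ennreal[OF i])
  also have "\<dots> \<le> (\<integral>\<^sup>+x. ennreal (a x * b x) \<partial>M)" using F by (intro nn_integral_mono_AE) (auto elim!: eventually_mono intro: ennreal_leI)
  also have "\<dots> \<le> ennreal (A powr (1/q) * B powr (1/p))" using False B by (intro nn_integral_Holder pq nn A meas) auto
  finally show ?thesis by (simp add: ennreal_le_iff)
 qed
 have "norm (\<integral>x. F x \<partial>M) powr p \<le> (A powr (1/q) * B powr (1/p)) powr p"
  using bound pq by (intro powr_mono2) auto
 also have "\<dots> = A powr (p / q) * B" using pq A B by (simp add: powr_mult powr_powr)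
 finally show ?thesis unfolding B(2) using B(1) by (simp add: ennreal_leI flip: ennreal_mult'')
qed

text \<open>The \<open>itself\<close> argument carries the dimension, which \<open>p\<close> and
  \<open>\<alpha>\<close> do not mention.\<close>

locale bergman =
 fixes p \<alpha> :: real and dim :: "'n::finite itself"
 assumes p: "1 < p" and \<alpha>: "-1 < \<alpha>"
begin

abbreviation vol :: "(complex^'n) measure" where "vol \<equiv> bergman_measure \<alpha>"

abbreviation lp :: "(complex^'n => complex) set" where "lp \<equiv> Lp p \<alpha>"

abbreviation Ap :: "(complex^'n => complex) set" where "Ap \<equiv> bergman_space p \<alpha>"

abbreviation lpnorm :: "(complex^'n => complex) => ereal" where "lpnorm \<equiv> Lp_norm p \<alpha>"

abbreviation opnorm :: "((complex^'n => complex) => (complex^'n => complex)) => ereal" where "opnorm \<equiv> op_norm p \<alpha>"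

abbreviation Bops :: "((complex^'n => complex) => (complex^'n => complex)) set" where "Bops \<equiv> bounded_ops p \<alpha>"

lemmas AE_vol = AE_bergman[OF \<alpha>]

text \<open>The p-th power of the norm with values in \<open>ennreal\<close> is defined for every
  function, and sums over weights pass through the integral. Estimates are made for
  \<open>Np\<close> and converted by \<open>Lp_norm_le_iff\<close> and
  \<open>op_norm_le_iff\<close>.\<close>

definition Np :: "(complex^'n => complex) => ennreal" where
 "Np f = (\<integral>\<^sup>+z. ennreal (norm (f z) powr p) \<partial>vol)"

lemma Lp_iff_Np: "f \<in> lp \<longleftrightarrow> f \<in> borel_fun \<and> Np f < \<infinity>"
proof -
 have "integrable vol (\<lambda>z. norm (f z) powr p) \<longleftrightarrow> Np f < \<infinity>"
  if [measurable]: "f \<in> borel_fun"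
  unfolding Np_def integrable_iff_bounded by simp
 then show ?thesis by (auto simp: Lp_def)
qed

lemma Lp_integrable:
 assumes f: "f \<in> lp"
 shows "integrable vol f"
proof -
 interpret finite_measure "vol" by (rule finite_measure_bergman[OF \<alpha>])
 have "integrable vol (\<lambda>z. 1 + norm (f z) powr p)" using f by (simp add: Lp_def)
 then show ?thesis
 proof (rule Bochner_Integration.integrable_bound)
  show "f \<in> borel_measurable vol" using f by (simp add: Lp_def)
  have "norm (f z) \<le> 1 + norm (f z) powr p" for z
  proof (cases "norm (f z) \<le> 1")
   case False
   then have "norm (f z) powr 1 \<le> norm (f z) powr p" using p by (intro powr_mono) auto
   then show ?thesis using False by simp
  qed (simp add: add_increasing2)
  then show "AE z in vol. norm (f z) \<le> norm (1 + norm (f z) powr p)"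
   by (intro AE_I2) (smt (verit) real_norm_def powr_ge_zero)
 qed
qed

lemma measurable_xr [measurable]:
 assumes [measurable]: "f \<in> borel_measurable M" "g \<in> borel_measurable M"
 shows "(\<lambda>x. xr (f x) (g x)) \<in> borel_measurable M"
 unfolding xr_def by measurable

text \<open>A Schur test with powers of the height as test functions, carried out for all indices at
  once: the sum over \<open>j\<close> of the p-th powers of the differences is at most
  \<open>\<eta>\<close> for near pairs and at most \<open>B\<close> for far ones. Two separate
  families are allowed so that the second can be composed with a map near the identity, or be
  0.\<close>

lemma schur_commutator:
 obtains C \<delta> where "0 < C" "0 < \<delta>"
  "\<And>(u :: complex^'n => complex) H C0 (J :: (int \<times> nat) set) \<phi> \<phi>' \<eta> B M.
   u \<in> lp ==> (\<lambda>x. H (fst x) (snd x)) \<in> borel_measurable (borel \<Otimes>\<^sub>M borel) ==> 0 \<le> C0 ==>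
   (\<And>z w. norm z < 1 ==> norm w < 1 ==> norm (H z w) \<le> C0 * dst z w powr (- (real CARD('n) + 1 + \<alpha>))) ==>
   finite J ==> 0 \<le> \<eta> ==> 0 \<le> B ==> 0 < M ==>
   (\<And>j. \<phi> j \<in> borel_fun) ==> (\<And>j. \<phi>' j \<in> borel_fun) ==>
   (\<And>z w. norm z < 1 ==> norm w < 1 ==> (\<Sum>j\<in>J. \<bar>\<phi> j z - \<phi>' j w\<bar> powr p) \<le> B) ==>
   (\<And>z w. norm z < 1 ==> norm w < 1 ==> xr z w \<le> M ==> (\<Sum>j\<in>J. \<bar>\<phi> j z - \<phi>' j w\<bar> powr p) \<le> \<eta>) ==>
   (\<Sum>j\<in>J. Np (\<lambda>z. \<integral>w. H z w * of_real (\<phi> j z - \<phi>' j w) * u w \<partial>vol))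
    \<le> ennreal (C0 powr p * (C * (\<eta> + B * M powr (- \<delta>)))) * Np u"
proof -
 define l where "l = real CARD('n) + 1 + \<alpha>"
 define q where "q = p / (p - 1)"
 have q: "1 < q" "1 / p + 1 / q = 1" using p by (auto simp: q_def field_simps)
 \<comment> \<open>Small enough for the three Forelli--Rudin integrals below: \<open>s * q\<close>,
   \<open>s * p\<close> and \<open>s * p + s\<close> have to stay below \<open>1 + \<alpha>\<close>.
   The same \<open>s\<close> becomes the rate of decay in \<open>M\<close>.\<close>
 define s where "s = (1 + \<alpha>) / (2 * (p + q))"
 have s: "0 < s" using p q \<alpha> by (simp add: s_def)
 have spq: "s * (p + q) = (1 + \<alpha>) / 2"
 proof -
  have "p + q \<noteq> 0" using p q by simp
  then show ?thesis unfolding s_def by (simp del: distrib_right_numeral distrib_left_numeral)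
 qed
 have s_le: "s * q < 1 + \<alpha>" "s * p + s < 1 + \<alpha>" "s * p < 1 + \<alpha>"
 proof -
  have "s * p > 0" "s * q > 0" "s * q > s" using s p q by auto
  then show "s * q < 1 + \<alpha>" "s * p + s < 1 + \<alpha>" "s * p < 1 + \<alpha>" using spq \<alpha> by (auto simp: distrib_left)
 qed
 obtain C1 where C1: "0 < C1" "\<And>z::complex^'n. norm z < 1 ==>
   (\<integral>\<^sup>+w. ennreal (dst z w powr (- l)) * ennreal (hgt w powr (- (s * q))) \<partial>vol) \<le> ennreal (C1 * hgt z powr (- (s * q)))"
  using forelli_rudin_weighted[OF \<alpha>, of "s * q" l, where 'n='n] s q s_le by (auto simp: l_def)
 obtain C2 where C2: "0 < C2" "\<And>z::complex^'n. norm z < 1 ==>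
   (\<integral>\<^sup>+w. ennreal (dst z w powr (- l)) * ennreal (hgt w powr (- (s * p))) \<partial>vol) \<le> ennreal (C2 * hgt z powr (- (s * p)))"
  using forelli_rudin_weighted[OF \<alpha>, of "s * p" l, where 'n='n] s p s_le by (auto simp: l_def)
 have sp_s: "0 < s * p - s" using s p by simp
 obtain C3 where C3: "0 < C3" "\<And>z::complex^'n. norm z < 1 ==>
   (\<integral>\<^sup>+w. ennreal (dst z w powr (- (l - 2 * s))) * ennreal (hgt w powr (- (s * p + s))) \<partial>vol)
    \<le> ennreal (C3 * hgt z powr (- (s * p - s)))"
 proof -
  have e: "l - 2 * s - (real CARD('n) + 1 + \<alpha>) + (s * p + s) = s * p - s" by (simp add: l_def)
  show ?thesis using that forelli_rudin_weighted[OF \<alpha>, of "s * p + s" "l - 2 * s", where 'n='n, unfolded e] sp_s s_le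
   by auto
 qed
 define C where "C = C1 powr (p / q) * (C2 + C3)"
 have C: "0 < C" using C1 C2 C3 by (simp add: C_def)
 show ?thesis
 proof (rule that[OF C s])
  fix u :: "complex^'n => complex" and H :: "complex^'n => complex^'n => complex" and C0 and J :: "(int \<times> nat) set" and \<phi> \<phi>' :: "int \<times> nat => complex^'n => real" and \<eta> B M :: real
  assume u: "u \<in> lp" and Hm [measurable]: "(\<lambda>x. H (fst x) (snd x)) \<in> borel_measurable (borel \<Otimes>\<^sub>M borel)"
   and C0: "0 \<le> C0" and H: "\<And>z w. norm z < 1 ==> norm w < 1 ==> norm (H z w) \<le> C0 * dst z w powr (- (real CARD('n) + 1 + \<alpha>))"
   and J: "finite J" and \<eta>: "0 \<le> \<eta>" and B: "0 \<le> B" and M: "0 < M"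
   and \<phi>m [measurable]: "\<And>j. \<phi> j \<in> borel_fun" "\<And>j. \<phi>' j \<in> borel_fun"
   and tB: "\<And>z w. norm z < 1 ==> norm w < 1 ==> (\<Sum>j\<in>J. \<bar>\<phi> j z - \<phi>' j w\<bar> powr p) \<le> B"
   and tE: "\<And>z w. norm z < 1 ==> norm w < 1 ==> xr z w \<le> M ==> (\<Sum>j\<in>J. \<bar>\<phi> j z - \<phi>' j w\<bar> powr p) \<le> \<eta>"
  interpret V: finite_measure vol by (rule finite_measure_bergman[OF \<alpha>])
  interpret VV: pair_sigma_finite vol vol ..
  have um [measurable]: "u \<in> borel_fun" using u by (simp add: Lp_iff_Np)
  let ?k = "\<lambda>z w. dst z w powr (- l)"
  define \<theta> where "\<theta> j z w = \<bar>\<phi> j z - \<phi>' j w\<bar>" for j z w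
  let ?I = "\<lambda>j z. \<integral>w. H z w * of_real (\<phi> j z - \<phi>' j w) * u w \<partial>vol"
  let ?U = "\<lambda>w. C0 powr p * norm (u w) powr p"
  define T where "T z w = \<eta> + B * M powr (- s) * (dst z w powr (2 * s) * hgt z powr (- s) * hgt w powr (- s))" for z w :: "complex^'n"
  have T: "(\<Sum>j\<in>J. \<theta> j z w powr p) \<le> T z w" if z: "norm z < 1" and w: "norm w < 1" for z w
  proof (cases "xr z w \<le> M")
   case True
   then have "(\<Sum>j\<in>J. \<theta> j z w powr p) \<le> \<eta>" using tE[OF z w] by (simp add: \<theta>_def)
   then show ?thesis using B by (simp add: T_def add_increasing2)
  next
   case False
   have hp: "0 < hgt z" "0 < hgt w" "0 < dst z w" using z w hgt_pos dst_pos[of z w] by auto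
   \<comment> \<open>For far pairs a factor that is at least 1 is inserted. It gains
     \<open>M powr (- s)\<close> and costs powers of \<open>dst\<close> and of the heights so small
     that the integrals still converge.\<close>
   have "1 \<le> (xr z w / M) powr s" using False M s by (intro ge_one_powr_ge_zero) auto
   also have "\<dots> = M powr (- s) * (dst z w powr (2 * s) * hgt z powr (- s) * hgt w powr (- s))"
    using hp M by (simp add: xr_def powr_divide powr_mult powr_minus_divide powr_powr flip: powr_numeral)
   finally have "B * 1 \<le> B * (M powr (- s) * (dst z w powr (2 * s) * hgt z powr (- s) * hgt w powr (- s)))"
    using B by (rule mult_left_mono)
   moreover have "(\<Sum>j\<in>J. \<theta> j z w powr p) \<le> B" using tB[OF z w] by (simp add: \<theta>_def)
   ultimately show ?thesis using \<eta> by (simp add: T_def mult.assoc)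
  qed
  have T0: "0 \<le> T z w" for z w using \<eta> B by (simp add: T_def)
  have step1: "(\<Sum>j\<in>J. ennreal (norm (?I j z) powr p))
    \<le> ennreal (C1 powr (p / q) * hgt z powr (- (s * p))) * (\<integral>\<^sup>+w. ennreal (?k z w * hgt w powr (s * p) * ?U w * T z w) \<partial>vol)"
   if z: "norm z < 1" for z
  proof -
   let ?D = "ennreal (C1 powr (p / q) * hgt z powr (- (s * p)))"
   have tz [measurable]: "(\<lambda>w. \<theta> j z w) \<in> borel_fun" for j unfolding \<theta>_def by measurable
   \<comment> \<open>The splitting of the Schur test: the kernel is divided with exponents
     \<open>1 / q\<close> and \<open>1 / p\<close>, and a power of the height is inserted together
     with its inverse. Everything that depends on \<open>j\<close> goes into
     \<open>b\<close>.\<close>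
   define a where "a w = ?k z w powr (1 / q) * hgt w powr (- s)" for w
   define b where "b j w = C0 * (?k z w powr (1 / p) * hgt w powr s * \<theta> j z w * norm (u w))" for j w
   have am [measurable]: "a \<in> borel_fun" unfolding a_def by measurable
   have bm [measurable]: "b j \<in> borel_fun" for j unfolding b_def by measurable
   have "(\<Sum>j\<in>J. ennreal (norm (?I j z) powr p)) \<le>
    (\<Sum>j\<in>J. ?D * (\<integral>\<^sup>+w. ennreal (?k z w * hgt w powr (s * p) * ?U w * \<theta> j z w powr p) \<partial>vol))"
   proof (rule sum_mono)
    fix j
    have "ennreal (norm (?I j z) powr p) \<le> ennreal ((C1 * hgt z powr (- (s * q))) powr (p / q)) * (\<integral>\<^sup>+w. ennreal (b j w powr p) \<partial>vol)"
    proof (rule norm_integral_Holder[OF p q])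
     show "a \<in> borel_measurable vol" "b j \<in> borel_measurable vol" by measurable
     show "0 < C1 * hgt z powr (- (s * q))" using C1 hgt_pos[OF z] by simp
     have "(\<integral>\<^sup>+w. ennreal (a w powr q) \<partial>vol) = (\<integral>\<^sup>+w. ennreal (?k z w) * ennreal (hgt w powr (- (s * q))) \<partial>vol)"
      using q by (intro nn_integral_cong) (simp add: a_def powr_mult powr_powr flip: ennreal_mult'')
     also have "\<dots> \<le> ennreal (C1 * hgt z powr (- (s * q)))" by (rule C1(2)[OF z])
     finally show "(\<integral>\<^sup>+w. ennreal (a w powr q) \<partial>vol) \<le> ennreal (C1 * hgt z powr (- (s * q)))" .
     show "0 \<le> a w" "0 \<le> b j w" for w using C0 by (simp_all add: a_def b_def \<theta>_def)
     show "AE w in vol. norm (H z w * of_real (\<phi> j z - \<phi>' j w) * u w) \<le> a w * b j w"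
      using AE_vol
     proof eventually_elim
      case (elim w)
      have "0 < hgt w" using elim by (rule hgt_pos)
      then have h: "hgt w powr (- s) * hgt w powr s = 1" by (simp flip: powr_add)
      have k: "?k z w powr (1 / q) * ?k z w powr (1 / p) = ?k z w"
       using q by (simp add: add.commute flip: powr_add)
      have "a w * b j w = C0 * ((?k z w powr (1 / q) * ?k z w powr (1 / p)) * (hgt w powr (- s) * hgt w powr s)) * \<theta> j z w * norm (u w)"
       by (simp only: a_def b_def mult_ac)
      also have "\<dots> = (C0 * ?k z w) * (\<theta> j z w * norm (u w))" unfolding h k by simp
      also have "\<dots> \<ge> norm (H z w) * (\<theta> j z w * norm (u w))"
       using H[OF z elim] by (intro mult_right_mono) (auto simp: \<theta>_def l_def)
      finally show ?case unfolding norm_mult norm_of_real \<theta>_def by (simp only: mult.assoc)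
     qed
    qed
    also have "(C1 * hgt z powr (- (s * q))) powr (p / q) = C1 powr (p / q) * hgt z powr (- (s * p))"
     using C1 q by (simp add: powr_mult powr_powr)
    also have "(\<integral>\<^sup>+w. ennreal (b j w powr p) \<partial>vol) = (\<integral>\<^sup>+w. ennreal (?k z w * hgt w powr (s * p) * ?U w * \<theta> j z w powr p) \<partial>vol)"
     using p C0 by (intro nn_integral_cong) (simp add: b_def powr_mult powr_powr mult_ac \<theta>_def)
    finally show "ennreal (norm (?I j z) powr p) \<le> ?D * (\<integral>\<^sup>+w. ennreal (?k z w * hgt w powr (s * p) * ?U w * \<theta> j z w powr p) \<partial>vol)" .
   qed
   also have "\<dots> = ?D * (\<integral>\<^sup>+w. (\<Sum>j\<in>J. ennreal (?k z w * hgt w powr (s * p) * ?U w * \<theta> j z w powr p)) \<partial>vol)"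
    by (subst nn_integral_sum) (auto simp: sum_distrib_left)
   also have "\<dots> \<le> ?D * (\<integral>\<^sup>+w. ennreal (?k z w * hgt w powr (s * p) * ?U w * T z w) \<partial>vol)"
   proof (intro mult_left_mono nn_integral_mono_AE)
    show "AE w in vol. (\<Sum>j\<in>J. ennreal (?k z w * hgt w powr (s * p) * ?U w * \<theta> j z w powr p)) \<le> ennreal (?k z w * hgt w powr (s * p) * ?U w * T z w)"
     using AE_vol
    proof eventually_elim
     case (elim w)
     have "(\<Sum>j\<in>J. ennreal (?k z w * hgt w powr (s * p) * ?U w * \<theta> j z w powr p)) =
      ennreal (?k z w * hgt w powr (s * p) * ?U w * (\<Sum>j\<in>J. \<theta> j z w powr p))"
      unfolding sum_distrib_left by (rule sum_ennreal) simp
     also have "\<dots> \<le> ennreal (?k z w * hgt w powr (s * p) * ?U w * T z w)"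
      using T[OF z elim] by (intro ennreal_leI mult_left_mono) auto
     finally show ?case .
    qed
   qed simp
   finally show ?thesis .
  qed
  have Tm [measurable]: "(\<lambda>x. T (fst x) (snd x)) \<in> borel_measurable (borel \<Otimes>\<^sub>M borel)" unfolding T_def by measurable
  define G where "G z w = ennreal (C1 powr (p / q) * hgt z powr (- (s * p))) * ennreal (?k z w * hgt w powr (s * p) * ?U w * T z w)" for z w
  have Gm: "(\<lambda>x. G (fst x) (snd x)) \<in> borel_measurable (vol \<Otimes>\<^sub>M vol)"
   unfolding G_def by measurable
  have im: "(\<lambda>z. ennreal (norm (?I j z) powr p)) \<in> borel_measurable vol" for j by measurable
  have "(\<Sum>j\<in>J. Np (?I j)) = (\<integral>\<^sup>+z. (\<Sum>j\<in>J. ennreal (norm (?I j z) powr p)) \<partial>vol)"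
   unfolding Np_def using im by (intro nn_integral_sum[symmetric]) auto
  also have "\<dots> \<le> (\<integral>\<^sup>+z. (\<integral>\<^sup>+w. G z w \<partial>vol) \<partial>vol)"
  proof (rule nn_integral_mono_AE)
   show "AE z in vol. (\<Sum>j\<in>J. ennreal (norm (?I j z) powr p)) \<le> (\<integral>\<^sup>+w. G z w \<partial>vol)"
    using AE_vol
   proof eventually_elim
    case (elim z)
    have "(\<lambda>w. T z w) \<in> borel_fun" unfolding T_def by measurable
    then have [measurable]: "T z \<in> borel_fun" by simp
    show ?case unfolding G_def by (subst nn_integral_cmult, measurable) (rule step1[OF elim])
   qed
  qed
  also have "\<dots> = (\<integral>\<^sup>+w. (\<integral>\<^sup>+z. G z w \<partial>vol) \<partial>vol)"
   using VV.Fubini'[of G] Gm by (simp add: case_prod_beta')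
  also have "\<dots> \<le> (\<integral>\<^sup>+w. ennreal (C * (\<eta> + B * M powr (- s))) * ennreal (?U w) \<partial>vol)"
  proof (rule nn_integral_mono_AE)
   show "AE w in vol. (\<integral>\<^sup>+z. G z w \<partial>vol) \<le> ennreal (C * (\<eta> + B * M powr (- s))) * ennreal (?U w)"
    using AE_vol
   proof eventually_elim
    case (elim w)
    let ?E = "C1 powr (p / q) * hgt w powr (s * p) * ?U w"
    have hw: "0 < hgt w" using elim by (rule hgt_pos)
    have "(\<integral>\<^sup>+z. G z w \<partial>vol) = (\<integral>\<^sup>+z. ennreal (?E * \<eta>) * (ennreal (dst w z powr (- l)) * ennreal (hgt z powr (- (s * p))))
      + ennreal (?E * (B * M powr (- s)) * hgt w powr (- s)) * (ennreal (dst w z powr (- (l - 2 * s))) * ennreal (hgt z powr (- (s * p + s)))) \<partial>vol)"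
    proof (intro nn_integral_cong_AE)
     show "AE z in vol. G z w = ennreal (?E * \<eta>) * (ennreal (dst w z powr (- l)) * ennreal (hgt z powr (- (s * p))))
      + ennreal (?E * (B * M powr (- s)) * hgt w powr (- s)) * (ennreal (dst w z powr (- (l - 2 * s))) * ennreal (hgt z powr (- (s * p + s))))"
      using AE_vol
     proof eventually_elim
      case (elim z)
      have hz: "0 < hgt z" using elim by (rule hgt_pos)
      have d: "dst z w powr (- l) * dst z w powr (2 * s) = dst z w powr (- (l - 2 * s))"
       by (simp flip: powr_add)
      have h: "hgt z powr (- (s * p)) * hgt z powr (- s) = hgt z powr (- (s * p + s))"
       by (simp flip: powr_add)
      have "G z w = ennreal (?E * \<eta> * (dst z w powr (- l) * hgt z powr (- (s * p)))
       + ?E * (B * M powr (- s)) * hgt w powr (- s) * (dst z w powr (- (l - 2 * s)) * hgt z powr (- (s * p + s))))"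
       unfolding G_def T_def d[symmetric] h[symmetric]
       by (subst ennreal_mult''[symmetric]) (use \<eta> B in \<open>auto simp: algebra_simps\<close>)
      also have "\<dots> = ennreal (?E * \<eta> * (dst z w powr (- l) * hgt z powr (- (s * p))))
       + ennreal (?E * (B * M powr (- s)) * hgt w powr (- s) * (dst z w powr (- (l - 2 * s)) * hgt z powr (- (s * p + s))))"
       using \<eta> B by (intro ennreal_plus) auto
      finally show ?case using \<eta> B by (simp add: dst_commute[of z w] ennreal_mult'')
     qed
    qed
    also have "\<dots> = ennreal (?E * \<eta>) * (\<integral>\<^sup>+z. ennreal (dst w z powr (- l)) * ennreal (hgt z powr (- (s * p))) \<partial>vol)
      + ennreal (?E * (B * M powr (- s)) * hgt w powr (- s)) * (\<integral>\<^sup>+z. ennreal (dst w z powr (- (l - 2 * s))) * ennreal (hgt z powr (- (s * p + s))) \<partial>vol)"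
     by (subst nn_integral_add, measurable) (simp add: nn_integral_cmult)
    also have "\<dots> \<le> ennreal (?E * \<eta>) * ennreal (C2 * hgt w powr (- (s * p)))
      + ennreal (?E * (B * M powr (- s)) * hgt w powr (- s)) * ennreal (C3 * hgt w powr (- (s * p - s)))"
     by (intro add_mono mult_left_mono C2(2) C3(2) elim) auto
    also have "\<dots> = ennreal (?E * \<eta> * (C2 * hgt w powr (- (s * p))) + ?E * (B * M powr (- s)) * hgt w powr (- s) * (C3 * hgt w powr (- (s * p - s))))"
     using \<eta> B C2(1) C3(1) by (simp add: ennreal_mult'')
    also have "\<dots> \<le> ennreal (C * (\<eta> + B * M powr (- s)) * ?U w)"
    proof (rule ennreal_leI)
     have h1: "hgt w powr (s * p) * hgt w powr (- (s * p)) = 1" using hw by (simp flip: powr_add)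
     have h2: "hgt w powr (s * p) * (hgt w powr (- s) * hgt w powr (- (s * p - s))) = 1" using hw by (simp flip: powr_add)
     have "?E * \<eta> * (C2 * hgt w powr (- (s * p))) + ?E * (B * M powr (- s)) * hgt w powr (- s) * (C3 * hgt w powr (- (s * p - s)))
      = C1 powr (p / q) * ?U w * \<eta> * C2 * (hgt w powr (s * p) * hgt w powr (- (s * p)))
      + C1 powr (p / q) * ?U w * (B * M powr (- s)) * C3 * (hgt w powr (s * p) * (hgt w powr (- s) * hgt w powr (- (s * p - s))))"
      by (simp only: mult_ac)
     also have "\<dots> = C1 powr (p / q) * ?U w * (\<eta> * C2 + (B * M powr (- s)) * C3)"
      unfolding h1 h2 by (simp add: algebra_simps)
     also have "\<dots> \<le> C1 powr (p / q) * ?U w * (\<eta> * (C2 + C3) + (B * M powr (- s)) * (C2 + C3))"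
      using \<eta> B C2(1) C3(1) by (intro mult_left_mono add_mono) auto
     finally show "?E * \<eta> * (C2 * hgt w powr (- (s * p))) + ?E * (B * M powr (- s)) * hgt w powr (- s) * (C3 * hgt w powr (- (s * p - s)))
      \<le> C * (\<eta> + B * M powr (- s)) * ?U w" by (simp add: C_def algebra_simps)
    qed
    finally show ?case by (simp add: ennreal_mult'')
   qed
  qed
  also have "\<dots> = ennreal (C * (\<eta> + B * M powr (- s))) * (ennreal (C0 powr p) * Np u)"
   unfolding Np_def by (simp add: nn_integral_cmult ennreal_mult'')
  also have "\<dots> = ennreal (C0 powr p * (C * (\<eta> + B * M powr (- s)))) * Np u"
   by (subst ennreal_mult') (simp_all add: mult_ac)
  finally show "(\<Sum>j\<in>J. Np (?I j)) \<le> ennreal (C0 powr p * (C * (\<eta> + B * M powr (- s)))) * Np u" .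
 qed
qed

section \<open>Holomorphy of kernel integrals\<close>

lemma integrable_mult_bounded:
 fixes F g :: "'a => complex"
 assumes F: "integrable M F" and [measurable]: "g \<in> borel_measurable M" and bd: "AE w in M. norm (g w) \<le> K"
 shows "integrable M (\<lambda>w. F w * g w)"
proof (rule Bochner_Integration.integrable_bound)
 show "integrable M (\<lambda>w. norm (F w) * K)" using F by simp
 show "(\<lambda>w. F w * g w) \<in> borel_measurable M" using borel_measurable_integrable[OF F] by simp
 show "AE w in M. norm (F w * g w) \<le> norm (norm (F w) * K)"
  using bd
 proof eventually_elim
  case (elim w)
  then have "0 \<le> K" using norm_ge_zero order_trans by blast
  then show ?case using elim by (simp add: norm_mult mult_left_mono)
 qed
qed

text \<open>Differentiation under the integral sign: on a closed disc of radius \<open>r < 1\<close>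
  the second-order Taylor remainder of the kernel is bounded uniformly in \<open>w\<close>, so the
  error of the difference quotient is at most a multiple of \<open>norm (z - z0)\<close>.\<close>

lemma holomorphic_bkern_integral:
 fixes \<tau> :: "'a => complex^'n"
 assumes F: "integrable M F" and [measurable]: "\<tau> \<in> borel_measurable M" and \<tau>: "AE w in M. norm (\<tau> w) \<le> 1"
 shows "holomorphic_several (\<lambda>z. \<integral>w. F w * bkern \<mu> z (\<tau> w) \<partial>M) (ball 0 1)"
 unfolding holomorphic_several_def
proof
 fix z0 :: "complex^'n" assume "z0 \<in> ball 0 1"
 then have z0: "norm z0 < 1" by simp
 define r where "r = (1 + norm z0) / 2"
 have r: "norm z0 < r" "r < 1" "0 < r" using z0 by (auto simp: r_def intro!: add_pos_nonneg)
 define s where "s = - complex_of_real \<mu>"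
 \<comment> \<open>\<open>\<Phi> 0\<close>, \<open>\<Phi> 1\<close> and \<open>\<Phi> 2\<close> are
   the kernel as a function of the inner product and its first two derivatives.\<close>
 define \<Phi> where "\<Phi> i u = (if i = 0 then (1 - u) powr s else if i = Suc 0 then - s * (1 - u) powr (s - 1)
  else s * (s - 1) * (1 - u) powr (s - 2))" for i :: nat and u :: complex
 have re: "1 - u \<notin> \<real>\<^sub>\<le>\<^sub>0" "1 - u \<noteq> 0" if "cmod u < 1" for u
  using that abs_Re_le_cmod[of u] by (auto simp: complex_nonpos_Reals_iff)
 have der: "(\<Phi> i has_field_derivative \<Phi> (Suc i) u) (at u within cball 0 r)" if "u \<in> cball 0 r" "i \<le> 1" for i u
 proof -
  have u: "cmod u < 1" using that r by simp
  have i: "i = 0 \<or> i = Suc 0" using that by auto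
  have d: "((\<lambda>u. (1 - u) powr a) has_field_derivative (- a * (1 - u) powr (a - 1))) (at u within cball 0 r)" for a
   by (rule DERIV_subset[where s=UNIV]) (auto intro!: derivative_eq_intros dest: re[OF u, THEN notE])
  from i show ?thesis
  proof
   assume i: "i = 0"
   then have "\<Phi> i = (\<lambda>u. (1 - u) powr s)" "\<Phi> (Suc i) u = - s * (1 - u) powr (s - 1)" by (auto simp: \<Phi>_def fun_eq_iff)
   then show ?thesis using d[of s] by simp
  next
   assume i: "i = Suc 0"
   then have e: "\<Phi> i = (\<lambda>u. - s * (1 - u) powr (s - 1))" "\<Phi> (Suc i) u = - s * (- (s - 1) * (1 - u) powr (s - 1 - 1))"
    by (auto simp: \<Phi>_def fun_eq_iff algebra_simps)
   show ?thesis unfolding e by (rule DERIV_cmult[OF d])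
  qed
 qed
 have cont: "continuous_on (cball 0 r) (\<lambda>u. (1 - u) powr a)" for a :: complex
 proof -
  have R: "Re u < 1" if "u \<in> cball 0 r" for u using that r abs_Re_le_cmod[of u] by simp
  show ?thesis
   by (intro continuous_intros) (use R in \<open>fastforce simp: complex_nonpos_Reals_iff complex_eq_iff\<close>)+
 qed
 have "\<exists>B. \<forall>u\<in>cball 0 r. cmod (\<Phi> i u) \<le> B" for i
 proof -
  have "continuous_on (cball 0 r) (\<Phi> i)"
   unfolding \<Phi>_def by (cases "i = 0"; cases "i = Suc 0") (auto intro!: continuous_intros cont)
  then have "compact (\<Phi> i ` cball 0 r)" by (intro compact_continuous_image) auto
  then obtain B where "\<forall>x\<in>\<Phi> i ` cball 0 r. norm x \<le> B" using compact_imp_bounded bounded_iff by blast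
  then show ?thesis by blast
 qed
 then obtain B where B: "\<And>i u. u \<in> cball 0 r ==> cmod (\<Phi> i u) \<le> B i" by metis
 have hin: "herm z (\<tau> w) \<in> cball 0 r" if "norm z \<le> r" "norm (\<tau> w) \<le> 1" for z w
 proof -
  have "cmod (herm z (\<tau> w)) \<le> norm z * norm (\<tau> w)" by (rule norm_herm_le)
  also have "\<dots> \<le> r * 1" using that r by (intro mult_mono) auto
  finally show ?thesis by simp
 qed
 have bk: "bkern \<mu> z (\<tau> w) = \<Phi> 0 (herm z (\<tau> w))" for z w
  by (simp add: bkern_def \<Phi>_def s_def powr_minus_divide)
 have \<Phi>m: "(\<lambda>w. \<Phi> i (herm z (\<tau> w))) \<in> borel_measurable M" for i z
  unfolding \<Phi>_def by (cases "i = 0"; cases "i = Suc 0") simp_all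
 have int\<Phi>: "integrable M (\<lambda>w. F w * \<Phi> i (herm z (\<tau> w)))" if "norm z \<le> r" for i z
  by (rule integrable_mult_bounded[OF F \<Phi>m, where K="B i"]) (use \<tau> hin that B in \<open>auto elim!: eventually_mono\<close>)
 define L where "L h = (\<integral>w. F w * \<Phi> 1 (herm z0 (\<tau> w)) * herm h (\<tau> w) \<partial>M)" for h
 have intL: "integrable M (\<lambda>w. F w * \<Phi> 1 (herm z0 (\<tau> w)) * herm h (\<tau> w))" for h
 proof (rule integrable_mult_bounded[where K="norm h"])
  show "integrable M (\<lambda>w. F w * \<Phi> 1 (herm z0 (\<tau> w)))" using r by (intro int\<Phi>) auto
  show "AE w in M. norm (herm h (\<tau> w)) \<le> norm h" using \<tau>
  proof eventually_elim
   case (elim w)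
   then show ?case using norm_herm_le[of h "\<tau> w"] by (smt (verit) mult_left_le norm_ge_zero)
  qed
 qed measurable
 have Ladd: "L (h + h') = L h + L h'" for h h'
  unfolding L_def herm_add_left distrib_left by (rule Bochner_Integration.integral_add[OF intL intL])
 have Lscale: "L (c *s h) = c * L h" for c h
  unfolding L_def herm_scale_left by (simp add: mult.left_commute[of _ c] flip: integral_mult_right_zero)
 have Llin: "bounded_linear L"
 proof (rule linear_conv_bounded_linear[THEN iffD1], rule linearI[OF Ladd])
  fix c :: real and h :: "complex^'n"
  have "c *\<^sub>R h = (complex_of_real c) *s h" by (simp add: vec_eq_iff scaleR_conv_of_real[where 'a=complex])
  then show "L (c *\<^sub>R h) = c *\<^sub>R L h" by (simp add: Lscale scaleR_conv_of_real[where 'a=complex])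
 qed
 define N where "N = (\<integral>w. norm (F w) \<partial>M)"
 have "((\<lambda>z. \<integral>w. F w * bkern \<mu> z (\<tau> w) \<partial>M) has_derivative L) (at z0)"
 proof (rule has_derivativeI_sandwich[where e="r - norm z0" and H="\<lambda>z. N * B 2 * norm (z - z0)"])
  show "0 < r - norm z0" using r by simp
  show "bounded_linear L" by (rule Llin)
  have "((\<lambda>z. N * B 2 * norm (z - z0)) \<longlongrightarrow> N * B 2 * norm (z0 - z0)) (at z0)" by (intro tendsto_intros)
  then show "((\<lambda>z. N * B 2 * norm (z - z0)) \<longlongrightarrow> 0) (at z0)" by simp
  fix z assume z: "z \<noteq> z0" "dist z z0 < r - norm z0"
  have zr: "norm z \<le> r" using z norm_triangle_ineq2[of z z0] by (simp add: dist_norm)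
  have z0r: "norm z0 \<le> r" using r by simp
  have "(\<integral>w. F w * bkern \<mu> z (\<tau> w) \<partial>M) - (\<integral>w. F w * bkern \<mu> z0 (\<tau> w) \<partial>M) - L (z - z0) =
   (\<integral>w. F w * \<Phi> 0 (herm z (\<tau> w)) - F w * \<Phi> 0 (herm z0 (\<tau> w)) - F w * \<Phi> 1 (herm z0 (\<tau> w)) * herm (z - z0) (\<tau> w) \<partial>M)"
   unfolding bk L_def using int\<Phi>[OF zr] int\<Phi>[OF z0r] intL by (subst Bochner_Integration.integral_diff, simp_all)
  also have "norm \<dots> \<le> (\<integral>w. norm (F w) * (B 2 * (norm (z - z0))\<^sup>2) \<partial>M)"
  proof (rule order.trans[OF integral_norm_bound], rule integral_mono_AE)
   show "integrable M (\<lambda>w. norm (F w) * (B 2 * (norm (z - z0))\<^sup>2))" using F by simp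
   show "integrable M (\<lambda>w. norm (F w * \<Phi> 0 (herm z (\<tau> w)) - F w * \<Phi> 0 (herm z0 (\<tau> w)) - F w * \<Phi> 1 (herm z0 (\<tau> w)) * herm (z - z0) (\<tau> w)))"
    using int\<Phi>[OF zr] int\<Phi>[OF z0r] intL by (intro integrable_norm Bochner_Integration.integrable_diff)
   show "AE w in M. norm (F w * \<Phi> 0 (herm z (\<tau> w)) - F w * \<Phi> 0 (herm z0 (\<tau> w)) - F w * \<Phi> 1 (herm z0 (\<tau> w)) * herm (z - z0) (\<tau> w)) \<le> norm (F w) * (B 2 * (norm (z - z0))\<^sup>2)"
    using \<tau>
   proof eventually_elim
    case (elim w)
    let ?u = "herm z (\<tau> w)" and ?v = "herm z0 (\<tau> w)"
    have uv: "?u \<in> cball 0 r" "?v \<in> cball 0 r" using hin zr z0r elim by auto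
    have B2: "0 \<le> B 2" using B[OF uv(1), of 2] by (meson norm_ge_zero order_trans)
    have "cmod (\<Phi> 0 ?u - (\<Sum>i\<le>1. \<Phi> i ?v * (?u - ?v) ^ i / (fact i))) \<le> B 2 * cmod (?u - ?v) ^ (Suc 1) / fact 1"
    proof (rule complex_Taylor[where S="cball 0 r"])
     show "cmod (\<Phi> (Suc 1) x) \<le> B 2" if "x \<in> cball 0 r" for x using B[OF that, of 2] by (simp add: numeral_2_eq_2)
    qed (use der uv in auto)
    then have 1: "cmod (\<Phi> 0 ?u - \<Phi> 0 ?v - \<Phi> 1 ?v * (?u - ?v)) \<le> B 2 * (cmod (?u - ?v))\<^sup>2"
     by (simp add: power2_eq_square algebra_simps)
    have "cmod (?u - ?v) \<le> norm (z - z0) * norm (\<tau> w)" using norm_herm_le[of "z - z0" "\<tau> w"] by (simp add: herm_diff_left)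
    also have "\<dots> \<le> norm (z - z0)" using elim by (simp add: mult_left_le)
    finally have "(cmod (?u - ?v))\<^sup>2 \<le> (norm (z - z0))\<^sup>2" by (intro power_mono) auto
    then have 2: "B 2 * (cmod (?u - ?v))\<^sup>2 \<le> B 2 * (norm (z - z0))\<^sup>2" using B2 by (rule mult_left_mono)
    have eq: "F w * \<Phi> 0 ?u - F w * \<Phi> 0 ?v - F w * \<Phi> 1 ?v * herm (z - z0) (\<tau> w) = F w * (\<Phi> 0 ?u - \<Phi> 0 ?v - \<Phi> 1 ?v * (?u - ?v))"
     by (simp add: herm_diff_left algebra_simps)
    show ?case unfolding eq norm_mult by (rule mult_left_mono[OF order.trans[OF 1 2]]) simp
   qed
  qed
  also have "\<dots> = N * B 2 * (norm (z - z0))\<^sup>2" by (simp add: N_def mult.assoc)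
  finally show "norm ((\<integral>w. F w * bkern \<mu> z (\<tau> w) \<partial>M) - (\<integral>w. F w * bkern \<mu> z0 (\<tau> w) \<partial>M) - L (z - z0)) / norm (z - z0)
   \<le> N * B 2 * norm (z - z0)"
   using z by (simp add: divide_le_eq power2_eq_square mult.assoc)
 qed
 then show "\<exists>L. ((\<lambda>z. \<integral>w. F w * bkern \<mu> z (\<tau> w) \<partial>M) has_derivative L) (at z0) \<and> (\<forall>c h. L (c *s h) = c * L h)"
  using Lscale by blast
qed

text \<open>Measurable maps of the ball that move points by at most 1 in the Bergman metric. They
  include the identity and, as the radius of an admissible lattice is at most 1, the map onto
  lattice points; one set of constants serves all of them.\<close>

definition near_id :: "(complex^'n => complex^'n) => bool" where
 "near_id \<tau> \<longleftrightarrow> \<tau> \<in> borel_fun \<and>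
  (\<forall>w. norm w < 1 --> norm (\<tau> w) < 1 \<and> xr w (\<tau> w) \<le> (cosh 1)\<^sup>2)"

lemma near_idD:
 assumes "near_id \<tau>"
 shows "\<tau> \<in> borel_fun" "norm w < 1 ==> norm (\<tau> w) < 1" "norm w < 1 ==> xr w (\<tau> w) \<le> (cosh 1)\<^sup>2"
 using assms by (auto simp: near_id_def)

lemma near_id_id: "near_id (\<lambda>w :: complex^'n. w)"
proof -
 have "xr w w \<le> (cosh 1)\<^sup>2" if "norm w < 1" for w :: "complex^'n"
 proof -
  have h: "0 < hgt w" using that by (rule hgt_pos)
  have "1 - herm w w = of_real (hgt w)" by (simp add: herm_self hgt_def)
  then have "dst w w = hgt w" using h by (simp add: dst_def)
  then have "xr w w = 1" using h by (simp add: xr_def power2_eq_square)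
  then show ?thesis using cosh_real_ge_1[of 1] by (simp add: one_le_power)
 qed
 then show ?thesis by (simp add: near_id_def)
qed

text \<open>For \<open>\<tau> = id\<close> this is the Bergman projection, and \<open>T\<^sub>\<mu> f\<close> is \<open>bker_op \<tau> (f \<circ> \<tau>)\<close> for the map \<open>\<tau>\<close> that sends
 \<open>D\<^sub>m\<close> to \<open>w\<^sub>m\<close>.\<close>

definition bker_op :: "(complex^'n => complex^'n) => (complex^'n => complex) => complex^'n => complex" where
 "bker_op \<tau> u z = (if z \<in> ball 0 1 then \<integral>w. u w * bkern (real CARD('n) + 1 + \<alpha>) z (\<tau> w) \<partial>vol else 0)"

lemma bergman_projection_eq: "bergman_projection \<alpha> = bker_op (\<lambda>w. w)"
 by (auto simp: fun_eq_iff bergman_projection_def toeplitz_measure_def bker_op_def bkern_def)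

lemma AE_near_id:
 assumes "near_id \<tau>"
 shows "AE w in vol. norm (\<tau> w) \<le> 1"
 using AE_vol by eventually_elim (use near_idD(2)[OF assms] in \<open>auto intro: less_imp_le\<close>)

lemma holomorphic_bker_op:
 fixes \<tau> :: "complex^'n => complex^'n"
 assumes \<tau>: "near_id \<tau>" and u: "integrable vol u"
 shows "holomorphic_several (bker_op \<tau> u) (ball 0 1)"
 unfolding holomorphic_several_def
proof
 fix z :: "complex^'n" assume z: "z \<in> ball 0 1"
 let ?g = "\<lambda>z :: complex^'n. \<integral>w. u w * bkern (real CARD('n) + 1 + \<alpha>) z (\<tau> w) \<partial>vol"
 have "holomorphic_several ?g (ball 0 1)"
  using near_idD(1)[OF \<tau>] by (intro holomorphic_bkern_integral[OF u _ AE_near_id[OF \<tau>]]) simp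
 then obtain L where L: "(?g has_derivative L) (at z)" "\<forall>c h. L (c *s h) = c * L h"
  using z unfolding holomorphic_several_def by blast
 have "(bker_op \<tau> u has_derivative L) (at z)"
  by (rule has_derivative_transform_within_open[OF L(1) open_ball z]) (simp add: bker_op_def)
 then show "\<exists>L. (bker_op \<tau> u has_derivative L) (at z) \<and> (\<forall>c h. L (c *s h) = c * L h)" using L(2) by blast
qed

lemma holomorphic_several_continuous:
 assumes "holomorphic_several f U"
 shows "continuous_on U f"
 unfolding continuous_on_eq_continuous_within
proof
 fix z assume "z \<in> U"
 then obtain L where "(f has_derivative L) (at z)" using assms unfolding holomorphic_several_def by blast
 then show "continuous (at z within U) f" by (meson continuous_at_imp_continuous_at_within has_derivative_continuous)
qed

lemma holomorphic_several_measurable: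
 assumes "holomorphic_several f (ball 0 1)" "\<And>z. z \<notin> ball 0 1 ==> f z = 0"
 shows "f \<in> borel_fun"
proof -
 have "f = (\<lambda>z. indicator (ball 0 1) z *\<^sub>R f z)" using assms(2) by (auto simp: fun_eq_iff indicator_def)
 moreover have "(\<lambda>z. indicator (ball 0 1) z *\<^sub>R f z) \<in> borel_fun"
  by (intro borel_measurable_continuous_on_indicator holomorphic_several_continuous[OF assms(1)]) simp
 ultimately show ?thesis by simp
qed

lemma Np_add_le:
 assumes [measurable]: "f \<in> borel_fun" "g \<in> borel_fun"
 shows "Np (\<lambda>z. f z + g z) \<le> ennreal (2 powr p) * (Np f + Np g)"
proof -
 have "norm (f z + g z) powr p \<le> 2 powr p * (norm (f z) powr p + norm (g z) powr p)" for z
 proof -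
  define m where "m = max (norm (f z)) (norm (g z))"
  have "norm (f z + g z) \<le> 2 * m" using norm_triangle_ineq[of "f z" "g z"] by (simp add: m_def)
  then have "norm (f z + g z) powr p \<le> (2 * m) powr p" using p by (intro powr_mono2) auto
  also have "\<dots> = 2 powr p * m powr p" by (simp add: powr_mult m_def max_def)
  also have "m powr p \<le> norm (f z) powr p + norm (g z) powr p" by (auto simp: m_def max_def)
  finally show ?thesis by simp
 qed
 then have "Np (\<lambda>z. f z + g z) \<le> (\<integral>\<^sup>+z. ennreal (2 powr p) * (ennreal (norm (f z) powr p) + ennreal (norm (g z) powr p)) \<partial>vol)"
  unfolding Np_def by (intro nn_integral_mono) (simp flip: ennreal_plus ennreal_mult'')
 also have "\<dots> = ennreal (2 powr p) * (Np f + Np g)"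
  unfolding Np_def by (subst nn_integral_cmult, simp, subst nn_integral_add) auto
 finally show ?thesis .
qed

lemma Np_mono_AE:
 assumes "AE z in vol. norm (f z) \<le> norm (g z)"
 shows "Np f \<le> Np g"
 unfolding Np_def using assms(1)
 by (intro nn_integral_mono_AE) (auto elim!: eventually_mono intro!: ennreal_leI powr_mono2 simp: p less_imp_le[OF p] order.trans[OF _ less_imp_le[OF p]])

lemma Np_mono:
 assumes "\<And>z. norm z < 1 ==> norm (f z) \<le> norm (g z)"
 shows "Np f \<le> Np g"
 by (rule Np_mono_AE) (use AE_vol assms in \<open>auto elim: eventually_mono\<close>)

lemma Np_cong:
 assumes "\<And>z. norm z < 1 ==> norm (f z) = norm (g z)"
 shows "Np f = Np g"
 unfolding Np_def by (intro nn_integral_cong_AE) (use AE_vol assms in \<open>auto elim!: eventually_mono\<close>)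

lemma Np_cmult:
 assumes [measurable]: "f \<in> borel_fun"
 shows "Np (\<lambda>z. c * f z) = ennreal (norm c powr p) * Np f"
 unfolding Np_def by (subst nn_integral_cmult[symmetric]) (auto simp: norm_mult powr_mult ennreal_mult'')

lemma Np_zero: "Np (\<lambda>z. 0) = 0" by (simp add: Np_def)

lemma bergman_spaceD:
 assumes "f \<in> Ap"
 shows "f \<in> lp" "holomorphic_several f (ball 0 1)" "\<And>z. norm z \<ge> 1 ==> f z = 0"
  "f \<in> borel_fun" "Np f < \<infinity>"
 using assms by (auto simp: bergman_space_def Lp_iff_Np)

lemma bergman_projection_reproduces:
 assumes f: "f \<in> Ap"
 shows "bker_op (\<lambda>w. w) f = f"
proof
 fix z
 show "bker_op (\<lambda>w. w) f z = f z"
  using bergman_reproducing[OF \<alpha> bergman_spaceD(2)[OF f] Lp_integrable[OF bergman_spaceD(1)[OF f]], of z]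
   bergman_spaceD(3)[OF f, of z] by (auto simp: bker_op_def)
qed

text \<open>The p-th powers sum to at most 1, so multiplication by the members splits
  \<open>Np\<close> without loss of constants. Stating this for finite index sets avoids infinite
  sums. The index will consist of a scale and the number of a cell.\<close>

definition weight_family :: "(int \<times> nat => complex^'n => real) => bool" where
 "weight_family \<phi> \<longleftrightarrow> (\<forall>j. \<phi> j \<in> borel_fun) \<and> (\<forall>j z. 0 \<le> \<phi> j z) \<and>
  (\<forall>J z. finite J --> norm z < 1 --> (\<Sum>j\<in>J. \<phi> j z powr p) \<le> 1)"

definition slow_family :: "real => real => (int \<times> nat => complex^'n => real) => bool" where
 "slow_family R \<eta> \<phi> \<longleftrightarrow> (\<forall>J z w. finite J --> norm z < 1 --> norm w < 1 --> xr z w \<le> R -->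
  (\<Sum>j\<in>J. \<bar>\<phi> j z - \<phi> j w\<bar> powr p) \<le> \<eta>)"

lemma weight_familyD:
 assumes "weight_family \<phi>"
 shows "\<phi> j \<in> borel_fun" "0 \<le> \<phi> j z"
  "finite J ==> norm z < 1 ==> (\<Sum>j\<in>J. \<phi> j z powr p) \<le> 1"
 using assms unfolding weight_family_def by blast+

lemma weight_family_le_1:
 assumes \<phi>: "weight_family \<phi>" and z: "norm z < 1"
 shows "\<phi> j z \<le> 1"
proof -
 have "\<phi> j z powr p \<le> 1" using weight_familyD(3)[OF \<phi>, of "{j}" z] z by simp
 then have "(\<phi> j z powr p) powr (1 / p) \<le> 1 powr (1 / p)" using p by (intro powr_mono2) auto
 then show "\<phi> j z \<le> 1" using p weight_familyD(2)[OF \<phi>, of j z] by (simp add: powr_powr)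
qed

lemma weight_family_diff:
 assumes \<phi>: "weight_family \<phi>" and J: "finite J" and z: "norm z < 1" "norm w < 1"
 shows "(\<Sum>j\<in>J. \<bar>\<phi> j z - \<phi> j w\<bar> powr p) \<le> 2"
proof -
 have "(\<Sum>j\<in>J. \<bar>\<phi> j z - \<phi> j w\<bar> powr p) \<le> (\<Sum>j\<in>J. \<phi> j z powr p + \<phi> j w powr p)"
 proof (rule sum_mono)
  fix j
  have nn: "0 \<le> \<phi> j z" "0 \<le> \<phi> j w" by (rule weight_familyD(2)[OF \<phi>])+
  then have "\<bar>\<phi> j z - \<phi> j w\<bar> \<le> max (\<phi> j z) (\<phi> j w)" by auto
  then have "\<bar>\<phi> j z - \<phi> j w\<bar> powr p \<le> max (\<phi> j z) (\<phi> j w) powr p" using p by (intro powr_mono2) auto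
  also have "\<dots> \<le> \<phi> j z powr p + \<phi> j w powr p" by (simp add: max_def)
  finally show "\<bar>\<phi> j z - \<phi> j w\<bar> powr p \<le> \<phi> j z powr p + \<phi> j w powr p" .
 qed
 also have "\<dots> \<le> 1 + 1"
  unfolding sum.distrib using J z by (intro add_mono weight_familyD(3)[OF \<phi>])
 finally show ?thesis by simp
qed

lemma dst_near_id:
 assumes \<tau>: "near_id \<tau>" and z: "norm z < 1" and w: "norm w < 1" and l: "0 < l"
 shows "dst z (\<tau> w) powr (- l) \<le> (2 + 16 * (cosh 1)\<^sup>2) powr l * dst z w powr (- l)"
proof -
 let ?c = "2 + 16 * (cosh (1::real))\<^sup>2"
 have c: "0 < ?c" by (simp add: add_pos_nonneg)
 have "dst z w \<le> ?c * dst z (\<tau> w)"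
  using near_idD[OF \<tau>] z w by (intro xr_dst_trans) (auto simp: xr_commute[of "\<tau> w" w])
 moreover have d: "0 < dst z w" using z w by (intro dst_pos) auto
 ultimately have "(?c * dst z (\<tau> w)) powr (- l) \<le> dst z w powr (- l)" using l by (intro powr_mono2') auto
 then have "?c powr l * (?c powr (- l) * dst z (\<tau> w) powr (- l)) \<le> ?c powr l * dst z w powr (- l)"
  using c by (intro mult_left_mono) (auto simp: powr_mult)
 moreover have "?c powr l * ?c powr (- l) = 1" using c by (simp flip: powr_add)
 ultimately show ?thesis by (simp only: mult.assoc[symmetric])
qed

text \<open>All three bounds are instances of \<open>schur_commutator\<close>, because a map near
  the identity changes the kernel by a bounded factor. The constants are fixed before the map, which
  keeps the final constants independent of the lattice.\<close>

lemma kernel_bounds: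
 obtains C \<delta> where "1 \<le> C" "0 < \<delta>"
  "\<And>(\<tau> :: complex^'n => complex^'n) u. near_id \<tau> ==> u \<in> lp ==> Np (bker_op \<tau> u) \<le> ennreal C * Np u"
  "\<And>(\<tau> :: complex^'n => complex^'n) f. near_id \<tau> ==> f \<in> Ap ==> Np (\<lambda>z. f (\<tau> z)) \<le> ennreal C * Np f"
  "\<And>(\<tau> :: complex^'n => complex^'n) u \<phi> R \<eta> J. near_id \<tau> ==> u \<in> lp ==> weight_family \<phi> ==> 0 < R ==> 0 \<le> \<eta> ==>
   slow_family R \<eta> \<phi> ==> finite J ==>
   (\<Sum>j\<in>J. Np (\<lambda>z. of_real (\<phi> j z) * bker_op \<tau> u z - bker_op \<tau> (\<lambda>w. of_real (\<phi> j (\<tau> w)) * u w) z))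
    \<le> ennreal (C * (\<eta> + R powr (- \<delta>))) * Np u"
proof (rule schur_commutator, goal_cases)
 case (1 C \<delta>)
 note C = 1(2,3)
 define l where "l = real CARD('n) + 1 + \<alpha>"
 have l: "0 < l" using \<alpha> by (simp add: l_def)
 note S = 1(4)[folded l_def]
 define M0 where "M0 = (cosh (1::real))\<^sup>2"
 have M0: "0 < M0" by (simp add: M0_def)
 define c0 where "c0 = (2 + 16 * M0) powr l"
 have c0: "0 < c0" using M0 by (simp add: c0_def)
 define c1 where "c1 = (2 + 16 * M0)\<^sup>2 * (4 * M0)"
 have c1: "0 < c1" using M0 by (simp add: c1_def)
 define C' where "C' = c0 powr p * C * 2 * (c1 powr \<delta> + 1) + 1"
 have C': "c0 powr p * (C * 2) \<le> C'" "1 \<le> C'"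
 proof -
  have "c0 powr p * (C * 2) * 1 \<le> c0 powr p * (C * 2) * (c1 powr \<delta> + 1)"
   using c0 C by (intro mult_left_mono) auto
  then show "c0 powr p * (C * 2) \<le> C'" by (simp add: C'_def mult.assoc)
  show "1 \<le> C'" unfolding C'_def using C c0 by (simp add: add_nonneg_nonneg)
 qed
 have kb: "norm (bkern l z (\<tau> w)) \<le> c0 * dst z w powr (- l)" if "near_id \<tau>" "norm z < 1" "norm w < 1" for \<tau> and z w :: "complex^'n"
  using dst_near_id[OF that l] near_idD(2)[OF that(1,3)] that norm_bkern[of z "\<tau> w" l] by (simp add: c0_def M0_def)
 have kb': "norm (bkern l (\<tau> z) w) \<le> c0 * dst z w powr (- l)" if "near_id \<tau>" "norm z < 1" "norm w < 1" for \<tau> and z w :: "complex^'n"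
  using dst_near_id[OF that(1,3,2) l] near_idD(2)[OF that(1,2)] that norm_bkern[of "\<tau> z" w l]
  by (simp add: c0_def M0_def dst_commute[of w])
 have single: "Np (\<lambda>z. \<integral>w. H z w * u w \<partial>vol) \<le> ennreal C' * Np u"
  if "u \<in> lp" "(\<lambda>x. H (fst x) (snd x)) \<in> borel_measurable (borel \<Otimes>\<^sub>M borel)"
   "\<And>z w. norm z < 1 ==> norm w < 1 ==> norm (H z w) \<le> c0 * dst z w powr (- l)"
  for u :: "complex^'n => complex" and H
 proof -
  \<comment> \<open>A single index, with first weight 1 and second weight 0, turns the commutator
    into the operator itself; \<open>\<eta>\<close>, \<open>B\<close> and \<open>M\<close> are all
    1.\<close>
  have "(\<Sum>j\<in>{(0::int,0::nat)}. Np (\<lambda>z. \<integral>w. H z w * of_real ((\<lambda>_ _. 1) j z - (\<lambda>_ _. 0) j w) * u w \<partial>vol))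
    \<le> ennreal (c0 powr p * (C * (1 + 1 * 1 powr (- \<delta>)))) * Np u"
   using that c0 by (intro S) auto
  then have "Np (\<lambda>z. \<integral>w. H z w * u w \<partial>vol) \<le> ennreal (c0 powr p * (C * 2)) * Np u" by simp
  also have "\<dots> \<le> ennreal C' * Np u" using C'(1) by (intro mult_right_mono ennreal_leI) auto
  finally show ?thesis .
 qed
 show ?thesis
 proof (rule that[of C' \<delta>])
  fix \<tau> :: "complex^'n => complex^'n" and u :: "complex^'n => complex" assume \<tau>: "near_id \<tau>" and u: "u \<in> lp"
  have [measurable]: "\<tau> \<in> borel_fun" by (rule near_idD[OF \<tau>])
  have "Np (bker_op \<tau> u) = Np (\<lambda>z. \<integral>w. bkern l z (\<tau> w) * u w \<partial>vol)"
   by (rule Np_cong) (simp add: bker_op_def l_def mult.commute)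
  also have "\<dots> \<le> ennreal C' * Np u" by (rule single[OF u]) (use kb[OF \<tau>] in auto)
  finally show "Np (bker_op \<tau> u) \<le> ennreal C' * Np u" .
 next
  fix \<tau> :: "complex^'n => complex^'n" and f :: "complex^'n => complex" assume \<tau>: "near_id \<tau>" and f: "f \<in> Ap"
  have [measurable]: "\<tau> \<in> borel_fun" by (rule near_idD[OF \<tau>])
  have "Np (\<lambda>z. f (\<tau> z)) = Np (\<lambda>z. \<integral>w. bkern l (\<tau> z) w * f w \<partial>vol)"
  proof (rule Np_cong)
   fix z :: "complex^'n" assume "norm z < 1"
   then have "norm (\<tau> z) < 1" by (rule near_idD[OF \<tau>])
   then show "norm (f (\<tau> z)) = norm (\<integral>w. bkern l (\<tau> z) w * f w \<partial>vol)"
    using fun_cong[OF bergman_projection_reproduces[OF f], of "\<tau> z"]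
    by (simp add: bker_op_def l_def mult.commute)
  qed
  also have "\<dots> \<le> ennreal C' * Np f" by (rule single[OF bergman_spaceD(1)[OF f]]) (use kb'[OF \<tau>] in auto)
  finally show "Np (\<lambda>z. f (\<tau> z)) \<le> ennreal C' * Np f" .
 next
  fix \<tau> :: "complex^'n => complex^'n" and u :: "complex^'n => complex"
   and \<phi> :: "int \<times> nat => complex^'n => real" and R \<eta> :: real and J
  assume \<tau>: "near_id \<tau>" and u: "u \<in> lp" and \<phi>: "weight_family \<phi>" and R: "0 < R" and \<eta>: "0 \<le> \<eta>"
   and sl: "slow_family R \<eta> \<phi>" and J: "finite (J :: (int \<times> nat) set)"
  have [measurable]: "\<tau> \<in> borel_fun" by (rule near_idD[OF \<tau>])
  have \<phi>m [measurable]: "\<phi> j \<in> borel_fun" for j by (rule weight_familyD[OF \<phi>])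
  have um [measurable]: "u \<in> borel_fun" using u by (simp add: Lp_iff_Np)
  have \<phi>1: "\<phi> j z \<le> 1" "0 \<le> \<phi> j z" if "norm z < 1" for j z
   using weight_family_le_1[OF \<phi> that] weight_familyD(2)[OF \<phi>] by auto
  have ui: "integrable vol u" by (rule Lp_integrable[OF u])
  have eq: "of_real (\<phi> j z) * bker_op \<tau> u z - bker_op \<tau> (\<lambda>w. of_real (\<phi> j (\<tau> w)) * u w) z =
    (\<integral>w. bkern l z (\<tau> w) * of_real (\<phi> j z - \<phi> j (\<tau> w)) * u w \<partial>vol)" if z: "norm z < 1" for j z
  proof -
   have bd: "AE w in vol. norm (bkern l z (\<tau> w)) \<le> (hgt z / 2) powr (- l)"
    using AE_near_id[OF \<tau>] by eventually_elim (use norm_bkern_le[OF z] l in auto)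
   have i1: "integrable vol (\<lambda>w. u w * bkern l z (\<tau> w))"
    by (rule integrable_mult_bounded[OF ui _ bd]) measurable
   have i2: "integrable vol (\<lambda>w. u w * bkern l z (\<tau> w) * of_real (\<phi> j (\<tau> w)))"
   proof (rule integrable_mult_bounded[OF i1, where K=1])
    show "AE w in vol. norm (complex_of_real (\<phi> j (\<tau> w))) \<le> 1"
     using AE_vol by eventually_elim (use \<phi>1 near_idD(2)[OF \<tau>] in auto)
   qed measurable
   have e1: "of_real (\<phi> j z) * bker_op \<tau> u z = (\<integral>w. of_real (\<phi> j z) * (u w * bkern l z (\<tau> w)) \<partial>vol)"
    using z by (simp add: bker_op_def l_def)
   have e2: "bker_op \<tau> (\<lambda>w. of_real (\<phi> j (\<tau> w)) * u w) z = (\<integral>w. u w * bkern l z (\<tau> w) * of_real (\<phi> j (\<tau> w)) \<partial>vol)"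
    using z by (simp add: bker_op_def l_def mult_ac)
   have "of_real (\<phi> j z) * bker_op \<tau> u z - bker_op \<tau> (\<lambda>w. of_real (\<phi> j (\<tau> w)) * u w) z =
    (\<integral>w. of_real (\<phi> j z) * (u w * bkern l z (\<tau> w)) \<partial>vol) - (\<integral>w. u w * bkern l z (\<tau> w) * of_real (\<phi> j (\<tau> w)) \<partial>vol)"
    unfolding e1 e2 ..
   also have "\<dots> = (\<integral>w. of_real (\<phi> j z) * (u w * bkern l z (\<tau> w)) - u w * bkern l z (\<tau> w) * of_real (\<phi> j (\<tau> w)) \<partial>vol)"
    using i1 i2 by (intro Bochner_Integration.integral_diff[symmetric]) auto
   also have "\<dots> = (\<integral>w. bkern l z (\<tau> w) * of_real (\<phi> j z - \<phi> j (\<tau> w)) * u w \<partial>vol)"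
    by (rule Bochner_Integration.integral_cong) (auto simp: algebra_simps)
   finally show ?thesis .
  qed
  have "(\<Sum>j\<in>J. Np (\<lambda>z. of_real (\<phi> j z) * bker_op \<tau> u z - bker_op \<tau> (\<lambda>w. of_real (\<phi> j (\<tau> w)) * u w) z)) =
    (\<Sum>j\<in>J. Np (\<lambda>z. \<integral>w. bkern l z (\<tau> w) * of_real (\<phi> j z - \<phi> j (\<tau> w)) * u w \<partial>vol))"
   by (intro sum.cong refl Np_cong) (simp add: eq)
  also have "\<dots> \<le> ennreal (c0 powr p * (C * (\<eta> + 2 * (R / c1) powr (- \<delta>)))) * Np u"
  proof (rule S[OF u, where \<phi>'="\<lambda>j w. \<phi> j (\<tau> w)"])
   show "(\<lambda>x. bkern l (fst x) (\<tau> (snd x))) \<in> borel_measurable (borel \<Otimes>\<^sub>M borel)" by measurable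
   show "(\<Sum>j\<in>J. \<bar>\<phi> j z - \<phi> j (\<tau> w)\<bar> powr p) \<le> 2" if "norm z < 1" "norm w < 1" for z w
    using that near_idD(2)[OF \<tau>] by (intro weight_family_diff[OF \<phi> J])
   show "(\<Sum>j\<in>J. \<bar>\<phi> j z - \<phi> j (\<tau> w)\<bar> powr p) \<le> \<eta>" if zw: "norm z < 1" "norm w < 1" "xr z w \<le> R / c1" for z w
   proof -
    \<comment> \<open>The weight is evaluated at the moved point, which multiplies \<open>xr\<close>
      by at most \<open>c1\<close>; hence the threshold \<open>R / c1\<close>.\<close>
    have "xr z (\<tau> w) \<le> c1 * xr z w"
     unfolding c1_def M0_def using zw near_idD[OF \<tau>] by (intro xr_trans) auto
    also have "\<dots> \<le> R" using zw(3) c1 by (simp add: field_simps)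
    finally show ?thesis using sl J zw near_idD(2)[OF \<tau>] unfolding slow_family_def by blast
   qed
  qed (use J \<eta> R c1 c0 kb[OF \<tau>] in auto)
  also have "\<dots> \<le> ennreal (C' * (\<eta> + R powr (- \<delta>))) * Np u"
  proof (intro mult_right_mono ennreal_leI)
   have "(R / c1) powr (- \<delta>) = c1 powr \<delta> * R powr (- \<delta>)" using R c1 by (simp add: powr_divide powr_minus_divide)
   then have "c0 powr p * (C * (\<eta> + 2 * (R / c1) powr (- \<delta>))) = c0 powr p * C * (\<eta> + 2 * c1 powr \<delta> * R powr (- \<delta>))" by simp
   also have "\<dots> \<le> c0 powr p * C * (2 * (c1 powr \<delta> + 1) * (\<eta> + R powr (- \<delta>)))"
    using C c0 \<eta> by (intro mult_left_mono) (auto simp: algebra_simps)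
   also have "\<dots> \<le> C' * (\<eta> + R powr (- \<delta>))" using \<eta> unfolding C'_def by (simp add: algebra_simps)
   finally show "c0 powr p * (C * (\<eta> + 2 * (R / c1) powr (- \<delta>))) \<le> C' * (\<eta> + R powr (- \<delta>))" .
  qed simp
  finally show "(\<Sum>j\<in>J. Np (\<lambda>z. of_real (\<phi> j z) * bker_op \<tau> u z - bker_op \<tau> (\<lambda>w. of_real (\<phi> j (\<tau> w)) * u w) z))
    \<le> ennreal (C' * (\<eta> + R powr (- \<delta>))) * Np u" .
 qed (use C C' in auto)
qed

section \<open>Slowly varying partitions\<close>

text \<open>The Berezin kernel, that is the squared modulus of the normalized reproducing kernel at
  the first argument. In the second argument it is a probability density with respect to
  \<open>vol\<close>.\<close>

definition berezin :: "complex^'n => complex^'n => real" where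
 "berezin \<xi> y = hgt \<xi> powr (real CARD('n) + 1 + \<alpha>) * dst \<xi> y powr (- (2 * (real CARD('n) + 1 + \<alpha>)))"

lemma berezin_nonneg [simp]: "0 \<le> berezin \<xi> y" by (simp add: berezin_def)

lemma measurable_berezin [measurable]:
 assumes [measurable]: "f \<in> borel_measurable M" "g \<in> borel_measurable M"
 shows "(\<lambda>x. berezin (f x) (g x)) \<in> borel_measurable M"
 unfolding berezin_def by measurable

lemma integrable_berezin:
 assumes "norm \<xi> < 1"
 shows "integrable vol (berezin \<xi>)"
 unfolding berezin_def using integrable_dst_powr[OF \<alpha> assms] by simp

lemma integral_berezin:
 fixes \<xi> :: "complex^'n"
 assumes "norm \<xi> < 1"
 shows "(\<integral>y. berezin \<xi> y \<partial>vol) = 1"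
proof -
 have "0 < hgt \<xi>" using assms by (intro hgt_pos)
 then show ?thesis
  unfolding berezin_def using berezin_mass[OF \<alpha> assms] by (simp flip: powr_add)
qed

text \<open>On the tail the factor \<open>(xr \<xi> y / M) powr \<delta>\<close> is at least 1.
  Inserting it leaves a Forelli--Rudin integral, which converges because \<open>\<delta>\<close> is
  half of \<open>1 + \<alpha>\<close>, and its powers of the height of \<open>\<xi>\<close>
  cancel.\<close>

lemma berezin_tail:
 obtains C \<delta> where "0 < C" "0 < \<delta>"
  "\<And>(\<xi> :: complex^'n) M A. norm \<xi> < 1 ==> 0 < M ==> A \<in> sets borel ==> (\<And>y. y \<in> A ==> norm y < 1 \<and> M < xr \<xi> y) ==>
   (\<integral>y. indicator A y * berezin \<xi> y \<partial>vol) \<le> C * M powr (- \<delta>)"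
proof -
 define l where "l = real CARD('n) + 1 + \<alpha>"
 define \<delta> where "\<delta> = (1 + \<alpha>) / 2"
 have \<delta>: "0 < \<delta>" "-1 < \<alpha> - \<delta>" "\<delta> < l" using \<alpha> by (auto simp: \<delta>_def l_def field_simps)
 have e: "2 * l - 2 * \<delta> - (real CARD('n) + 1 + \<alpha>) + \<delta> = l - \<delta>" by (simp add: l_def)
 obtain C where C: "0 < C" "\<And>z::complex^'n. norm z < 1 ==>
   (\<integral>\<^sup>+w. ennreal (dst z w powr (- (2 * l - 2 * \<delta>))) * ennreal (hgt w powr (- \<delta>)) \<partial>vol)
    \<le> ennreal (C * hgt z powr (- (l - \<delta>)))"
  using forelli_rudin_weighted[OF \<alpha> \<delta>(2), of "2 * l - 2 * \<delta>", where 'n='n, unfolded e] \<delta> by auto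
 show ?thesis
 proof (rule that[OF C(1) \<delta>(1)])
  fix \<xi> :: "complex^'n" and M :: real and A
  assume \<xi>: "norm \<xi> < 1" and M: "0 < M" and [measurable]: "A \<in> sets borel" and A: "\<And>y. y \<in> A ==> norm y < 1 \<and> M < xr \<xi> y"
  have h: "0 < hgt \<xi>" using \<xi> by (rule hgt_pos)
  have "(\<integral>\<^sup>+y. ennreal (indicator A y * berezin \<xi> y) \<partial>vol) \<le>
    (\<integral>\<^sup>+y. ennreal (M powr (- \<delta>) * hgt \<xi> powr (l - \<delta>)) * (ennreal (dst \<xi> y powr (- (2 * l - 2 * \<delta>))) * ennreal (hgt y powr (- \<delta>))) \<partial>vol)"
  proof (intro nn_integral_mono)
   fix y
   show "ennreal (indicator A y * berezin \<xi> y) \<le> ennreal (M powr (- \<delta>) * hgt \<xi> powr (l - \<delta>)) * (ennreal (dst \<xi> y powr (- (2 * l - 2 * \<delta>))) * ennreal (hgt y powr (- \<delta>)))"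
   proof (cases "y \<in> A")
    case True
    have hy: "0 < hgt y" "0 < dst \<xi> y" using A[OF True] hgt_pos[of y] dst_pos[of \<xi> y] \<xi> by auto
    have "1 \<le> (xr \<xi> y / M) powr \<delta>" using A[OF True] M \<delta> by (intro ge_one_powr_ge_zero) auto
    also have "\<dots> = M powr (- \<delta>) * (dst \<xi> y powr (2 * \<delta>) * hgt \<xi> powr (- \<delta>) * hgt y powr (- \<delta>))"
     using h hy M by (simp add: xr_def powr_divide powr_mult powr_minus_divide powr_powr flip: powr_numeral)
    finally have "berezin \<xi> y * 1 \<le> berezin \<xi> y * (M powr (- \<delta>) * (dst \<xi> y powr (2 * \<delta>) * hgt \<xi> powr (- \<delta>) * hgt y powr (- \<delta>)))"
     by (rule mult_left_mono) simp
    also have "\<dots> = M powr (- \<delta>) * (hgt \<xi> powr l * hgt \<xi> powr (- \<delta>)) * (dst \<xi> y powr (- (2 * l)) * dst \<xi> y powr (2 * \<delta>)) * hgt y powr (- \<delta>)"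
     by (simp add: berezin_def l_def mult_ac)
    also have "\<dots> = M powr (- \<delta>) * hgt \<xi> powr (l - \<delta>) * (dst \<xi> y powr (- (2 * l - 2 * \<delta>)) * hgt y powr (- \<delta>))"
     by (simp add: mult.assoc add.commute flip: powr_add)
    finally show ?thesis using True by (simp add: ennreal_leI flip: ennreal_mult'')
   qed simp
  qed
  also have "\<dots> = ennreal (M powr (- \<delta>) * hgt \<xi> powr (l - \<delta>)) * (\<integral>\<^sup>+y. ennreal (dst \<xi> y powr (- (2 * l - 2 * \<delta>))) * ennreal (hgt y powr (- \<delta>)) \<partial>vol)"
   by (rule nn_integral_cmult) measurable
  also have "\<dots> \<le> ennreal (M powr (- \<delta>) * hgt \<xi> powr (l - \<delta>)) * ennreal (C * hgt \<xi> powr (- (l - \<delta>)))"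
   by (intro mult_left_mono C(2) \<xi>) simp
  also have "\<dots> = ennreal (M powr (- \<delta>) * C * (hgt \<xi> powr (l - \<delta>) * hgt \<xi> powr (- (l - \<delta>))))"
   using C(1) by (simp add: mult_ac flip: ennreal_mult'')
  also have "hgt \<xi> powr (l - \<delta>) * hgt \<xi> powr (- (l - \<delta>)) = 1" using h by (simp flip: powr_add)
  finally have "(\<integral>\<^sup>+y. ennreal (indicator A y * berezin \<xi> y) \<partial>vol) \<le> ennreal (C * M powr (- \<delta>))" by (simp add: mult.commute)
  moreover have "(\<integral>y. indicator A y * berezin \<xi> y \<partial>vol) = enn2real (\<integral>\<^sup>+y. ennreal (indicator A y * berezin \<xi> y) \<partial>vol)"
   by (intro integral_eq_nn_integral) auto
  ultimately show "(\<integral>y. indicator A y * berezin \<xi> y \<partial>vol) \<le> C * M powr (- \<delta>)"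
   using enn2real_mono[of _ "ennreal (C * M powr (- \<delta>))"] C(1) by simp
 qed
qed

text \<open>The quotient of two Berezin kernels depends only on the quotient of the heights and that
  of the values of \<open>dst\<close>. Both are close to 1 if the points are close at the scale of
  \<open>hgt \<xi>\<close>: to the order of its square root in general, to first order along
  \<open>\<xi>\<close>.\<close>

lemma berezin_Lipschitz:
 assumes \<epsilon>: "0 < \<epsilon>"
 obtains \<kappa> where "0 < \<kappa>"
  "\<And>(\<xi> :: complex^'n) \<xi>'. norm \<xi> < 1 ==> norm \<xi>' < 1 ==> (norm (\<xi> - \<xi>'))\<^sup>2 \<le> \<kappa>\<^sup>2 * hgt \<xi> ==>
   cmod (herm \<xi> (\<xi> - \<xi>')) \<le> \<kappa> * hgt \<xi> ==>
   (\<integral>y. \<bar>berezin \<xi> y - berezin \<xi>' y\<bar> \<partial>vol) \<le> \<epsilon>"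
proof -
 define l where "l = real CARD('n) + 1 + \<alpha>"
 have "((\<lambda>x::real\<times>real. fst x powr l * snd x powr (- (2 * l))) \<longlongrightarrow> 1 powr l * 1 powr (- (2 * l))) (at (1, 1))"
  by (intro tendsto_intros) (auto intro!: tendsto_eq_intros)
 then have "((\<lambda>x::real\<times>real. fst x powr l * snd x powr (- (2 * l))) \<longlongrightarrow> 1) (at (1, 1))" by simp
 then obtain d where d: "0 < d" "\<And>x. x \<noteq> (1, 1) ==> dist x (1, 1) < d ==> dist (fst x powr l * snd x powr (- (2 * l))) 1 < \<epsilon>"
  using \<epsilon> unfolding tendsto_iff eventually_at by blast
 have d': "\<bar>t powr l * r powr (- (2 * l)) - 1\<bar> \<le> \<epsilon>" if "\<bar>t - 1\<bar> < d / 2" "\<bar>r - 1\<bar> < d / 2" for t r :: real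
 proof (cases "(t, r) = (1, 1)")
  case False
  have "dist (t, r) (1, 1) \<le> \<bar>t - 1\<bar> + \<bar>r - 1\<bar>"
   unfolding dist_prod_def by (simp add: dist_real_def) (metis abs_ge_zero power2_abs sqrt_sum_squares_le_sum)
  then show ?thesis using d(2)[OF False] that by (simp add: dist_real_def)
 qed (use \<epsilon> in auto)
 \<comment> \<open>The two quotients turn out to be within \<open>3 * \<kappa>\<close> and
   \<open>4 * \<kappa>\<close> of 1, and both numbers have to be below \<open>d / 2\<close>.\<close>
 define \<kappa> where "\<kappa> = min 1 (d / 10)"
 have \<kappa>: "0 < \<kappa>" "\<kappa> \<le> 1" "5 * \<kappa> \<le> d / 2" using d(1) by (auto simp: \<kappa>_def)
 show ?thesis
 proof (rule that[OF \<kappa>(1)])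
  fix \<xi> \<xi>' :: "complex^'n"
  assume \<xi>: "norm \<xi> < 1" "norm \<xi>' < 1" and a: "(norm (\<xi> - \<xi>'))\<^sup>2 \<le> \<kappa>\<^sup>2 * hgt \<xi>" and b: "cmod (herm \<xi> (\<xi> - \<xi>')) \<le> \<kappa> * hgt \<xi>"
  have h: "0 < hgt \<xi>" "0 < hgt \<xi>'" using \<xi> hgt_pos by auto
  have na: "norm (\<xi> - \<xi>') \<le> \<kappa> * sqrt (hgt \<xi>)"
   by (rule power2_le_imp_le) (use a \<kappa> h in \<open>auto simp: power_mult_distrib\<close>)
  have "hgt \<xi>' - hgt \<xi> = 2 * Re (herm \<xi> (\<xi> - \<xi>')) - (norm (\<xi> - \<xi>'))\<^sup>2"
   unfolding norm_diff_sqr hgt_def by (simp add: herm_diff_right herm_self)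
  then have "\<bar>hgt \<xi>' - hgt \<xi>\<bar> \<le> 2 * cmod (herm \<xi> (\<xi> - \<xi>')) + (norm (\<xi> - \<xi>'))\<^sup>2"
   using abs_Re_le_cmod[of "herm \<xi> (\<xi> - \<xi>')"] zero_le_power2[of "norm (\<xi> - \<xi>')"] by linarith
  also have "\<dots> \<le> 2 * (\<kappa> * hgt \<xi>) + \<kappa>\<^sup>2 * hgt \<xi>" using a b by simp
  also have "\<kappa>\<^sup>2 * hgt \<xi> \<le> \<kappa> * hgt \<xi>" using \<kappa> h by (simp add: power2_eq_square)
  finally have t: "\<bar>hgt \<xi>' / hgt \<xi> - 1\<bar> \<le> 3 * \<kappa>" using h by (simp add: abs_le_iff field_simps)
  have pw: "\<bar>berezin \<xi> y - berezin \<xi>' y\<bar> \<le> \<epsilon> * berezin \<xi> y" if y: "norm y < 1" for y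
  proof -
   have dp: "0 < dst \<xi> y" "0 < dst \<xi>' y" using dst_pos[of \<xi> y] dst_pos[of \<xi>' y] \<xi> y by auto
   have "\<bar>dst \<xi>' y - dst \<xi> y\<bar> \<le> cmod (herm y (\<xi> - \<xi>'))"
   proof -
    have "\<bar>dst y \<xi>' - dst y \<xi>\<bar> \<le> cmod ((1 - herm y \<xi>') - (1 - herm y \<xi>))"
     unfolding dst_def by (rule norm_triangle_ineq3)
    then show ?thesis by (simp add: dst_commute[of _ y] herm_diff_right norm_minus_commute)
   qed
   also have "\<dots> \<le> sqrt (2 * dst y \<xi>) * norm (\<xi> - \<xi>') + cmod (herm \<xi> (\<xi> - \<xi>'))"
    using \<xi> y by (intro dst_diff_le) auto
   also have "\<dots> \<le> sqrt (2 * dst y \<xi>) * (\<kappa> * sqrt (2 * dst y \<xi>)) + \<kappa> * (2 * dst y \<xi>)"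
   proof (intro add_mono mult_left_mono)
    have h2: "hgt \<xi> \<le> 2 * dst y \<xi>" using hgt_le_dst'[of y \<xi>] \<xi> y by simp
    then have "\<kappa> * sqrt (hgt \<xi>) \<le> \<kappa> * sqrt (2 * dst y \<xi>)" using \<kappa> by (intro mult_left_mono) auto
    then show "norm (\<xi> - \<xi>') \<le> \<kappa> * sqrt (2 * dst y \<xi>)" using na by simp
    have "\<kappa> * hgt \<xi> \<le> \<kappa> * (2 * dst y \<xi>)" using h2 \<kappa> by (intro mult_left_mono) auto
    then show "cmod (herm \<xi> (\<xi> - \<xi>')) \<le> \<kappa> * (2 * dst y \<xi>)" using b by simp
   qed auto
   also have "\<dots> = 4 * \<kappa> * dst \<xi> y" by (simp add: dst_commute[of y])
   finally have r: "\<bar>dst \<xi>' y / dst \<xi> y - 1\<bar> \<le> 4 * \<kappa>" using dp by (simp add: abs_le_iff field_simps)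
   have "\<bar>(hgt \<xi>' / hgt \<xi>) powr l * (dst \<xi>' y / dst \<xi> y) powr (- (2 * l)) - 1\<bar> \<le> \<epsilon>"
    using t r \<kappa> by (intro d') auto
   then have "\<bar>berezin \<xi> y * ((hgt \<xi>' / hgt \<xi>) powr l * (dst \<xi>' y / dst \<xi> y) powr (- (2 * l)) - 1)\<bar> \<le> berezin \<xi> y * \<epsilon>"
    unfolding abs_mult by (simp add: mult_left_mono)
   moreover have "berezin \<xi> y * ((hgt \<xi>' / hgt \<xi>) powr l * (dst \<xi>' y / dst \<xi> y) powr (- (2 * l))) = berezin \<xi>' y"
    unfolding berezin_def l_def[symmetric] using h dp by (simp add: powr_divide)
   ultimately show ?thesis by (simp add: right_diff_distrib abs_minus_commute mult.commute)
  qed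
  have "(\<integral>y. \<bar>berezin \<xi> y - berezin \<xi>' y\<bar> \<partial>vol) \<le> (\<integral>y. \<epsilon> * berezin \<xi> y \<partial>vol)"
   using integrable_berezin[OF \<xi>(1)] integrable_berezin[OF \<xi>(2)] AE_vol
   by (intro integral_mono_AE) (auto intro!: pw elim!: eventually_mono)
  also have "\<dots> = \<epsilon>" by (simp add: integral_berezin[OF \<xi>(1)])
  finally show "(\<integral>y. \<bar>berezin \<xi> y - berezin \<xi>' y\<bar> \<partial>vol) \<le> \<epsilon>" .
 qed
qed

text \<open>Moves a point of smaller height along its radius to a height of order
  \<open>2 powr l\<close>. For \<open>l \<ge> 0\<close> the maximum makes the map constantly
  0.\<close>

definition shrink :: "int => complex^'n => complex^'n" where
 "shrink l x = max 0 (1 - 2 powr (of_int l)) *\<^sub>R x"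

definition level :: "complex^'n => int" where "level x = \<lfloor>log 2 (hgt x)\<rfloor>"

lemma level_bounds:
 assumes "norm x < 1"
 shows "2 powr of_int (level x) \<le> hgt x" "hgt x < 2 powr (of_int (level x) + 1)"
proof -
 have h: "0 < hgt x" using assms by (rule hgt_pos)
 show "2 powr of_int (level x) \<le> hgt x" using h by (simp add: level_def flip: le_log_iff)
 have "log 2 (hgt x) < of_int (level x) + 1" unfolding level_def by linarith
 then show "hgt x < 2 powr (of_int (level x) + 1)" using h by (simp add: log_less_iff)
qed

lemma norm_shrink: assumes "norm x < 1"
 shows "norm (shrink l x) < 1"
proof -
 have "max 0 (1 - 2 powr (of_int l)) * norm x \<le> 1 * norm x" by (intro mult_right_mono) auto
 then show ?thesis using assms by (simp add: shrink_def)
qed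

lemma shrink_measurable [measurable]:
 assumes [measurable]: "f \<in> borel_measurable M"
 shows "(\<lambda>x. shrink l (f x)) \<in> borel_measurable M"
 unfolding shrink_def by measurable

lemma level_measurable [measurable]: "level \<in> borel \<rightarrow>\<^sub>M count_space UNIV"
 unfolding level_def[abs_def] by measurable

text \<open>Scaling does not increase Euclidean differences, which are controlled by the height of
  \<open>x\<close>, while the height of the contracted point exceeds that of \<open>x\<close> by a
  factor \<open>2 ^ L\<close> unless the image is 0. At the new scale the points are therefore
  close, in the two senses required by \<open>berezin_Lipschitz\<close>.\<close>

lemma shrink_contracts:
 assumes x: "norm x < 1" "norm x' < 1" and R: "xr x x' \<le> R" and l: "level x + int L < l"
 shows "(norm (shrink l x - shrink l x'))\<^sup>2 \<le> 4 * R * 2 powr (- real L) * hgt (shrink l x)"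
  "cmod (herm (shrink l x) (shrink l x - shrink l x')) \<le> (1 + 2 * R) * 2 powr (- real L) * hgt (shrink l x)"
proof -
 define s where "s = max 0 (1 - 2 powr (real_of_int l))"
 have s: "0 \<le> s" "s \<le> 1" by (auto simp: s_def)
 have sx: "shrink l y = s *\<^sub>R y" for y by (simp add: shrink_def s_def)
 have R0: "0 < R" using xr_pos[OF x] R by simp
 have d: "dst x x' \<le> 2 * R * hgt x" by (rule xr_dst[OF x R])
 have h: "0 < hgt x" using x by (intro hgt_pos)
 have hs0: "0 \<le> hgt (shrink l x)" using norm_shrink[OF x(1)] by (intro hgt_nonneg) (auto intro: less_imp_le)
 have key: "s * hgt x \<le> 2 powr (- real L) * hgt (shrink l x)"
 proof (cases "s = 0")
  case False
  then have s1: "1 - s = 2 powr (real_of_int l)" by (auto simp: s_def max_def split: if_splits)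
  have "hgt x \<le> 2 powr (of_int (level x) + 1)" using level_bounds(2)[OF x(1)] by simp
  also have "\<dots> \<le> 2 powr (real_of_int l - real L)" using l by (intro powr_mono) auto
  also have "\<dots> = 2 powr (- real L) * (1 - s)" unfolding s1 by (simp add: powr_diff powr_minus_divide)
  also have "1 - s \<le> hgt (shrink l x)"
  proof -
   have "(norm (shrink l x))\<^sup>2 \<le> s\<^sup>2 * 1"
    unfolding sx norm_scaleR power_mult_distrib power2_abs
    using x by (intro mult_left_mono) (auto simp: power_le_one)
   also have "\<dots> \<le> s" using s by (simp add: power2_eq_square mult_left_le)
   finally show ?thesis by (simp add: hgt_def)
  qed
  finally have "hgt x \<le> 2 powr (- real L) * hgt (shrink l x)" by (simp add: mult_left_mono)
  moreover have "s * hgt x \<le> hgt x" using s h by (simp add: mult_left_le_one_le)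
  ultimately show ?thesis by simp
 qed (use hs0 in simp)
 have "(norm (shrink l x - shrink l x'))\<^sup>2 = s\<^sup>2 * (norm (x - x'))\<^sup>2"
  unfolding sx by (simp add: power_mult_distrib flip: scaleR_diff_right)
 also have "\<dots> \<le> s * (2 * dst x x')"
 proof (intro mult_mono)
  show "s\<^sup>2 \<le> s" using s by (simp add: power2_eq_square mult_left_le)
  show "(norm (x - x'))\<^sup>2 \<le> 2 * dst x x'" using x by (intro norm_diff_le_dst) auto
 qed (use s in auto)
 also have "\<dots> \<le> s * (2 * (2 * R * hgt x))" using d s by (intro mult_left_mono) auto
 also have "\<dots> = 4 * R * (s * hgt x)" by simp
 also have "\<dots> \<le> 4 * R * (2 powr (- real L) * hgt (shrink l x))" using key R0 by (intro mult_left_mono) auto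
 finally show "(norm (shrink l x - shrink l x'))\<^sup>2 \<le> 4 * R * 2 powr (- real L) * hgt (shrink l x)" by (simp only: mult.assoc)
 have "cmod (herm (shrink l x) (shrink l x - shrink l x')) = s\<^sup>2 * cmod (herm x (x - x'))"
  unfolding sx using s by (simp add: herm_scaleR norm_mult power2_eq_square flip: scaleR_diff_right)
 also have "\<dots> \<le> s * (hgt x + dst x x')"
 proof (intro mult_mono)
  show "s\<^sup>2 \<le> s" using s by (simp add: power2_eq_square mult_left_le)
  show "cmod (herm x (x - x')) \<le> hgt x + dst x x'" using x by (intro herm_self_diff) auto
 qed (use s in auto)
 also have "\<dots> \<le> s * ((1 + 2 * R) * hgt x)" using d s by (intro mult_left_mono) (auto simp: algebra_simps)
 also have "\<dots> = (1 + 2 * R) * (s * hgt x)" by simp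
 also have "\<dots> \<le> (1 + 2 * R) * (2 powr (- real L) * hgt (shrink l x))" using key R0 by (intro mult_left_mono) auto
 finally show "cmod (herm (shrink l x) (shrink l x - shrink l x')) \<le> (1 + 2 * R) * 2 powr (- real L) * hgt (shrink l x)" by (simp only: mult.assoc)
qed

text \<open>Consecutive points of the chain \<open>z\<close>, \<open>shrink l z\<close>,
  \<open>w\<close>, \<open>shrink l z'\<close>, \<open>z'\<close> are within multiples of
  \<open>2 powr l\<close> in \<open>dst\<close>, and the heights of \<open>z\<close> and
  \<open>z'\<close> are at least \<open>2 powr (l - 2 * L)\<close>. The nested constants are those
  of three quasi-triangle inequalities.\<close>

lemma shrink_support:
 assumes z: "norm z < 1" "norm z' < 1" "norm w < 1" and M: "xr (shrink l z) w \<le> M" "xr (shrink l z') w \<le> M"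
  and l: "level z < l" "l \<le> level z + 2 * int L" "level z' < l" "l \<le> level z' + 2 * int L"
 shows "xr z z' \<le> (4 + 4 * (12 * M + 4 * (12 * M + 8)))\<^sup>2 * 2 powr (4 * real L)"
proof -
 define s where "s = max 0 (1 - 2 powr (real_of_int l))"
 define e where "e = 2 powr (real_of_int l)"
 have e: "0 < e" by (simp add: e_def)
 have s: "0 \<le> s" "s \<le> 1" "1 - s \<le> e" by (auto simp: s_def e_def)
 have sx: "shrink l y = s *\<^sub>R y" for y by (simp add: shrink_def s_def)
 have M0: "0 < M" using xr_pos[of "shrink l z" w] norm_shrink[OF z(1)] z M by simp
 have A: "dst y (shrink l y) \<le> 2 * e \<and> dst (shrink l y) w \<le> 6 * M * e \<and> e * 2 powr (- 2 * real L) \<le> hgt y"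
  if y: "norm y < 1" "xr (shrink l y) w \<le> M" "level y < l" "l \<le> level y + 2 * int L" for y
 proof (intro conjI)
  have h: "0 < hgt y" using y by (intro hgt_pos)
  have "hgt y \<le> 2 powr (of_int (level y) + 1)" using level_bounds(2)[OF y(1)] by simp
  also have "\<dots> \<le> e" unfolding e_def using y(3) by (intro powr_mono) auto
  finally have he: "hgt y \<le> e" .
  have "1 - herm y (shrink l y) = of_real ((1 - s) + s * hgt y)"
   unfolding sx by (simp add: herm_scaleR herm_self hgt_def algebra_simps)
  then have "dst y (shrink l y) = (1 - s) + s * hgt y" unfolding dst_def using s h by (simp only: norm_of_real) simp
  also have "\<dots> \<le> e + 1 * e" using s he h by (intro add_mono mult_mono) auto
  finally show "dst y (shrink l y) \<le> 2 * e" by simp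
  have "hgt (shrink l y) = (1 - s) * (1 + s) + s\<^sup>2 * hgt y"
   unfolding sx hgt_def by (simp add: power_mult_distrib algebra_simps power2_eq_square)
  also have "\<dots> \<le> e * 2 + 1 * e" using s he h e by (intro add_mono mult_mono) (auto simp: power_le_one)
  finally have hs: "hgt (shrink l y) \<le> 3 * e" by simp
  have "dst (shrink l y) w \<le> 2 * M * hgt (shrink l y)" using y norm_shrink[OF y(1)] z by (intro xr_dst) auto
  also have "\<dots> \<le> 2 * M * (3 * e)" using hs M0 by (intro mult_left_mono) auto
  finally show "dst (shrink l y) w \<le> 6 * M * e" by simp
  have "e * 2 powr (- 2 * real L) = 2 powr (real_of_int l - 2 * real L)" unfolding e_def by (simp add: powr_diff powr_minus_divide)
  also have "\<dots> \<le> 2 powr of_int (level y)" using y(4) by (intro powr_mono) auto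
  also have "\<dots> \<le> hgt y" by (rule level_bounds(1)[OF y(1)])
  finally show "e * 2 powr (- 2 * real L) \<le> hgt y" .
 qed
 note Az = A[OF z(1) M(1) l(1,2)] and Az' = A[OF z(2) M(2) l(3,4)]
 have n: "norm z \<le> 1" "norm z' \<le> 1" "norm w \<le> 1" "norm (shrink l z) \<le> 1" "norm (shrink l z') \<le> 1"
  using z norm_shrink by (auto intro: less_imp_le)
 have "dst z z' \<le> 2 * dst z (shrink l z) + 4 * dst (shrink l z) z'" using n by (intro dst_quasi_triangle)
 also have "dst (shrink l z) z' \<le> 2 * dst (shrink l z) w + 4 * dst w z'" using n by (intro dst_quasi_triangle)
 also have "dst w z' \<le> 2 * dst w (shrink l z') + 4 * dst (shrink l z') z'" using n by (intro dst_quasi_triangle)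
 finally have "dst z z' \<le> 2 * (2 * e) + 4 * (2 * (6 * M * e) + 4 * (2 * (6 * M * e) + 4 * (2 * e)))"
  using Az Az' by (simp add: dst_commute[of w] dst_commute[of "shrink l z'" z'])
 also have "\<dots> = (4 + 4 * (12 * M + 4 * (12 * M + 8))) * e" by (simp add: algebra_simps)
 finally have "(dst z z')\<^sup>2 \<le> ((4 + 4 * (12 * M + 4 * (12 * M + 8))) * e)\<^sup>2" by (intro power_mono) auto
 also have "\<dots> = (4 + 4 * (12 * M + 4 * (12 * M + 8)))\<^sup>2 * 2 powr (4 * real L) * ((e * 2 powr (- 2 * real L)) * (e * 2 powr (- 2 * real L)))"
 proof -
  have "2 powr (4 * real L) * (2 powr (- 2 * real L) * 2 powr (- 2 * real L)) = 1" by (simp flip: powr_add)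
  then show ?thesis by (simp only: power_mult_distrib power2_eq_square) (simp add: mult_ac)
 qed
 also have "\<dots> \<le> (4 + 4 * (12 * M + 4 * (12 * M + 8)))\<^sup>2 * 2 powr (4 * real L) * (hgt z * hgt z')"
  using Az Az' e hgt_pos[OF z(1)] by (intro mult_left_mono mult_mono) auto
 finally show ?thesis using z by (simp add: xr_le_iff mult.assoc)
qed

text \<open>Taking p-th roots turns a family whose variation is small in the sum of absolute values
  into one whose variation is small in the sum of p-th powers.\<close>

lemma powr_root_diff:
 fixes a b :: real
 assumes "0 \<le> a" "0 \<le> b"
 shows "\<bar>a powr (1/p) - b powr (1/p)\<bar> powr p \<le> \<bar>a - b\<bar>"
proof -
 have main: "(a powr (1/p) - b powr (1/p)) powr p \<le> a - b" if "0 \<le> b" "b \<le> a" for a b :: real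
 proof (cases "a = 0")
  case True then show ?thesis using that by simp
 next
  case False
  define t where "t = b / a"
  have a: "0 < a" using that False by simp
  have t: "0 \<le> t" "t \<le> 1" using that a by (auto simp: t_def)
  have b: "b = a * t" using a by (simp add: t_def)
  have t1: "t \<le> t powr (1/p)"
  proof (cases "t = 0")
   case False
   then have "t powr 1 \<le> t powr (1/p)" using t p by (intro powr_mono') auto
   then show ?thesis using t by simp
  qed simp
  have t2: "t powr (1/p) \<le> 1" using t p by (intro powr_le1) auto
  have "(1 - t powr (1/p)) powr p \<le> (1 - t powr (1/p)) powr 1"
  proof (cases "t powr (1/p) = 1")
   case False
   then show ?thesis using t2 p by (intro powr_mono') auto
  qed simp
  also have "\<dots> \<le> 1 - t" using t1 t2 by simp
  finally have "a * (1 - t powr (1/p)) powr p \<le> a * (1 - t)" using a by (intro mult_left_mono) auto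
  moreover have "(a powr (1/p) - b powr (1/p)) powr p = a * (1 - t powr (1/p)) powr p"
  proof -
   have "a powr (1/p) - b powr (1/p) = a powr (1/p) * (1 - t powr (1/p))"
    unfolding b using a t by (simp add: powr_mult right_diff_distrib)
   then show ?thesis using a t2 p by (simp add: powr_mult powr_powr)
  qed
  ultimately show ?thesis by (simp add: b right_diff_distrib)
 qed
 show ?thesis
 proof (cases "b \<le> a")
  case True
  then have "b powr (1/p) \<le> a powr (1/p)" using assms p by (intro powr_mono2) auto
  then show ?thesis using main[of b a] True assms by simp
 next
  case False
  then have "a powr (1/p) \<le> b powr (1/p)" using assms p by (intro powr_mono2) auto
  then show ?thesis using main[of a b] False assms by (simp add: abs_minus_commute[of "a powr _"] abs_minus_commute[of a])
 qed
qed

lemma sum_prod_bound: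
 fixes g :: "int \<times> nat => real"
 assumes J: "finite J" and I: "finite I" and g: "\<And>j. 0 \<le> g j"
  and c: "\<And>l F. finite F ==> (\<Sum>m\<in>F. g (l, m)) \<le> c l" and c0: "\<And>l. l \<notin> I ==> c l \<le> 0"
 shows "(\<Sum>j\<in>J. g j) \<le> (\<Sum>l\<in>I. c l)"
proof -
 let ?A = "fst ` J \<union> I" and ?F = "snd ` J"
 have cn: "0 \<le> c l" for l using c[of "{}" l] by simp
 have "(\<Sum>j\<in>J. g j) \<le> (\<Sum>j\<in>?A \<times> ?F. g j)"
 proof (rule sum_mono2)
  show "J \<subseteq> ?A \<times> ?F" using subset_fst_snd[of J] by auto
 qed (use J I g in auto)
 also have "\<dots> = (\<Sum>l\<in>?A. \<Sum>m\<in>?F. g (l, m))" by (simp add: sum.cartesian_product)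
 also have "\<dots> \<le> (\<Sum>l\<in>?A. c l)" using J by (intro sum_mono c) auto
 also have "\<dots> = (\<Sum>l\<in>I. c l)"
  using J I c0 cn by (intro sum.mono_neutral_right) (auto intro: antisym)
 finally show ?thesis .
qed

text \<open>\<open>\<phi> (l, m) x\<^sup>p\<close> is \<open>1 / L\<close> times the Berezin transform of the indicator function of \<open>D m\<close> at \<open>shrink l x\<close>, for \<open>L\<close>
 consecutive scales \<open>2\<^sup>l\<close> above the height of \<open>x\<close>. At these scales neighbouring points have been contracted, so that
 their Berezin kernels are close, and passing to a neighbour changes only a bounded number of the \<open>L\<close> scales. Cutting off
 the tails makes the supports bounded.\<close>

lemma slow_family_exists:
 fixes D :: "nat => (complex^'n) set" and w :: "nat => complex^'n" and R \<eta> M0 :: real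
 assumes R: "0 < R" and \<eta>: "0 < \<eta>" and M0: "0 < M0"
  and D: "\<And>m. D m \<in> sets borel" "disjoint_family D" "(\<Union>m. D m) = ball 0 1"
  and w: "\<And>m. norm (w m) < 1" "\<And>m y. y \<in> D m ==> xr y (w m) \<le> M0"
 obtains \<phi> :: "int \<times> nat => complex^'n => real" and R' where "weight_family \<phi>" "slow_family R \<eta> \<phi>"
  "\<And>z. norm z < 1 ==> \<exists>J. finite J \<and> 1 / 2 \<le> (\<Sum>j\<in>J. \<phi> j z powr p)"
  "\<And>j z z'. norm z < 1 ==> norm z' < 1 ==> \<phi> j z \<noteq> 0 ==> \<phi> j z' \<noteq> 0 ==> xr z z' \<le> R'"
proof -
 note [measurable] = D(1)
 have Dball: "norm y < 1" if "y \<in> D m" for y m using that D(3) by auto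
 define c1 where "c1 = (2 + 16 * M0)\<^sup>2 * (4 * M0)"
 have c1: "0 < c1" using M0 by (simp add: c1_def)
 obtain Ct \<delta> where Ct: "0 < Ct" "0 < \<delta>" and tail: "\<And>(\<xi> :: complex^'n) M A. norm \<xi> < 1 ==> 0 < M ==> A \<in> sets borel ==>
   (\<And>y. y \<in> A ==> norm y < 1 \<and> M < xr \<xi> y) ==> (\<integral>y. indicator A y * berezin \<xi> y \<partial>vol) \<le> Ct * M powr (- \<delta>)"
  using berezin_tail by blast
 \<comment> \<open>The bound 1/4 on the discarded tail leaves 3/4 - 1/4 = 1/2 for the lower bound of
   the sum; the bound \<open>\<eta> / 4\<close> enters the slowness estimate once for each of the
   two points.\<close>
 define \<tau>0 where "\<tau>0 = min (1/4) (\<eta> / 4)"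
 have \<tau>0: "0 < \<tau>0" "\<tau>0 \<le> 1/4" "\<tau>0 \<le> \<eta> / 4" using \<eta> by (auto simp: \<tau>0_def)
 define M1 where "M1 = (Ct / \<tau>0) powr (1 / \<delta>)"
 have M1: "0 < M1" using Ct \<tau>0 by (simp add: M1_def)
 have M1e: "Ct * M1 powr (- \<delta>) = \<tau>0"
  using Ct \<tau>0 by (simp add: M1_def powr_powr powr_minus_divide)
 \<comment> \<open>The cutoff is tested at the centre \<open>w m\<close> instead of the points of
   \<open>D m\<close>. Passing between them costs the factor \<open>c1\<close>.\<close>
 define M' where "M' = c1 * M1"
 have M': "0 < M'" using c1 M1 by (simp add: M'_def)
 obtain \<kappa> where \<kappa>: "0 < \<kappa>" and lip: "\<And>(\<xi> :: complex^'n) \<xi>'. norm \<xi> < 1 ==> norm \<xi>' < 1 ==> (norm (\<xi> - \<xi>'))\<^sup>2 \<le> \<kappa>\<^sup>2 * hgt \<xi> ==>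
   cmod (herm \<xi> (\<xi> - \<xi>')) \<le> \<kappa> * hgt \<xi> ==> (\<integral>y. \<bar>berezin \<xi> y - berezin \<xi>' y\<bar> \<partial>vol) \<le> \<eta> / 4"
  using berezin_Lipschitz[of "\<eta> / 4"] \<eta> by auto
 define Q where "Q = 1 + \<bar>log 2 (4 * R)\<bar>"
 have Q: "0 < Q" by (simp add: Q_def add_pos_nonneg)
 \<comment> \<open>The second and third property make contracted neighbours close enough for
   \<open>\<kappa>\<close>. The last one makes the unshared scales, at most \<open>Q\<close> on
   either side, negligible among \<open>L\<close>; \<open>Q\<close> bounds the difference of the
   levels of points with \<open>xr\<close> at most \<open>R\<close>.\<close>
 obtain L :: nat where L: "0 < L" "4 * R * 2 powr (- real L) \<le> \<kappa>\<^sup>2" "(1 + 2 * R) * 2 powr (- real L) \<le> \<kappa>" "2 * Q / L \<le> \<eta> / 4"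
 proof -
  define e where "e = min (\<kappa>\<^sup>2 / (4 * R)) (\<kappa> / (1 + 2 * R))"
  have "0 < e" using \<kappa> R by (simp add: e_def)
  then obtain n1 where n1: "(1/2) ^ n1 < e" using real_arch_pow_inv[of e "1/2"] by auto
  obtain n2 where n2: "2 * Q / (\<eta> / 4) < real n2" using reals_Archimedean2 by blast
  define L where "L = max 1 (max n1 n2)"
  have "2 powr (- real L) = (1/2) ^ L" by (simp add: powr_minus_divide powr_realpow power_one_over)
  also have "\<dots> \<le> (1/2) ^ n1" by (rule power_decreasing) (auto simp: L_def)
  finally have e: "2 powr (- real L) \<le> e" using n1 by simp
  have "4 * R * 2 powr (- real L) \<le> 4 * R * (\<kappa>\<^sup>2 / (4 * R))" using e R by (intro mult_left_mono) (auto simp: e_def)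
  then have 1: "4 * R * 2 powr (- real L) \<le> \<kappa>\<^sup>2" using R by simp
  have "(1 + 2 * R) * 2 powr (- real L) \<le> (1 + 2 * R) * (\<kappa> / (1 + 2 * R))" using e R by (intro mult_left_mono) (auto simp: e_def)
  then have 2: "(1 + 2 * R) * 2 powr (- real L) \<le> \<kappa>" using R by simp
  have L0: "0 < L" by (simp add: L_def)
  have "2 * Q / (\<eta> / 4) \<le> real L" using n2 by (auto simp: L_def)
  then have 3: "2 * Q / L \<le> \<eta> / 4" using L0 \<eta> by (simp add: field_simps)
  show ?thesis by (rule that[OF L0 1 2 3])
 qed
 define bb where "bb m \<xi> = (\<integral>y. indicator (D m) y * berezin \<xi> y \<partial>vol)" for m \<xi>
 interpret finite_measure vol by (rule finite_measure_bergman[OF \<alpha>])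
 have bbm [measurable]: "bb m \<in> borel_fun" for m unfolding bb_def by measurable
 have int: "integrable vol (\<lambda>y. indicator A y * f y)" if "integrable vol f" "A \<in> sets borel" for A and f :: "complex^'n => real"
  using integrable_mult_indicator[of A vol f] that by simp
 have bb0: "0 \<le> bb m \<xi>" for m \<xi> unfolding bb_def by (intro integral_nonneg_AE) auto
 have indF: "(\<Sum>m\<in>F. indicator (D m) y) = (indicator (\<Union>m\<in>F. D m) y :: real)" if "finite F" for F y
  using that D(2) by (subst indicator_UN_disjoint) (auto intro: disjoint_family_on_mono)
 have sum_bb: "(\<Sum>m\<in>F. bb m \<xi>) = (\<integral>y. indicator (\<Union>m\<in>F. D m) y * berezin \<xi> y \<partial>vol)" if F: "finite F" and \<xi>: "norm \<xi> < 1" for F \<xi>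
 proof -
  have "(\<Sum>m\<in>F. bb m \<xi>) = (\<integral>y. (\<Sum>m\<in>F. indicator (D m) y * berezin \<xi> y) \<partial>vol)"
   unfolding bb_def using int[OF integrable_berezin[OF \<xi>]] by (intro Bochner_Integration.integral_sum[symmetric]) auto
  then show ?thesis by (simp add: indF[OF F] flip: sum_distrib_right)
 qed
 have sum1: "(\<Sum>m\<in>F. bb m \<xi>) \<le> 1" if F: "finite F" and \<xi>: "norm \<xi> < 1" for F \<xi>
 proof -
  have "(\<Sum>m\<in>F. bb m \<xi>) \<le> (\<integral>y. berezin \<xi> y \<partial>vol)"
   unfolding sum_bb[OF that] using F by (intro integral_mono int integrable_berezin[OF \<xi>]) (auto simp: indicator_def)
  then show ?thesis by (simp add: integral_berezin[OF \<xi>])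
 qed
 have sum_lim: "\<exists>N. 3/4 \<le> (\<Sum>m<N. bb m \<xi>)" if \<xi>: "norm \<xi> < 1" for \<xi>
 proof -
  have "(\<lambda>N. \<integral>y. indicator (\<Union>m<N. D m) y * berezin \<xi> y \<partial>vol) \<longlonglongrightarrow> (\<integral>y. berezin \<xi> y \<partial>vol)"
  proof (rule integral_dominated_convergence[where w="berezin \<xi>"])
   show "integrable vol (berezin \<xi>)" by (rule integrable_berezin[OF \<xi>])
   show "AE y in vol. (\<lambda>N. indicator (\<Union>m<N. D m) y * berezin \<xi> y) \<longlonglongrightarrow> berezin \<xi> y"
    using AE_vol
   proof eventually_elim
    case (elim y)
    then obtain m where m: "y \<in> D m" using D(3) by (metis UN_E mem_ball_0)
    show ?case
    proof (rule tendsto_eventually, rule eventually_mono[OF eventually_gt_at_top[of m]])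
     fix N assume "m < N"
     then have "y \<in> (\<Union>m<N. D m)" using m by auto
     then show "indicator (\<Union>m<N. D m) y * berezin \<xi> y = berezin \<xi> y" by simp
    qed
   qed
  qed (auto simp: indicator_def)
  then have "(\<lambda>N. \<Sum>m<N. bb m \<xi>) \<longlonglongrightarrow> 1" by (simp add: integral_berezin[OF \<xi>] sum_bb[OF _ \<xi>])
  then have "eventually (\<lambda>N. 3/4 < (\<Sum>m<N. bb m \<xi>)) sequentially" by (rule order_tendstoD) simp
  then show ?thesis by (auto simp: eventually_sequentially intro: less_imp_le)
 qed
 have sum_tail: "(\<Sum>m\<in>F. if M' < xr \<xi> (w m) then bb m \<xi> else 0) \<le> \<tau>0" if F: "finite F" and \<xi>: "norm \<xi> < 1" for F \<xi>
 proof -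
  define F' where "F' = {m \<in> F. M' < xr \<xi> (w m)}"
  have F': "finite F'" using F by (simp add: F'_def)
  have "(\<Sum>m\<in>F. if M' < xr \<xi> (w m) then bb m \<xi> else 0) = (\<Sum>m\<in>F'. bb m \<xi>)"
   unfolding F'_def using F by (intro sum.inter_filter[symmetric])
  also have "\<dots> = (\<integral>y. indicator (\<Union>m\<in>F'. D m) y * berezin \<xi> y \<partial>vol)" by (rule sum_bb[OF F' \<xi>])
  also have "\<dots> \<le> Ct * M1 powr (- \<delta>)"
  proof (rule tail[OF \<xi> M1])
   show "(\<Union>m\<in>F'. D m) \<in> sets borel" using F' by (intro sets.finite_UN) auto
   fix y assume "y \<in> (\<Union>m\<in>F'. D m)"
   then obtain m where m: "m \<in> F" "M' < xr \<xi> (w m)" "y \<in> D m" by (auto simp: F'_def)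
   have "xr \<xi> (w m) \<le> c1 * xr \<xi> y"
    unfolding c1_def using \<xi> Dball[OF m(3)] w m by (intro xr_trans) auto
   then have "c1 * M1 < c1 * xr \<xi> y" using m(2) by (simp add: M'_def)
   then show "norm y < 1 \<and> M1 < xr \<xi> y" using c1 Dball[OF m(3)] by simp
  qed
  finally show ?thesis by (simp add: M1e)
 qed
 have sum_diff: "(\<Sum>m\<in>F. \<bar>bb m \<xi> - bb m \<xi>'\<bar>) \<le> (\<integral>y. \<bar>berezin \<xi> y - berezin \<xi>' y\<bar> \<partial>vol)"
  if F: "finite F" and \<xi>: "norm \<xi> < 1" "norm \<xi>' < 1" for F \<xi> \<xi>'
 proof -
  let ?d = "\<lambda>y. \<bar>berezin \<xi> y - berezin \<xi>' y\<bar>"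
  have id: "integrable vol ?d"
   by (intro integrable_abs Bochner_Integration.integrable_diff integrable_berezin \<xi>)
  have "\<bar>bb m \<xi> - bb m \<xi>'\<bar> \<le> (\<integral>y. indicator (D m) y * ?d y \<partial>vol)" for m
  proof -
   have "bb m \<xi> - bb m \<xi>' = (\<integral>y. indicator (D m) y * (berezin \<xi> y - berezin \<xi>' y) \<partial>vol)"
    unfolding bb_def right_diff_distrib
    using int[OF integrable_berezin[OF \<xi>(1)]] int[OF integrable_berezin[OF \<xi>(2)]]
    by (intro Bochner_Integration.integral_diff[symmetric]) auto
   also have "\<bar>\<dots>\<bar> \<le> (\<integral>y. \<bar>indicator (D m) y * (berezin \<xi> y - berezin \<xi>' y)\<bar> \<partial>vol)" by (rule integral_abs_bound)
   finally show ?thesis by (simp add: abs_mult)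
  qed
  then have "(\<Sum>m\<in>F. \<bar>bb m \<xi> - bb m \<xi>'\<bar>) \<le> (\<Sum>m\<in>F. \<integral>y. indicator (D m) y * ?d y \<partial>vol)" by (rule sum_mono)
  also have "\<dots> = (\<integral>y. (\<Sum>m\<in>F. indicator (D m) y * ?d y) \<partial>vol)"
   using int[OF id] by (intro Bochner_Integration.integral_sum[symmetric]) auto
  also have "\<dots> = (\<integral>y. indicator (\<Union>m\<in>F. D m) y * ?d y \<partial>vol)"
   by (simp add: indF[OF F] flip: sum_distrib_right)
  also have "\<dots> \<le> (\<integral>y. ?d y \<partial>vol)"
   using F by (intro integral_mono int id) (auto simp: indicator_def)
  finally show ?thesis .
 qed
 \<comment> \<open>\<open>L\<close> consecutive scales, beginning above a gap of \<open>L\<close>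
   over the level of \<open>x\<close>. The gap provides the contraction, the number of scales the
   averaging.\<close>
 define I where "I x = {level x + int L <.. level x + 2 * int L}" for x :: "complex^'n"
 have Ifin: "finite (I x)" "card (I x) = L" for x by (auto simp: I_def)
 define \<psi>0 where "\<psi>0 j x = (if fst j \<in> I x then bb (snd j) (shrink (fst j) x) / L else 0)" for j x
 define \<psi> where "\<psi> j x = (if xr (shrink (fst j) x) (w (snd j)) \<le> M' then \<psi>0 j x else 0)" for j x
 define \<phi> where "\<phi> j x = \<psi> j x powr (1 / p)" for j x
 have \<psi>00: "0 \<le> \<psi>0 j x" for j x by (simp add: \<psi>0_def bb0)
 have \<psi>n: "0 \<le> \<psi> j x" "\<psi> j x \<le> \<psi>0 j x" for j x by (simp_all add: \<psi>_def \<psi>00)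
 have \<phi>p: "\<phi> j x powr p = \<psi> j x" for j x using p \<psi>n(1)[of j x] by (simp add: \<phi>_def powr_powr)
 have Lr: "real L > 0" using L by simp
 have sum_const: "(\<Sum>l\<in>I x. if l \<in> I x then c / real L else 0) = c" for x c
  using Ifin[of x] Lr by simp
 show ?thesis
 proof (rule that[of \<phi> "(4 + 4 * (12 * M' + 4 * (12 * M' + 8)))\<^sup>2 * 2 powr (4 * real L)"])
  show "weight_family \<phi>"
   unfolding weight_family_def
  proof (intro conjI allI impI)
   fix j :: "int \<times> nat"
   have [measurable]: "Measurable.pred borel (\<lambda>x. fst j \<in> I x)"
    unfolding I_def by (rule measurable_compose[OF level_measurable]) simp
   show "\<phi> j \<in> borel_fun" unfolding \<phi>_def \<psi>_def \<psi>0_def by measurable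
  next
   fix j :: "int \<times> nat" and x show "0 \<le> \<phi> j x" by (simp add: \<phi>_def)
  next
   fix J :: "(int \<times> nat) set" and x :: "complex^'n" assume J: "finite J" and x: "norm x < 1"
   have "(\<Sum>j\<in>J. \<phi> j x powr p) \<le> (\<Sum>j\<in>J. \<psi>0 j x)" unfolding \<phi>p by (intro sum_mono \<psi>n)
   also have "\<dots> \<le> (\<Sum>l\<in>I x. if l \<in> I x then 1 / L else 0)"
   proof (rule sum_prod_bound[OF J Ifin(1) \<psi>00])
    fix l and F :: "nat set" assume "finite F"
    then have "(\<Sum>m\<in>F. bb m (shrink l x)) \<le> 1" using norm_shrink[OF x] by (intro sum1)
    then show "(\<Sum>m\<in>F. \<psi>0 (l, m) x) \<le> (if l \<in> I x then 1 / L else 0)"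
     using Lr by (auto simp: \<psi>0_def divide_right_mono simp flip: sum_divide_distrib)
   qed simp
   also have "\<dots> = 1" by (rule sum_const)
   finally show "(\<Sum>j\<in>J. \<phi> j x powr p) \<le> 1" .
  qed
  show "slow_family R \<eta> \<phi>"
   unfolding slow_family_def
  proof (intro allI impI)
   fix J :: "(int \<times> nat) set" and x x' :: "complex^'n"
   assume J: "finite J" and x: "norm x < 1" "norm x' < 1" and X: "xr x x' \<le> R"
   have h: "0 < hgt x" "0 < hgt x'" using x hgt_pos by auto
   define td where "td j y = (if M' < xr (shrink (fst j) y) (w (snd j)) then \<psi>0 j y else 0)" for j and y :: "complex^'n"
   have td: "(\<Sum>j\<in>J. td j y) \<le> \<tau>0" if y: "norm y < 1" for y
   proof -
    have "(\<Sum>j\<in>J. td j y) \<le> (\<Sum>l\<in>I y. if l \<in> I y then \<tau>0 / L else 0)"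
    proof (rule sum_prod_bound[OF J Ifin(1)])
     show "0 \<le> td j y" for j by (simp add: td_def \<psi>00)
     fix l and F :: "nat set" assume F: "finite F"
     have "(\<Sum>m\<in>F. td (l, m) y) = (if l \<in> I y then (\<Sum>m\<in>F. if M' < xr (shrink l y) (w m) then bb m (shrink l y) else 0) / L else 0)"
      unfolding td_def \<psi>0_def sum_divide_distrib by (auto intro!: sum.cong sum.neutral)
     also have "\<dots> \<le> (if l \<in> I y then \<tau>0 / L else 0)"
      using sum_tail[OF F norm_shrink[OF y, of l]] Lr by (auto intro: divide_right_mono)
     finally show "(\<Sum>m\<in>F. td (l, m) y) \<le> (if l \<in> I y then \<tau>0 / L else 0)" .
    qed simp
    then show ?thesis by (simp only: sum_const)
   qed
   define k k' where "k = level x" and "k' = level x'"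
   have kk: "\<bar>real_of_int (k - k')\<bar> \<le> Q"
   proof -
    have gen: "real_of_int (level a - level b) \<le> Q" if ab: "norm a < 1" "norm b < 1" "xr b a \<le> R" for a b :: "complex^'n"
    proof -
     have "2 powr of_int (level a) \<le> hgt a" by (rule level_bounds(1)[OF ab(1)])
     also have "\<dots> \<le> 4 * R * hgt b" by (rule xr_hgt[OF ab(2,1,3)])
     also have "\<dots> \<le> 4 * R * 2 powr (of_int (level b) + 1)" using level_bounds(2)[OF ab(2)] R by (intro mult_left_mono) auto
     finally have "log 2 (2 powr of_int (level a)) \<le> log 2 (4 * R * 2 powr (of_int (level b) + 1))" using R by (subst log_le_cancel_iff) auto
     also have "\<dots> = log 2 (4 * R) + (of_int (level b) + 1)" using R by (simp add: log_mult)
     finally show ?thesis by (simp add: Q_def)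
    qed
    show ?thesis using gen[OF x(1,2)] gen[OF x(2,1)] X by (simp add: abs_le_iff k_def k'_def xr_commute)
   qed
   have cardd: "card (I a - I b) \<le> nat \<bar>level a - level b\<bar>" for a b
   proof -
    have "I a - I b \<subseteq> {level a + int L <.. level b + int L} \<union> {level b + 2 * int L <.. level a + 2 * int L}"
     by (auto simp: I_def)
    then have "card (I a - I b) \<le> card ({level a + int L <.. level b + int L} \<union> {level b + 2 * int L <.. level a + 2 * int L})"
     by (intro card_mono) auto
    also have "\<dots> \<le> card {level a + int L <.. level b + int L} + card {level b + 2 * int L <.. level a + 2 * int L}"
     by (rule card_Un_le)
    also have "\<dots> = nat \<bar>level a - level b\<bar>" by simp
    finally show ?thesis .
   qed
   \<comment> \<open>At a common scale the contribution is the difference of two Berezin kernels. At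
     a scale that belongs to only one of the points it is the whole mass,
     \<open>1 / L\<close>.\<close>
   define c where "c l = (if l \<in> I x \<and> l \<in> I x' then \<eta> / 4 / L else if l \<in> I x \<or> l \<in> I x' then 1 / L else 0)" for l
   have main: "(\<Sum>j\<in>J. \<bar>\<psi>0 j x - \<psi>0 j x'\<bar>) \<le> (\<Sum>l\<in>I x \<union> I x'. c l)"
   proof (rule sum_prod_bound[OF J])
    fix l and F :: "nat set" assume F: "finite F"
    note ns = norm_shrink[OF x(1), of l] norm_shrink[OF x(2), of l]
    have s1: "(\<Sum>m\<in>F. bb m (shrink l x)) \<le> 1" "(\<Sum>m\<in>F. bb m (shrink l x')) \<le> 1" using sum1[OF F] ns by auto
    show "(\<Sum>m\<in>F. \<bar>\<psi>0 (l, m) x - \<psi>0 (l, m) x'\<bar>) \<le> c l"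
    proof (cases "l \<in> I x \<and> l \<in> I x'")
     case True
     then have l: "level x + int L < l" by (simp add: I_def)
     have hs: "0 \<le> hgt (shrink l x)" using ns by (intro hgt_nonneg) auto
     have "(\<Sum>m\<in>F. \<bar>bb m (shrink l x) - bb m (shrink l x')\<bar>) \<le> (\<integral>y. \<bar>berezin (shrink l x) y - berezin (shrink l x') y\<bar> \<partial>vol)"
      by (rule sum_diff[OF F ns])
     also have "\<dots> \<le> \<eta> / 4"
     proof (rule lip[OF ns])
      show "(norm (shrink l x - shrink l x'))\<^sup>2 \<le> \<kappa>\<^sup>2 * hgt (shrink l x)"
       using shrink_contracts(1)[OF x X l] mult_right_mono[OF L(2) hs] by linarith
      show "cmod (herm (shrink l x) (shrink l x - shrink l x')) \<le> \<kappa> * hgt (shrink l x)"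
       using shrink_contracts(2)[OF x X l] mult_right_mono[OF L(3) hs] by linarith
     qed
     finally have "(\<Sum>m\<in>F. \<bar>bb m (shrink l x) - bb m (shrink l x')\<bar>) / L \<le> \<eta> / 4 / L" using Lr by (intro divide_right_mono) auto
     moreover have "\<bar>\<psi>0 (l, m) x - \<psi>0 (l, m) x'\<bar> = \<bar>bb m (shrink l x) - bb m (shrink l x')\<bar> / L" for m
      using True Lr by (simp add: \<psi>0_def flip: diff_divide_distrib)
     ultimately show ?thesis using True by (simp add: c_def sum_divide_distrib)
    next
     case False
     then show ?thesis
      using s1 bb0 Lr by (auto simp: c_def \<psi>0_def divide_right_mono simp flip: sum_divide_distrib)
    qed
   next
    show "finite (I x \<union> I x')" by (simp add: Ifin)
    show "c l \<le> 0" if "l \<notin> I x \<union> I x'" for l using that by (simp add: c_def)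
   qed simp
   also have "(\<Sum>l\<in>I x \<union> I x'. c l) \<le> \<eta> / 4 + 2 * Q / L"
   proof -
    have "I x \<union> I x' = (I x \<inter> I x') \<union> ((I x - I x') \<union> (I x' - I x))" by auto
    then have "(\<Sum>l\<in>I x \<union> I x'. c l) = (\<Sum>l\<in>(I x \<inter> I x') \<union> ((I x - I x') \<union> (I x' - I x)). c l)" by simp
    also have "\<dots> = (\<Sum>l\<in>I x \<inter> I x'. c l) + ((\<Sum>l\<in>I x - I x'. c l) + (\<Sum>l\<in>I x' - I x. c l))"
     using Ifin by (subst sum.union_disjoint, simp, simp, blast, subst sum.union_disjoint) auto
    also have "(\<Sum>l\<in>I x \<inter> I x'. c l) = real (card (I x \<inter> I x')) * (\<eta> / 4 / L)" by (simp add: c_def)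
    also have "\<dots> \<le> real L * (\<eta> / 4 / L)"
     using card_mono[OF Ifin(1)[of x], of "I x \<inter> I x'"] Ifin(2)[of x] \<eta> by (intro mult_right_mono) auto
    also have "(\<Sum>l\<in>I x - I x'. c l) = real (card (I x - I x')) * (1 / L)" by (simp add: c_def)
    also have "\<dots> \<le> Q * (1 / L)"
    proof (rule mult_right_mono)
     show "real (card (I x - I x')) \<le> Q" using cardd[of x x'] kk unfolding k_def k'_def by linarith
    qed simp
    also have "(\<Sum>l\<in>I x' - I x. c l) = real (card (I x' - I x)) * (1 / L)" by (simp add: c_def)
    also have "\<dots> \<le> Q * (1 / L)"
    proof (rule mult_right_mono)
     show "real (card (I x' - I x)) \<le> Q" using cardd[of x' x] kk unfolding k_def k'_def by linarith
    qed simp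
    finally show ?thesis using Lr by simp
   qed
   finally have m2: "(\<Sum>j\<in>J. \<bar>\<psi>0 j x - \<psi>0 j x'\<bar>) \<le> \<eta> / 2" using L(4) by simp
   have "(\<Sum>j\<in>J. \<bar>\<phi> j x - \<phi> j x'\<bar> powr p) \<le> (\<Sum>j\<in>J. \<bar>\<psi>0 j x - \<psi>0 j x'\<bar> + td j x + td j x')"
   proof (rule sum_mono)
    fix j
    have "\<bar>\<phi> j x - \<phi> j x'\<bar> powr p \<le> \<bar>\<psi> j x - \<psi> j x'\<bar>"
     unfolding \<phi>_def by (rule powr_root_diff[OF \<psi>n(1) \<psi>n(1)])
    also have "\<dots> \<le> \<bar>\<psi>0 j x - \<psi>0 j x'\<bar> + td j x + td j x'"
     using \<psi>00[of j x] \<psi>00[of j x'] by (auto simp: \<psi>_def td_def)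
    finally show "\<bar>\<phi> j x - \<phi> j x'\<bar> powr p \<le> \<bar>\<psi>0 j x - \<psi>0 j x'\<bar> + td j x + td j x'" .
   qed
   \<comment> \<open>The total \<open>\<eta>\<close> is shared equally by the common scales, the
     unshared scales and the two tails.\<close>
   also have "\<dots> \<le> \<eta> / 2 + \<tau>0 + \<tau>0" unfolding sum.distrib using m2 td x by (intro add_mono) auto
   also have "\<dots> \<le> \<eta>" using \<tau>0(3) by simp
   finally show "(\<Sum>j\<in>J. \<bar>\<phi> j x - \<phi> j x'\<bar> powr p) \<le> \<eta>" .
  qed
  show "\<exists>J. finite J \<and> 1 / 2 \<le> (\<Sum>j\<in>J. \<phi> j x powr p)" if x: "norm x < 1" for x
  proof -
   have "\<exists>N. 3/4 \<le> (\<Sum>m<N. bb m (shrink l x))" for l by (rule sum_lim[OF norm_shrink[OF x]])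
   then obtain N where N: "\<And>l. 3/4 \<le> (\<Sum>m<N l. bb m (shrink l x))" by metis
   define J where "J = Sigma (I x) (\<lambda>l. {..<N l})"
   have "finite J" using Ifin by (auto simp: J_def)
   moreover have "1 / 2 \<le> (\<Sum>j\<in>J. \<phi> j x powr p)"
   proof -
    have "1 / 2 = (\<Sum>l\<in>I x. (1 / 2) / real L)" using Ifin[of x] Lr by simp
    also have "\<dots> \<le> (\<Sum>l\<in>I x. \<Sum>m<N l. \<psi> (l, m) x)"
    proof (rule sum_mono)
     fix l assume l: "l \<in> I x"
     have "\<psi> (l, m) x = (bb m (shrink l x) - (if M' < xr (shrink l x) (w m) then bb m (shrink l x) else 0)) / L" for m
      using l by (simp add: \<psi>_def \<psi>0_def not_less)
     then have "(\<Sum>m<N l. \<psi> (l, m) x) = ((\<Sum>m<N l. bb m (shrink l x)) - (\<Sum>m<N l. if M' < xr (shrink l x) (w m) then bb m (shrink l x) else 0)) / L"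
      by (simp add: sum_subtractf flip: sum_divide_distrib)
     also have "\<dots> \<ge> (3/4 - 1/4) / L"
      using N[of l] sum_tail[OF _ norm_shrink[OF x, of l], of "{..<N l}"] \<tau>0(2) Lr
      by (intro divide_right_mono diff_mono) auto
     finally show "(1 / 2) / real L \<le> (\<Sum>m<N l. \<psi> (l, m) x)" by simp
    qed
    also have "\<dots> = (\<Sum>j\<in>J. \<psi> j x)" unfolding J_def using Ifin by (subst sum.Sigma) auto
    finally show ?thesis by (simp add: \<phi>p)
   qed
   ultimately show ?thesis by blast
  qed
  fix j :: "int \<times> nat" and z z' :: "complex^'n" assume z: "norm z < 1" "norm z' < 1" and nz: "\<phi> j z \<noteq> 0" "\<phi> j z' \<noteq> 0"
  obtain l m where j: "j = (l, m)" by (cases j)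
  have "\<psi> j z \<noteq> 0" "\<psi> j z' \<noteq> 0" using nz by (auto simp: \<phi>_def)
  then have "xr (shrink l z) (w m) \<le> M'" "l \<in> I z" "xr (shrink l z') (w m) \<le> M'" "l \<in> I z'"
   by (auto simp: \<psi>_def \<psi>0_def j split: if_splits)
  then show "xr z z' \<le> (4 + 4 * (12 * M' + 4 * (12 * M' + 8)))\<^sup>2 * 2 powr (4 * real L)"
   using z w(1) by (intro shrink_support[where w="w m" and l=l]) (auto simp: I_def)
 qed
qed

section \<open>Operators and lattices\<close>

lemma Lp_I: "f \<in> borel_fun ==> Np f < \<infinity> ==> f \<in> lp"
 by (simp add: Lp_iff_Np)

lemma Lp_D: assumes "f \<in> lp"
 shows "f \<in> borel_fun" "Np f < \<infinity>"
 using assms by (simp_all add: Lp_iff_Np)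

lemma Np_mult_le:
 assumes [measurable]: "f \<in> borel_fun"
  and g: "\<And>z. norm z < 1 ==> norm (g z) \<le> K" and K: "0 \<le> K"
 shows "Np (\<lambda>z. g z * f z) \<le> ennreal (K powr p) * Np f"
proof -
 have "Np (\<lambda>z. g z * f z) \<le> Np (\<lambda>z. of_real K * f z)"
  using g K by (intro Np_mono) (simp add: norm_mult mult_right_mono)
 also have "\<dots> = ennreal (K powr p) * Np f" using K by (subst Np_cmult) auto
 finally show ?thesis .
qed

lemma Lp_mult:
 assumes "f \<in> lp" "g \<in> borel_fun"
"\<And>z. norm z < 1 ==> norm (g z) \<le> K"
 shows "(\<lambda>z. g z * f z) \<in> lp"
proof (rule Lp_I)
 have K: "0 \<le> K" using assms(3)[of 0] by (simp add: order.trans[OF norm_ge_zero])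
 show "(\<lambda>z. g z * f z) \<in> borel_fun" using Lp_D(1)[OF assms(1)] assms(2) by measurable
 have "Np (\<lambda>z. g z * f z) \<le> ennreal (K powr p) * Np f"
  using Lp_D(1)[OF assms(1)] assms K by (intro Np_mult_le) auto
 also have "\<dots> < \<infinity>" using Lp_D(2)[OF assms(1)] by (simp add: ennreal_mult_less_top)
 finally show "Np (\<lambda>z. g z * f z) < \<infinity>" .
qed

lemma Lp_add:
 assumes "f \<in> lp" "g \<in> lp"
 shows "(\<lambda>z. f z + g z) \<in> lp"
proof (rule Lp_I)
 note m [measurable] = Lp_D(1)[OF assms(1)] Lp_D(1)[OF assms(2)]
 show "(\<lambda>z. f z + g z) \<in> borel_fun" by measurable
 have "Np (\<lambda>z. f z + g z) \<le> ennreal (2 powr p) * (Np f + Np g)" by (rule Np_add_le[OF m])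
 also have "\<dots> < \<infinity>" using Lp_D(2)[OF assms(1)] Lp_D(2)[OF assms(2)] by (simp add: ennreal_mult_less_top)
 finally show "Np (\<lambda>z. f z + g z) < \<infinity>" .
qed

lemma Lp_cmult: assumes "f \<in> lp"
 shows "(\<lambda>z. c * f z) \<in> lp"
 using Lp_D[OF assms] by (intro Lp_I) (auto simp: Np_cmult ennreal_mult_less_top)

lemma Lp_diff: assumes "f \<in> lp" "g \<in> lp"
 shows "(\<lambda>z. f z - g z) \<in> lp"
 using Lp_add[OF assms(1) Lp_cmult[OF assms(2), of "-1"]] by simp

lemma holomorphic_several_add:
 assumes "holomorphic_several f U" "holomorphic_several g U"
 shows "holomorphic_several (\<lambda>z. f z + g z) U"
 unfolding holomorphic_several_def
proof
 fix z assume z: "z \<in> U"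
 obtain L where L: "(f has_derivative L) (at z)" "\<forall>c h. L (c *s h) = c * L h" using assms(1) z unfolding holomorphic_several_def by blast
 obtain M where M: "(g has_derivative M) (at z)" "\<forall>c h. M (c *s h) = c * M h" using assms(2) z unfolding holomorphic_several_def by blast
 show "\<exists>L. ((\<lambda>z. f z + g z) has_derivative L) (at z) \<and> (\<forall>c h. L (c *s h) = c * L h)"
  using has_derivative_add[OF L(1) M(1)] L(2) M(2) by (intro exI[of _ "\<lambda>h. L h + M h"]) (auto simp: distrib_left)
qed

lemma holomorphic_several_mult:
 assumes "holomorphic_several f U" "holomorphic_several g U"
 shows "holomorphic_several (\<lambda>z. f z * g z) U"
 unfolding holomorphic_several_def
proof
 fix z assume z: "z \<in> U"
 obtain L where L: "(f has_derivative L) (at z)" "\<forall>c h. L (c *s h) = c * L h" using assms(1) z unfolding holomorphic_several_def by blast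
 obtain M where M: "(g has_derivative M) (at z)" "\<forall>c h. M (c *s h) = c * M h" using assms(2) z unfolding holomorphic_several_def by blast
 show "\<exists>L. ((\<lambda>z. f z * g z) has_derivative L) (at z) \<and> (\<forall>c h. L (c *s h) = c * L h)"
  using has_derivative_mult[OF L(1) M(1)] L(2) M(2)
  by (intro exI[of _ "\<lambda>h. f z * M h + L h * g z"]) (auto simp: algebra_simps)
qed

lemma holomorphic_several_const: "holomorphic_several (\<lambda>z. c) U"
 unfolding holomorphic_several_def by (auto intro!: exI[of _ "\<lambda>h. 0"])

lemma holomorphic_several_cong:
 fixes f g :: "complex^'n => complex"
 assumes "holomorphic_several f (ball 0 1)" "\<And>z. norm z < 1 ==> f z = g z"
 shows "holomorphic_several g (ball 0 1)"
 unfolding holomorphic_several_def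
proof
 fix z :: "complex^'n" assume z: "z \<in> ball 0 1"
 then obtain L where L: "(f has_derivative L) (at z)" "\<forall>c h. L (c *s h) = c * L h"
  using assms(1) unfolding holomorphic_several_def by blast
 have "(g has_derivative L) (at z)"
  by (rule has_derivative_transform_within_open[OF L(1) open_ball z]) (simp add: assms(2))
 then show "\<exists>L. (g has_derivative L) (at z) \<and> (\<forall>c h. L (c *s h) = c * L h)" using L(2) by blast
qed

lemma bergman_spaceI:
 assumes "f \<in> lp" "holomorphic_several f (ball 0 1)" "\<And>z. norm z \<ge> 1 ==> f z = 0"
 shows "f \<in> Ap"
 using assms by (auto simp: bergman_space_def)

lemma bergman_space_lincomb:
 assumes "f \<in> Ap" "g \<in> Ap"
 shows "(\<lambda>z. c * f z + g z) \<in> Ap"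
 using assms by (intro bergman_spaceI Lp_add Lp_cmult holomorphic_several_add holomorphic_several_mult holomorphic_several_const)
  (auto simp: bergman_spaceD)

lemma bergman_space_zero: "(\<lambda>z. 0) \<in> Ap"
 by (intro bergman_spaceI Lp_I holomorphic_several_const) (auto simp: Np_zero)

lemma bergman_space_cmult: "f \<in> Ap ==> (\<lambda>z. c * f z) \<in> Ap"
 using bergman_space_lincomb[of f "\<lambda>z. 0" c] bergman_space_zero by simp

lemma bergman_space_add: "f \<in> Ap ==> g \<in> Ap ==> (\<lambda>z. f z + g z) \<in> Ap"
 using bergman_space_lincomb[of f g 1] by simp

lemma bergman_space_diff: "f \<in> Ap ==> g \<in> Ap ==> (\<lambda>z. f z - g z) \<in> Ap"
 using bergman_space_lincomb[of g f "-1"] by simp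

lemma bker_op_bergman:
 fixes \<tau> :: "complex^'n => complex^'n"
 assumes \<tau>: "near_id \<tau>" and u: "u \<in> lp"
 shows "bker_op \<tau> u \<in> Ap"
proof (rule bergman_spaceI)
 show hol: "holomorphic_several (bker_op \<tau> u) (ball 0 1)"
  by (rule holomorphic_bker_op[OF \<tau> Lp_integrable[OF u]])
 show z: "bker_op \<tau> u z = 0" if "norm z \<ge> 1" for z using that by (simp add: bker_op_def)
 obtain C where "Np (bker_op \<tau> u) \<le> ennreal C * Np u"
  using kernel_bounds \<tau> u by metis
 also have "\<dots> < \<infinity>" using Lp_D(2)[OF u] by (simp add: ennreal_mult_less_top)
 finally show "bker_op \<tau> u \<in> lp"
  using hol z by (intro Lp_I holomorphic_several_measurable) auto
qed

lemma integrable_bker: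
 fixes \<tau> :: "complex^'n => complex^'n"
 assumes \<tau>: "near_id \<tau>" and u: "u \<in> lp" and z: "norm z < 1" and l: "0 \<le> l"
 shows "integrable vol (\<lambda>w. u w * bkern l z (\<tau> w))"
proof (rule integrable_mult_bounded[OF Lp_integrable[OF u], where K="(hgt z / 2) powr (- l)"])
 have [measurable]: "\<tau> \<in> borel_fun" by (rule near_idD[OF \<tau>])
 show "(\<lambda>w. bkern l z (\<tau> w)) \<in> borel_measurable vol" by measurable
 show "AE w in vol. norm (bkern l z (\<tau> w)) \<le> (hgt z / 2) powr (- l)"
  using AE_near_id[OF \<tau>] by eventually_elim (use norm_bkern_le[OF z] l in auto)
qed

lemma bker_op_lincomb:
 fixes \<tau> :: "complex^'n => complex^'n"
 assumes \<tau>: "near_id \<tau>" and u: "u \<in> lp" "v \<in> lp"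
 shows "bker_op \<tau> (\<lambda>w. c * u w + v w) = (\<lambda>z. c * bker_op \<tau> u z + bker_op \<tau> v z)"
proof
 fix z
 show "bker_op \<tau> (\<lambda>w. c * u w + v w) z = c * bker_op \<tau> u z + bker_op \<tau> v z"
 proof (cases "norm z < 1")
  case True
  have l: "0 \<le> real CARD('n) + 1 + \<alpha>" using \<alpha> by simp
  note i = integrable_bker[OF \<tau> u(1) True l] integrable_bker[OF \<tau> u(2) True l]
  show ?thesis using True i by (simp add: bker_op_def distrib_right mult.assoc)
 qed (simp add: bker_op_def)
qed

section \<open>Operator norms in terms of p-th powers\<close>

lemma Lp_norm_le_iff:
 assumes c: "0 \<le> c"
 shows "lpnorm f \<le> ereal c \<longleftrightarrow> f \<in> borel_fun \<and> Np f \<le> ennreal (c powr p)"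
proof (cases "f \<in> lp")
 case True
 note [measurable] = Lp_D(1)[OF True]
 define x where "x = (\<integral>z. norm (f z) powr p \<partial>vol)"
 have x: "0 \<le> x" unfolding x_def by (intro integral_nonneg_AE) auto
 have N: "Np f = ennreal x"
  unfolding Np_def x_def using True by (intro nn_integral_eq_integral) (auto simp: Lp_def)
 have "x powr (1 / p) \<le> c \<longleftrightarrow> x \<le> c powr p"
 proof
  assume "x powr (1 / p) \<le> c"
  then have "(x powr (1 / p)) powr p \<le> c powr p" using p by (intro powr_mono2) auto
  then show "x \<le> c powr p" using p x by (simp add: powr_powr)
 next
  assume "x \<le> c powr p"
  then have "x powr (1 / p) \<le> (c powr p) powr (1 / p)" using p x by (intro powr_mono2) auto
  then show "x powr (1 / p) \<le> c" using p c by (simp add: powr_powr)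
 qed
 then show ?thesis using True N x by (simp add: Lp_norm_def x_def[symmetric])
next
 case False
 then show ?thesis by (auto simp: Lp_norm_def Lp_iff_Np intro: le_less_trans)
qed

lemma Lp_norm_nonneg: "0 \<le> lpnorm f"
 by (simp add: Lp_norm_def)

text \<open>What is needed to pass from the unit ball to all functions in \<open>op_norm\<close>. It
  also covers operators that leave the Bergman space, such as a cutoff composed with an
  operator.\<close>

definition homogeneous_op :: "((complex^'n => complex) => (complex^'n => complex)) => bool" where
 "homogeneous_op T \<longleftrightarrow> (\<forall>f\<in>Ap. T f \<in> borel_fun \<and> (\<forall>c. T (\<lambda>z. c * f z) = (\<lambda>z. c * T f z)))"

lemma op_norm_le_iff:
 assumes c: "0 \<le> c" and T: "homogeneous_op T"
 shows "opnorm T \<le> ereal c \<longleftrightarrow> (\<forall>f\<in>Ap. Np (T f) \<le> ennreal (c powr p) * Np f)"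
proof
 assume A: "\<forall>f\<in>Ap. Np (T f) \<le> ennreal (c powr p) * Np f"
 show "opnorm T \<le> ereal c"
  unfolding op_norm_def
 proof (rule SUP_least)
  fix f assume "f \<in> {f \<in> Ap. lpnorm f \<le> 1}"
  then have f: "f \<in> Ap" "Np f \<le> 1"
   using Lp_norm_le_iff[of 1 f] by (auto simp: one_ereal_def)
  have "Np (T f) \<le> ennreal (c powr p) * Np f" by (rule A[rule_format, OF f(1)])
  also have "\<dots> \<le> ennreal (c powr p) * 1" using f(2) by (rule mult_left_mono) simp
  finally show "lpnorm (T f) \<le> ereal c"
   using T f(1) unfolding Lp_norm_le_iff[OF c] homogeneous_op_def by simp
 qed
next
 assume A: "opnorm T \<le> ereal c"
 show "\<forall>f\<in>Ap. Np (T f) \<le> ennreal (c powr p) * Np f"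
 proof
  fix f assume f: "f \<in> Ap"
  define x where "x = enn2real (Np f)"
  have x: "0 \<le> x" "Np f = ennreal x" using bergman_spaceD(5)[OF f] by (auto simp: x_def less_top)
  have Tm: "T f \<in> borel_fun" using T f by (auto simp: homogeneous_op_def)
  \<comment> \<open>The function may have norm 0, so it is normalized by a number \<open>y\<close>
    above \<open>Np f\<close>, and \<open>y\<close> tends to \<open>Np f\<close> at the end.\<close>
  have *: "Np (T f) \<le> ennreal (c powr p * y)" if y: "x < y" for y
  proof -
   define s where "s = y powr (1 / p)"
   have y0: "0 < y" using x y by simp
   have s: "0 < s" "s powr p = y" using y0 p by (auto simp: s_def powr_powr)
   define g where "g z = of_real (1 / s) * f z" for z
   have g: "g \<in> Ap" unfolding g_def by (rule bergman_space_cmult[OF f])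
   have "Np g = ennreal (x / y)"
    unfolding g_def using s x y0 bergman_spaceD(4)[OF f]
    by (subst Np_cmult) (simp_all add: norm_divide powr_divide flip: ennreal_mult'')
   also have "\<dots> \<le> 1" using y y0 x by (simp flip: ennreal_1)
   finally have "lpnorm g \<le> 1" using Lp_norm_le_iff[of 1 g] bergman_spaceD(4)[OF g] by (simp add: one_ereal_def)
   then have "lpnorm (T g) \<le> opnorm T" unfolding op_norm_def using g by (intro SUP_upper) auto
   also note A
   finally have "Np (T g) \<le> ennreal (c powr p)" unfolding Lp_norm_le_iff[OF c] by simp
   moreover have "f = (\<lambda>z. of_real s * g z)" using s by (auto simp: g_def)
   then have "T f = (\<lambda>z. of_real s * T g z)" using T g unfolding homogeneous_op_def by metis
   moreover have "T g \<in> borel_fun" using T g by (auto simp: homogeneous_op_def)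
   ultimately have "Np (T f) \<le> ennreal (s powr p) * ennreal (c powr p)"
    using s by (simp add: Np_cmult mult_left_mono)
   then show ?thesis using s y0 by (simp add: mult.commute flip: ennreal_mult'')
  qed
  have "Np (T f) \<le> ennreal (c powr p * x)"
  proof (rule tendsto_lowerbound)
   show "((\<lambda>y. ennreal (c powr p * y)) \<longlongrightarrow> ennreal (c powr p * x)) (at_right x)" by (intro tendsto_intros)
   show "\<forall>\<^sub>F y in at_right x. Np (T f) \<le> ennreal (c powr p * y)"
    using * by (auto simp: eventually_at_filter)
  qed simp
  then show "Np (T f) \<le> ennreal (c powr p) * Np f" using x by (simp add: ennreal_mult'')
 qed
qed

lemma op_norm_nonneg: "0 \<le> opnorm T"
proof -
 have "lpnorm (\<lambda>z. 0) \<le> 1" using Lp_norm_le_iff[of 1 "\<lambda>z. 0"] p by (simp add: Np_zero one_ereal_def)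
 then have "lpnorm (T (\<lambda>z. 0)) \<le> opnorm T"
  unfolding op_norm_def using bergman_space_zero by (intro SUP_upper) auto
 then show ?thesis using Lp_norm_nonneg order.trans by blast
qed

lemma bounded_opsD:
 assumes S: "S \<in> Bops" and f: "f \<in> Ap"
 shows "S f \<in> Ap"
  "g \<in> Ap ==> S (\<lambda>z. c * f z + g z) = (\<lambda>z. c * S f z + S g z)"
  "S (\<lambda>z. 0) = (\<lambda>z. 0)"
  "S (\<lambda>z. c * f z) = (\<lambda>z. c * S f z)"
  "g \<in> Ap ==> S (\<lambda>z. f z + g z) = (\<lambda>z. S f z + S g z)"
  "g \<in> Ap ==> S (\<lambda>z. g z - f z) = (\<lambda>z. S g z - S f z)"
proof -
 show 1: "S f \<in> Ap" using S f by (auto simp: bounded_ops_def)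
 show 2: "S (\<lambda>z. c * f z + g z) = (\<lambda>z. c * S f z + S g z)" if "g \<in> Ap" for g c
  using S f that unfolding bounded_ops_def by blast
 show 3: "S (\<lambda>z. 0) = (\<lambda>z. 0)"
 proof -
  note z = bergman_space_zero
  have lin: "\<forall>f\<in>Ap. \<forall>g\<in>Ap. \<forall>c. S (\<lambda>z. c * f z + g z) = (\<lambda>z. c * S f z + S g z)"
   using S by (simp add: bounded_ops_def)
  have "S (\<lambda>z. 1 * 0 + 0) = (\<lambda>z. 1 * S (\<lambda>z. 0) z + S (\<lambda>z. 0) z)"
   by (rule lin[rule_format, OF z z])
  then show ?thesis by (simp add: fun_eq_iff)
 qed
 show "S (\<lambda>z. c * f z) = (\<lambda>z. c * S f z)" using 2[OF bergman_space_zero, of c] 3 by simp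
 show "S (\<lambda>z. f z + g z) = (\<lambda>z. S f z + S g z)" if "g \<in> Ap" using 2[OF that, of 1] by simp
 show "S (\<lambda>z. g z - f z) = (\<lambda>z. S g z - S f z)" if "g \<in> Ap" using 2[OF that, of "-1"] by simp
qed

lemma bounded_ops_homogeneous:
 assumes S: "S \<in> Bops"
 shows "homogeneous_op S"
 unfolding homogeneous_op_def using bounded_opsD[OF S] bergman_spaceD(4) by blast

lemma bounded_ops_Np:
 assumes S: "S \<in> Bops"
 obtains K where "1 \<le> K" "\<And>f. f \<in> Ap ==> Np (S f) \<le> ennreal K * Np f"
proof -
 have fin: "opnorm S < \<infinity>" using S by (simp add: bounded_ops_def)
 obtain c where c: "0 \<le> c" "opnorm S = ereal c"
  using fin op_norm_nonneg[of S] by (cases "opnorm S") auto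
 have le: "\<forall>f\<in>Ap. Np (S f) \<le> ennreal (c powr p) * Np f"
  using op_norm_le_iff[OF c(1) bounded_ops_homogeneous[OF S]] c(2) by simp
 show ?thesis
 proof (rule that[of "max 1 (c powr p)"])
  fix f assume "f \<in> Ap"
  then have "Np (S f) \<le> ennreal (c powr p) * Np f" using le by blast
  also have "\<dots> \<le> ennreal (max 1 (c powr p)) * Np f" by (intro mult_right_mono ennreal_leI) auto
  finally show "Np (S f) \<le> ennreal (max 1 (c powr p)) * Np f" .
 qed simp
qed

lemma bounded_opsI:
 assumes "\<And>f. f \<in> Ap ==> T f \<in> Ap"
  and lin: "\<And>f g c. f \<in> Ap ==> g \<in> Ap ==> T (\<lambda>z. c * f z + g z) = (\<lambda>z. c * T f z + T g z)"
  and K: "0 \<le> K" "\<And>f. f \<in> Ap ==> Np (T f) \<le> ennreal K * Np f"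
 shows "T \<in> Bops"
proof -
 have z: "T (\<lambda>z. 0) = (\<lambda>z. 0)"
  using lin[OF bergman_space_zero bergman_space_zero, of 1] by (simp add: fun_eq_iff)
 have "homogeneous_op T"
  unfolding homogeneous_op_def using assms(1) bergman_spaceD(4) lin[OF _ bergman_space_zero] z by fastforce
 moreover have "(K powr (1 / p)) powr p = K" using p K by (simp add: powr_powr)
 ultimately have "opnorm T \<le> ereal (K powr (1 / p))" using op_norm_le_iff[of "K powr (1/p)" T] K by simp
 then have "opnorm T < \<infinity>" by (rule le_less_trans) simp
 then show ?thesis using assms(1) lin by (auto simp: bounded_ops_def)
qed

end

section \<open>The lattice measure as an image of the weighted measure\<close>

locale bergman_lattice = bergman p \<alpha> dim for p \<alpha> :: real and dim :: "'n::finite itself" +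
 fixes \<rho> :: real and D :: "nat => (complex^'n) set" and w :: "nat => complex^'n"
 assumes L: "admissible_lattice p \<alpha> \<rho> D w"
begin

abbreviation mu :: "(complex^'n) measure" where "mu \<equiv> lattice_measure \<alpha> D w"

definition latmap :: "complex^'n => complex^'n" where
 "latmap u = (if u \<in> ball 0 1 then w (THE m. u \<in> D m) else 0)"

lemma lattice_facts:
 shows "\<And>m. D m \<in> sets borel" "disjoint_family D" "(\<Union>m. D m) = ball 0 1" "\<And>m. norm (w m) < 1"
  "\<And>m y. y \<in> D m ==> xr y (w m) \<le> (cosh 1)\<^sup>2" "0 < \<rho>" "\<rho> \<le> 1"
  "\<And>m. w m \<in> D m" "\<And>m y. norm y < 1 ==> xr (w m) y \<le> (cosh (\<rho> / 4))\<^sup>2 ==> y \<in> D m"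
proof -
 note A = L[unfolded admissible_lattice_def]
 show 1: "D m \<in> sets borel" "norm (w m) < 1" for m using A by auto
 show "disjoint_family D" "(\<Union>m. D m) = ball 0 1" "0 < \<rho>" "\<rho> \<le> 1" using A by auto
 have r: "0 < \<rho>" "\<rho> \<le> 1" using A by auto
 show "xr y (w m) \<le> (cosh 1)\<^sup>2" if "y \<in> D m" for m y
 proof -
  have "y \<in> bergman_ball (w m) \<rho>" using that A by blast
  then have "xr (w m) y \<le> (cosh \<rho>)\<^sup>2" using bergman_ball_eq[OF 1(2), of \<rho> m] r by auto
  also have "\<dots> \<le> (cosh 1)\<^sup>2" using r by (intro power_mono) (auto simp: cosh_real_nonneg_le_iff)
  finally show ?thesis by (simp add: xr_commute)
 qed
 show 2: "y \<in> D m" if "norm y < 1" "xr (w m) y \<le> (cosh (\<rho> / 4))\<^sup>2" for m y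
 proof -
  have "y \<in> bergman_ball (w m) (\<rho> / 4)" using that r bergman_ball_eq[OF 1(2), of "\<rho> / 4" m] by auto
  then show ?thesis using A by blast
 qed
 show "w m \<in> D m" for m
 proof (rule 2[OF 1(2)])
  have h: "0 < hgt (w m)" using 1(2) by (rule hgt_pos)
  have "1 - herm (w m) (w m) = of_real (hgt (w m))" by (simp add: herm_self hgt_def)
  then have "dst (w m) (w m) = hgt (w m)" using h by (simp add: dst_def)
  then have "xr (w m) (w m) = 1" using h by (simp add: xr_def power2_eq_square)
  then show "xr (w m) (w m) \<le> (cosh (\<rho> / 4))\<^sup>2" using cosh_real_ge_1[of "\<rho> / 4"] by (simp add: one_le_power)
 qed
qed

lemma lattice_unique:
 assumes "u \<in> D m" "u \<in> D m'"
 shows "m' = m"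
 using lattice_facts(2) assms unfolding disjoint_family_on_def by blast

lemma lattice_UN_iff:
 assumes m: "u \<in> D m"
 shows "u \<in> (\<Union>k. if w k \<in> S then D k else {}) \<longleftrightarrow> w m \<in> S"
proof
 assume "u \<in> (\<Union>k. if w k \<in> S then D k else {})"
 then obtain k where k: "u \<in> (if w k \<in> S then D k else {})" by blast
 then have wk: "w k \<in> S" by (rule contrapos_pp) simp
 with k have "u \<in> D k" by simp
 then have "k = m" by (rule lattice_unique[OF m])
 then show "w m \<in> S" using wk by simp
next
 assume "w m \<in> S"
 then have "u \<in> (if w m \<in> S then D m else {})" using m by simp
 then show "u \<in> (\<Union>k. if w k \<in> S then D k else {})" by blast
qed

lemma lat_map_eq:
 assumes u: "u \<in> D m"
 shows "latmap u = w m"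
proof -
 have "u \<in> ball 0 1" using lattice_facts(3) u by blast
 moreover have "(THE m. u \<in> D m) = m"
  using u lattice_facts(2) by (intro the_equality) (auto simp: disjoint_family_on_def)
 ultimately show ?thesis by (simp add: latmap_def)
qed

lemma near_id_lat_map:
 shows "near_id (latmap)"
proof -
 note F = lattice_facts
 have meas: "latmap \<in> borel_fun"
 proof (rule borel_measurableI)
  fix S :: "(complex^'n) set" assume "open S"
  have "latmap -` S = (\<Union>m. if w m \<in> S then D m else {}) \<union> (if 0 \<in> S then - ball 0 1 else {})"
  proof (intro set_eqI)
   fix u
   show "u \<in> latmap -` S \<longleftrightarrow> u \<in> (\<Union>m. if w m \<in> S then D m else {}) \<union> (if 0 \<in> S then - ball 0 1 else {})"
   proof (cases "u \<in> ball 0 1")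
    case True
    then obtain m where m: "u \<in> D m" using F(3) by blast
    have "u \<in> (\<Union>m. if w m \<in> S then D m else {}) \<longleftrightarrow> w m \<in> S"
     by (rule lattice_UN_iff[OF m])
    then show ?thesis using lat_map_eq[OF m] True by auto
   next
    case False
    then have "u \<notin> D m" for m using F(3) by blast
    then show ?thesis using False by (auto simp: latmap_def split: if_splits)
   qed
  qed
  also have "\<dots> \<in> sets borel" using F(1) by auto
  finally show "latmap -` S \<inter> space borel \<in> sets borel" by simp
 qed
 moreover have "norm (latmap u) < 1 \<and> xr u (latmap u) \<le> (cosh 1)\<^sup>2" if u: "norm u < 1" for u
 proof -
  obtain m where m: "u \<in> D m" using F(3) u by (metis UN_E mem_ball_0)
  then show ?thesis using lat_map_eq[OF m] F by simp
 qed
 ultimately show ?thesis by (simp add: near_id_def)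
qed

text \<open>As an image of \<open>vol\<close> under a map near the identity, the discrete measure is
  accessible to \<open>kernel_bounds\<close>: its operator is the kernel operator of that map, with
  constants that do not depend on the lattice.\<close>

lemma lattice_measure_distr:
 shows "mu = distr vol borel (latmap)"
proof (rule measure_eqI)
 note F = lattice_facts
 have [measurable]: "latmap \<in> borel_fun" using near_idD[OF near_id_lat_map] by blast
 show "sets (mu) = sets (distr vol borel (latmap))" by (simp add: lattice_measure_def)
 fix A assume "A \<in> sets (mu)"
 then have A [measurable]: "A \<in> sets borel" by (simp add: lattice_measure_def)
 let ?E = "\<lambda>m. if w m \<in> A then D m else {}"
 have "emeasure (mu) A = (\<integral>\<^sup>+m. emeasure vol (D m) * indicator (w -` A) m \<partial>count_space UNIV)"
  unfolding lattice_measure_def by (subst emeasure_distr) (auto simp: emeasure_density)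
 also have "\<dots> = (\<Sum>m. emeasure vol (?E m))"
  by (subst nn_integral_count_space_nat) (auto intro!: suminf_cong)
 also have "\<dots> = emeasure vol (\<Union>m. ?E m)"
  using F(1,2) by (intro suminf_emeasure) (auto simp: disjoint_family_on_def)
 also have "\<dots> = emeasure vol (latmap -` A)"
 proof (rule emeasure_eq_AE)
  show "AE u in vol. (u \<in> (\<Union>m. ?E m)) = (u \<in> latmap -` A)"
   using AE_vol
  proof eventually_elim
   case (elim u)
   then obtain m where m: "u \<in> D m" using F(3) by (metis UN_E mem_ball_0)
   have "u \<in> (\<Union>m. ?E m) \<longleftrightarrow> w m \<in> A"
    by (rule lattice_UN_iff[OF m])
   then show ?case using lat_map_eq[OF m] by simp
  qed
  show "(\<Union>m. ?E m) \<in> sets vol" using F(1) by auto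
  have "latmap -` A \<inter> space borel \<in> sets borel" by measurable
  then show "latmap -` A \<in> sets vol" by simp
 qed
 also have "\<dots> = emeasure (distr vol borel (latmap)) A"
  by (subst emeasure_distr) auto
 finally show "emeasure (mu) A = emeasure (distr vol borel (latmap)) A" .
qed

lemma toeplitz_lattice_density:
 assumes [measurable]: "f \<in> borel_fun" "G \<in> sets borel"
 shows "toeplitz_measure \<alpha> (density (mu) (indicator G)) f =
  bker_op latmap (\<lambda>u. indicator G (latmap u) * f (latmap u))"
proof
 fix z
 have [measurable]: "latmap \<in> borel_fun" using near_idD[OF near_id_lat_map] by blast
 have e: "(indicator G :: _ => ennreal) = (\<lambda>x. ennreal (indicator G x))" by (auto simp: indicator_def)
 have "(\<integral>v. f v / (1 - herm z v) powr of_real (real CARD('n) + 1 + \<alpha>) \<partial>density (mu) (indicator G))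
  = (\<integral>v. indicator G v *\<^sub>R (f v / (1 - herm z v) powr of_real (real CARD('n) + 1 + \<alpha>)) \<partial>mu)"
  unfolding lattice_measure_distr e by (subst integral_density) auto
 also have "\<dots> = (\<integral>u. indicator G (latmap u) *\<^sub>R (f (latmap u) / (1 - herm z (latmap u)) powr of_real (real CARD('n) + 1 + \<alpha>)) \<partial>vol)"
  unfolding lattice_measure_distr by (subst integral_distr) auto
 also have "\<dots> = (\<integral>u. indicator G (latmap u) * f (latmap u) * bkern (real CARD('n) + 1 + \<alpha>) z (latmap u) \<partial>vol)"
  by (rule Bochner_Integration.integral_cong) (auto simp: bkern_def indicator_def)
 finally show "toeplitz_measure \<alpha> (density (mu) (indicator G)) f z =
  bker_op latmap (\<lambda>u. indicator G (latmap u) * f (latmap u)) z"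
  by (simp add: toeplitz_measure_def bker_op_def)
qed

lemma toeplitz_lattice:
 assumes f: "f \<in> borel_fun"
 shows "toeplitz_measure \<alpha> (mu) f = bker_op latmap (\<lambda>u. f (latmap u))"
proof -
 have "density (mu) (indicator UNIV) = mu"
  using density_1[of "mu"] by (simp add: indicator_def)
 then show ?thesis using toeplitz_lattice_density[OF f, of UNIV] by simp
qed

end

context bergman
begin

abbreviation bproj :: "(complex^'n => complex) => complex^'n => complex" where
 "bproj \<equiv> bker_op (\<lambda>w. w)"

abbreviation mul :: "(complex^'n => complex) => (complex^'n => complex) => complex^'n => complex" (infixr "\<cdot>" 70) where
 "f \<cdot> g \<equiv> \<lambda>z. f z * g z"

abbreviation weigh :: "(complex^'n => real) => (complex^'n => complex) => complex^'n => complex" (infixr "\<odot>" 70) where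
 "\<phi> \<odot> g \<equiv> \<lambda>z. of_real (\<phi> z) * g z"

section \<open>Maps that almost commute with slow families\<close>

definition outer :: "real => complex^'n => complex" where "outer t = indicator (- ball 0 t)"

definition inner_cut :: "real => complex^'n => complex" where "inner_cut t = indicator (ball 0 t)"

lemma outer_measurable [measurable]: "outer t \<in> borel_fun"
 unfolding outer_def by (intro borel_measurable_indicator) simp

lemma inner_cut_measurable [measurable]: "inner_cut t \<in> borel_fun"
 unfolding inner_cut_def by (intro borel_measurable_indicator) simp

lemma norm_outer_le: "norm (outer t z) \<le> 1" by (simp add: outer_def indicator_def)

lemma norm_inner_cut_le: "norm (inner_cut t z) \<le> 1" by (simp add: inner_cut_def indicator_def)

lemma cut_split: "inner_cut t z + outer t z = 1"
 by (auto simp: inner_cut_def outer_def indicator_def)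

lemma cut_split_fun: "f = (\<lambda>z. inner_cut t z * f z + outer t z * f z)"
 by (simp add: fun_eq_iff cut_split flip: distrib_right)

lemma outer_measure_small:
 assumes e: "0 < e"
 obtains t where "0 < t" "t < 1" "\<And>t'. t \<le> t' ==> measure vol (ball 0 1 - ball 0 t') \<le> e"
proof -
 interpret finite_measure vol by (rule finite_measure_bergman[OF \<alpha>])
 define A where "A k = (ball 0 1 - ball 0 (1 - 1 / real (k + 2)) :: (complex^'n) set)" for k
 have "(\<lambda>k. measure vol (A k)) \<longlonglongrightarrow> measure vol (\<Inter>k. A k)"
 proof (rule finite_Lim_measure_decseq)
  show "range A \<subseteq> sets vol" by (auto simp: A_def)
  show "decseq A" unfolding decseq_def A_def by (auto simp: frac_le intro: order.trans)
   (smt (verit) frac_le of_nat_0_le_iff of_nat_mono)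
 qed
 moreover have "(\<Inter>k. A k) = {}"
 proof (rule ccontr)
  assume "(\<Inter>k. A k) \<noteq> {}"
  then obtain z where z: "\<And>k. z \<in> A k" by auto
  then have "norm z < 1" by (auto simp: A_def)
  then obtain k where "inverse (real (Suc k)) < 1 - norm z" using reals_Archimedean[of "1 - norm z"] by auto
  moreover have "1 / real (k + 2) \<le> inverse (real (Suc k))" by (simp add: field_simps)
  moreover have "1 - 1 / real (k + 2) \<le> norm z" using z[of k] by (auto simp: A_def)
  ultimately show False by simp
 qed
 ultimately have "(\<lambda>k. measure vol (A k)) \<longlonglongrightarrow> 0" by simp
 then have "eventually (\<lambda>k. measure vol (A k) < e) sequentially" using e by (rule order_tendstoD)
 then obtain k where k: "measure vol (A k) < e" by (auto simp: eventually_sequentially)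
 show ?thesis
 proof (rule that[of "1 - 1 / real (k + 2)"])
  fix t' assume "1 - 1 / real (k + 2) \<le> t'"
  then have "measure vol (ball 0 1 - ball 0 t') \<le> measure vol (A k)"
   unfolding A_def by (intro finite_measure_mono) auto
  then show "measure vol (ball 0 1 - ball 0 t') \<le> e" using k by simp
 qed (auto simp: field_simps)
qed

lemma two_terms:
 fixes A B C N :: ennreal
 assumes "A \<le> ennreal K * (B + C)" "B \<le> ennreal b * N" "C \<le> ennreal c * N" "K * (b + c) \<le> e" "0 \<le> b" "0 \<le> c" "0 \<le> K"
 shows "A \<le> ennreal e * N"
proof -
 have "A \<le> ennreal K * (ennreal b * N + ennreal c * N)"
  using assms(1) by (rule order.trans) (intro mult_left_mono add_mono assms, simp)
 also have "\<dots> = ennreal (K * (b + c)) * N"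
  using assms by (simp add: ennreal_mult' ennreal_plus distrib_right mult.assoc)
 also have "\<dots> \<le> ennreal e * N" using assms by (intro mult_right_mono ennreal_leI) auto
 finally show ?thesis .
qed

lemma sum_Np_add_le:
 assumes "\<And>j. j \<in> J ==> f j \<in> borel_fun" "\<And>j. j \<in> J ==> g j \<in> borel_fun"
 shows "(\<Sum>j\<in>J. Np (\<lambda>z. f j z + g j z)) \<le> ennreal (2 powr p) * ((\<Sum>j\<in>J. Np (f j)) + (\<Sum>j\<in>J. Np (g j)))"
 unfolding sum.distrib[symmetric] sum_distrib_left using assms by (intro sum_mono Np_add_le) auto

lemma sum_weight_Np:
 assumes \<phi>: "weight_family \<phi>" and J: "finite J" and [measurable]: "g \<in> borel_fun"
 shows "(\<Sum>j\<in>J. Np (\<phi> j \<odot> g)) \<le> Np g"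
proof -
 have [measurable]: "\<phi> j \<in> borel_fun" for j by (rule weight_familyD[OF \<phi>])
 have "(\<Sum>j\<in>J. Np (\<phi> j \<odot> g)) = (\<integral>\<^sup>+z. (\<Sum>j\<in>J. ennreal (norm (of_real (\<phi> j z) * g z) powr p)) \<partial>vol)"
  unfolding Np_def by (intro nn_integral_sum[symmetric]) measurable
 also have "\<dots> \<le> Np g"
  unfolding Np_def
 proof (rule nn_integral_mono_AE)
  show "AE z in vol. (\<Sum>j\<in>J. ennreal (norm (of_real (\<phi> j z) * g z) powr p)) \<le> ennreal (norm (g z) powr p)"
   using AE_vol
  proof eventually_elim
   case (elim z)
   have "(\<Sum>j\<in>J. ennreal (norm (of_real (\<phi> j z) * g z) powr p)) = ennreal (\<Sum>j\<in>J. norm (of_real (\<phi> j z) * g z) powr p)"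
    by (intro sum_ennreal) simp
   also have "(\<Sum>j\<in>J. norm (of_real (\<phi> j z) * g z) powr p) = (\<Sum>j\<in>J. \<phi> j z powr p) * norm (g z) powr p"
    unfolding sum_distrib_right using weight_familyD(2)[OF \<phi>] by (intro sum.cong) (auto simp: norm_mult powr_mult)
   also have "\<dots> \<le> 1 * norm (g z) powr p"
    using weight_familyD(3)[OF \<phi> J elim] by (intro mult_right_mono) auto
   finally show ?case by (simp add: ennreal_leI)
  qed
 qed
 finally show ?thesis .
qed

lemma weight_mult_Lp:
 assumes \<phi>: "weight_family \<phi>" and f: "f \<in> lp"
 shows "(\<phi> j \<odot> f) \<in> lp"
proof (rule Lp_mult[OF f, where K=1])
 have [measurable]: "\<phi> j \<in> borel_fun" by (rule weight_familyD[OF \<phi>])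
 show "(\<lambda>z. complex_of_real (\<phi> j z)) \<in> borel_fun" by measurable
 show "norm (complex_of_real (\<phi> j z)) \<le> 1" if "norm z < 1" for z
  using weight_family_le_1[OF \<phi> that] weight_familyD(2)[OF \<phi>, of j z] by simp
qed

lemma cut_Lp:
 assumes f: "f \<in> lp"
 shows "(outer t \<cdot> f) \<in> lp" "(inner_cut t \<cdot> f) \<in> lp"
 by (rule Lp_mult[OF f, where K=1], use norm_outer_le norm_inner_cut_le in auto)+

lemma Np_cut_le:
 shows "Np (outer t \<cdot> f) \<le> Np f" "Np (inner_cut t \<cdot> f) \<le> Np f"
proof -
 show "Np (outer t \<cdot> f) \<le> Np f"
 proof (rule Np_mono)
  show "norm (outer t z * f z) \<le> norm (f z)" for z
   using mult_right_mono[OF norm_outer_le[of t z] norm_ge_zero[of "f z"]] by (simp add: norm_mult)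
 qed
 show "Np (inner_cut t \<cdot> f) \<le> Np f"
 proof (rule Np_mono)
  show "norm (inner_cut t z * f z) \<le> norm (f z)" for z
   using mult_right_mono[OF norm_inner_cut_le[of t z] norm_ge_zero[of "f z"]] by (simp add: norm_mult)
 qed
qed

lemma slow_family_mono:
 assumes "slow_family R \<eta> \<phi>" "R' \<le> R" "\<eta> \<le> \<eta>'"
 shows "slow_family R' \<eta>' \<phi>"
 using assms unfolding slow_family_def by (meson order_trans)

text \<open>Gentle families are almost constant on hyperbolic balls of radius growing as \<open>\<eta>\<close> shrinks.\<close>

definition gentle :: "real => (int \<times> nat => complex^'n => real) => bool" where
 "gentle \<eta> \<phi> \<longleftrightarrow> weight_family \<phi> \<and> slow_family (1 / \<eta>) \<eta> \<phi>"

definition commutes :: "real => (int \<times> nat => complex^'n => real) => ((complex^'n => complex) => complex^'n => complex) => bool" where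
 "commutes e \<phi> A \<longleftrightarrow> (\<forall>g\<in>lp. \<forall>J. finite J -->
  (\<Sum>j\<in>J. Np (\<lambda>z. of_real (\<phi> j z) * A g z - A (\<phi> j \<odot> g) z)) \<le> ennreal e * Np g)"

text \<open>The domain is the whole of L^p, as the product of a weight with a holomorphic function
  is not holomorphic. Operators on the Bergman space enter after composition with
  \<open>bproj\<close>.\<close>

definition bounded_map :: "((complex^'n => complex) => complex^'n => complex) => bool" where
 "bounded_map A \<longleftrightarrow> (\<forall>g\<in>lp. A g \<in> lp) \<and>
  (\<forall>g\<in>lp. \<forall>h\<in>lp. \<forall>c. A (\<lambda>z. c * g z + h z) = (\<lambda>z. c * A g z + A h z)) \<and>
  (\<exists>K\<ge>1. \<forall>g\<in>lp. Np (A g) \<le> ennreal K * Np g)"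

text \<open>The analogue of a band-dominated operator. The scale \<open>\<eta>\<close> depends on
  the map and the accuracy but not on the family, so families may be chosen afterwards.\<close>

definition tame :: "((complex^'n => complex) => complex^'n => complex) => bool" where
 "tame A \<longleftrightarrow> bounded_map A \<and> (\<forall>e>0. \<exists>\<eta>>0. \<forall>\<phi>. gentle \<eta> \<phi> --> commutes e \<phi> A)"

lemma commutesD:
 "commutes e \<phi> A ==> g \<in> lp ==> finite J ==>
  (\<Sum>j\<in>J. Np (\<lambda>z. of_real (\<phi> j z) * A g z - A (\<phi> j \<odot> g) z)) \<le> ennreal e * Np g"
 by (simp add: commutes_def)

lemma gentle_mono: "gentle \<eta> \<phi> ==> 0 < \<eta> ==> \<eta> \<le> \<eta>' ==> gentle \<eta>' \<phi>"
 using slow_family_mono[of "1 / \<eta>" \<eta> \<phi> "1 / \<eta>'" \<eta>'] frac_le[of 1 1 \<eta> \<eta>'] by (simp add: gentle_def)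

lemma tameD:
 assumes "tame A"
 shows "bounded_map A"
  "\<And>e. 0 < e ==> \<exists>\<eta>>0. \<forall>\<phi>. gentle \<eta> \<phi> --> commutes e \<phi> A"
 using assms by (auto simp: tame_def)

lemma tame_two:
 assumes A: "tame A" and B: "tame B" and e: "0 < e1" "0 < e2"
 shows "\<exists>\<eta>>0. \<forall>\<phi>. gentle \<eta> \<phi> --> commutes e1 \<phi> A \<and> commutes e2 \<phi> B"
proof -
 obtain \<eta>1 where 1: "0 < \<eta>1" "\<And>\<phi>. gentle \<eta>1 \<phi> ==> commutes e1 \<phi> A" using tameD(2)[OF A e(1)] by blast
 obtain \<eta>2 where 2: "0 < \<eta>2" "\<And>\<phi>. gentle \<eta>2 \<phi> ==> commutes e2 \<phi> B" using tameD(2)[OF B e(2)] by blast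
 show ?thesis
  using 1 2 gentle_mono[of "min \<eta>1 \<eta>2" _ \<eta>1] gentle_mono[of "min \<eta>1 \<eta>2" _ \<eta>2] by (intro exI[of _ "min \<eta>1 \<eta>2"]) auto
qed

lemma bounded_mapD:
 assumes "bounded_map A" and g: "g \<in> lp"
 shows "A g \<in> lp" "h \<in> lp ==> A (\<lambda>z. c * g z + h z) = (\<lambda>z. c * A g z + A h z)"
  "h \<in> lp ==> A (\<lambda>z. g z + h z) = (\<lambda>z. A g z + A h z)"
  "h \<in> lp ==> A (\<lambda>z. h z - g z) = (\<lambda>z. A h z - A g z)"
proof -
 show "A g \<in> lp" using assms by (auto simp: bounded_map_def)
 show 2: "A (\<lambda>z. c * g z + h z) = (\<lambda>z. c * A g z + A h z)" if "h \<in> lp" for c h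
  using assms that unfolding bounded_map_def by blast
 show "A (\<lambda>z. g z + h z) = (\<lambda>z. A g z + A h z)" if "h \<in> lp" using 2[OF that, of 1] by simp
 show "A (\<lambda>z. h z - g z) = (\<lambda>z. A h z - A g z)" if "h \<in> lp" using 2[OF that, of "-1"] by simp
qed

lemma bounded_map_bound:
 assumes "bounded_map A"
 obtains K where "1 \<le> K" "\<And>g. g \<in> lp ==> Np (A g) \<le> ennreal K * Np g"
 using assms unfolding bounded_map_def by blast

lemma ennreal_mult_le_trans:
 fixes N :: ennreal
 assumes "A \<le> ennreal a * B" "B \<le> ennreal b * N" "a * b \<le> c" "0 \<le> a" "0 \<le> b"
 shows "A \<le> ennreal c * N"
proof -
 have "A \<le> ennreal a * (ennreal b * N)" using assms(1) by (rule order.trans) (intro mult_left_mono assms, simp)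
 also have "\<dots> = ennreal (a * b) * N" using assms by (simp add: ennreal_mult mult.assoc)
 also have "\<dots> \<le> ennreal c * N" using assms by (intro mult_right_mono ennreal_leI) auto
 finally show ?thesis .
qed

lemma bounded_map_compose:
 assumes A: "bounded_map A" and B: "bounded_map B"
 shows "bounded_map (\<lambda>g. A (B g))"
proof -
 obtain K where K: "1 \<le> K" "\<And>g. g \<in> lp ==> Np (A g) \<le> ennreal K * Np g" using bounded_map_bound[OF A] by blast
 obtain L where L: "1 \<le> L" "\<And>g. g \<in> lp ==> Np (B g) \<le> ennreal L * Np g" using bounded_map_bound[OF B] by blast
 have "1 * 1 \<le> K * L" using K(1) L(1) by (intro mult_mono) auto
 moreover have "Np (A (B g)) \<le> ennreal (K * L) * Np g" if "g \<in> lp" for g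
  by (rule ennreal_mult_le_trans[OF K(2)[OF bounded_mapD(1)[OF B that]] L(2)[OF that]]) (use K(1) L(1) in auto)
 ultimately show ?thesis
  unfolding bounded_map_def using bounded_mapD[OF A] bounded_mapD[OF B] by (auto intro!: exI[of _ "K * L"])
qed

text \<open>The commutator of a weight with A B is [\<phi>, A] B + A [\<phi>, B]; the accuracies are
  divided by the bounds of the other factor.\<close>

lemma tame_compose:
 assumes A: "tame A" and B: "tame B"
 shows "tame (\<lambda>g. A (B g))"
 unfolding tame_def
proof (intro conjI allI impI)
 note bA = tameD(1)[OF A] and bB = tameD(1)[OF B]
 show "bounded_map (\<lambda>g. A (B g))" by (rule bounded_map_compose[OF bA bB])
 fix e :: real assume e: "0 < e"
 obtain K where K: "1 \<le> K" "\<And>g. g \<in> lp ==> Np (A g) \<le> ennreal K * Np g" using bounded_map_bound[OF bA] by blast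
 obtain L where L: "1 \<le> L" "\<And>g. g \<in> lp ==> Np (B g) \<le> ennreal L * Np g" using bounded_map_bound[OF bB] by blast
 define e1 where "e1 = e / (2 powr p * 2 * L)"
 define e2 where "e2 = e / (2 powr p * 2 * K)"
 have e12: "0 < e1" "0 < e2" using e K L by (auto simp: e1_def e2_def)
 obtain \<eta> where \<eta>: "0 < \<eta>" "\<And>\<phi>. gentle \<eta> \<phi> ==> commutes e1 \<phi> A \<and> commutes e2 \<phi> B" using tame_two[OF A B e12] by blast
 show "\<exists>\<eta>>0. \<forall>\<phi>. gentle \<eta> \<phi> --> commutes e \<phi> (\<lambda>g. A (B g))"
  unfolding commutes_def
 proof (intro exI[of _ \<eta>] conjI \<eta>(1) allI impI ballI)
  fix \<phi> g and J :: "(int \<times> nat) set"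
  assume gen: "gentle \<eta> \<phi>" and g: "g \<in> lp" and J: "finite J"
  have w: "weight_family \<phi>" using gen by (simp add: gentle_def)
  note Bg = bounded_mapD(1)[OF bB g]
  note wg = weight_mult_Lp[OF w g] and wBg = weight_mult_Lp[OF w Bg]
  note Bwg = bounded_mapD(1)[OF bB wg]
  note c = Lp_diff[OF wBg Bwg]
  have [measurable]: "\<phi> j \<in> borel_fun" for j by (rule weight_familyD[OF w])
  note [measurable] = Lp_D(1)[OF bounded_mapD(1)[OF bA Bg]] Lp_D(1)[OF bounded_mapD(1)[OF bA wBg]] Lp_D(1)[OF bounded_mapD(1)[OF bA c]]
  let ?C = "\<lambda>j z. of_real (\<phi> j z) * B g z - B (\<phi> j \<odot> g) z"
  have "(\<Sum>j\<in>J. Np (\<lambda>z. of_real (\<phi> j z) * A (B g) z - A (B (\<phi> j \<odot> g)) z)) =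
   (\<Sum>j\<in>J. Np (\<lambda>z. (of_real (\<phi> j z) * A (B g) z - A (\<phi> j \<odot> B g) z) + A (?C j) z))"
   by (intro sum.cong refl arg_cong[where f=Np] ext) (simp add: bounded_mapD(4)[OF bA Bwg wBg])
  also have "\<dots> \<le> ennreal (2 powr p) * ((\<Sum>j\<in>J. Np (\<lambda>z. of_real (\<phi> j z) * A (B g) z - A (\<phi> j \<odot> B g) z)) + (\<Sum>j\<in>J. Np (A (?C j))))"
   by (intro sum_Np_add_le) measurable
  finally show "(\<Sum>j\<in>J. Np (\<lambda>z. of_real (\<phi> j z) * A (B g) z - A (B (\<phi> j \<odot> g)) z)) \<le> ennreal e * Np g"
  proof (rule two_terms)
   show "(\<Sum>j\<in>J. Np (\<lambda>z. of_real (\<phi> j z) * A (B g) z - A (\<phi> j \<odot> B g) z)) \<le> ennreal (e1 * L) * Np g"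
    by (rule ennreal_mult_le_trans[OF commutesD[OF conjunct1[OF \<eta>(2)[OF gen]] Bg J] L(2)[OF g]]) (use L e12 in auto)
   have "(\<Sum>j\<in>J. Np (A (?C j))) \<le> ennreal K * (\<Sum>j\<in>J. Np (?C j))"
    unfolding sum_distrib_left by (intro sum_mono K(2) c)
   from ennreal_mult_le_trans[OF this commutesD[OF conjunct2[OF \<eta>(2)[OF gen]] g J]]
   show "(\<Sum>j\<in>J. Np (A (?C j))) \<le> ennreal (K * e2) * Np g" using K e12 by auto
   show "2 powr p * (e1 * L + K * e2) \<le> e" using K L by (simp add: e1_def e2_def field_simps)
  qed (use K L e12 in auto)
 qed
qed

lemma bounded_map_bproj:
 shows "bounded_map (bproj :: (complex^'n => complex) => _)"
proof -
 obtain C where C: "1 \<le> C" "\<And>(\<tau> :: complex^'n => complex^'n) u. near_id \<tau> ==> u \<in> lp ==> Np (bker_op \<tau> u) \<le> ennreal C * Np u"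
  using kernel_bounds by metis
 show ?thesis
  unfolding bounded_map_def
  using bker_op_bergman[OF near_id_id] bker_op_lincomb[OF near_id_id] C near_id_id bergman_spaceD(1) by blast
qed

lemma small_scale:
 fixes e C \<delta> :: real
 assumes C: "1 \<le> C" and \<delta>: "0 < \<delta>" and e: "0 < e"
 obtains \<eta> where "0 < \<eta>" "C * (\<eta> + (1 / \<eta>) powr (- \<delta>)) \<le> e"
proof (rule that)
 define x where "x = e / (2 * C)"
 have x: "0 < x" using C e by (simp add: x_def)
 let ?\<eta> = "min x (x powr (1 / \<delta>))"
 show pos: "0 < ?\<eta>" using x by simp
 have "(1 / ?\<eta>) powr (- \<delta>) = ?\<eta> powr \<delta>" using pos by (simp add: powr_minus_divide powr_divide)
 also have "\<dots> \<le> (x powr (1 / \<delta>)) powr \<delta>" using pos \<delta> by (intro powr_mono2) auto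
 also have "\<dots> = x" using x \<delta> by (simp add: powr_powr)
 finally have "C * (?\<eta> + (1 / ?\<eta>) powr (- \<delta>)) \<le> C * (x + x)" using C by (intro mult_left_mono add_mono) auto
 then show "C * (?\<eta> + (1 / ?\<eta>) powr (- \<delta>)) \<le> e" using C by (simp add: x_def)
qed

lemma tame_bproj: "tame bproj"
 unfolding tame_def
proof (intro conjI bounded_map_bproj allI impI)
 fix e :: real assume e: "0 < e"
 show "\<exists>\<eta>>0. \<forall>\<phi>. gentle \<eta> \<phi> --> commutes e \<phi> bproj"
 proof (rule kernel_bounds, goal_cases)
  case (1 C \<delta>)
  obtain \<eta> where \<eta>: "0 < \<eta>" "C * (\<eta> + (1 / \<eta>) powr (- \<delta>)) \<le> e" using small_scale[OF 1(1,2) e] by blast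
  show ?thesis
   unfolding commutes_def gentle_def
  proof (intro exI[of _ \<eta>] conjI \<eta>(1) allI impI ballI)
   fix \<phi> g and J :: "(int \<times> nat) set" assume "weight_family \<phi> \<and> slow_family (1 / \<eta>) \<eta> \<phi>" "g \<in> lp" "finite J"
   then have "(\<Sum>j\<in>J. Np (\<lambda>z. of_real (\<phi> j z) * bproj g z - bproj (\<phi> j \<odot> g) z)) \<le> ennreal (C * (\<eta> + (1 / \<eta>) powr (- \<delta>))) * Np g"
    using \<eta>(1) by (intro 1(5)[OF near_id_id]) auto
   also have "\<dots> \<le> ennreal e * Np g" by (intro mult_right_mono ennreal_leI \<eta>(2)) simp
   finally show "(\<Sum>j\<in>J. Np (\<lambda>z. of_real (\<phi> j z) * bproj g z - bproj (\<phi> j \<odot> g) z)) \<le> ennreal e * Np g" .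
  qed
 qed
qed

lemma tame_mult:
 assumes b: "b \<in> borel_fun" "1 \<le> K" "\<And>z. norm (b z) \<le> K"
 shows "tame (\<lambda>g. b \<cdot> g)"
 unfolding tame_def
proof (intro conjI allI impI)
 have "1 \<le> K powr p" using b(2) p by (simp add: ge_one_powr_ge_zero)
 moreover have "Np (b \<cdot> g) \<le> ennreal (K powr p) * Np g" if "g \<in> lp" for g
  using Lp_D(1)[OF that] b by (intro Np_mult_le) auto
 ultimately show "bounded_map (\<lambda>g. b \<cdot> g)"
  unfolding bounded_map_def using Lp_mult[OF _ b(1,3)]
  by (intro conjI ballI allI exI[of _ "K powr p"]) (auto simp: algebra_simps)
 fix e :: real
 have "commutes e \<phi> (\<lambda>g. b \<cdot> g)" for \<phi> by (simp add: commutes_def mult.left_commute Np_zero)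
 then show "\<exists>\<eta>>0. \<forall>\<phi>. gentle \<eta> \<phi> --> commutes e \<phi> (\<lambda>g. b \<cdot> g)" by (intro exI[of _ 1]) auto
qed

text \<open>A tame map almost commutes with a slowly decaying radial cutoff, which separates \<open>inner_cut s\<close> from \<open>outer t\<close>.\<close>

lemma radial_cutoff:
 assumes s: "s < 1" and \<eta>: "0 < \<eta>"
 obtains t and \<psi> :: "complex^'n => real" where "t < 1" "gentle \<eta> (\<lambda>j. if j = (0, 0) then \<psi> else (\<lambda>z. 0))"
  "\<And>z. norm z < s ==> \<psi> z = 1" "\<And>z. t \<le> norm z ==> \<psi> z = 0"
proof -
 define h0 where "h0 = 1 - (max s 0)\<^sup>2"
 have h0: "0 < h0" "h0 \<le> 1" using s by (auto simp: h0_def max_def abs_square_less_1)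
 define d where "d = \<eta> powr (1 / p)"
 have d: "0 < d" "d powr p = \<eta>" using \<eta> p by (auto simp: d_def powr_powr)
 define R where "R = 4 * (1 / \<eta>)"
 have R: "0 < R" using \<eta> by (simp add: R_def)
 \<comment> \<open>The cutoff is affine in the logarithm of the height with slope
   \<open>1 / \<Lambda>\<close>. Heights of points with \<open>xr\<close> at most
   \<open>1 / \<eta>\<close> differ by a factor of at most \<open>R\<close>, so the cutoff varies by
   at most \<open>d\<close>, whose p-th power is \<open>\<eta>\<close>.\<close>
 define \<Lambda> where "\<Lambda> = (\<bar>ln R\<bar> + 1) / d"
 have \<Lambda>: "0 < \<Lambda>" using d by (simp add: \<Lambda>_def add_nonneg_pos)
 define \<psi> where "\<psi> z = (if norm z < 1 then max 0 (min 1 (1 - (ln h0 - ln (hgt z)) / \<Lambda>)) else 0)" for z :: "complex^'n"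
 define t where "t = sqrt (1 - h0 * exp (- \<Lambda>))"
 have he: "0 < h0 * exp (- \<Lambda>)" "h0 * exp (- \<Lambda>) \<le> 1" using h0 \<Lambda> by (auto intro: mult_le_one)
 have cm [measurable]: "\<psi> \<in> borel_fun" unfolding \<psi>_def by measurable
 have c01: "0 \<le> \<psi> z" "\<psi> z \<le> 1" for z by (auto simp: \<psi>_def)
 have dif: "\<bar>\<psi> z - \<psi> w\<bar> \<le> d" if z: "norm z < 1" and w: "norm w < 1" and x: "xr z w \<le> 1 / \<eta>" for z w
 proof -
  have h: "0 < hgt z" "0 < hgt w" using z w hgt_pos by auto
  have "hgt w \<le> R * hgt z" "hgt z \<le> R * hgt w"
   using xr_hgt[OF z w x] xr_hgt[OF w z, of "1 / \<eta>"] x by (auto simp: R_def xr_commute[of w])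
  then have "ln (hgt w) \<le> ln (R * hgt z)" "ln (hgt z) \<le> ln (R * hgt w)" using h R by (auto intro!: ln_mono)
  then have "\<bar>ln (hgt z) - ln (hgt w)\<bar> \<le> \<bar>ln R\<bar> + 1" using h R by (simp add: ln_mult)
  then have "\<bar>ln (hgt z) - ln (hgt w)\<bar> / \<Lambda> \<le> (\<bar>ln R\<bar> + 1) / \<Lambda>" using \<Lambda> by (intro divide_right_mono) auto
  moreover have "(\<bar>ln R\<bar> + 1) / \<Lambda> = d" using \<Lambda> d by (simp add: \<Lambda>_def)
  moreover have "\<bar>\<psi> z - \<psi> w\<bar> \<le> \<bar>(ln h0 - ln (hgt z)) / \<Lambda> - (ln h0 - ln (hgt w)) / \<Lambda>\<bar>" using z w by (auto simp: \<psi>_def max_def min_def)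
  moreover have "\<bar>(ln h0 - ln (hgt z)) / \<Lambda> - (ln h0 - ln (hgt w)) / \<Lambda>\<bar> = \<bar>ln (hgt z) - ln (hgt w)\<bar> / \<Lambda>"
   using \<Lambda> by (simp add: abs_minus_commute flip: diff_divide_distrib)
  ultimately show ?thesis by simp
 qed
 show ?thesis
 proof (rule that)
  show "t < 1" using he by (simp add: t_def)
  show "\<psi> z = 1" if z: "norm z < s" for z
  proof -
   have "(norm z)\<^sup>2 \<le> (max s 0)\<^sup>2" using z by (intro power_mono) auto
   then have "ln h0 \<le> ln (hgt z)" using h0 by (intro ln_mono) (auto simp: h0_def hgt_def)
   then show ?thesis using z s \<Lambda> by (auto simp: \<psi>_def min_def max_def field_simps)
  qed
  show "\<psi> z = 0" if z: "t \<le> norm z" for z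
  proof (cases "norm z < 1")
   case True
   have "1 - h0 * exp (- \<Lambda>) \<le> (norm z)\<^sup>2" using z he by (simp add: t_def sqrt_le_D)
   then have "hgt z \<le> h0 * exp (- \<Lambda>)" by (simp add: hgt_def)
   then have "ln (hgt z) \<le> ln (h0 * exp (- \<Lambda>))" using hgt_pos[OF True] by (intro ln_mono) auto
   then have "\<Lambda> \<le> ln h0 - ln (hgt z)" using h0 by (simp add: ln_mult)
   then show ?thesis using \<Lambda> by (simp add: \<psi>_def)
  qed (simp add: \<psi>_def)
  let ?\<phi> = "\<lambda>j :: int \<times> nat. if j = (0, 0) then \<psi> else (\<lambda>z. 0)"
  have one: "(\<Sum>j\<in>J. (if j = (0, 0) then x else 0)) \<le> x" if "finite J" "0 \<le> x" for J and x :: real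
   using that by (simp add: sum.delta)
  have "(\<Sum>j\<in>J. ?\<phi> j z powr p) \<le> 1" if "finite J" for J z
  proof -
   have "(\<Sum>j\<in>J. ?\<phi> j z powr p) = (\<Sum>j\<in>J. if j = (0, 0) then \<psi> z powr p else 0)" using p by (intro sum.cong) auto
   also have "\<dots> \<le> \<psi> z powr p" by (rule one[OF that]) simp
   also have "\<dots> \<le> 1" using c01[of z] p powr_mono2[of p "\<psi> z" 1] by simp
   finally show ?thesis .
  qed
  moreover have "(\<Sum>j\<in>J. \<bar>?\<phi> j z - ?\<phi> j w\<bar> powr p) \<le> \<eta>" if J: "finite J" and z: "norm z < 1" "norm w < 1" "xr z w \<le> 1 / \<eta>" for J z w
  proof -
   have "(\<Sum>j\<in>J. \<bar>?\<phi> j z - ?\<phi> j w\<bar> powr p) = (\<Sum>j\<in>J. if j = (0, 0) then \<bar>\<psi> z - \<psi> w\<bar> powr p else 0)" using p by (intro sum.cong) auto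
   also have "\<dots> \<le> \<bar>\<psi> z - \<psi> w\<bar> powr p" by (rule one[OF J]) simp
   also have "\<dots> \<le> d powr p" using dif[OF z] p by (intro powr_mono2) auto
   finally show ?thesis by (simp add: d)
  qed
  ultimately show "gentle \<eta> ?\<phi>"
   using c01 unfolding gentle_def weight_family_def slow_family_def by auto
 qed
qed

text \<open>The cutoff, regarded as a family with one nonzero member, kills the outer part of
  \<open>g\<close> and is 1 on the inner ball. There the image of the outer part therefore coincides
  with a commutator.\<close>

lemma localizing:
 assumes A: "tame A" and s: "s < 1" and e: "0 < e"
 obtains t where "t < 1" "\<And>g. g \<in> lp ==> Np (inner_cut s \<cdot> A (outer t \<cdot> g)) \<le> ennreal e * Np g"
proof -
 note bA = tameD(1)[OF A]
 obtain \<eta> where \<eta>: "0 < \<eta>" "\<And>\<phi>. gentle \<eta> \<phi> ==> commutes e \<phi> A" using tameD(2)[OF A e] by blast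
 obtain t and \<psi> :: "complex^'n => real" where t: "t < 1" and gen: "gentle \<eta> (\<lambda>j. if j = (0, 0) then \<psi> else (\<lambda>z. 0))"
  and \<psi>: "\<And>z. norm z < s ==> \<psi> z = 1" "\<And>z. t \<le> norm z ==> \<psi> z = 0" using radial_cutoff[OF s \<eta>(1)] by blast
 show ?thesis
 proof (rule that[OF t])
  fix g assume g: "g \<in> lp"
  note go = cut_Lp(1)[OF g, of t]
  have z: "\<psi> \<odot> (outer t \<cdot> g) = (\<lambda>z. 0)" using \<psi>(2) by (force simp: fun_eq_iff outer_def indicator_def)
  have A0: "A (\<lambda>z. 0) = (\<lambda>z. 0)" using bounded_mapD(4)[OF bA g g] by simp
  have "Np (inner_cut s \<cdot> A (outer t \<cdot> g)) \<le> Np (\<lambda>z. of_real (\<psi> z) * A (outer t \<cdot> g) z - A (\<psi> \<odot> (outer t \<cdot> g)) z)"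
   unfolding z A0 using \<psi>(1) by (intro Np_mono) (auto simp: inner_cut_def indicator_def)
  also have "\<dots> \<le> ennreal e * Np (outer t \<cdot> g)"
   using commutesD[OF \<eta>(2)[OF gen] go, of "{(0, 0)}"] by simp
  also have "\<dots> \<le> ennreal e * Np g" by (intro mult_left_mono Np_cut_le) simp
  finally show "Np (inner_cut s \<cdot> A (outer t \<cdot> g)) \<le> ennreal e * Np g" .
 qed
qed

section \<open>From multiplication operators to the Toeplitz algebra\<close>

lemma Linf_representative:
 fixes a :: "complex^'n => complex"
 assumes a: "a \<in> Linf"
 obtains b K where "b \<in> borel_fun" "1 \<le> K" "\<And>z. norm (b z) \<le> K"
  "\<And>f. f \<in> borel_fun ==> toeplitz \<alpha> a f = bproj (\<lambda>w. b w * f w)"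
proof -
 have "borel_measurable (uniform_measure lborel (ball 0 1 :: (complex^'n) set)) = (borel_fun :: (complex^'n => complex) set)"
  by (rule measurable_cong_sets) (simp_all add: uniform_measure_def)
 then have am [measurable]: "a \<in> borel_fun" using a by (simp add: Linf_def)
 obtain K where K: "AE z in uniform_measure lborel (ball 0 1). norm (a z) \<le> K" using a by (auto simp: Linf_def)
 define K' where "K' = max 1 K"
 \<comment> \<open>An essentially bounded symbol is truncated to one that is bounded everywhere,
   since multiplication acts on functions and not on classes.\<close>
 define b where "b z = (if norm (a z) \<le> K' then a z else 0)" for z
 have bm [measurable]: "b \<in> borel_fun" unfolding b_def by measurable
 have "AE z in vol. norm (a z) \<le> K'"
  unfolding bergman_measure_def using K
  by (subst AE_density) (auto elim!: eventually_mono simp: K'_def)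
 then have ae: "AE z in vol. a z = b z" by eventually_elim (simp add: b_def)
 show ?thesis
 proof (rule that[OF bm])
  show "1 \<le> K'" by (simp add: K'_def)
  show "norm (b z) \<le> K'" for z by (auto simp: b_def K'_def max_def)
  fix f :: "complex^'n => complex" assume [measurable]: "f \<in> borel_fun"
  show "toeplitz \<alpha> a f = bproj (\<lambda>w. b w * f w)"
   unfolding toeplitz_def bergman_projection_eq mult_op_def
  proof
   fix z
   have "(\<integral>w. a w * f w * bkern (real CARD('n) + 1 + \<alpha>) z w \<partial>vol) =
     (\<integral>w. b w * f w * bkern (real CARD('n) + 1 + \<alpha>) z w \<partial>vol)"
    by (rule integral_cong_AE) (use ae in \<open>auto elim: eventually_mono\<close>)
   then show "bproj (\<lambda>z. a z * f z) z = bproj (\<lambda>w. b w * f w) z" by (simp add: bker_op_def)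
  qed
 qed
qed

lemma tame_cong:
 assumes A: "tame A" and eq: "\<And>g. g \<in> lp ==> B g = A g"
 shows "tame B"
 unfolding tame_def
proof (intro conjI allI impI)
 have "(\<lambda>z. c * g z + h z) \<in> lp" if "g \<in> lp" "h \<in> lp" for c g h
  by (rule Lp_add[OF Lp_cmult[OF that(1)] that(2)])
 then show "bounded_map B" using tameD(1)[OF A] unfolding bounded_map_def by (simp add: eq)
 fix e :: real assume "0 < e"
 then obtain \<eta> where \<eta>: "0 < \<eta>" "\<And>\<phi>. gentle \<eta> \<phi> ==> commutes e \<phi> A" using tameD(2)[OF A] by blast
 have "commutes e \<phi> B" if "gentle \<eta> \<phi>" for \<phi>
  using \<eta>(2)[OF that] that weight_mult_Lp unfolding gentle_def commutes_def by (simp add: eq)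
 then show "\<exists>\<eta>>0. \<forall>\<phi>. gentle \<eta> \<phi> --> commutes e \<phi> B" using \<eta>(1) by blast
qed

text \<open>The commutator with A is that with B, plus (B - A) applied to the weighted functions,
  minus the weighted function (B - A) g. The last two are summed over the family by
  \<open>sum_weight_Np\<close>, so the number of weights does not matter.\<close>

lemma tame_limit:
 assumes bA: "bounded_map A"
  and appr: "\<And>e. 0 < e ==> \<exists>B. tame B \<and> (\<forall>g\<in>lp. Np (\<lambda>z. B g z - A g z) \<le> ennreal e * Np g)"
 shows "tame A"
 unfolding tame_def
proof (intro conjI bA allI impI)
 fix e :: real assume e: "0 < e"
 define e1 where "e1 = e / (2 powr p * 2)"
 define e2 where "e2 = e / (2 powr p * 2 powr p * 4)"
 have e12: "0 < e1" "0 < e2" using e by (auto simp: e1_def e2_def)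
 obtain B where B: "tame B" and BA: "\<And>g. g \<in> lp ==> Np (\<lambda>z. B g z - A g z) \<le> ennreal e2 * Np g"
  using appr[OF e12(2)] by blast
 note bB = tameD(1)[OF B]
 obtain \<eta> where \<eta>: "0 < \<eta>" "\<And>\<phi>. gentle \<eta> \<phi> ==> commutes e1 \<phi> B" using tameD(2)[OF B e12(1)] by blast
 show "\<exists>\<eta>>0. \<forall>\<phi>. gentle \<eta> \<phi> --> commutes e \<phi> A"
  unfolding commutes_def
 proof (intro exI[of _ \<eta>] conjI \<eta>(1) allI impI ballI)
  fix \<phi> g and J :: "(int \<times> nat) set"
  assume gen: "gentle \<eta> \<phi>" and g: "g \<in> lp" and J: "finite J"
  have w: "weight_family \<phi>" using gen by (simp add: gentle_def)
  note wg = weight_mult_Lp[OF w g]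
  have [measurable]: "\<phi> j \<in> borel_fun" for j by (rule weight_familyD[OF w])
  note [measurable] = Lp_D(1)[OF g] Lp_D(1)[OF bounded_mapD(1)[OF bA g]] Lp_D(1)[OF bounded_mapD(1)[OF bB g]] Lp_D(1)[OF bounded_mapD(1)[OF bA wg]] Lp_D(1)[OF bounded_mapD(1)[OF bB wg]]
  let ?B = "\<lambda>j z. of_real (\<phi> j z) * B g z - B (\<phi> j \<odot> g) z"
  let ?D = "\<lambda>j z. B (\<phi> j \<odot> g) z - A (\<phi> j \<odot> g) z"
  let ?E = "\<lambda>j z. of_real (- \<phi> j z) * (B g z - A g z)"
  have "(\<Sum>j\<in>J. Np (\<lambda>z. of_real (\<phi> j z) * A g z - A (\<phi> j \<odot> g) z)) = (\<Sum>j\<in>J. Np (\<lambda>z. ?B j z + (?D j z + ?E j z)))"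
   by (intro sum.cong refl arg_cong[where f=Np] ext) (simp add: algebra_simps)
  also have "\<dots> \<le> ennreal (2 powr p) * ((\<Sum>j\<in>J. Np (?B j)) + (\<Sum>j\<in>J. Np (\<lambda>z. ?D j z + ?E j z)))"
   by (intro sum_Np_add_le) measurable
  finally show "(\<Sum>j\<in>J. Np (\<lambda>z. of_real (\<phi> j z) * A g z - A (\<phi> j \<odot> g) z)) \<le> ennreal e * Np g"
  proof (rule two_terms)
   show "(\<Sum>j\<in>J. Np (?B j)) \<le> ennreal e1 * Np g" by (rule commutesD[OF \<eta>(2)[OF gen] g J])
   have "(\<Sum>j\<in>J. Np (\<lambda>z. ?D j z + ?E j z)) \<le> ennreal (2 powr p) * ((\<Sum>j\<in>J. Np (?D j)) + (\<Sum>j\<in>J. Np (?E j)))"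
    by (intro sum_Np_add_le) measurable
   then show "(\<Sum>j\<in>J. Np (\<lambda>z. ?D j z + ?E j z)) \<le> ennreal (2 powr p * (e2 + e2)) * Np g"
   proof (rule two_terms)
    have "(\<Sum>j\<in>J. Np (?D j)) \<le> ennreal e2 * (\<Sum>j\<in>J. Np (\<phi> j \<odot> g))"
     unfolding sum_distrib_left by (intro sum_mono BA wg)
    also have "\<dots> \<le> ennreal e2 * Np g" by (intro mult_left_mono sum_weight_Np[OF w J]) auto
    finally show "(\<Sum>j\<in>J. Np (?D j)) \<le> ennreal e2 * Np g" .
    have "(\<Sum>j\<in>J. Np (?E j)) = (\<Sum>j\<in>J. Np (\<phi> j \<odot> (\<lambda>z. B g z - A g z)))"
     by (intro sum.cong refl Np_cong) (simp add: norm_mult)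
    also have "\<dots> \<le> Np (\<lambda>z. B g z - A g z)" by (intro sum_weight_Np[OF w J]) measurable
    also have "\<dots> \<le> ennreal e2 * Np g" by (rule BA[OF g])
    finally show "(\<Sum>j\<in>J. Np (?E j)) \<le> ennreal e2 * Np g" .
   qed (use e12 in auto)
   show "2 powr p * (e1 + 2 powr p * (e2 + e2)) \<le> e" by (simp add: e1_def e2_def field_simps)
  qed (use e12 in auto)
 qed
qed

lemma tame_add:
 assumes A: "tame A" and B: "tame B"
 shows "tame (\<lambda>g z. A g z + B g z)"
 unfolding tame_def
proof (intro conjI allI impI)
 note bA = tameD(1)[OF A] and bB = tameD(1)[OF B]
 obtain K where K: "1 \<le> K" "\<And>g. g \<in> lp ==> Np (A g) \<le> ennreal K * Np g" using bounded_map_bound[OF bA] by blast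
 obtain L where L: "1 \<le> L" "\<And>g. g \<in> lp ==> Np (B g) \<le> ennreal L * Np g" using bounded_map_bound[OF bB] by blast
 have "1 * 1 \<le> 2 powr p * (K + L)" using K(1) L(1) p by (intro mult_mono) (auto intro: ge_one_powr_ge_zero)
 moreover have "Np (\<lambda>z. A g z + B g z) \<le> ennreal (2 powr p * (K + L)) * Np g" if g: "g \<in> lp" for g
  using Np_add_le[OF Lp_D(1)[OF bounded_mapD(1)[OF bA g]] Lp_D(1)[OF bounded_mapD(1)[OF bB g]]]
  by (rule two_terms[OF _ K(2)[OF g] L(2)[OF g]]) (use K L in auto)
 ultimately show "bounded_map (\<lambda>g z. A g z + B g z)"
  unfolding bounded_map_def using bounded_mapD(2)[OF bA] bounded_mapD(2)[OF bB] Lp_add[OF bounded_mapD(1)[OF bA] bounded_mapD(1)[OF bB]]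
  by (intro conjI ballI allI exI[of _ "2 powr p * (K + L)"]) (auto simp: algebra_simps)
 fix e :: real assume e: "0 < e"
 define e1 where "e1 = e / (2 powr p * 2)"
 have e1: "0 < e1" using e by (simp add: e1_def)
 obtain \<eta> where \<eta>: "0 < \<eta>" "\<And>\<phi>. gentle \<eta> \<phi> ==> commutes e1 \<phi> A \<and> commutes e1 \<phi> B" using tame_two[OF A B e1 e1] by blast
 show "\<exists>\<eta>>0. \<forall>\<phi>. gentle \<eta> \<phi> --> commutes e \<phi> (\<lambda>g z. A g z + B g z)"
  unfolding commutes_def
 proof (intro exI[of _ \<eta>] conjI \<eta>(1) allI impI ballI)
  fix \<phi> g and J :: "(int \<times> nat) set"
  assume gen: "gentle \<eta> \<phi>" and g: "g \<in> lp" and J: "finite J"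
  have w: "weight_family \<phi>" using gen by (simp add: gentle_def)
  note wg = weight_mult_Lp[OF w g]
  have [measurable]: "\<phi> j \<in> borel_fun" for j by (rule weight_familyD[OF w])
  note [measurable] = Lp_D(1)[OF bounded_mapD(1)[OF bA g]] Lp_D(1)[OF bounded_mapD(1)[OF bB g]] Lp_D(1)[OF bounded_mapD(1)[OF bA wg]] Lp_D(1)[OF bounded_mapD(1)[OF bB wg]]
  let ?A = "\<lambda>j z. of_real (\<phi> j z) * A g z - A (\<phi> j \<odot> g) z"
  let ?B = "\<lambda>j z. of_real (\<phi> j z) * B g z - B (\<phi> j \<odot> g) z"
  have "(\<Sum>j\<in>J. Np (\<lambda>z. of_real (\<phi> j z) * (A g z + B g z) - (A (\<phi> j \<odot> g) z + B (\<phi> j \<odot> g) z))) = (\<Sum>j\<in>J. Np (\<lambda>z. ?A j z + ?B j z))"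
   by (intro sum.cong refl arg_cong[where f=Np] ext) (simp add: algebra_simps)
  also have "\<dots> \<le> ennreal (2 powr p) * ((\<Sum>j\<in>J. Np (?A j)) + (\<Sum>j\<in>J. Np (?B j)))"
   by (intro sum_Np_add_le) measurable
  finally show "(\<Sum>j\<in>J. Np (\<lambda>z. of_real (\<phi> j z) * (A g z + B g z) - (A (\<phi> j \<odot> g) z + B (\<phi> j \<odot> g) z))) \<le> ennreal e * Np g"
   using \<eta>(2)[OF gen] e1 by (intro two_terms[OF _ commutesD[OF _ g J] commutesD[OF _ g J]]) (auto simp: e1_def)
 qed
qed

text \<open>The projection reproduces the Bergman space, so an operator there and its composition
  with \<open>bproj\<close> on L^p determine each other, up to the norm of the projection.\<close>

lemma bounded_ops_iff:
 shows "S \<in> Bops \<longleftrightarrow> (\<forall>f\<in>Ap. S f \<in> Ap) \<and> bounded_map (\<lambda>g. S (bproj g))"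
proof (intro iffI conjI ballI)
 note bP = bounded_map_bproj
 have PA: "bproj g \<in> Ap" if "g \<in> lp" for g
  by (rule bker_op_bergman[OF near_id_id that])
 { assume S: "S \<in> Bops"
  note D = bounded_opsD[OF S]
  show "S f \<in> Ap" if "f \<in> Ap" for f by (rule D(1)[OF that])
  obtain K where K: "1 \<le> K" "\<And>f. f \<in> Ap ==> Np (S f) \<le> ennreal K * Np f" using bounded_ops_Np[OF S] by blast
  obtain L where L: "1 \<le> L" "\<And>g. g \<in> lp ==> Np (bproj g) \<le> ennreal L * Np g" using bounded_map_bound[OF bP] by blast
  have KL: "1 * 1 \<le> K * L" using K(1) L(1) by (intro mult_mono) auto
  have "Np (S (bproj g)) \<le> ennreal (K * L) * Np g" if g: "g \<in> lp" for g
   by (rule ennreal_mult_le_trans[OF K(2)[OF PA[OF g]] L(2)[OF g]]) (use K(1) L(1) in auto)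
  then show "bounded_map (\<lambda>g. S (bproj g))"
   unfolding bounded_map_def using KL bergman_spaceD(1)[OF D(1)[OF PA]] bounded_mapD(2)[OF bP] D(2)[OF PA PA]
   by (intro conjI ballI allI exI[of _ "K * L"]) auto }
 { assume A: "(\<forall>f\<in>Ap. S f \<in> Ap) \<and> bounded_map (\<lambda>g. S (bproj g))"
  then have bS: "bounded_map (\<lambda>g. S (bproj g))" by blast
  obtain K where K: "1 \<le> K" "\<And>g. g \<in> lp ==> Np (S (bproj g)) \<le> ennreal K * Np g" using bounded_map_bound[OF bS] by blast
  note R = bergman_projection_reproduces
  show "S \<in> Bops"
  proof (rule bounded_opsI[where K=K])
   fix f g and c assume f: "f \<in> Ap" and g: "g \<in> Ap"
   have "S (bproj (\<lambda>z. c * f z + g z)) = (\<lambda>z. c * S (bproj f) z + S (bproj g) z)"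
    by (rule bounded_mapD(2)[OF bS bergman_spaceD(1)[OF f] bergman_spaceD(1)[OF g]])
   then show "S (\<lambda>z. c * f z + g z) = (\<lambda>z. c * S f z + S g z)" unfolding R[OF f] R[OF g] R[OF bergman_space_lincomb[OF f g]] .
  next
   fix f assume f: "f \<in> Ap"
   show "Np (S f) \<le> ennreal K * Np f" using K(2)[OF bergman_spaceD(1)[OF f]] unfolding R[OF f] .
  qed (use A K in auto) }
qed

text \<open>Boundedness is carried through the induction because among the rules generating the
  algebra only the one for limits assumes it.\<close>

theorem toeplitz_algebra_tame:
 assumes S: "S \<in> toeplitz_algebra p \<alpha>"
 shows "S \<in> Bops \<and> tame (\<lambda>g. S (bproj g))"
 using S
proof induction
 note tP = tame_bproj
 have PA: "bproj g \<in> Ap" if "g \<in> lp" for g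
  by (rule bker_op_bergman[OF near_id_id that])
 note iff = bounded_ops_iff
 have bm: "bounded_map A" if "tame A" for A
  using that by (simp add: tame_def)
 {
  case (generator a)
  obtain b K where b: "b \<in> borel_fun" "1 \<le> K" "\<And>z. norm (b z) \<le> K"
   and eq: "\<And>f. f \<in> borel_fun ==> toeplitz \<alpha> a f = bproj (\<lambda>w. b w * f w)"
   using Linf_representative[OF generator] by blast
  have "tame (\<lambda>g. bproj (\<lambda>z. b z * bproj g z))"
   by (rule tame_compose[OF tP tame_compose[OF tame_mult[OF b] tP]])
  then have t: "tame (\<lambda>g. toeplitz \<alpha> a (bproj g))"
   by (rule tame_cong) (rule eq[OF bergman_spaceD(4)[OF PA]])
  have "toeplitz \<alpha> a f \<in> Ap" if "f \<in> Ap" for f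
   unfolding eq[OF bergman_spaceD(4)[OF that]] by (rule PA[OF Lp_mult[OF bergman_spaceD(1)[OF that] b(1,3)]])
  then show ?case using t bm[OF t] unfolding iff by blast
 next
  case (add S T)
  have t: "tame (\<lambda>g z. S (bproj g) z + T (bproj g) z)" using add by (intro tame_add) auto
  then show ?case using bm[OF t] add bergman_space_add unfolding iff by blast
 next
  case (scale S c)
  have "tame (\<lambda>g z. (\<lambda>z. c) z * S (bproj g) z)"
   by (rule tame_compose[OF tame_mult[where K="max 1 (norm c)"]]) (use scale in auto)
  then have t: "tame (\<lambda>g z. c * S (bproj g) z)" .
  then show ?case using bm[OF t] scale bergman_space_cmult unfolding iff by blast
 next
  case (compose S T)
  \<comment> \<open>Inserting a projection between the factors changes nothing, as \<open>T\<close>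
    maps into the Bergman space, where the projection is the identity.\<close>
  have "tame (\<lambda>g. S (bproj (T (bproj g))))"
   by (rule tame_compose[of "\<lambda>g. S (bproj g)" "\<lambda>g. T (bproj g)"]) (use compose in auto)
  then have t: "tame (\<lambda>g. (S \<circ> T) (bproj g))"
  proof (rule tame_cong)
   fix g assume "g \<in> lp"
   then have "T (bproj g) \<in> Ap" using compose PA unfolding iff by blast
   then show "(S \<circ> T) (bproj g) = S (bproj (T (bproj g)))"
    by (simp add: bergman_projection_reproduces)
  qed
  then show ?case using bm[OF t] compose unfolding iff by auto
 next
  case (limit T S)
  have "tame (\<lambda>g. S (bproj g))"
  proof (rule tame_limit)
   show "bounded_map (\<lambda>g. S (bproj g))" using limit(2) unfolding iff by blast
   fix e :: real assume e: "0 < e"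
   obtain L where L: "1 \<le> L" "\<And>g. g \<in> lp ==> Np (bproj g) \<le> ennreal L * Np g"
    using bounded_map_bound[OF bm[OF tP]] by blast
   define c where "c = (e / L) powr (1 / p)"
   have c: "0 < c" "c powr p = e / L" using e L p by (auto simp: c_def powr_powr)
   have "eventually (\<lambda>m. opnorm (\<lambda>f z. T m f z - S f z) < ereal c) sequentially"
    using limit(3) c by (intro order_tendstoD) auto
   then obtain m where m: "opnorm (\<lambda>f z. T m f z - S f z) < ereal c" by (auto simp: eventually_sequentially)
   have Tm: "T m \<in> Bops" using limit by blast
   have h: "homogeneous_op (\<lambda>f z. T m f z - S f z)"
    unfolding homogeneous_op_def
   proof (intro ballI conjI allI)
    fix f assume f: "f \<in> Ap"
    note [measurable] = bergman_spaceD(4)[OF bounded_opsD(1)[OF Tm f]] bergman_spaceD(4)[OF bounded_opsD(1)[OF limit(2) f]]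
    show "(\<lambda>z. T m f z - S f z) \<in> borel_fun" by measurable
    show "(\<lambda>z. T m (\<lambda>z. c * f z) z - S (\<lambda>z. c * f z) z) = (\<lambda>z. c * (T m f z - S f z))" for c
     by (simp add: bounded_opsD(4)[OF Tm f] bounded_opsD(4)[OF limit(2) f] algebra_simps)
   qed
   have "Np (\<lambda>z. T m f z - S f z) \<le> ennreal (e / L) * Np f" if "f \<in> Ap" for f
    using op_norm_le_iff[OF _ h, of c] m c that by auto
   then have "Np (\<lambda>z. T m (bproj g) z - S (bproj g) z) \<le> ennreal e * Np g" if "g \<in> lp" for g
    by (rule ennreal_mult_le_trans[OF _ L(2)[OF that]]) (use that PA L e in auto)
   then show "\<exists>B. tame B \<and> (\<forall>g\<in>lp. Np (\<lambda>z. B g z - S (bproj g) z) \<le> ennreal e * Np g)"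
    using limit by (intro exI[of _ "\<lambda>g. T m (bproj g)"]) auto
  qed
  then show ?case using limit(2) by blast
 }
qed

section \<open>The four quantities\<close>

text \<open>Every comparison starts from a finite number \<open>t\<close> above the right-hand side.
  Even if that side is 0, \<open>t\<close> is positive and can serve as the accuracy in choosing
  weights.\<close>

lemma ereal_le_scale:
 fixes x y :: ereal
 assumes le: "\<And>t. 0 < t ==> y < ereal t ==> x \<le> ereal (K * t)" and y: "0 \<le> y" and K: "0 < K"
 shows "x \<le> ereal K * y"
proof (cases y)
 case (real r)
 have r: "0 \<le> r" using y real by simp
 show ?thesis
 proof (rule ereal_le_epsilon2)
  fix e :: real assume e: "0 < e"
  have "x \<le> ereal (K * (r + e / K))" using le[of "r + e / K"] r e K real by (simp add: add_nonneg_pos)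
  also have "K * (r + e / K) = K * r + e" using K by (simp add: field_simps)
  finally show "x \<le> ereal K * y + ereal e" using real by simp
 qed
qed (use y K in auto)

text \<open>\<open>Lim\<close> determines a value only once convergence is known. Monotonicity
  provides it and identifies the limit with an infimum.\<close>

lemma Lim_at_left_antitone:
 fixes f :: "real => ereal"
 assumes anti: "\<And>x y. x \<le> y ==> y < a ==> f y \<le> f x"
 shows "Lim (at_left a) f = (INF x\<in>{..<a}. f x)"
proof (rule tendsto_Lim)
 show "(f \<longlongrightarrow> (INF x\<in>{..<a}. f x)) (at_left a)"
 proof (rule order_tendstoI)
  fix l assume l: "l < (INF x\<in>{..<a}. f x)"
  have "l < f x" if "x < a" for x using l INF_lower[of x "{..<a}" f] that by (auto intro: less_le_trans)
  then show "eventually (\<lambda>x. l < f x) (at_left a)"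
   by (intro eventually_mono[OF eventually_at_left_real[of "a - 1" a]]) auto
 next
  fix u assume "(INF x\<in>{..<a}. f x) < u"
  then obtain x where x: "x < a" "f x < u" by (auto simp: INF_less_iff)
  show "eventually (\<lambda>x. f x < u) (at_left a)"
   using eventually_at_left_real[OF x(1)] by eventually_elim (rule le_less_trans[OF anti x(2)], auto)
 qed
qed simp

lemma Lim_at_top_mono:
 fixes f :: "real => ereal"
 assumes mono: "\<And>x y. 0 < x ==> x \<le> y ==> f x \<le> f y"
 shows "Lim at_top f = (SUP x\<in>{0<..}. f x)"
proof (rule tendsto_Lim)
 show "(f \<longlongrightarrow> (SUP x\<in>{0<..}. f x)) at_top"
 proof (rule order_tendstoI)
  fix u assume u: "(SUP x\<in>{0<..}. f x) < u"
  have "f x < u" if "0 < x" for x using u SUP_upper[of x "{0<..}" f] that by (auto intro: le_less_trans)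
  then show "eventually (\<lambda>x. f x < u) at_top"
   by (intro eventually_mono[OF eventually_gt_at_top[of 0]])
 next
  fix l assume "l < (SUP x\<in>{0<..}. f x)"
  then obtain x where x: "0 < x" "l < f x" by (auto simp: less_SUP_iff)
  show "eventually (\<lambda>x. l < f x) at_top"
   using eventually_ge_at_top[of x] by eventually_elim (use mono x in \<open>auto intro: less_le_trans\<close>)
 qed
qed simp

lemma eventually_to_sphere:
 "eventually P (to_sphere :: (complex^'n) filter) \<longleftrightarrow> (\<exists>s<1. \<forall>z. s < norm z --> norm z < 1 --> P z)"
 unfolding to_sphere_def eventually_filtercomap eventually_at_left_field
proof
 assume "\<exists>Q. (\<exists>b<1. \<forall>y>b. y < 1 --> Q y) \<and> (\<forall>x. Q (norm x) --> P x)"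
 then show "\<exists>s<1. \<forall>z. s < norm z --> norm z < 1 --> P z" by blast
next
 assume "\<exists>s<1. \<forall>z. s < norm z --> norm z < 1 --> P z"
 then obtain s where "s < 1" "\<forall>z. s < norm z --> norm z < 1 --> P z" by blast
 then show "\<exists>Q. (\<exists>b<1. \<forall>y>b. y < 1 --> Q y) \<and> (\<forall>x. Q (norm x) --> P x)"
  by (intro exI[of _ "\<lambda>y. s < y \<and> y < 1"]) auto
qed

lemma to_sphere_nontrivial: "(to_sphere :: (complex^'n) filter) \<noteq> bot"
proof
 assume "(to_sphere :: (complex^'n) filter) = bot"
 then have "eventually (\<lambda>_. False) (to_sphere :: (complex^'n) filter)" by simp
 then obtain s where s: "s < 1" "\<And>z :: complex^'n. s < norm z ==> norm z < 1 ==> False"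
  unfolding eventually_to_sphere by blast
 define c where "c = (max s 0 + 1) / 2"
 have c: "0 \<le> c" "s < c" "c < 1" using s by (auto simp: c_def)
 obtain z :: "complex^'n" where "norm z = c" using vector_choose_size[OF c(1)] by blast
 then show False using s(2)[of z] c by simp
qed

lemma op_norm_cut_le:
 assumes S: "S \<in> Bops" and A: "A \<in> sets borel" and c: "0 \<le> c"
 shows "opnorm (mult_op (indicator A) \<circ> S) \<le> ereal c \<longleftrightarrow>
  (\<forall>f\<in>Ap. Np (\<lambda>z. indicator A z * S f z) \<le> ennreal (c powr p) * Np f)"
proof -
 have "homogeneous_op (mult_op (indicator A) \<circ> S)"
  unfolding homogeneous_op_def
 proof (intro ballI conjI allI)
  fix f and c assume f: "f \<in> Ap"
  note [measurable] = bergman_spaceD(4)[OF bounded_opsD(1)[OF S f]] A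
  show "(mult_op (indicator A) \<circ> S) f \<in> borel_fun" by (simp add: mult_op_def)
  show "(mult_op (indicator A) \<circ> S) (\<lambda>z. c * f z) = (\<lambda>z. c * (mult_op (indicator A) \<circ> S) f z)"
   by (simp add: mult_op_def bounded_opsD(4)[OF S f] mult_ac)
 qed
 from op_norm_le_iff[OF c this] show ?thesis by (simp add: mult_op_def)
qed

lemma op_norm_outer_le:
 assumes S: "S \<in> Bops" and c: "0 \<le> c"
 shows "opnorm (mult_op (indicator (ball 0 1 - ball 0 r)) \<circ> S) \<le> ereal c \<longleftrightarrow>
  (\<forall>f\<in>Ap. Np (outer r \<cdot> S f) \<le> ennreal (c powr p) * Np f)"
proof -
 have "Np (\<lambda>z. indicator (ball 0 1 - ball 0 r) z * S f z) = Np (outer r \<cdot> S f)" for f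
  by (rule Np_cong) (auto simp: outer_def indicator_def)
 then show ?thesis by (subst op_norm_cut_le[OF S _ c]) auto
qed

lemma c_quantity_eq:
 assumes S: "S \<in> Bops"
 shows "c_quantity p \<alpha> S = (INF r\<in>{..<1}. opnorm (mult_op (indicator (ball 0 1 - ball 0 r)) \<circ> S))"
 unfolding c_quantity_def
proof (rule Lim_at_left_antitone)
 fix x y :: real assume xy: "x \<le> y" "y < 1"
 let ?n = "\<lambda>x. opnorm (mult_op (indicator (ball 0 1 - ball 0 x)) \<circ> S)"
 show "?n y \<le> ?n x"
 proof (cases "?n x")
  case (real c)
  then have c: "0 \<le> c" using op_norm_nonneg[of "mult_op (indicator (ball 0 1 - ball 0 x)) \<circ> S"] by simp
  have "Np (outer y \<cdot> S f) \<le> ennreal (c powr p) * Np f" if f: "f \<in> Ap" for f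
  proof -
   have "Np (outer y \<cdot> S f) \<le> Np (outer x \<cdot> S f)"
    using xy by (intro Np_mono) (auto simp: outer_def indicator_def)
   also have "\<dots> \<le> ennreal (c powr p) * Np f"
    using op_norm_outer_le[OF S c, of x] real f by auto
   finally show ?thesis .
  qed
  then show ?thesis using op_norm_outer_le[OF S c, of y] real by simp
 next
  case MInf
  then show ?thesis using op_norm_nonneg[of "mult_op (indicator (ball 0 1 - ball 0 x)) \<circ> S"] by simp
 qed simp
qed

lemma c_quantity_nonneg:
 assumes "S \<in> Bops"
 shows "0 \<le> c_quantity p \<alpha> S"
 unfolding c_quantity_eq[OF assms] by (intro INF_greatest op_norm_nonneg)

lemma c_quantity_lessD:
 assumes S: "S \<in> Bops" and c: "c_quantity p \<alpha> S < ereal c" "0 < c"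
 obtains r where "r < 1" "\<And>r' f. r \<le> r' ==> f \<in> Ap ==> Np (outer r' \<cdot> S f) \<le> ennreal (c powr p) * Np f"
proof -
 obtain r where r: "r < 1" "opnorm (mult_op (indicator (ball 0 1 - ball 0 r)) \<circ> S) < ereal c"
  using c(1) unfolding c_quantity_eq[OF S] by (auto simp: INF_less_iff)
 show ?thesis
 proof (rule that[OF r(1)])
  fix r' and f assume r': "r \<le> r'" and f: "f \<in> Ap"
  have "Np (outer r' \<cdot> S f) \<le> Np (outer r \<cdot> S f)"
   using r' by (intro Np_mono) (auto simp: outer_def indicator_def)
  also have "\<dots> \<le> ennreal (c powr p) * Np f"
   using op_norm_outer_le[OF S, of c r] r(2) c f by auto
  finally show "Np (outer r' \<cdot> S f) \<le> ennreal (c powr p) * Np f" .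
 qed
qed

lemma c_quantity_leI:
 assumes S: "S \<in> Bops" and r: "r < 1" and c: "0 \<le> c"
  and le: "\<And>f. f \<in> Ap ==> Np (outer r \<cdot> S f) \<le> ennreal (c powr p) * Np f"
 shows "c_quantity p \<alpha> S \<le> ereal c"
 unfolding c_quantity_eq[OF S] using r op_norm_outer_le[OF S c, of r] le by (intro INF_lower2[of r]) auto

lemma bergman_ball_measurable:
 assumes "norm z < 1" "0 \<le> r"
 shows "bergman_ball z r \<in> sets borel"
proof -
 have "{w \<in> space borel. w \<in> ball 0 1 \<and> xr z w \<le> (cosh r)\<^sup>2} \<in> sets borel" by measurable
 then show ?thesis unfolding bergman_ball_eq[OF assms] by simp
qed

lemma b_quantity_lessD:
 fixes S :: "(complex^'n => complex) => (complex^'n => complex)"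
 assumes S: "S \<in> Bops" and c: "b_quantity p \<alpha> S < ereal c" "0 < c" and r: "0 < r"
 obtains s where "s < 1" "\<And>z f. s < norm z ==> norm z < 1 ==> f \<in> Ap ==>
  Np (\<lambda>w. indicator (bergman_ball z r) w * S f w) \<le> ennreal (c powr p) * Np f"
proof -
 have "Limsup to_sphere (\<lambda>z. opnorm (mult_op (indicator (bergman_ball z r)) \<circ> S)) \<le> b_quantity p \<alpha> S"
  unfolding b_quantity_def using r by (intro SUP_upper) auto
 then have "eventually (\<lambda>z. opnorm (mult_op (indicator (bergman_ball z r)) \<circ> S) < ereal c) to_sphere"
  using c(1) by (intro Limsup_lessD) auto
 then obtain s where s: "s < 1" "\<And>z. s < norm z ==> norm z < 1 ==> opnorm (mult_op (indicator (bergman_ball z r)) \<circ> S) < ereal c"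
  unfolding eventually_to_sphere by blast
 show ?thesis
 proof (rule that[OF s(1)])
  fix z :: "complex^'n" and f :: "complex^'n => complex" assume z: "s < norm z" "norm z < 1" and f: "f \<in> Ap"
  show "Np (\<lambda>w. indicator (bergman_ball z r) w * S f w) \<le> ennreal (c powr p) * Np f"
   using op_norm_cut_le[OF S bergman_ball_measurable[OF z(2), of r], of c] s(2)[OF z] c r f by auto
 qed
qed

lemma b_quantity_leI:
 fixes S :: "(complex^'n => complex) => (complex^'n => complex)"
 assumes S: "S \<in> Bops" and c: "0 \<le> c"
  and le: "\<And>r. 0 < r ==> \<exists>s<1. \<forall>z. s < norm z --> norm z < 1 --> (\<forall>f\<in>Ap.
   Np (\<lambda>w. indicator (bergman_ball z r) w * S f w) \<le> ennreal (c powr p) * Np f)"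
 shows "b_quantity p \<alpha> S \<le> ereal c"
 unfolding b_quantity_def
proof (intro SUP_least Limsup_bounded)
 fix r :: real assume "r \<in> {0<..}"
 then have r: "0 < r" by simp
 obtain s where s: "s < 1" "\<And>z f. s < norm z ==> norm z < 1 ==> f \<in> Ap ==>
   Np (\<lambda>w. indicator (bergman_ball z r) w * S f w) \<le> ennreal (c powr p) * Np f"
  using le[OF r] by blast
 show "eventually (\<lambda>z. opnorm (mult_op (indicator (bergman_ball z r)) \<circ> S) \<le> ereal c) to_sphere"
  unfolding eventually_to_sphere
  using s op_norm_cut_le[OF S bergman_ball_measurable c] r by (intro exI[of _ s]) auto
qed

lemma b_quantity_nonneg:
 shows "0 \<le> b_quantity p \<alpha> (S :: (complex^'n => complex) => (complex^'n => complex))"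
proof -
 have "0 \<le> Limsup to_sphere (\<lambda>z. opnorm (mult_op (indicator (bergman_ball z 1)) \<circ> S))"
  by (rule le_Limsup[OF to_sphere_nontrivial]) (simp add: op_norm_nonneg)
 also have "\<dots> \<le> b_quantity p \<alpha> S" unfolding b_quantity_def by (intro SUP_upper) auto
 finally show ?thesis .
qed

lemma ess_norm_nonneg:
 fixes S :: "(complex^'n => complex) => complex^'n => complex"
 shows "0 \<le> ess_norm p \<alpha> S"
 unfolding ess_norm_def by (intro INF_greatest op_norm_nonneg)

section \<open>Interpolation at finitely many points\<close>

lemma bergman_spaceI_bounded:
 assumes g: "holomorphic_several g (ball 0 1)" and bd: "\<And>z. norm z < 1 ==> norm (g z) \<le> B"
 shows "(\<lambda>z. if z \<in> ball 0 1 then g z else 0) \<in> Ap"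
proof (rule bergman_spaceI)
 let ?g = "\<lambda>z. if z \<in> ball 0 1 then g z else 0"
 show h: "holomorphic_several ?g (ball 0 1)" by (rule holomorphic_several_cong[OF g]) simp
 show "?g z = 0" if "1 \<le> norm z" for z using that by simp
 have m: "?g \<in> borel_fun" by (rule holomorphic_several_measurable[OF h]) auto
 show "?g \<in> lp"
 proof (rule Lp_I[OF m])
  have B: "0 \<le> B" by (rule order.trans[OF norm_ge_zero[of "g 0"] bd]) simp
  have "Np ?g \<le> (\<integral>\<^sup>+z. ennreal (B powr p) \<partial>vol)"
   unfolding Np_def using bd B p by (intro nn_integral_mono ennreal_leI powr_mono2) auto
  also have "\<dots> < \<infinity>" using emeasure_bergman_UNIV[OF \<alpha>, where 'n='n] by (simp add: ennreal_mult_less_top)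
  finally show "Np ?g < \<infinity>" .
 qed
qed

lemma holomorphic_several_prod:
 fixes g :: "'b => complex^'n => complex"
 assumes "finite F" "\<And>i. i \<in> F ==> holomorphic_several (g i) (ball 0 1)"
 shows "holomorphic_several (\<lambda>z. \<Prod>i\<in>F. g i z) (ball 0 1)"
 using assms by (induction F) (auto intro: holomorphic_several_const holomorphic_several_mult)

text \<open>Induction with a product over the old points \<open>y\<close> of the affine functions
  \<open>herm z (x - y) - herm y (x - y)\<close>. Such a factor vanishes at \<open>y\<close>, and at
  the new point \<open>x\<close> it is the squared distance of \<open>x\<close> and
  \<open>y\<close>.\<close>

lemma bergman_interpolation:
 fixes F :: "(complex^'n) set" and c
 assumes F: "finite F" "\<And>x. x \<in> F ==> norm x < 1"
 shows "\<exists>g\<in>Ap. \<forall>x\<in>F. g x = c x"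
 using F
proof (induction F)
 case empty
 show ?case using bergman_space_zero by auto
next
 case (insert x F)
 then obtain g where g: "g \<in> Ap" "\<And>y. y \<in> F ==> g y = c y" by auto
 define P where "P z = (\<Prod>y\<in>F. herm z (x - y) - herm y (x - y))" for z
 have hol: "holomorphic_several P (ball 0 1)"
  unfolding P_def
 proof (rule holomorphic_several_prod[OF insert(1)])
  fix y
  have "holomorphic_several (\<lambda>z. (\<lambda>\<zeta>. \<zeta> - herm y (x - y)) (herm z (x - y))) (ball 0 1)"
   by (rule holomorphic_several_compose_herm[of _ UNIV]) (auto intro!: holomorphic_intros)
  then show "holomorphic_several (\<lambda>z. herm z (x - y) - herm y (x - y)) (ball 0 1)" by simp
 qed
 have bd: "norm (P z) \<le> (\<Prod>y\<in>F. norm (x - y) + norm y * norm (x - y))" if "norm z < 1" for z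
  unfolding P_def prod_norm[symmetric]
 proof (rule prod_mono, intro conjI)
  fix y
  have "norm (herm z (x - y) - herm y (x - y)) \<le> norm (herm z (x - y)) + norm (herm y (x - y))" by (rule norm_triangle_ineq4)
  also have "\<dots> \<le> norm z * norm (x - y) + norm y * norm (x - y)" by (intro add_mono norm_herm_le)
  also have "\<dots> \<le> 1 * norm (x - y) + norm y * norm (x - y)" using that by (intro add_mono mult_right_mono) auto
  finally show "norm (herm z (x - y) - herm y (x - y)) \<le> norm (x - y) + norm y * norm (x - y)" by simp
 qed simp
 let ?P = "\<lambda>z. if z \<in> ball 0 1 then P z else 0"
 have PA: "?P \<in> Ap" by (rule bergman_spaceI_bounded[OF hol bd])
 have Px: "P x \<noteq> 0"
 proof -
  have "herm x (x - y) - herm y (x - y) \<noteq> 0" if "y \<in> F" for y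
   using that insert(2) by (auto simp: herm_self simp flip: herm_diff_left)
  then show ?thesis using insert(1) by (auto simp: P_def)
 qed
 have Py: "P y = 0" if "y \<in> F" for y unfolding P_def using insert(1) that by (intro prod_zero) auto
 define k where "k = (c x - g x) / P x"
 show ?case
 proof (intro bexI[of _ "\<lambda>z. k * ?P z + g z"] ballI)
  fix y assume "y \<in> insert x F"
  then show "k * ?P y + g y = c y" using Px Py g(2) insert.prems by (auto simp: k_def)
 qed (rule bergman_space_lincomb[OF PA g(1)])
qed

end

context bergman_lattice
begin

abbreviation rng :: "complex^'n => real => (complex^'n => complex) set" where
 "rng z r \<equiv> toeplitz_measure \<alpha> (density mu (indicator (bergman_ball z r))) ` Ap"

text \<open>A packing argument. Distinct lattice points are hyperbolically separated, because the
  ball of radius \<open>\<rho> / 4\<close> around one of them lies in its cell. After an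
  automorphism taking the centre to the origin their heights are bounded below, so they are
  separated in the Euclidean sense, and a finite net of the closed ball bounds their number
  uniformly in \<open>z\<close>.\<close>

lemma lattice_count:
 assumes r: "0 \<le> r"
 obtains N where "\<And>z. norm z < 1 ==> finite {m. w m \<in> bergman_ball z r} \<and> card {m. w m \<in> bergman_ball z r} \<le> N"
proof -
 note F = lattice_facts
 define M where "M = (cosh (\<rho> / 4))\<^sup>2"
 have "1 < cosh (\<rho> / 4)" using F(6) by (metis cosh_0 cosh_real_nonneg_less_iff divide_pos_pos order_refl less_imp_le zero_less_numeral)
 then have M: "1 < M" by (simp add: M_def one_less_power)
 define c where "c = (cosh r)\<^sup>2"
 have c: "1 \<le> c" unfolding c_def using cosh_real_ge_1[of r] by (simp add: one_le_power)
 define \<epsilon> where "\<epsilon> = sqrt (M - 1) / c"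
 have \<epsilon>: "0 < \<epsilon>" using M c by (simp add: \<epsilon>_def)
 obtain k where k: "finite k" "cball (0 :: complex^'n) 1 \<subseteq> (\<Union>x\<in>k. ball x (\<epsilon> / 2))"
  using compact_cball[of "0 :: complex^'n" 1] \<epsilon> unfolding compact_eq_totally_bounded by (metis half_gt_zero)
 show ?thesis
 proof (rule that[of "card k"])
  fix z :: "complex^'n" assume z: "norm z < 1"
  define A where "A = {m. w m \<in> bergman_ball z r}"
  have A: "xr z (w m) \<le> c" if "m \<in> A" for m
   using that bergman_ball_eq[OF z r] by (auto simp: A_def c_def)
  define v where "v m = ball_aut z (w m)" for m
  have v: "norm (v m) < 1" for m unfolding v_def by (rule norm_ball_aut_less[OF z F(4)])
  have hv: "1 / c \<le> hgt (v m)" if "m \<in> A" for m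
  proof -
   have "1 / hgt (v m) \<le> c" using A[OF that] xr_eq_hgt[OF z F(4), of m] by (simp add: v_def)
   then show ?thesis using hgt_pos[OF v[of m]] c by (simp add: field_simps)
  qed
  have sep: "\<epsilon> \<le> dist (v m) (v m')" if m: "m \<in> A" "m' \<in> A" "m \<noteq> m'" for m m'
  proof -
   have "M < xr (w m) (w m')"
   proof (rule ccontr)
    assume "\<not> M < xr (w m) (w m')"
    then have "w m' \<in> D m" using F(9)[OF F(4)] by (simp add: M_def)
    then show False using lattice_unique[OF _ F(8)] m(3) by blast
   qed
   then have "M - 1 \<le> xr (v m) (v m') - 1" unfolding v_def xr_ball_aut[OF z F(4) F(4)] by simp
   then have "(M - 1) * (1 / c * (1 / c)) \<le> (xr (v m) (v m') - 1) * (hgt (v m) * hgt (v m'))"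
    using M c hv[OF m(1)] hv[OF m(2)] hgt_pos[OF v[of m]] hgt_pos[OF v[of m']] by (intro mult_mono) auto
   also have "\<dots> \<le> (norm (v m - v m'))\<^sup>2" by (rule xr_sub_1[OF v v])
   finally have "\<epsilon>\<^sup>2 \<le> (norm (v m - v m'))\<^sup>2" using M by (simp add: \<epsilon>_def power_divide power2_eq_square)
   then show ?thesis unfolding dist_norm by (rule power2_le_imp_le) simp
  qed
  have "\<exists>x\<in>k. dist x (v m) < \<epsilon> / 2" for m
  proof -
   have "v m \<in> cball 0 1" using v[of m] by simp
   then have "v m \<in> (\<Union>x\<in>k. ball x (\<epsilon> / 2))" using k(2) by (rule subsetD[rotated])
   then show ?thesis by (elim UN_E) (auto simp: mem_ball)
  qed
  then obtain q where q: "\<And>m. q m \<in> k" "\<And>m. dist (q m) (v m) < \<epsilon> / 2" by metis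
  have "inj_on q A"
  proof (rule inj_onI, rule ccontr)
   fix m m' assume m: "m \<in> A" "m' \<in> A" "q m = q m'" "m \<noteq> m'"
   have "dist (v m) (v m') \<le> dist (q m) (v m) + dist (q m) (v m')" by (rule dist_triangle3)
   also have "\<dots> < \<epsilon>" using q(2)[of m] q(2)[of m'] m(3) by simp
   finally show False using sep[OF m(1,2,4)] by simp
  qed
  then show "finite {m. w m \<in> bergman_ball z r} \<and> card {m. w m \<in> bergman_ball z r} \<le> card k"
   unfolding A_def[symmetric] using k(1) q(1) by (meson card_inj_on_le finite_subset image_subsetI inj_on_finite)
 qed
qed

lemma bker_op_cong:
 assumes [measurable]: "\<tau> \<in> borel_fun" "u \<in> borel_fun" "v \<in> borel_fun"
  and eq: "\<And>y. norm y < 1 ==> u y = v y"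
 shows "bker_op \<tau> u = bker_op \<tau> v"
proof
 fix z
 have "(\<integral>y. u y * bkern (real CARD('n) + 1 + \<alpha>) z (\<tau> y) \<partial>vol) = (\<integral>y. v y * bkern (real CARD('n) + 1 + \<alpha>) z (\<tau> y) \<partial>vol)"
  by (rule integral_cong_AE) (use AE_vol eq in \<open>auto elim!: eventually_mono\<close>)
 then show "bker_op \<tau> u z = bker_op \<tau> v z" by (simp add: bker_op_def)
qed

lemma lat_map_point:
 assumes u: "norm u < 1"
 obtains m where "latmap u = w m" "u \<in> D m"
proof -
 obtain m where "u \<in> D m" using lattice_facts(3) u by (metis UN_E mem_ball_0)
 then show ?thesis using that lat_map_eq by blast
qed

text \<open>The product of \<open>\<psi>\<close> with \<open>f\<close> is not holomorphic, but the
  localized operator sees only its values at the finitely many lattice points in the ball.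
  Interpolation replaces it by a member of the Bergman space.\<close>

lemma toeplitz_range_weighted:
 assumes f: "f \<in> Ap"
  and [measurable]: "\<psi> \<in> borel_fun" and z: "norm z < 1" and r: "0 \<le> r"
  and supp: "\<And>v. norm v < 1 ==> \<psi> v \<noteq> 0 ==> v \<in> bergman_ball z r"
 shows "bker_op latmap (\<lambda>u. \<psi> (latmap u) * f (latmap u)) \<in> rng z r"
proof -
 note F = lattice_facts
 note [measurable] = near_idD(1)[OF near_id_lat_map] bergman_spaceD(4)[OF f] bergman_ball_measurable[OF z r]
 have fin: "finite (w ` {m. w m \<in> bergman_ball z r})" using lattice_count[OF r] z by (metis finite_imageI)
 obtain g where g: "g \<in> Ap" "\<And>x. x \<in> w ` {m. w m \<in> bergman_ball z r} ==> g x = \<psi> x * f x"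
  using bergman_interpolation[OF fin, of "\<lambda>x. \<psi> x * f x"] F(4) by blast
 note [measurable] = bergman_spaceD(4)[OF g(1)]
 have "bker_op latmap (\<lambda>u. indicator (bergman_ball z r) (latmap u) * g (latmap u)) =
   bker_op latmap (\<lambda>u. \<psi> (latmap u) * f (latmap u))"
 proof (rule bker_op_cong)
  fix y :: "complex^'n" assume y: "norm y < 1"
  obtain m where m: "latmap y = w m" using lat_map_point[OF y] by blast
  show "indicator (bergman_ball z r) (latmap y) * g (latmap y) = \<psi> (latmap y) * f (latmap y)"
   unfolding m using g(2) supp[OF F(4), of m] by (cases "w m \<in> bergman_ball z r") auto
 qed measurable
 then show ?thesis
  using toeplitz_lattice_density[OF bergman_spaceD(4)[OF g(1)] bergman_ball_measurable[OF z r]] g(1) by (metis imageI)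
qed

lemma toeplitz_rangeE:
 assumes z: "norm z < 1" and r: "0 \<le> r"
  and f: "f \<in> rng z r"
 obtains g where "g \<in> Ap" "f = bker_op latmap (\<lambda>u. indicator (bergman_ball z r) (latmap u) * g (latmap u))"
 using f toeplitz_lattice_density[OF bergman_spaceD(4) bergman_ball_measurable[OF z r]] by blast

lemma near_id_compose_Lp:
 assumes \<tau>: "near_id \<tau>" and f: "f \<in> Ap"
 shows "(\<lambda>z. f (\<tau> z)) \<in> lp"
proof (rule Lp_I)
 note [measurable] = near_idD(1)[OF \<tau>] bergman_spaceD(4)[OF f]
 show "(\<lambda>z. f (\<tau> z)) \<in> borel_fun" by measurable
 obtain C where "Np (\<lambda>z. f (\<tau> z)) \<le> ennreal C * Np f"
  using kernel_bounds \<tau> f by metis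
 also have "\<dots> < \<infinity>" using bergman_spaceD(5)[OF f] by (simp add: ennreal_mult_less_top)
 finally show "Np (\<lambda>z. f (\<tau> z)) < \<infinity>" .
qed

lemma toeplitz_range_bergman:
 assumes z: "norm z < 1" and r: "0 \<le> r"
  and f: "f \<in> rng z r"
 shows "f \<in> Ap" "(\<lambda>v. c * f v) \<in> rng z r"
proof -
 note nid = near_id_lat_map
 note [measurable] = near_idD(1)[OF nid] bergman_ball_measurable[OF z r]
 obtain g where g: "g \<in> Ap" and fg: "f = bker_op latmap (\<lambda>u. indicator (bergman_ball z r) (latmap u) * g (latmap u))"
  by (rule toeplitz_rangeE[OF z r f])
 have lp: "(\<lambda>u. indicator (bergman_ball z r) (latmap u) * g (latmap u)) \<in> lp"
  by (rule Lp_mult[OF near_id_compose_Lp[OF nid g], where K=1]) (auto simp: indicator_def)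
 show "f \<in> Ap" unfolding fg by (rule bker_op_bergman[OF nid lp])
 have "(\<lambda>v. c * f v) = bker_op latmap (\<lambda>u. indicator (bergman_ball z r) (latmap u) * (c * g (latmap u)))"
 proof
  fix v
  show "c * f v = bker_op latmap (\<lambda>u. indicator (bergman_ball z r) (latmap u) * (c * g (latmap u))) v"
   unfolding fg bker_op_def by (simp add: mult.left_commute[of _ c] mult.assoc)
 qed
 also have "\<dots> = toeplitz_measure \<alpha> (density mu (indicator (bergman_ball z r))) (\<lambda>v. c * g v)"
  using bergman_spaceD(4)[OF bergman_space_cmult[OF g]] by (subst toeplitz_lattice_density) auto
 finally show "(\<lambda>v. c * f v) \<in> rng z r"
  using bergman_space_cmult[OF g] by blast
qed

lemma bergman_ball_mono: "r \<le> r' ==> bergman_ball z r \<subseteq> bergman_ball z r'"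
 by (auto simp: bergman_ball_def)

lemma toeplitz_range_mono:
 assumes z: "norm z < 1" and r: "0 \<le> r" "r \<le> r'"
 shows "rng z r \<subseteq> rng z r'"
proof
 fix f assume "f \<in> rng z r"
 then obtain g where g: "g \<in> Ap" and fg: "f = bker_op latmap (\<lambda>u. indicator (bergman_ball z r) (latmap u) * g (latmap u))"
  by (rule toeplitz_rangeE[OF z r(1)])
 show "f \<in> rng z r'"
  unfolding fg
 proof (rule toeplitz_range_weighted[OF g _ z])
  show "indicator (bergman_ball z r) \<in> borel_fun" by (intro borel_measurable_indicator bergman_ball_measurable z r)
  show "v \<in> bergman_ball z r'" if "indicator (bergman_ball z r) v \<noteq> (0 :: complex)" for v
   using that bergman_ball_mono[OF r(2), of z] by (auto simp: indicator_def split: if_splits)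
 qed (use r in auto)
qed

section \<open>The quantity defined by localized ranges\<close>

lemma a_quantity_eq:
 shows "a_quantity p \<alpha> mu S = (SUP r\<in>{0<..}. a_radius p \<alpha> mu S r)"
 unfolding a_quantity_def
proof (rule Lim_at_top_mono)
 fix x y :: real assume xy: "0 < x" "x \<le> y"
 show "a_radius p \<alpha> mu S x \<le> a_radius p \<alpha> mu S y"
  unfolding a_radius_def
 proof (rule Limsup_mono)
  show "eventually (\<lambda>z. (SUP f\<in>{f \<in> rng z x. lpnorm f \<le> 1}. lpnorm (S f))
   \<le> (SUP f\<in>{f \<in> rng z y. lpnorm f \<le> 1}. lpnorm (S f))) to_sphere"
   unfolding eventually_to_sphere
  proof (intro exI[of _ 0] conjI allI impI SUP_subset_mono)
   fix z :: "complex^'n" assume "norm z < 1"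
   then show "{f \<in> rng z x. lpnorm f \<le> 1} \<subseteq> {f \<in> rng z y. lpnorm f \<le> 1}"
    using toeplitz_range_mono[OF _ less_imp_le[OF xy(1)] xy(2), of z] by auto
  qed auto
 qed
qed

lemma a_quantity_nonneg:
 shows "0 \<le> a_quantity p \<alpha> mu S"
proof -
 have "0 \<le> a_radius p \<alpha> mu S 1"
  unfolding a_radius_def
 proof (rule le_Limsup[OF to_sphere_nontrivial])
  have "0 \<le> (SUP f\<in>{f \<in> rng z 1. lpnorm f \<le> 1}. lpnorm (S f))" for z
  proof (rule order.trans[OF Lp_norm_nonneg[of "S (\<lambda>z. 0)"]], rule SUP_upper[where i="\<lambda>z. 0" and f="\<lambda>f. lpnorm (S f)"])
   have "toeplitz_measure \<alpha> (density mu (indicator (bergman_ball z 1))) (\<lambda>z. 0) = (\<lambda>z. 0)"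
    by (simp add: toeplitz_measure_def fun_eq_iff)
   then have "(\<lambda>z. 0) \<in> rng z 1" using bergman_space_zero by (metis imageI)
   moreover have "lpnorm (\<lambda>z :: complex^'n. 0) \<le> ereal 1" by (subst Lp_norm_le_iff) (auto simp: Np_zero)
   ultimately show "(\<lambda>z. 0) \<in> {f \<in> rng z 1. lpnorm f \<le> 1}" by (simp add: one_ereal_def)
  qed
  then show "eventually (\<lambda>z. 0 \<le> (SUP f\<in>{f \<in> rng z 1. lpnorm f \<le> 1}. lpnorm (S f))) to_sphere"
   by simp
 qed
 also have "\<dots> \<le> a_quantity p \<alpha> mu S" unfolding a_quantity_eq by (intro SUP_upper) auto
 finally show ?thesis .
qed

lemma a_quantity_leI:
 assumes S: "S \<in> Bops" and c: "0 \<le> c"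
  and le: "\<And>r. 0 < r ==> \<exists>s<1. \<forall>z. s < norm z --> norm z < 1 -->
   (\<forall>f\<in>rng z r. Np (S f) \<le> ennreal (c powr p) * Np f)"
 shows "a_quantity p \<alpha> mu S \<le> ereal c"
 unfolding a_quantity_eq a_radius_def
proof (intro SUP_least Limsup_bounded)
 fix r :: real assume "r \<in> {0<..}"
 then have r: "0 < r" by simp
 obtain s where s: "s < 1" "\<And>z f. s < norm z ==> norm z < 1 ==> f \<in> rng z r ==>
  Np (S f) \<le> ennreal (c powr p) * Np f"
  using le[OF r] by blast
 show "eventually (\<lambda>z. (SUP f\<in>{f \<in> rng z r. lpnorm f \<le> 1}. lpnorm (S f)) \<le> ereal c) to_sphere"
  unfolding eventually_to_sphere
 proof (intro exI[of _ s] conjI s(1) allI impI SUP_least)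
  fix z :: "complex^'n" and f assume z: "s < norm z" "norm z < 1" and "f \<in> {f \<in> rng z r. lpnorm f \<le> 1}"
  then have f: "f \<in> rng z r" "Np f \<le> 1"
   using Lp_norm_le_iff[of 1 f] by (auto simp: one_ereal_def)
  have fA: "f \<in> Ap" by (rule toeplitz_range_bergman(1)[OF z(2) _ f(1)]) (use r in simp)
  have "Np (S f) \<le> ennreal (c powr p) * Np f" by (rule s(2)[OF z f(1)])
  also have "\<dots> \<le> ennreal (c powr p) * 1" using f(2) by (rule mult_left_mono) simp
  finally show "lpnorm (S f) \<le> ereal c"
   using bergman_spaceD(4)[OF bounded_opsD(1)[OF S fA]] unfolding Lp_norm_le_iff[OF c] by simp
 qed
qed

lemma a_quantity_lessD:
 assumes S: "S \<in> Bops"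
  and c: "a_quantity p \<alpha> mu S < ereal c" "0 < c" and r: "0 < r"
 obtains s where "s < 1" "\<And>z f. s < norm z ==> norm z < 1 ==> f \<in> rng z r ==>
  Np (S f) \<le> ennreal (c powr p) * Np f"
proof -
 have "a_radius p \<alpha> mu S r \<le> a_quantity p \<alpha> mu S"
  unfolding a_quantity_eq using r by (intro SUP_upper) auto
 then have "eventually (\<lambda>z. (SUP f\<in>{f \<in> rng z r. lpnorm f \<le> 1}. lpnorm (S f)) < ereal c) to_sphere"
  using c(1) unfolding a_radius_def by (intro Limsup_lessD) auto
 then obtain s where s: "s < 1" and sup: "\<And>z. s < norm z ==> norm z < 1 ==>
   (SUP f\<in>{f \<in> rng z r. lpnorm f \<le> 1}. lpnorm (S f)) < ereal c"
  unfolding eventually_to_sphere by blast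
 show ?thesis
 proof (rule that[OF s])
  fix z f assume z: "s < norm z" "norm z < 1" and f: "f \<in> rng z r"
  have fA: "f \<in> Ap" by (rule toeplitz_range_bergman(1)[OF z(2) _ f]) (use r in simp)
  have SfA: "S f \<in> Ap" by (rule bounded_opsD(1)[OF S fA])
  define x where "x = enn2real (Np f)"
  have x: "0 \<le> x" "Np f = ennreal x" using bergman_spaceD(5)[OF fA] by (auto simp: x_def less_top)
  show "Np (S f) \<le> ennreal (c powr p) * Np f"
  proof (cases "x = 0")
   case True
   obtain K where "Np (S f) \<le> ennreal K * Np f" using bounded_ops_Np[OF S] fA by metis
   then show ?thesis using x(2) True by simp
  next
   case False
   define k where "k = x powr (- 1 / p)"
   have "k powr p = x powr (- 1)" using p by (simp add: k_def powr_powr)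
   then have k: "0 < k" "k powr p = 1 / x" using False x by (auto simp: k_def powr_minus_divide)
   let ?f = "\<lambda>v. of_real k * f v"
   note fm = bergman_spaceD(4)[OF fA] bergman_spaceD(4)[OF SfA]
   have "?f \<in> rng z r"
    by (rule toeplitz_range_bergman(2)[OF z(2) _ f]) (use r in simp)
   moreover have "Np ?f = 1"
    using fm k x False by (simp add: Np_cmult flip: ennreal_mult)
   then have "lpnorm ?f \<le> ereal 1"
    using fm by (subst Lp_norm_le_iff) auto
   ultimately have "lpnorm (S ?f) \<le> (SUP f\<in>{f \<in> rng z r. lpnorm f \<le> 1}. lpnorm (S f))"
    by (intro SUP_upper) (auto simp: one_ereal_def)
   also have "\<dots> \<le> ereal c" using sup[OF z] by simp
   finally have "Np (S ?f) \<le> ennreal (c powr p)"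
    using Lp_norm_le_iff[of c] c by auto
   then have le: "ennreal (1 / x) * Np (S f) \<le> ennreal (c powr p)"
    unfolding bounded_opsD(4)[OF S fA] using fm k by (simp add: Np_cmult)
   have "Np (S f) = ennreal x * (ennreal (1 / x) * Np (S f))"
    using x False by (simp add: mult.assoc[symmetric] flip: ennreal_mult)
   also have "\<dots> \<le> ennreal x * ennreal (c powr p)" by (rule mult_left_mono[OF le]) simp
   finally show ?thesis using x(2) by (simp add: mult.commute)
  qed
 qed
qed

end

context bergman
begin

section \<open>Comparison of the quantities\<close>

lemma hgt_small:
 assumes e: "0 < e"
 obtains s where "0 \<le> s" "s < 1" "\<And>z :: complex^'n. s < norm z ==> norm z < 1 ==> hgt z < e"
proof (rule that[of "max 0 (1 - e / 2)"])
 fix z :: "complex^'n" assume z: "max 0 (1 - e / 2) < norm z" "norm z < 1"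
 have "hgt z = (1 - norm z) * (1 + norm z)" by (simp add: hgt_def power2_eq_square algebra_simps)
 also have "\<dots> \<le> (1 - norm z) * 2" using z by (intro mult_left_mono) auto
 also have "\<dots> < e" using z by simp
 finally show "hgt z < e" .
qed (use e in auto)

text \<open>On a hyperbolic ball of radius \<open>r\<close> the height varies by a factor of at most
  \<open>4 * (cosh r)\<^sup>2\<close>. If the centre is close enough to the sphere, the ball is
  therefore contained in the region where the outer estimate holds.\<close>

lemma b_le_c:
 assumes S: "S \<in> Bops"
 shows "b_quantity p \<alpha> S \<le> ereal 1 * c_quantity p \<alpha> S"
proof (rule ereal_le_scale)
 fix t :: real assume t: "0 < t" "c_quantity p \<alpha> S < ereal t"
 obtain r1 where r1: "r1 < 1" "\<And>r' f. r1 \<le> r' ==> f \<in> Ap ==> Np (outer r' \<cdot> S f) \<le> ennreal (t powr p) * Np f"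
  using c_quantity_lessD[OF S t(2,1)] by blast
 define r2 where "r2 = max r1 0"
 have r2: "0 \<le> r2" "r2 < 1" "r1 \<le> r2" using r1 by (auto simp: r2_def)
 have r2': "0 < 1 - r2\<^sup>2" using r2 by (simp add: abs_square_less_1)
 show "b_quantity p \<alpha> S \<le> ereal (1 * t)"
 proof (rule b_quantity_leI[OF S])
  fix r :: real assume r: "0 < r"
  have c: "0 < 4 * (cosh r)\<^sup>2" by simp
  obtain s where s: "0 \<le> s" "s < 1" "\<And>z :: complex^'n. s < norm z ==> norm z < 1 ==> hgt z < (1 - r2\<^sup>2) / (4 * (cosh r)\<^sup>2)"
   using hgt_small[of "(1 - r2\<^sup>2) / (4 * (cosh r)\<^sup>2)"] r2' c by (metis divide_pos_pos)
  show "\<exists>s<1. \<forall>z. s < norm z --> norm z < 1 --> (\<forall>f\<in>Ap.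
   Np (\<lambda>w. indicator (bergman_ball z r) w * S f w) \<le> ennreal ((1 * t) powr p) * Np f)"
  proof (intro exI[of _ s] conjI s(2) allI impI ballI)
   fix z :: "complex^'n" and f assume z: "s < norm z" "norm z < 1" and f: "f \<in> Ap"
   have out: "outer r2 v = 1" if v: "v \<in> bergman_ball z r" for v :: "complex^'n"
   proof -
    have v': "norm v < 1" "xr z v \<le> (cosh r)\<^sup>2" using v bergman_ball_eq[OF z(2), of r] r by auto
    have "hgt v \<le> 4 * (cosh r)\<^sup>2 * hgt z" by (rule xr_hgt[OF z(2) v'])
    also have "\<dots> < 1 - r2\<^sup>2" using s(3)[OF z] c by (simp add: field_simps)
    finally have "r2\<^sup>2 \<le> (norm v)\<^sup>2" by (simp add: hgt_def)
    then have "r2 \<le> norm v" by (rule power2_le_imp_le) simp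
    then show ?thesis by (simp add: outer_def)
   qed
   have "Np (\<lambda>w. indicator (bergman_ball z r) w * S f w) \<le> Np (outer r2 \<cdot> S f)"
    by (rule Np_mono) (auto simp: indicator_def out)
   also have "\<dots> \<le> ennreal (t powr p) * Np f" by (rule r1(2)[OF r2(3) f])
   finally show "Np (\<lambda>w. indicator (bergman_ball z r) w * S f w) \<le> ennreal ((1 * t) powr p) * Np f" by simp
  qed
 qed (use t in simp)
qed (use c_quantity_nonneg[OF S] in auto)

text \<open>The factor 2 is the inverse of the lower bound 1/2. That bound holds for a finite set of
  indices depending on the point, so the index type is enumerated and monotone convergence is
  applied. Only weights that are nonzero somewhere outside radius \<open>r\<close> are
  summed.\<close>

lemma weight_exhaust:
 assumes \<phi>: "weight_family \<phi>" and [measurable]: "h \<in> borel_fun"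
  and low: "\<And>z. norm z < 1 ==> \<exists>J. finite J \<and> 1 / 2 \<le> (\<Sum>j\<in>J. \<phi> j z powr p)"
  and bound: "\<And>J. finite J ==> (\<And>j. j \<in> J ==> \<exists>z. r \<le> norm z \<and> norm z < 1 \<and> \<phi> j z \<noteq> 0) ==>
   (\<Sum>j\<in>J. Np (\<phi> j \<odot> h)) \<le> B"
 shows "Np (outer r \<cdot> h) \<le> 2 * B"
proof -
 have [measurable]: "\<phi> j \<in> borel_fun" for j by (rule weight_familyD[OF \<phi>])
 define J' where "J' = {j. \<exists>z. r \<le> norm z \<and> norm z < 1 \<and> \<phi> j z \<noteq> 0}"
 define Jk where "Jk k = {j \<in> J'. to_nat j \<le> k}" for k
 have fin: "finite (Jk k)" for k
  by (rule inj_on_finite[of to_nat _ "{..k}"]) (auto simp: Jk_def intro: inj_onI)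
 define F where "F k z = (\<Sum>j\<in>Jk k. ennreal (norm (of_real (\<phi> j z) * h z) powr p))" for k z
 have [measurable]: "F k \<in> borel_fun" for k unfolding F_def by measurable
 have inc: "incseq F"
  unfolding incseq_def le_fun_def F_def by (intro allI impI sum_mono2 fin) (auto simp: Jk_def)
 have "Np (outer r \<cdot> h) \<le> (\<integral>\<^sup>+z. 2 * (SUP k. F k z) \<partial>vol)"
  unfolding Np_def
 proof (rule nn_integral_mono_AE)
  show "AE z in vol. ennreal (norm (outer r z * h z) powr p) \<le> 2 * (SUP k. F k z)"
   using AE_vol
  proof eventually_elim
   case (elim z)
   show ?case
   proof (cases "norm z < r")
    case False
    obtain J where J: "finite J" "1 / 2 \<le> (\<Sum>j\<in>J. \<phi> j z powr p)" using low[OF elim] by blast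
    define k where "k = Max (to_nat ` (J \<union> {undefined}))"
    have k: "to_nat j \<le> k" if "j \<in> J" for j unfolding k_def using J(1) that by (intro Max_ge) auto
    have "(\<Sum>j\<in>J. \<phi> j z powr p) = (\<Sum>j\<in>J \<inter> J'. \<phi> j z powr p)"
     using J(1) False elim by (intro sum.mono_neutral_right) (auto simp: J'_def)
    also have "\<dots> \<le> (\<Sum>j\<in>Jk k. \<phi> j z powr p)"
     using fin k by (intro sum_mono2) (auto simp: Jk_def)
    finally have half: "1 / 2 \<le> (\<Sum>j\<in>Jk k. \<phi> j z powr p)" using J by simp
    have "norm (h z) powr p \<le> 2 * ((\<Sum>j\<in>Jk k. \<phi> j z powr p) * norm (h z) powr p)"
     using mult_right_mono[OF half, of "norm (h z) powr p"] by simp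
    also have "(\<Sum>j\<in>Jk k. \<phi> j z powr p) * norm (h z) powr p = (\<Sum>j\<in>Jk k. norm (of_real (\<phi> j z) * h z) powr p)"
     unfolding sum_distrib_right using weight_familyD(2)[OF \<phi>] by (intro sum.cong) (auto simp: norm_mult powr_mult)
    finally have "ennreal (norm (h z) powr p) \<le> ennreal (2 * (\<Sum>j\<in>Jk k. norm (of_real (\<phi> j z) * h z) powr p))"
     by (rule ennreal_leI)
    also have "\<dots> = 2 * F k z" unfolding F_def by (simp add: ennreal_mult sum_nonneg)
    also have "\<dots> \<le> 2 * (SUP k. F k z)" by (intro mult_left_mono SUP_upper) auto
    finally show ?thesis using False by (simp add: outer_def)
   qed (simp add: outer_def)
  qed
 qed
 also have "\<dots> = 2 * (\<integral>\<^sup>+z. (SUP k. F k z) \<partial>vol)" by (rule nn_integral_cmult) measurable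
 also have "(\<integral>\<^sup>+z. (SUP k. F k z) \<partial>vol) = (SUP k. \<integral>\<^sup>+z. F k z \<partial>vol)"
  by (rule nn_integral_monotone_convergence_SUP[OF inc]) simp
 also have "\<dots> \<le> B"
 proof (rule SUP_least)
  fix k
  have "(\<integral>\<^sup>+z. F k z \<partial>vol) = (\<Sum>j\<in>Jk k. Np (\<phi> j \<odot> h))"
   unfolding F_def Np_def by (rule nn_integral_sum) measurable
  also have "\<dots> \<le> B" by (rule bound[OF fin]) (auto simp: Jk_def J'_def)
  finally show "(\<integral>\<^sup>+z. F k z \<partial>vol) \<le> B" .
 qed
 finally show ?thesis by (simp add: mult_left_mono)
qed

lemma radius_exists: obtains r :: real where "0 < r" "R \<le> (cosh r)\<^sup>2"
proof (rule that[of "2 * max R 1"])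
 let ?r = "2 * max R 1"
 have "R \<le> (1 + ?r) / 2" by simp
 also have "\<dots> \<le> cosh ?r" using exp_ge_add_one_self[of ?r] by (simp add: cosh_field_def add_increasing2 del: exp_ge_add_one_self)
 also have "\<dots> \<le> (cosh ?r)\<^sup>2" using cosh_real_ge_1[of ?r] by (rule self_le_power) simp
 finally show "R \<le> (cosh ?r)\<^sup>2" .
qed simp

end

context bergman_lattice
begin

lemma gentle_family_exists:
 assumes \<eta>: "0 < \<eta>"
 obtains \<phi> and r where "gentle \<eta> \<phi>" "0 < r"
  "\<And>z. norm z < 1 ==> \<exists>J. finite J \<and> 1 / 2 \<le> (\<Sum>j\<in>J. \<phi> j z powr p)"
  "\<And>j z v. norm z < 1 ==> \<phi> j z \<noteq> 0 ==> norm v < 1 ==> \<phi> j v \<noteq> 0 ==> v \<in> bergman_ball z r"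
proof -
 note F = lattice_facts
 obtain \<phi> and R' where \<phi>: "weight_family \<phi>" "slow_family (1 / \<eta>) \<eta> \<phi>"
  "\<And>z. norm z < 1 ==> \<exists>J. finite J \<and> 1 / 2 \<le> (\<Sum>j\<in>J. \<phi> j z powr p)"
  "\<And>j z z'. norm z < 1 ==> norm z' < 1 ==> \<phi> j z \<noteq> 0 ==> \<phi> j z' \<noteq> 0 ==> xr z z' \<le> R'"
  by (rule slow_family_exists[OF _ \<eta> _ F(1,2,3,4,5), where R="1 / \<eta>"]) (use \<eta> in auto)
 obtain r where r: "0 < r" "R' \<le> (cosh r)\<^sup>2" using radius_exists by blast
 show ?thesis
 proof (rule that[OF _ r(1) \<phi>(3)])
  show "gentle \<eta> \<phi>" using \<phi> by (simp add: gentle_def)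
  fix j and z v :: "complex^'n" assume "norm z < 1" "\<phi> j z \<noteq> 0" "norm v < 1" "\<phi> j v \<noteq> 0"
  then show "v \<in> bergman_ball z r" using \<phi>(4)[of z v j] r bergman_ball_eq[of z r] by auto
 qed
qed

end

context bergman
begin

text \<open>The lattice supplies the cells from which the weights are built, and \<open>K\<close> is
  fixed before it. Each weighted image is replaced by the image of the weighted function, cut off to
  a hyperbolic ball containing the support of the weight, where \<open>b\<close> controls
  it.\<close>

lemma c_le_b:
 obtains K where "0 < K" "\<And>\<rho> (D :: nat => (complex^'n) set) w (S :: (complex^'n => complex) => (complex^'n => complex)). admissible_lattice p \<alpha> \<rho> D w ==> S \<in> toeplitz_algebra p \<alpha> ==>
  c_quantity p \<alpha> S \<le> ereal K * b_quantity p \<alpha> S"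
proof -
 obtain C where C: "1 \<le> C" "\<And>g. g \<in> lp ==> Np (bproj g) \<le> ennreal C * Np (g :: complex^'n => complex)"
  using bounded_map_bound[OF bounded_map_bproj] by blast
 \<comment> \<open>The factor 2 comes from \<open>weight_exhaust\<close>, \<open>2 powr p\<close>
   from splitting off the commutators, \<open>C\<close> from the projection of the weighted
   functions, and 1 from the commutators, whose accuracy is \<open>t powr p\<close>.\<close>
 define K where "K = (2 * (2 powr p * (C + 1))) powr (1 / p)"
 have K: "0 < K" "K powr p = 2 * (2 powr p * (C + 1))" using C p by (auto simp: K_def powr_powr)
 show ?thesis
 proof (rule that[OF K(1)])
  fix \<rho> and D :: "nat => (complex^'n) set" and w and S :: "(complex^'n => complex) => (complex^'n => complex)"
  assume L: "admissible_lattice p \<alpha> \<rho> D w" and "S \<in> toeplitz_algebra p \<alpha>"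
  then have S: "S \<in> Bops" and tame: "tame (\<lambda>g. S (bproj g))" using toeplitz_algebra_tame by auto
  interpret bergman_lattice p \<alpha> dim \<rho> D w by unfold_locales (rule L)
  show "c_quantity p \<alpha> S \<le> ereal K * b_quantity p \<alpha> S"
  proof (rule ereal_le_scale[OF _ b_quantity_nonneg K(1)])
   fix t :: real assume t: "0 < t" "b_quantity p \<alpha> S < ereal t"
   have e: "0 < t powr p" using t by simp
   obtain \<eta> where \<eta>: "0 < \<eta>" "\<And>\<phi>. gentle \<eta> \<phi> ==> commutes (t powr p) \<phi> (\<lambda>g. S (bproj g))" using tameD(2)[OF tame e] by blast
   obtain \<phi> :: "int \<times> nat => complex^'n => real" and r0 where gen: "gentle \<eta> \<phi>" and r0: "0 < r0"
    and low: "\<And>z. norm z < 1 ==> \<exists>J. finite J \<and> 1 / 2 \<le> (\<Sum>j\<in>J. \<phi> j z powr p)"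
    and supp: "\<And>j z v. norm z < 1 ==> \<phi> j z \<noteq> 0 ==> norm v < 1 ==> \<phi> j v \<noteq> 0 ==> v \<in> bergman_ball z r0"
    using gentle_family_exists[OF \<eta>(1)] by blast
   have \<phi>: "weight_family \<phi>" using gen by (simp add: gentle_def)
   have [measurable]: "\<phi> j \<in> borel_fun" for j by (rule weight_familyD[OF \<phi>])
   obtain s where s: "s < 1" "\<And>z f. s < norm z ==> norm z < 1 ==> f \<in> Ap ==>
    Np (\<lambda>w. indicator (bergman_ball z r0) w * S f w) \<le> ennreal (t powr p) * Np f"
    using b_quantity_lessD[OF S t(2,1) r0] by blast
   define r where "r = (s + 1) / 2"
   have r: "s < r" "r < 1" using s by (auto simp: r_def)
   show "c_quantity p \<alpha> S \<le> ereal (K * t)"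
   proof (rule c_quantity_leI[OF S r(2)])
    fix f :: "complex^'n => complex" assume f: "f \<in> Ap"
    note fL = bergman_spaceD(1)[OF f]
    note Pf = bergman_projection_reproduces[OF f]
    note [measurable] = bergman_spaceD(4)[OF bounded_opsD(1)[OF S f]]
    have wP: "bproj (\<phi> j \<odot> f) \<in> Ap" for j
     by (rule bker_op_bergman[OF near_id_id weight_mult_Lp[OF \<phi> fL]])
    note [measurable] = bergman_spaceD(4)[OF bounded_opsD(1)[OF S wP]]
    have "Np (outer r \<cdot> S f) \<le> 2 * (ennreal (2 powr p * (C + 1) * t powr p) * Np f)"
    proof (rule weight_exhaust[OF \<phi> _ low])
     fix J :: "(int \<times> nat) set" assume J: "finite J" and "\<And>j. j \<in> J ==> \<exists>z. r \<le> norm z \<and> norm z < 1 \<and> \<phi> j z \<noteq> 0"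
     then obtain \<zeta> where \<zeta>: "\<And>j. j \<in> J ==> r \<le> norm (\<zeta> j) \<and> norm (\<zeta> j) < 1 \<and> \<phi> j (\<zeta> j) \<noteq> 0" by metis
     note [measurable] = bergman_ball_measurable[OF _ less_imp_le[OF r0]]
     \<comment> \<open>Where \<open>\<phi> j\<close> is nonzero the indicator is 1 and the two terms
       add up to \<open>\<phi> j\<close> times \<open>S f\<close>; elsewhere the left-hand side is
       0.\<close>
     let ?A = "\<lambda>j z. indicator (bergman_ball (\<zeta> j) r0) z * S (bproj (\<phi> j \<odot> f)) z"
     let ?G = "\<lambda>j z. of_real (\<phi> j z) * S f z - S (bproj (\<phi> j \<odot> f)) z"
     have "(\<Sum>j\<in>J. Np (\<phi> j \<odot> S f)) \<le> (\<Sum>j\<in>J. Np (\<lambda>z. ?A j z + ?G j z))"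
     proof (intro sum_mono Np_mono)
      fix j and z :: "complex^'n" assume j: "j \<in> J" and z: "norm z < 1"
      show "norm (of_real (\<phi> j z) * S f z) \<le> norm (?A j z + ?G j z)"
      proof (cases "\<phi> j z = 0")
       case False
       then have "z \<in> bergman_ball (\<zeta> j) r0"
        using \<zeta>[OF j] z by (intro supp[of "\<zeta> j" j z]) auto
       then show ?thesis by simp
      qed simp
     qed
     also have "\<dots> \<le> ennreal (2 powr p) * ((\<Sum>j\<in>J. Np (?A j)) + (\<Sum>j\<in>J. Np (?G j)))"
     proof (rule sum_Np_add_le)
      fix j assume "j \<in> J"
      then have [measurable]: "bergman_ball (\<zeta> j) r0 \<in> sets borel" using \<zeta> r0 by (intro bergman_ball_measurable) auto
      show "?A j \<in> borel_fun" by measurable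
      show "?G j \<in> borel_fun" by measurable
     qed
     finally show "(\<Sum>j\<in>J. Np (\<phi> j \<odot> S f)) \<le> ennreal (2 powr p * (C + 1) * t powr p) * Np f"
     proof (rule two_terms)
      have "(\<Sum>j\<in>J. Np (?A j)) \<le> (\<Sum>j\<in>J. ennreal (t powr p * C) * Np (\<phi> j \<odot> f))"
      proof (rule sum_mono)
       fix j assume j: "j \<in> J"
       show "Np (?A j) \<le> ennreal (t powr p * C) * Np (\<phi> j \<odot> f)"
        using \<zeta>[OF j] r C
        by (intro ennreal_mult_le_trans[OF s(2)[OF _ _ wP] C(2)[OF weight_mult_Lp[OF \<phi> fL]]]) auto
      qed
      also have "\<dots> = ennreal (t powr p * C) * (\<Sum>j\<in>J. Np (\<phi> j \<odot> f))" by (simp add: sum_distrib_left)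
      also have "\<dots> \<le> ennreal (t powr p * C) * Np f"
       by (intro mult_left_mono sum_weight_Np[OF \<phi> J] bergman_spaceD(4)[OF f]) simp
      finally show "(\<Sum>j\<in>J. Np (?A j)) \<le> ennreal (t powr p * C) * Np f" .
      show "(\<Sum>j\<in>J. Np (?G j)) \<le> ennreal (t powr p) * Np f"
       using commutesD[OF \<eta>(2)[OF gen] fL J] unfolding Pf .
     qed (use C t in \<open>auto simp: algebra_simps\<close>)
    qed simp
    also have "\<dots> = ennreal ((K * t) powr p) * Np f"
    proof -
     have "ennreal ((K * t) powr p) = ennreal (2 * (2 powr p * (C + 1) * t powr p))" using K t by (simp add: powr_mult mult_ac)
     also have "\<dots> = 2 * ennreal (2 powr p * (C + 1) * t powr p)" using C by (subst ennreal_mult) auto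
     finally show ?thesis by (simp add: mult.assoc)
    qed
    finally show "Np (outer r \<cdot> S f) \<le> ennreal ((K * t) powr p) * Np f" .
   qed (use K t in auto)
  qed
 qed
qed

end

context bergman_lattice
begin

lemma ennreal_mult_sum_le:
 assumes "\<And>j. j \<in> J ==> A j \<le> ennreal a * B j" "(\<Sum>j\<in>J. B j) \<le> ennreal b * N" "a * b \<le> c" "0 \<le> a" "0 \<le> b"
 shows "(\<Sum>j\<in>J. A j) \<le> ennreal c * N"
proof (rule ennreal_mult_le_trans[OF _ assms(2-)])
 show "(\<Sum>j\<in>J. A j) \<le> ennreal a * (\<Sum>j\<in>J. B j)"
  unfolding sum_distrib_left by (intro sum_mono assms)
qed

lemma lattice_near_identity:
 assumes f: "f \<in> Ap"
 shows "Np (\<lambda>z. f z - bker_op latmap (\<lambda>u. f (latmap u)) z) \<le> ennreal ((1/4) powr p) * Np f"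
proof -
 let ?T = "\<lambda>f. bker_op latmap (\<lambda>u. f (latmap u))"
 note nid = near_id_lat_map
 note T = toeplitz_lattice
 have TA: "?T f \<in> Ap" if "f \<in> Ap" for f
  by (rule bker_op_bergman[OF nid near_id_compose_Lp[OF nid that]])
 have h: "homogeneous_op (\<lambda>f z. toeplitz_measure \<alpha> mu f z - f z)"
  unfolding homogeneous_op_def
 proof (intro ballI conjI allI)
  fix f assume f: "f \<in> Ap"
  note fm [measurable] = bergman_spaceD(4)[OF f] bergman_spaceD(4)[OF TA[OF f]]
  show "(\<lambda>z. toeplitz_measure \<alpha> mu f z - f z) \<in> borel_fun"
   unfolding T[OF fm(1)] by measurable
  fix c
  have "?T (\<lambda>z. c * f z) = (\<lambda>z. c * ?T f z)" by (auto simp: bker_op_def fun_eq_iff mult.assoc)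
  then show "(\<lambda>z. toeplitz_measure \<alpha> mu (\<lambda>z. c * f z) z - c * f z) = (\<lambda>z. c * (toeplitz_measure \<alpha> mu f z - f z))"
   unfolding T[OF fm(1)] T[OF bergman_spaceD(4)[OF bergman_space_cmult[OF f]]] by (simp add: algebra_simps)
 qed
 have "opnorm (\<lambda>f z. toeplitz_measure \<alpha> mu f z - f z) < 1 / 4"
  using L by (simp add: admissible_lattice_def)
 also have "(1 / 4 :: ereal) = ereal (1 / 4)" by (simp add: one_ereal_def numeral_eq_ereal)
 finally have "Np (\<lambda>z. toeplitz_measure \<alpha> mu f z - f z) \<le> ennreal ((1/4) powr p) * Np f"
  using op_norm_le_iff[OF _ h, of "1/4"] f by auto
 moreover have "Np (\<lambda>z. f z - ?T f z) = Np (\<lambda>z. ?T f z - f z)"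
  by (rule Np_cong) (rule norm_minus_commute)
 ultimately show ?thesis unfolding T[OF bergman_spaceD(4)[OF f]] by simp
qed

text \<open>In \<open>S f = S (T f) + S (f - T f)\<close> the last term is again controlled by the
  quantity itself, with the factor 1/4 from the choice of the lattice. It can be moved to the
  left-hand side because boundedness of \<open>S\<close> makes the quantity finite.\<close>

lemma absorb:
 assumes S: "S \<in> Bops"
  and r: "r < 1" and M: "0 < M"
  and le: "\<And>f. f \<in> Ap ==>
   Np (outer r \<cdot> S (bker_op latmap (\<lambda>u. f (latmap u)))) \<le> ennreal M * Np f"
 shows "c_quantity p \<alpha> S \<le> ereal ((2 powr (p + 2) * M) powr (1 / p))"
proof -
 let ?T = "\<lambda>f. bker_op latmap (\<lambda>u. f (latmap u))"
 note nid = near_id_lat_map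
 have TA: "?T f \<in> Ap" if "f \<in> Ap" for f
  by (rule bker_op_bergman[OF nid near_id_compose_Lp[OF nid that]])
 obtain K where K: "1 \<le> K" "\<And>f. f \<in> Ap ==> Np (S f) \<le> ennreal K * Np f" using bounded_ops_Np[OF S] by blast
 have "(K powr (1 / p)) powr p = K" using K p by (simp add: powr_powr)
 then have "c_quantity p \<alpha> S \<le> ereal (K powr (1 / p))"
  using K(2) Np_cut_le(1) by (intro c_quantity_leI[OF S, of 0]) (auto intro: order.trans)
 then obtain x where x: "c_quantity p \<alpha> S = ereal x" "0 \<le> x"
  using c_quantity_nonneg[OF S] by (cases "c_quantity p \<alpha> S") auto
 \<comment> \<open>A number strictly above the quantity \<open>x\<close> is required. Exceeding it
   by \<open>M\<close> in the p-th power keeps the surplus proportional to the final bound.\<close>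
 define c where "c = (x powr p + M) powr (1 / p)"
 have pos: "0 < x powr p + M" using M by (intro add_nonneg_pos) auto
 then have c0: "0 < c" unfolding c_def by simp
 have cp: "c powr p = x powr p + M" using pos p by (simp add: c_def powr_powr)
 have "x < c"
 proof (rule ccontr)
  assume "\<not> x < c"
  then have "c powr p \<le> x powr p" using c0 p by (intro powr_mono2) auto
  then show False using cp M by simp
 qed
 then have "c_quantity p \<alpha> S < ereal c" using x by simp
 from c_quantity_lessD[OF S this c0] obtain r1 where r1: "r1 < 1"
  "\<And>r' f. r1 \<le> r' ==> f \<in> Ap ==> Np (outer r' \<cdot> S f) \<le> ennreal (c powr p) * Np f" by blast
 define r2 where "r2 = max r r1"
 define d where "d = (2 powr p * (M + c powr p * (1/4) powr p)) powr (1 / p)"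
 have dp: "d powr p = 2 powr p * (M + c powr p * (1/4) powr p)" using p M by (simp add: d_def powr_powr)
 have "c_quantity p \<alpha> S \<le> ereal d"
 proof (rule c_quantity_leI[OF S])
  show "r2 < 1" using r r1 by (simp add: r2_def)
  show "0 \<le> d" by (simp add: d_def)
  fix f assume f: "f \<in> Ap"
  note fT = bergman_space_diff[OF f TA[OF f]]
  note [measurable] = bergman_spaceD(4)[OF bounded_opsD(1)[OF S TA[OF f]]] bergman_spaceD(4)[OF bounded_opsD(1)[OF S fT]]
  have "S f = S (\<lambda>z. ?T f z + (f z - ?T f z))" by simp
  also have "\<dots> = (\<lambda>z. S (?T f) z + S (\<lambda>z. f z - ?T f z) z)" by (rule bounded_opsD(5)[OF S TA[OF f] fT])
  finally have "Np (outer r2 \<cdot> S f) = Np (\<lambda>z. outer r2 z * S (?T f) z + outer r2 z * S (\<lambda>z. f z - ?T f z) z)"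
   by (simp add: distrib_left)
  also have "\<dots> \<le> ennreal (2 powr p) * (Np (outer r2 \<cdot> S (?T f)) + Np (\<lambda>z. outer r2 z * S (\<lambda>z. f z - ?T f z) z))"
   by (intro Np_add_le) measurable
  finally show "Np (outer r2 \<cdot> S f) \<le> ennreal (d powr p) * Np f"
  proof (rule two_terms)
   have "Np (outer r2 \<cdot> S (?T f)) \<le> Np (outer r \<cdot> S (?T f))"
    by (rule Np_mono) (auto simp: outer_def indicator_def r2_def)
   then show "Np (outer r2 \<cdot> S (?T f)) \<le> ennreal M * Np f" using le[OF f] by (rule order.trans)
   show "Np (\<lambda>z. outer r2 z * S (\<lambda>z. f z - ?T f z) z) \<le> ennreal (c powr p * (1/4) powr p) * Np f"
    by (rule ennreal_mult_le_trans[OF r1(2)[OF _ fT] lattice_near_identity[OF f]]) (auto simp: r2_def)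
  qed (use M dp in auto)
 qed
 then have "x \<le> d" using x by simp
 then have "x powr p \<le> 2 powr p * (M + c powr p * (1/4) powr p)" unfolding dp[symmetric] using x p by (intro powr_mono2) auto
 also have "\<dots> = 2 powr p * M + c powr p * (2 powr p * (1/4) powr p)" by (simp add: algebra_simps)
 \<comment> \<open>This is where 1/4 matters: after the loss of \<open>2 powr p\<close> in adding
   two functions, the coefficient of \<open>c powr p\<close> is still at most 1/2.\<close>
 also have "2 powr p * (1/4) powr p = (1 / 2 :: real) powr p" by (simp flip: powr_mult)
 also have "c powr p * (1 / 2 :: real) powr p \<le> c powr p * (1 / 2)"
  using p powr_mono'[of 1 p "1/2"] by (intro mult_left_mono) auto
 finally have "x powr p \<le> 2 * (2 powr p * M) + M" unfolding cp by (simp add: field_simps)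
 moreover have "M \<le> 2 * (2 powr p * M)" using mult_right_mono[of 1 "2 * 2 powr p" M] M p ge_one_powr_ge_zero[of 2 p] by simp
 ultimately have "x powr p \<le> 4 * (2 powr p * M)" by simp
 then have "x powr p \<le> 2 powr (p + 2) * M" by (simp add: powr_add)
 then have "(x powr p) powr (1 / p) \<le> (2 powr (p + 2) * M) powr (1 / p)" using p by (intro powr_mono2) auto
 then show ?thesis using x p by (simp add: powr_powr)
qed

end

context bergman
begin

text \<open>With T the lattice operator applied to \<open>f\<close>, the weighted image of T has
  three parts: \<open>S\<close> applied to the localized \<open>Tj j\<close>, \<open>S\<close>
  applied to the projected error \<open>E j\<close> of moving the weight through the lattice kernel,
  and the commutator of the weight with the composition of \<open>S\<close> and
  \<open>bproj\<close>. Only the first part has to be controlled by \<open>a\<close>.\<close>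

lemma c_le_a:
 obtains K where "0 < K" "\<And>\<rho> (D :: nat => (complex^'n) set) w (S :: (complex^'n => complex) => (complex^'n => complex)).
  admissible_lattice p \<alpha> \<rho> D w ==> S \<in> toeplitz_algebra p \<alpha> ==>
  c_quantity p \<alpha> S \<le> ereal K * a_quantity p \<alpha> (lattice_measure \<alpha> D w) S"
proof (rule kernel_bounds, goal_cases)
 case (1 C \<delta>)
 note C = 1(2) and \<delta> = 1(3) and k1 = 1(4) and k2 = 1(5) and k3 = 1(6)
 \<comment> \<open>The factor \<open>2 powr (p + 2)\<close> is that of \<open>absorb\<close>, 2 that
   of \<open>weight_exhaust\<close>, and \<open>2 powr p\<close> comes from the first splitting. Its
   two parts each contribute \<open>C\<^sup>2\<close>.\<close>
 define K where "K = (2 powr (p + 2) * (2 * 2 powr p * (2 * C\<^sup>2))) powr (1 / p)"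
 have K: "0 < K" "K powr p = 2 powr (p + 2) * (2 * 2 powr p * (2 * C\<^sup>2))" using C p by (auto simp: K_def powr_powr)
 show ?thesis
 proof (rule that[OF K(1)])
  fix \<rho> and D :: "nat => (complex^'n) set" and w and S :: "(complex^'n => complex) => (complex^'n => complex)"
  assume L: "admissible_lattice p \<alpha> \<rho> D w" and "S \<in> toeplitz_algebra p \<alpha>"
  then have S: "S \<in> Bops" and tame: "tame (\<lambda>g. S (bproj g))" using toeplitz_algebra_tame by auto
  interpret bergman_lattice p \<alpha> dim \<rho> D w by unfold_locales (rule L)
  define \<tau> where "\<tau> = latmap"
  have nid: "near_id \<tau>" unfolding \<tau>_def by (rule near_id_lat_map)
  have bA: "bounded_map (\<lambda>g. S (bproj g))" using tame by (simp add: tame_def)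
  obtain B where B: "1 \<le> B" "\<And>g. g \<in> lp ==> Np (S (bproj g)) \<le> ennreal B * Np g" using bounded_map_bound[OF bA] by blast
  show "c_quantity p \<alpha> S \<le> ereal K * a_quantity p \<alpha> mu S"
  proof (rule ereal_le_scale[OF _ a_quantity_nonneg K(1)])
   fix t :: real assume t: "0 < t" "a_quantity p \<alpha> mu S < ereal t"
   define e1 where "e1 = t powr p / (2 powr p * 2)"
   have e1: "0 < e1" using t by (simp add: e1_def)
   obtain \<eta>1 where \<eta>1: "0 < \<eta>1" "\<And>\<phi>. gentle \<eta>1 \<phi> ==> commutes e1 \<phi> (\<lambda>g. S (bproj g))" using tameD(2)[OF tame e1] by blast
   \<comment> \<open>The error of moving weights through the kernel passes through \<open>S\<close>,
     whose bound \<open>B\<close> must not enter \<open>K\<close>. Hence this scale is chosen after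
     \<open>B\<close>.\<close>
   obtain \<eta>2 where \<eta>2: "0 < \<eta>2" "B * (\<eta>2 + (1 / \<eta>2) powr (- \<delta>)) \<le> e1" using small_scale[OF B(1) \<delta> e1] by blast
   obtain \<phi> :: "int \<times> nat => complex^'n => real" and r0 where gen: "gentle (min \<eta>1 \<eta>2) \<phi>" and r0: "0 < r0"
    and low: "\<And>z. norm z < 1 ==> \<exists>J. finite J \<and> 1 / 2 \<le> (\<Sum>j\<in>J. \<phi> j z powr p)"
    and supp: "\<And>j z v. norm z < 1 ==> \<phi> j z \<noteq> 0 ==> norm v < 1 ==> \<phi> j v \<noteq> 0 ==> v \<in> bergman_ball z r0"
    by (rule gentle_family_exists[of "min \<eta>1 \<eta>2"]) (use \<eta>1 \<eta>2 in simp, rule that, assumption+)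
   have \<phi>: "weight_family \<phi>" using gen by (simp add: gentle_def)
   have com: "commutes e1 \<phi> (\<lambda>g. S (bproj g))" and s2: "slow_family (1 / \<eta>2) \<eta>2 \<phi>"
    using gentle_mono[OF gen, of \<eta>1] gentle_mono[OF gen, of \<eta>2] \<eta>1 \<eta>2 by (auto simp: gentle_def)
   have [measurable]: "\<phi> j \<in> borel_fun" for j by (rule weight_familyD[OF \<phi>])
   have \<phi>\<tau>: "weight_family (\<lambda>j z. \<phi> j (\<tau> z))"
    using weight_familyD[OF \<phi>] near_idD[OF nid] unfolding weight_family_def by (auto intro: measurable_compose)
   obtain s where s: "s < 1" "\<And>z f. s < norm z ==> norm z < 1 ==> f \<in> rng z r0 ==>
    Np (S f) \<le> ennreal (t powr p) * Np f"
    using a_quantity_lessD[OF S t(2,1) r0] by blast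
   define r where "r = (s + 1) / 2"
   have r: "s < r" "r < 1" using s by (auto simp: r_def)
   let ?M = "2 * (2 powr p * (2 * C\<^sup>2) * t powr p)"
   have M: "0 < ?M" using C t by simp
   have "c_quantity p \<alpha> S \<le> ereal ((2 powr (p + 2) * ?M) powr (1 / p))"
   proof (rule absorb[OF S r(2) M])
    fix f :: "complex^'n => complex" assume f: "f \<in> Ap"
    define u where "u z = f (\<tau> z)" for z
    have u: "u \<in> lp" unfolding u_def by (rule near_id_compose_Lp[OF nid f])
    have Nu: "Np u \<le> ennreal C * Np f" unfolding u_def by (rule k2[OF nid f])
    define T where "T = bker_op \<tau> u"
    have T: "T \<in> Ap" unfolding T_def by (rule bker_op_bergman[OF nid u])
    note PT = bergman_projection_reproduces[OF T]
    have NT: "Np T \<le> ennreal (C * C) * Np f"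
     unfolding T_def by (rule ennreal_mult_le_trans[OF k1[OF nid u] Nu]) (use C in auto)
    define Tj where "Tj j = bker_op \<tau> (\<lambda>z. of_real (\<phi> j (\<tau> z)) * u z)" for j
    have wu: "(\<lambda>z. of_real (\<phi> j (\<tau> z)) * u z) \<in> lp" for j using weight_mult_Lp[OF \<phi>\<tau> u] .
    have Tj: "Tj j \<in> Ap" for j unfolding Tj_def by (rule bker_op_bergman[OF nid wu])
    have PTj: "bproj (Tj j) = Tj j" for j by (rule bergman_projection_reproduces[OF Tj])
    have wT: "(\<phi> j \<odot> T) \<in> lp" for j by (rule weight_mult_Lp[OF \<phi> bergman_spaceD(1)[OF T]])
    \<comment> \<open>The commutator of the weight with the lattice kernel, to which the third bound
      of \<open>kernel_bounds\<close> applies. It is not holomorphic, so \<open>S\<close> can be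
      applied to it only through the projection.\<close>
    define E where "E j z = of_real (\<phi> j z) * T z - Tj j z" for j z
    have E: "E j \<in> lp" for j unfolding E_def by (rule Lp_diff[OF wT bergman_spaceD(1)[OF Tj]])
    note ST = bounded_opsD(1)[OF S T] and STj = bounded_opsD(1)[OF S Tj]
    note [measurable] = bergman_spaceD(4)[OF ST] bergman_spaceD(4)[OF STj]
     Lp_D(1)[OF bounded_mapD(1)[OF bA E]] Lp_D(1)[OF bounded_mapD(1)[OF bA wT]]
    let ?G = "\<lambda>j z. of_real (\<phi> j z) * S T z - S (bproj (\<phi> j \<odot> T)) z"
    have AE: "S (bproj (E j)) = (\<lambda>z. S (bproj (\<phi> j \<odot> T)) z - S (Tj j) z)" for j
     using bounded_mapD(4)[OF bA bergman_spaceD(1)[OF Tj] wT, of j j] unfolding PTj E_def .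
    have "Np (outer r \<cdot> S T) \<le> 2 * (ennreal (2 powr p * (2 * C\<^sup>2) * t powr p) * Np f)"
    proof (rule weight_exhaust[OF \<phi> _ low])
     fix J :: "(int \<times> nat) set" assume J: "finite J" and "\<And>j. j \<in> J ==> \<exists>z. r \<le> norm z \<and> norm z < 1 \<and> \<phi> j z \<noteq> 0"
     then obtain \<zeta> where \<zeta>: "\<And>j. j \<in> J ==> r \<le> norm (\<zeta> j) \<and> norm (\<zeta> j) < 1 \<and> \<phi> j (\<zeta> j) \<noteq> 0" by metis
     have "(\<Sum>j\<in>J. Np (\<phi> j \<odot> S T)) = (\<Sum>j\<in>J. Np (\<lambda>z. S (Tj j) z + (S (bproj (E j)) z + ?G j z)))"
      unfolding AE by simp
     also have "\<dots> \<le> ennreal (2 powr p) * ((\<Sum>j\<in>J. Np (S (Tj j))) + (\<Sum>j\<in>J. Np (\<lambda>z. S (bproj (E j)) z + ?G j z)))"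
      by (intro sum_Np_add_le) measurable
     finally show "(\<Sum>j\<in>J. Np (\<phi> j \<odot> S T)) \<le> ennreal (2 powr p * (2 * C\<^sup>2) * t powr p) * Np f"
     proof (rule two_terms)
      show "(\<Sum>j\<in>J. Np (S (Tj j))) \<le> ennreal (t powr p * (C * C)) * Np f"
      proof (rule ennreal_mult_sum_le)
       fix j assume j: "j \<in> J"
       have "Tj j \<in> rng (\<zeta> j) r0"
        unfolding Tj_def u_def \<tau>_def
       proof (rule toeplitz_range_weighted[OF f])
        show "(\<lambda>v. complex_of_real (\<phi> j v)) \<in> borel_fun" by measurable
        fix v :: "complex^'n" assume "norm v < 1" "complex_of_real (\<phi> j v) \<noteq> 0"
        then show "v \<in> bergman_ball (\<zeta> j) r0"
         using \<zeta>[OF j] by (intro supp[of "\<zeta> j" j v]) auto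
       qed (use \<zeta>[OF j] r0 in auto)
       then show "Np (S (Tj j)) \<le> ennreal (t powr p * C) * Np (\<lambda>z. of_real (\<phi> j (\<tau> z)) * u z)"
        using \<zeta>[OF j] r C by (intro ennreal_mult_le_trans[OF s(2) k1[OF nid wu, folded Tj_def]]) auto
      next
       have "(\<Sum>j\<in>J. Np (\<lambda>z. of_real (\<phi> j (\<tau> z)) * u z)) \<le> Np u"
        by (rule sum_weight_Np[OF \<phi>\<tau> J Lp_D(1)[OF u]])
       then show "(\<Sum>j\<in>J. Np (\<lambda>z. of_real (\<phi> j (\<tau> z)) * u z)) \<le> ennreal C * Np f" using Nu by (rule order.trans)
      qed (use C in auto)
      have "(\<Sum>j\<in>J. Np (\<lambda>z. S (bproj (E j)) z + ?G j z)) \<le>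
       ennreal (2 powr p) * ((\<Sum>j\<in>J. Np (S (bproj (E j)))) + (\<Sum>j\<in>J. Np (?G j)))"
       by (intro sum_Np_add_le) measurable
      then show "(\<Sum>j\<in>J. Np (\<lambda>z. S (bproj (E j)) z + ?G j z)) \<le> ennreal (t powr p * (C * C)) * Np f"
      proof (rule two_terms)
       let ?X = "\<eta>2 + (1 / \<eta>2) powr (- \<delta>)"
       have E1: "(\<Sum>j\<in>J. Np (E j)) \<le> ennreal (C * ?X * C) * Np f"
        unfolding E_def Tj_def T_def
        by (rule ennreal_mult_le_trans[OF k3[OF nid u \<phi> _ less_imp_le[OF \<eta>2(1)] s2 J] Nu]) (use C \<eta>2(1) in auto)
       have E2: "B * (C * ?X * C) \<le> e1 * (C * C)" using mult_right_mono[OF \<eta>2(2), of "C * C"] C by (simp add: mult_ac)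
       show "(\<Sum>j\<in>J. Np (S (bproj (E j)))) \<le> ennreal (e1 * (C * C)) * Np f"
        by (rule ennreal_mult_sum_le[OF B(2)[OF E] E1 E2]) (use B C \<eta>2(1) in auto)
       show "(\<Sum>j\<in>J. Np (?G j)) \<le> ennreal (e1 * (C * C)) * Np f"
        using commutesD[OF com bergman_spaceD(1)[OF T] J] unfolding PT
        by (rule ennreal_mult_le_trans[OF _ NT]) (use e1 C in auto)
      qed (use e1 C in \<open>auto simp: e1_def\<close>)
     qed (use C t in \<open>auto simp: power2_eq_square\<close>)
    qed simp
    also have "\<dots> = ennreal ?M * Np f" using C by (subst (2) ennreal_mult) (auto simp: mult.assoc)
    finally show "Np (outer r \<cdot> S (bker_op latmap (\<lambda>u. f (latmap u)))) \<le> ennreal ?M * Np f"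
     by (simp add: T_def u_def[abs_def] \<tau>_def)
   qed
   also have "(2 powr (p + 2) * ?M) powr (1 / p) = (K powr p * t powr p) powr (1 / p)" unfolding K(2) by (simp add: mult_ac)
   also have "\<dots> = K * t" using K(1) t p by (simp add: powr_powr flip: powr_mult)
   finally show "c_quantity p \<alpha> S \<le> ereal (K * t)" .
  qed
 qed
qed

section \<open>Localized ranges near the sphere\<close>

lemma span_pairing:
 fixes w :: "nat => complex^'n" and G f
 assumes M: "finite M" "\<And>m. m \<in> M ==> norm (w m) < 1" and [measurable]: "f \<in> borel_fun"
  and f: "\<And>v. norm v < 1 ==> f v = (\<Sum>m\<in>M. a m * bkern (real CARD('n) + 1 + \<alpha>) v (w m))"
  and G: "holomorphic_several G (ball 0 1)" and Gm [measurable]: "G \<in> borel_fun" and bd: "\<And>v. norm v < 1 ==> norm (G v) \<le> B"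
 shows "(\<integral>v. f v * cnj (G v) \<partial>vol) = (\<Sum>m\<in>M. a m * cnj (G (w m)))"
proof -
 define l where "l = real CARD('n) + 1 + \<alpha>"
 have l: "0 \<le> l" using \<alpha> by (simp add: l_def)
 have Gi: "integrable vol G" by (rule integrable_bergman_bounded[OF \<alpha> Gm bd])
 have ki: "integrable vol (\<lambda>v. G v * bkern l (w m) v)" if "m \<in> M" for m
 proof (rule integrable_mult_bounded[OF Gi, where K="(hgt (w m) / 2) powr (- l)"])
  show "AE v in vol. norm (bkern l (w m) v) \<le> (hgt (w m) / 2) powr (- l)"
   using AE_vol by eventually_elim (use norm_bkern_le[OF M(2)[OF that]] l in auto)
 qed measurable
 have eq: "bkern l v (w m) * cnj (G v) = cnj (G v * bkern l (w m) v)" if "m \<in> M" "norm v < 1" for m v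
  using cnj_bkern[OF M(2)[OF that(1)], of v l] that(2) by (simp add: mult.commute)
 have "(\<integral>v. f v * cnj (G v) \<partial>vol) = (\<integral>v. (\<Sum>m\<in>M. a m * cnj (G v * bkern l (w m) v)) \<partial>vol)"
 proof (rule integral_cong_AE)
  show "AE v in vol. f v * cnj (G v) = (\<Sum>m\<in>M. a m * cnj (G v * bkern l (w m) v))"
   using AE_vol
  proof eventually_elim
   case (elim v)
   show ?case unfolding f[OF elim] l_def[symmetric] sum_distrib_right
    by (intro sum.cong refl) (simp only: mult.assoc eq[OF _ elim])
  qed
 qed measurable
 also have "\<dots> = (\<Sum>m\<in>M. \<integral>v. a m * cnj (G v * bkern l (w m) v) \<partial>vol)"
  by (rule Bochner_Integration.integral_sum) (intro integrable_mult_right integrable_cnj ki)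
 also have "\<dots> = (\<Sum>m\<in>M. a m * cnj (G (w m)))"
 proof (intro sum.cong refl)
  fix m assume m: "m \<in> M"
  have "(\<integral>v. a m * cnj (G v * bkern l (w m) v) \<partial>vol) = a m * (\<integral>v. cnj (G v * bkern l (w m) v) \<partial>vol)"
   by (rule integral_mult_right_zero)
  also have "(\<integral>v. cnj (G v * bkern l (w m) v) \<partial>vol) = cnj (\<integral>v. G v * bkern l (w m) v \<partial>vol)" by (rule Bochner_Integration.integral_cnj)
  \<comment> \<open>The reproducing formula for \<open>G\<close>, so the pairing depends on
    \<open>G\<close> only through its values at the nodes.\<close>
  also have "(\<integral>v. G v * bkern l (w m) v \<partial>vol) = G (w m)"
   unfolding l_def by (rule bergman_reproducing[OF \<alpha> G Gi M(2)[OF m]])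
  finally show "(\<integral>v. a m * cnj (G v * bkern l (w m) v) \<partial>vol) = a m * cnj (G (w m))" .
 qed
 finally show ?thesis .
qed

lemma norm_one_minus_prod_le:
 fixes \<psi> :: "'a => complex"
 assumes "finite M" "\<And>m. m \<in> M ==> norm (\<psi> m) \<le> 2"
 shows "norm (\<Prod>m\<in>M. 1 - \<psi> m) \<le> 3 ^ card M" "norm (1 - (\<Prod>m\<in>M. 1 - \<psi> m)) \<le> 3 ^ card M * (\<Sum>m\<in>M. norm (\<psi> m))"
proof -
 have "norm (\<Prod>m\<in>M. 1 - \<psi> m) \<le> 3 ^ card M \<and> norm (1 - (\<Prod>m\<in>M. 1 - \<psi> m)) \<le> 3 ^ card M * (\<Sum>m\<in>M. norm (\<psi> m))"
  using assms
 proof (induction M)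
  case (insert x M)
  let ?P = "\<Prod>m\<in>M. 1 - \<psi> m"
  have IH: "norm ?P \<le> 3 ^ card M" "norm (1 - ?P) \<le> 3 ^ card M * (\<Sum>m\<in>M. norm (\<psi> m))" using insert by auto
  have "norm (1 - \<psi> x) \<le> norm (1 :: complex) + norm (\<psi> x)" by (rule norm_triangle_ineq4)
  also have "\<dots> \<le> 3" using insert.prems[of x] by simp
  finally have "norm (1 - \<psi> x) * norm ?P \<le> 3 * 3 ^ card M" using IH by (intro mult_mono) auto
  moreover have "norm (1 - (1 - \<psi> x) * ?P) \<le> 3 * 3 ^ card M * (norm (\<psi> x) + (\<Sum>m\<in>M. norm (\<psi> m)))"
  proof -
   have "1 - (1 - \<psi> x) * ?P = (1 - ?P) + \<psi> x * ?P" by (simp add: algebra_simps)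
   then have "norm (1 - (1 - \<psi> x) * ?P) \<le> norm (1 - ?P) + norm (\<psi> x) * norm ?P"
    by (metis norm_mult norm_triangle_ineq)
   also have "\<dots> \<le> 3 ^ card M * (\<Sum>m\<in>M. norm (\<psi> m)) + norm (\<psi> x) * 3 ^ card M" using IH by (intro add_mono mult_left_mono) auto
   also have "\<dots> = 3 ^ card M * (norm (\<psi> x) + (\<Sum>m\<in>M. norm (\<psi> m)))" by (simp add: algebra_simps)
   also have "\<dots> \<le> 3 * 3 ^ card M * (norm (\<psi> x) + (\<Sum>m\<in>M. norm (\<psi> m)))" by (intro mult_right_mono) (auto intro!: add_nonneg_nonneg sum_nonneg)
   finally show ?thesis .
  qed
  ultimately show ?case using insert(1,2) by (simp add: norm_mult)
 qed simp
 then show "norm (\<Prod>m\<in>M. 1 - \<psi> m) \<le> 3 ^ card M" "norm (1 - (\<Prod>m\<in>M. 1 - \<psi> m)) \<le> 3 ^ card M * (\<Sum>m\<in>M. norm (\<psi> m))" by auto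
qed

text \<open>Pairing with the kernel at \<^term>\<open>u\<close> sees the span only through the values at the points \<^term>\<open>w m\<close>, so the
 kernel may be multiplied by \<open>Q\<close>, which equals 1 at these points and is small away from them.\<close>

lemma span_point_bound:
 fixes w :: "nat => complex^'n" and f
 assumes pq: "1 < q" "1 / p + 1 / q = 1" and M: "finite M" "\<And>m. norm (w m) < 1" and fA: "f \<in> Ap"
  and f: "\<And>v. norm v < 1 ==> f v = (\<Sum>m\<in>M. a m * bkern (real CARD('n) + 1 + \<alpha>) v (w m))"
  and Q: "\<And>v. Q v = 1 - (\<Prod>m\<in>M. 1 - of_real (hgt (w m)) * bkern 1 v (w m))"
  and A: "0 < A" "(\<integral>\<^sup>+v. ennreal (norm (Q v) powr q) \<partial>vol) \<le> ennreal A"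
  and u: "norm u < 1" and \<kappa>: "(hgt u / 2) powr (- (real CARD('n) + 1 + \<alpha>)) \<le> \<kappa>"
 shows "ennreal (norm (f u) powr p) \<le> ennreal (\<kappa> powr p * A powr (p / q)) * Np f"
proof -
 define l where "l = real CARD('n) + 1 + \<alpha>"
 have l: "0 \<le> l" using \<alpha> by (simp add: l_def)
 have \<kappa>0: "0 \<le> \<kappa>" using \<kappa> by (rule order.trans[rotated]) simp
 note fm [measurable] = bergman_spaceD(4)[OF fA]
 have Qm [measurable]: "Q \<in> borel_fun" unfolding Q[abs_def] by measurable
 have \<psi>: "norm (of_real (hgt (w m)) * bkern 1 v (w m)) \<le> 2" if "norm v < 1" for v m
 proof -
  have "norm (of_real (hgt (w m)) * bkern 1 v (w m)) = hgt (w m) / dst v (w m)"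
   using hgt_pos[OF M(2), of m] norm_bkern[of v "w m" 1] that M(2)[of m] dst_pos[of v "w m"] by (simp add: norm_mult powr_minus_divide)
  also have "\<dots> \<le> 2" using hgt_le_dst'[of v "w m"] dst_pos[of v "w m"] that M(2)[of m] by (simp add: field_simps)
  finally show ?thesis .
 qed
 have Qb: "norm (Q v) \<le> 3 ^ card M * (2 * card M)" if v: "norm v < 1" for v
 proof -
  have "norm (Q v) \<le> 3 ^ card M * (\<Sum>m\<in>M. norm (of_real (hgt (w m)) * bkern 1 v (w m)))"
   unfolding Q by (rule norm_one_minus_prod_le(2)[OF M(1) \<psi>[OF v]])
  also have "\<dots> \<le> 3 ^ card M * (\<Sum>m\<in>M. 2)" by (intro mult_left_mono sum_mono \<psi>[OF v]) simp
  finally show ?thesis by (simp add: mult.commute)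
 qed
 have kb: "norm (bkern l v u) \<le> \<kappa>" if v: "norm v < 1" for v
 proof -
  have "norm (bkern l v u) = norm (bkern l u v)" using cnj_bkern[OF u, of v l] v by (metis complex_mod_cnj less_imp_le)
  also have "\<dots> \<le> \<kappa>" using norm_bkern_le[OF u, of v l] v l \<kappa> by (simp add: l_def)
  finally show ?thesis .
 qed
 define G where "G v = bkern l v u * Q v" for v
 have Gm [measurable]: "G \<in> borel_fun" unfolding G_def by measurable
 have Gb: "norm (G v) \<le> \<kappa> * (3 ^ card M * (2 * card M))" if "norm v < 1" for v
  unfolding G_def norm_mult using kb[OF that] Qb[OF that] \<kappa>0 by (intro mult_mono) auto
 have Gh: "holomorphic_several G (ball 0 1)"
  unfolding G_def Q diff_conv_add_uminus
 proof (intro holomorphic_several_mult holomorphic_several_add holomorphic_several_const holomorphic_several_bkern)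
  show "norm u \<le> 1" using u by simp
  have "holomorphic_several (\<lambda>v. (-1) * (\<Prod>m\<in>M. 1 + (- of_real (hgt (w m))) * bkern 1 v (w m))) (ball 0 1)"
   using M by (intro holomorphic_several_mult holomorphic_several_prod holomorphic_several_add holomorphic_several_const holomorphic_several_bkern) (auto intro: less_imp_le)
  then show "holomorphic_several (\<lambda>v. - (\<Prod>m\<in>M. 1 + - (of_real (hgt (w m)) * bkern 1 v (w m)))) (ball 0 1)" by simp
 qed
 \<comment> \<open>At \<open>w m\<close> the kernel of exponent 1 is the inverse of the height, so
   the factor belonging to \<open>m\<close> vanishes and with it the whole product.\<close>
 have Q1: "Q (w m) = 1" if "m \<in> M" for m
 proof -
  have h: "0 < hgt (w m)" by (rule hgt_pos[OF M(2)])
  have "1 - herm (w m) (w m) = of_real (hgt (w m))" by (simp add: herm_self hgt_def)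
  then have "bkern 1 (w m) (w m) = 1 / of_real (hgt (w m))" using h by (simp add: bkern_def)
  then have "1 - of_real (hgt (w m)) * bkern 1 (w m) (w m) = 0" using h by simp
  then have "(\<Prod>m'\<in>M. 1 - of_real (hgt (w m')) * bkern 1 (w m) (w m')) = 0" using that by (intro prod_zero[OF M(1)]) (rule bexI)
  then show ?thesis by (simp add: Q)
 qed
 have "(\<integral>v. f v * cnj (G v) \<partial>vol) = (\<Sum>m\<in>M. a m * cnj (G (w m)))"
  by (rule span_pairing[OF M(1,2) fm f Gh Gm Gb])
 also have "\<dots> = f u"
  unfolding f[OF u] l_def[symmetric]
 proof (intro sum.cong refl)
  fix m assume "m \<in> M"
  then show "a m * cnj (G (w m)) = a m * bkern l u (w m)"
   using cnj_bkern[OF M(2)[of m], of u l] u by (simp add: G_def Q1)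
 qed
 finally have fu: "f u = (\<integral>v. f v * cnj (G v) \<partial>vol)" by simp
 have "ennreal (norm (f u) powr p) \<le> ennreal (A powr (p / q)) * (\<integral>\<^sup>+v. ennreal ((\<kappa> * norm (f v)) powr p) \<partial>vol)"
  unfolding fu
 proof (rule norm_integral_Holder[OF p pq _ _ _ _ _ A])
  show "AE v in vol. norm (f v * cnj (G v)) \<le> norm (Q v) * (\<kappa> * norm (f v))"
   using AE_vol
  proof eventually_elim
   case (elim v)
   have "norm (bkern l v u) * (norm (Q v) * norm (f v)) \<le> \<kappa> * (norm (Q v) * norm (f v))" by (rule mult_right_mono[OF kb[OF elim]]) simp
   then show ?case by (simp add: G_def norm_mult mult_ac)
  qed
 qed (use \<kappa>0 in auto)
 also have "(\<integral>\<^sup>+v. ennreal ((\<kappa> * norm (f v)) powr p) \<partial>vol) = ennreal (\<kappa> powr p) * Np f"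
  using \<kappa>0 by (simp add: Np_def powr_mult ennreal_mult'' nn_integral_cmult)
 finally show ?thesis by (simp add: ennreal_mult'' mult_ac)
qed

end

context bergman_lattice
begin

lemma toeplitz_range_span:
 assumes z: "norm z < 1" and r: "0 \<le> r"
  and f: "f \<in> rng z r"
 shows "\<exists>a. \<forall>v. norm v < 1 --> f v = (\<Sum>m\<in>{m. w m \<in> bergman_ball z r}. a m * bkern (real CARD('n) + 1 + \<alpha>) v (w m))"
proof -
 interpret finite_measure vol by (rule finite_measure_bergman[OF \<alpha>])
 note F = lattice_facts
 define M where "M = {m. w m \<in> bergman_ball z r}"
 have fin: "finite M" unfolding M_def using lattice_count[OF r] z by metis
 note [measurable] = near_idD(1)[OF near_id_lat_map] bergman_ball_measurable[OF z r] F(1)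
 obtain g where g: "g \<in> Ap" and fg: "f = bker_op latmap (\<lambda>u. indicator (bergman_ball z r) (latmap u) * g (latmap u))"
  by (rule toeplitz_rangeE[OF z r f])
 note [measurable] = bergman_spaceD(4)[OF g]
 define l where "l = real CARD('n) + 1 + \<alpha>"
 have "f v = (\<Sum>m\<in>M. (of_real (measure vol (D m)) * g (w m)) * bkern l v (w m))" if v: "norm v < 1" for v
 proof -
  have "f v = (\<integral>y. indicator (bergman_ball z r) (latmap y) * g (latmap y) * bkern l v (latmap y) \<partial>vol)"
   using v by (simp add: fg bker_op_def l_def)
  also have "\<dots> = (\<integral>y. (\<Sum>m\<in>M. indicator (D m) y *\<^sub>R (g (w m) * bkern l v (w m))) \<partial>vol)"
  proof (rule integral_cong_AE)
   show "AE y in vol. indicator (bergman_ball z r) (latmap y) * g (latmap y) * bkern l v (latmap y) =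
     (\<Sum>m\<in>M. indicator (D m) y *\<^sub>R (g (w m) * bkern l v (w m)))"
    using AE_vol
   proof eventually_elim
    case (elim y)
    obtain k where k: "latmap y = w k" "y \<in> D k" using lat_map_point[OF elim] by blast
    have ind: "indicator (D m) y = (if m = k then 1 else 0 :: real)" for m
    proof (cases "m = k")
     case False
     then have "y \<notin> D m" using lattice_unique[OF k(2), of m] by blast
     then show ?thesis using False by simp
    qed (use k(2) in simp)
    have "(\<Sum>m\<in>M. indicator (D m) y *\<^sub>R (g (w m) * bkern l v (w m))) = (if k \<in> M then g (w k) * bkern l v (w k) else 0)"
    proof -
     have "(\<Sum>m\<in>M. indicator (D m) y *\<^sub>R (g (w m) * bkern l v (w m))) = (\<Sum>m\<in>M. if m = k then g (w m) * bkern l v (w m) else 0)"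
      unfolding ind by (intro sum.cong refl) auto
     then show ?thesis by (simp only: sum.delta[OF fin])
    qed
    then show ?case unfolding k(1) by (simp add: M_def indicator_def)
   qed
  qed measurable
  also have "\<dots> = (\<Sum>m\<in>M. \<integral>y. indicator (D m) y *\<^sub>R (g (w m) * bkern l v (w m)) \<partial>vol)"
   by (rule Bochner_Integration.integral_sum) (auto intro!: integrable_scaleR_left simp: emeasure_eq_measure)
  also have "\<dots> = (\<Sum>m\<in>M. (of_real (measure vol (D m)) * g (w m)) * bkern l v (w m))"
   by (intro sum.cong refl) (simp add: emeasure_eq_measure scaleR_conv_of_real mult.assoc)
  finally show ?thesis .
 qed
 then show ?thesis unfolding M_def[symmetric] l_def by (intro exI[of _ "\<lambda>m. of_real (measure vol (D m)) * g (w m)"]) simp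
qed

lemma dst_ge: assumes "norm u \<le> 1"
 shows "1 - norm v \<le> dst v u"
proof -
 have "norm (herm v u) \<le> norm v * norm u" by (rule norm_herm_le)
 also have "\<dots> \<le> norm v * 1" using assms by (intro mult_left_mono) auto
 finally show ?thesis using norm_triangle_ineq2[of 1 "herm v u"] by (simp add: dst_def)
qed

text \<open>By \<open>span_point_bound\<close> it suffices that \<open>Q\<close> is small in L^q. On
  a fixed ball of radius \<open>\<sigma>\<close> it is small because the nodes have small heights
  when \<open>z\<close> is near the sphere; the remaining shell has small measure and
  \<open>Q\<close> is bounded there. Both bounds need the number of nodes to be bounded uniformly in
  \<open>z\<close>.\<close>

lemma toeplitz_range_vanishes:
 assumes t: "t < 1" and r: "0 \<le> r" and e: "0 < e"
 obtains s where "s < 1" "\<And>z f. s < norm z ==> norm z < 1 ==> f \<in> rng z r ==>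
  Np (inner_cut t \<cdot> f) \<le> ennreal e * Np f"
proof -
 interpret finite_measure vol by (rule finite_measure_bergman[OF \<alpha>])
 note F = lattice_facts
 define l where "l = real CARD('n) + 1 + \<alpha>"
 have l: "0 < l" using \<alpha> by (simp add: l_def)
 define q where "q = p / (p - 1)"
 have q: "1 < q" "1 / p + 1 / q = 1" using p by (auto simp: q_def field_simps)
 define t' where "t' = max t 0"
 have t': "0 \<le> t'" "t' < 1" "t \<le> t'" using t by (auto simp: t'_def)
 have t2: "0 < 1 - t'\<^sup>2" using t' by (simp add: abs_square_less_1)
 define \<kappa> where "\<kappa> = ((1 - t'\<^sup>2) / 2) powr (- l)"
 have \<kappa>: "0 < \<kappa>" using t2 by (simp add: \<kappa>_def)
 \<comment> \<open>Solves for the factor \<open>e\<close> in \<open>span_point_bound\<close>;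
   \<open>\<kappa>\<close> bounds the kernel at points of norm below \<open>t\<close>.\<close>
 define A where "A = (e / \<kappa> powr p) powr (q / p)"
 have A: "0 < A" "\<kappa> powr p * A powr (p / q) = e" using e \<kappa> p q by (simp_all add: A_def powr_powr)
 obtain N where N: "\<And>z. norm z < 1 ==> finite {m. w m \<in> bergman_ball z r} \<and> card {m. w m \<in> bergman_ball z r} \<le> N"
  using lattice_count[OF r] by blast
 \<comment> \<open>The numerical factor of \<open>norm_one_minus_prod_le\<close>, with the number of
   nodes replaced by its bound; the summand 1 keeps it positive.\<close>
 define W where "W = 3 ^ N * real N + 1"
 have W: "0 < W" by (simp add: W_def add_nonneg_pos)
 obtain \<sigma> where \<sigma>: "0 < \<sigma>" "\<sigma> < 1" "measure vol (ball 0 1 - ball 0 \<sigma>) \<le> A / (2 * (2 * W) powr q)"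
  using outer_measure_small[of "A / (2 * (2 * W) powr q)"] A W by (metis divide_pos_pos mult_pos_pos order_refl powr_gt_zero zero_less_numeral less_irrefl)
 define c where "c = 4 * (cosh r)\<^sup>2"
 have c: "0 < c" by (simp add: c_def)
 \<comment> \<open>On the ball of radius \<open>\<sigma>\<close> each term of the product is at most
   \<open>c * \<epsilon> / (1 - \<sigma>)\<close>, so that \<open>Q\<close> is at most
   \<open>(A / 2) powr (1 / q)\<close> there.\<close>
 define \<epsilon> where "\<epsilon> = (A / 2) powr (1 / q) * (1 - \<sigma>) / (W * c)"
 have \<epsilon>: "0 < \<epsilon>" using A \<sigma> W c by (simp add: \<epsilon>_def)
 obtain s where s: "0 \<le> s" "s < 1" "\<And>z :: complex^'n. s < norm z ==> norm z < 1 ==> hgt z < \<epsilon>" using hgt_small[OF \<epsilon>] by blast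
 show ?thesis
 proof (rule that[OF s(2)])
  fix z :: "complex^'n" and f assume z: "s < norm z" "norm z < 1" and f: "f \<in> rng z r"
  have fA: "f \<in> Ap" by (rule toeplitz_range_bergman(1)[OF z(2) r f])
  define M where "M = {m. w m \<in> bergman_ball z r}"
  have M: "finite M" "card M \<le> N" using N[OF z(2)] by (auto simp: M_def)
  obtain a where a: "\<And>v. norm v < 1 ==> f v = (\<Sum>m\<in>M. a m * bkern (real CARD('n) + 1 + \<alpha>) v (w m))"
   using toeplitz_range_span[OF z(2) r f] unfolding M_def by blast
  define Q where "Q v = 1 - (\<Prod>m\<in>M. 1 - of_real (hgt (w m)) * bkern 1 v (w m))" for v
  have \<psi>: "norm (of_real (hgt (w m)) * bkern 1 v (w m)) = hgt (w m) / dst v (w m)" if "norm v < 1" for v m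
   using hgt_pos[OF F(4), of m] norm_bkern[of v "w m" 1] that F(4)[of m] by (simp add: norm_mult powr_minus_divide)
  have \<psi>2: "norm (of_real (hgt (w m)) * bkern 1 v (w m)) \<le> 2" if "norm v < 1" for v m
   unfolding \<psi>[OF that] using hgt_le_dst'[of v "w m"] dst_pos[of v "w m"] that F(4)[of m] by (simp add: field_simps)
  have Qb: "norm (Q v) \<le> W * b" if v: "norm v < 1" and b: "\<And>m. m \<in> M ==> norm (of_real (hgt (w m)) * bkern 1 v (w m)) \<le> b" "0 \<le> b" for v b
  proof -
   have "norm (Q v) \<le> 3 ^ card M * (\<Sum>m\<in>M. norm (of_real (hgt (w m)) * bkern 1 v (w m)))"
    unfolding Q_def by (rule norm_one_minus_prod_le(2)[OF M(1) \<psi>2[OF v]])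
   also have "\<dots> \<le> 3 ^ card M * (\<Sum>m\<in>M. b)" by (intro mult_left_mono sum_mono b) simp_all
   also have "\<dots> = (3 ^ card M * real (card M)) * b" by simp
   also have "\<dots> \<le> (3 ^ N * real N) * b" using M(2) b(2) by (intro mult_right_mono mult_mono power_increasing) auto
   also have "\<dots> \<le> W * b" using b(2) by (intro mult_right_mono) (auto simp: W_def)
   finally show ?thesis .
  qed
  have hw: "hgt (w m) \<le> c * \<epsilon>" if "m \<in> M" for m
  proof -
   have "xr z (w m) \<le> (cosh r)\<^sup>2" using that bergman_ball_eq[OF z(2) r] by (auto simp: M_def)
   then have "hgt (w m) \<le> c * hgt z" unfolding c_def by (rule xr_hgt[OF z(2) F(4)])
   also have "\<dots> \<le> c * \<epsilon>" using s(3)[OF z] c by (intro mult_left_mono) auto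
   finally show ?thesis .
  qed
  have QA: "(\<integral>\<^sup>+v. ennreal (norm (Q v) powr q) \<partial>vol) \<le> ennreal A"
  proof -
   have "(\<integral>\<^sup>+v. ennreal (norm (Q v) powr q) \<partial>vol) \<le> (\<integral>\<^sup>+v. ennreal (A / 2) + ennreal ((2 * W) powr q) * indicator (ball 0 1 - ball 0 \<sigma>) v \<partial>vol)"
   proof (rule nn_integral_mono_AE)
    show "AE v in vol. ennreal (norm (Q v) powr q) \<le> ennreal (A / 2) + ennreal ((2 * W) powr q) * indicator (ball 0 1 - ball 0 \<sigma>) v"
     using AE_vol
    proof eventually_elim
     case (elim v)
     show ?case
     proof (cases "norm v < \<sigma>")
      case True
      have "norm (Q v) \<le> W * (c * \<epsilon> / (1 - \<sigma>))"
      proof (rule Qb[OF elim])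
       fix m assume m: "m \<in> M"
       have "1 - \<sigma> \<le> dst v (w m)" using dst_ge[of "w m" v] F(4)[of m] True by simp
       then show "norm (of_real (hgt (w m)) * bkern 1 v (w m)) \<le> c * \<epsilon> / (1 - \<sigma>)"
        unfolding \<psi>[OF elim] using hw[OF m] \<sigma> c \<epsilon> by (intro frac_le) auto
      qed (use c \<epsilon> \<sigma> in auto)
      also have "\<dots> = (A / 2) powr (1 / q)" using W c \<sigma> by (simp add: \<epsilon>_def)
      finally have "norm (Q v) powr q \<le> ((A / 2) powr (1 / q)) powr q" using q by (intro powr_mono2) auto
      also have "\<dots> = A / 2" using A q by (simp add: powr_powr)
      finally have "ennreal (norm (Q v) powr q) \<le> ennreal (A / 2)" by (rule ennreal_leI)
      then show ?thesis by (rule order.trans) simp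
     next
      case False
      have "norm (Q v) \<le> W * 2" by (rule Qb[OF elim \<psi>2[OF elim]]) simp_all
      then have "norm (Q v) powr q \<le> (2 * W) powr q" using q by (intro powr_mono2) auto
      then have "ennreal (norm (Q v) powr q) \<le> ennreal ((2 * W) powr q)" by (rule ennreal_leI)
      then show ?thesis using False elim by (simp add: add_increasing)
     qed
    qed
   qed
   also have "\<dots> = ennreal (A / 2) + ennreal ((2 * W) powr q) * emeasure vol (ball 0 1 - ball 0 \<sigma>)"
    using emeasure_bergman_UNIV[OF \<alpha>, where 'n='n] by (subst nn_integral_add) (auto simp: nn_integral_cmult)
   also have "\<dots> = ennreal (A / 2 + (2 * W) powr q * measure vol (ball 0 1 - ball 0 \<sigma>))"
    using A by (simp add: emeasure_eq_measure ennreal_mult' ennreal_plus)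
   also have "\<dots> \<le> ennreal (A / 2 + (2 * W) powr q * (A / (2 * (2 * W) powr q)))"
    using \<sigma> by (intro ennreal_leI add_left_mono mult_left_mono) auto
   also have "\<dots> = ennreal A" using W by simp
   finally show ?thesis .
  qed
  have pt: "ennreal (norm (f u) powr p) \<le> ennreal e * Np f" if u: "norm u < t" for u
  proof -
   have u1: "norm u < 1" "norm u < t'" using u t t' by auto
   have "(norm u)\<^sup>2 \<le> t'\<^sup>2" using u1 by (intro power_mono) auto
   then have "1 - t'\<^sup>2 \<le> hgt u" by (simp add: hgt_def)
   then have "(hgt u / 2) powr (- l) \<le> \<kappa>" unfolding \<kappa>_def using t2 l by (intro powr_mono2') auto
   then show ?thesis
    unfolding A(2)[symmetric] l_def
    by (intro span_point_bound[where M=M and w=w and a=a and Q=Q and q=q, OF q M(1) F(4) fA _ Q_def A(1) QA u1(1)] a)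
  qed
  have "Np (inner_cut t \<cdot> f) \<le> (\<integral>\<^sup>+v. ennreal e * Np f \<partial>vol)"
   unfolding Np_def[of "\<lambda>v. inner_cut t v * f v"]
  proof (rule nn_integral_mono)
   fix v
   show "ennreal (norm (inner_cut t v * f v) powr p) \<le> ennreal e * Np f"
    using pt[of v] by (cases "norm v < t") (auto simp: inner_cut_def)
  qed
  also have "\<dots> = ennreal e * Np f" using emeasure_bergman_UNIV[OF \<alpha>, where 'n='n] by simp
  finally show "Np (inner_cut t \<cdot> f) \<le> ennreal e * Np f" .
 qed
qed

text \<open>Outside radius \<open>r1\<close> the image of \<open>f\<close> is controlled by
  \<open>c\<close>. Inside, \<open>f\<close> is cut at a radius \<open>t'\<close> beyond which
  \<open>localizing\<close> makes the image small, and its part within \<open>t'\<close> is itself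
  small because \<open>f\<close> comes from a range localized near the sphere.\<close>

lemma a_le_c:
 assumes "S \<in> toeplitz_algebra p \<alpha>"
 shows "a_quantity p \<alpha> mu S \<le> ereal 4 * c_quantity p \<alpha> S"
proof -
 have S: "S \<in> Bops" and tame: "tame (\<lambda>g. S (bproj g))" using toeplitz_algebra_tame assms by auto
 have bA: "bounded_map (\<lambda>g. S (bproj g))" using tame by (simp add: tame_def)
 obtain B where B: "1 \<le> B" "\<And>g. g \<in> lp ==> Np (S (bproj g)) \<le> ennreal B * Np g" using bounded_map_bound[OF bA] by blast
 show ?thesis
 proof (rule ereal_le_scale[OF _ c_quantity_nonneg[OF S]])
  fix t :: real assume t: "0 < t" "c_quantity p \<alpha> S < ereal t"
  obtain r1 where r1: "r1 < 1" "\<And>r' f. r1 \<le> r' ==> f \<in> Ap ==> Np (outer r' \<cdot> S f) \<le> ennreal (t powr p) * Np f"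
   using c_quantity_lessD[OF S t(2,1)] by blast
  define e2 where "e2 = t powr p / (2 powr p * 2)"
  define e3 where "e3 = e2 / B"
  have e23: "0 < e2" "0 < e3" using t B by (auto simp: e2_def e3_def)
  obtain t' where t': "t' < 1" "\<And>g. g \<in> lp ==> Np (inner_cut r1 \<cdot> S (bproj (outer t' \<cdot> g))) \<le> ennreal e2 * Np g"
   using localizing[OF tame r1(1) e23(1)] by blast
  show "a_quantity p \<alpha> mu S \<le> ereal (4 * t)"
  proof (rule a_quantity_leI[OF S])
   fix r :: real assume r: "0 < r"
   obtain s where s: "s < 1" "\<And>z f. s < norm z ==> norm z < 1 ==> f \<in> rng z r ==>
     Np (inner_cut t' \<cdot> f) \<le> ennreal e3 * Np f"
    using toeplitz_range_vanishes[OF t'(1) less_imp_le[OF r] e23(2)] by blast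
   show "\<exists>s<1. \<forall>z. s < norm z --> norm z < 1 -->
    (\<forall>f\<in>rng z r. Np (S f) \<le> ennreal ((4 * t) powr p) * Np f)"
   proof (intro exI[of _ s] conjI s(1) allI impI ballI)
    fix z :: "complex^'n" and f assume z: "s < norm z" "norm z < 1" and fr: "f \<in> rng z r"
    have f: "f \<in> Ap" by (rule toeplitz_range_bergman(1)[OF z(2) less_imp_le[OF r] fr])
    note fL = bergman_spaceD(1)[OF f]
    note fi = cut_Lp(2)[OF fL, of t'] and fo = cut_Lp(1)[OF fL, of t']
    note [measurable] = bergman_spaceD(4)[OF bounded_opsD(1)[OF S f]] Lp_D(1)[OF bounded_mapD(1)[OF bA fi]] Lp_D(1)[OF bounded_mapD(1)[OF bA fo]]
    have "S f = S (bproj f)" by (simp add: bergman_projection_reproduces[OF f])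
    also have "\<dots> = S (bproj (\<lambda>v. inner_cut t' v * f v + outer t' v * f v))" by (simp flip: cut_split_fun)
    also have "\<dots> = (\<lambda>v. S (bproj (inner_cut t' \<cdot> f)) v + S (bproj (outer t' \<cdot> f)) v)"
     by (rule bounded_mapD(3)[OF bA fi fo])
    finally have "Np (inner_cut r1 \<cdot> S f) = Np (\<lambda>v. inner_cut r1 v * S (bproj (inner_cut t' \<cdot> f)) v + inner_cut r1 v * S (bproj (outer t' \<cdot> f)) v)"
     by (simp add: distrib_left)
    also have "\<dots> \<le> ennreal (2 powr p) * (Np (inner_cut r1 \<cdot> S (bproj (inner_cut t' \<cdot> f))) + Np (inner_cut r1 \<cdot> S (bproj (outer t' \<cdot> f))))"
     by (intro Np_add_le) measurable
    finally have inner: "Np (inner_cut r1 \<cdot> S f) \<le> ennreal (t powr p) * Np f"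
    proof (rule two_terms)
     show "Np (inner_cut r1 \<cdot> S (bproj (inner_cut t' \<cdot> f))) \<le> ennreal e2 * Np f"
      by (rule ennreal_mult_le_trans[OF order.trans[OF Np_cut_le(2) B(2)[OF fi]] s(2)[OF z fr]]) (use B e23 in \<open>auto simp: e3_def\<close>)
     show "Np (inner_cut r1 \<cdot> S (bproj (outer t' \<cdot> f))) \<le> ennreal e2 * Np f" by (rule t'(2)[OF fL])
    qed (use e23 in \<open>auto simp: e2_def\<close>)
    have "Np (S f) = Np (\<lambda>v. inner_cut r1 v * S f v + outer r1 v * S f v)" by (simp flip: cut_split_fun)
    also have "\<dots> \<le> ennreal (2 powr p) * (Np (inner_cut r1 \<cdot> S f) + Np (outer r1 \<cdot> S f))"
     by (intro Np_add_le) measurable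
    finally show "Np (S f) \<le> ennreal ((4 * t) powr p) * Np f"
    proof (rule two_terms[OF _ inner r1(2)[OF order_refl f]])
     \<comment> \<open>One factor 2 pays for adding two functions, the other for the sum of two
       equal terms, as \<open>2 \<le> 2 powr p\<close>.\<close>
     have "(4 * t) powr p = (2 * 2) powr p * t powr p" using t by (subst powr_mult) auto
     also have "\<dots> = 2 powr p * (2 powr p * t powr p)" by (subst powr_mult) auto
     also have "2 powr p * (2 powr p * t powr p) \<ge> 2 powr p * (2 powr 1 * t powr p)"
      using p by (intro mult_left_mono mult_right_mono powr_mono) auto
     finally show "2 powr p * (t powr p + t powr p) \<le> (4 * t) powr p" by simp
    qed auto
   qed
  qed (use t in auto)
 qed simp
qed

end

section \<open>The essential norm\<close>

context bergman
begin

lemma outer_Np_small: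
 assumes g: "g \<in> lp" and e: "0 < e"
 obtains k0 where "\<And>k. k0 \<le> k ==> Np (outer (1 - 1 / real (k + 2)) \<cdot> g) \<le> ennreal e"
proof -
 note [measurable] = Lp_D(1)[OF g]
 have "(\<lambda>k. Np (outer (1 - 1 / real (k + 2)) \<cdot> g)) \<longlonglongrightarrow> (\<integral>\<^sup>+z. 0 \<partial>vol)"
  unfolding Np_def
 proof (rule nn_integral_dominated_convergence[where w="\<lambda>z. ennreal (norm (g z) powr p)"])
  show "(\<integral>\<^sup>+z. ennreal (norm (g z) powr p) \<partial>vol) < \<infinity>" using Lp_D(2)[OF g] by (simp add: Np_def)
  show "AE z in vol. ennreal (norm (outer (1 - 1 / real (k + 2)) z * g z) powr p) \<le> ennreal (norm (g z) powr p)" for k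
   using p by (intro AE_I2 ennreal_leI powr_mono2) (auto simp: outer_def indicator_def)
  show "AE z in vol. (\<lambda>k. ennreal (norm (outer (1 - 1 / real (k + 2)) z * g z) powr p)) \<longlonglongrightarrow> 0"
   using AE_vol
  proof eventually_elim
   case (elim z)
   have "(\<lambda>k. 1 - 1 / real (k + 2)) \<longlonglongrightarrow> 1" by real_asymp
   then have "eventually (\<lambda>k. norm z < 1 - 1 / real (k + 2)) sequentially" using elim by (rule order_tendstoD)
   then show ?case by (intro tendsto_eventually) (auto elim!: eventually_mono simp: outer_def)
  qed
 qed measurable
 then have "eventually (\<lambda>k. Np (outer (1 - 1 / real (k + 2)) \<cdot> g) < ennreal e) sequentially"
  using e by (intro order_tendstoD) auto
 then show ?thesis using that by (auto simp: eventually_sequentially intro: less_imp_le)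
qed

text \<open>Otherwise there are unit vectors whose images keep a fixed mass outside radii tending to
  1. A subsequence of the images converges in norm to some \<open>g\<close>, whose own mass outside
  these radii tends to 0.\<close>

lemma compact_ops_outer_small:
 assumes Q: "Q \<in> compact_ops p \<alpha>" and e: "0 < e"
 obtains r where "r < 1" "\<And>f. f \<in> Ap ==> Np (outer r \<cdot> Q f) \<le> ennreal e * Np f"
proof -
 have Qb: "Q \<in> Bops" using Q by (simp add: compact_ops_def)
 define r where "r k = 1 - 1 / real (k + 2)" for k
 define c where "c = e powr (1 / p)"
 have c: "0 \<le> c" "c powr p = e" using e p by (auto simp: c_def powr_powr)
 have "\<exists>k. opnorm (mult_op (indicator (ball 0 1 - ball 0 (r k))) \<circ> Q) \<le> ereal c"
 proof (rule ccontr)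
  assume neg: "\<nexists>k. opnorm (mult_op (indicator (ball 0 1 - ball 0 (r k))) \<circ> Q) \<le> ereal c"
  have "\<exists>f. f \<in> Ap \<and> lpnorm f \<le> 1 \<and> \<not> Np (outer (r k) \<cdot> Q f) \<le> ennreal e" for k
  proof -
   have "ereal c < opnorm (mult_op (indicator (ball 0 1 - ball 0 (r k))) \<circ> Q)" using neg by (simp add: not_le)
   then obtain f where f: "f \<in> Ap" "lpnorm f \<le> 1"
    and lt: "ereal c < lpnorm ((mult_op (indicator (ball 0 1 - ball 0 (r k))) \<circ> Q) f)"
    unfolding op_norm_def less_SUP_iff by blast
   note [measurable] = bergman_spaceD(4)[OF bounded_opsD(1)[OF Qb f(1)]]
   have "(\<lambda>z. indicator (ball 0 1 - ball 0 (r k)) z * Q f z) \<in> borel_fun" by measurable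
   then have "\<not> Np (\<lambda>z. indicator (ball 0 1 - ball 0 (r k)) z * Q f z) \<le> ennreal e"
    using lt Lp_norm_le_iff[OF c(1), of "\<lambda>z. indicator (ball 0 1 - ball 0 (r k)) z * Q f z"]
    by (auto simp: mult_op_def c(2) not_le)
   moreover have "Np (\<lambda>z. indicator (ball 0 1 - ball 0 (r k)) z * Q f z) = Np (outer (r k) \<cdot> Q f)"
    by (rule Np_cong) (auto simp: outer_def indicator_def)
   ultimately show ?thesis using f by auto
  qed
  then obtain f where f: "\<And>k. f k \<in> Ap" "\<And>k. lpnorm (f k) \<le> 1"
   "\<And>k. \<not> Np (outer (r k) \<cdot> Q (f k)) \<le> ennreal e" by metis
  then obtain s g where s: "strict_mono s" and g: "g \<in> Ap"
   and lim: "(\<lambda>k. lpnorm (\<lambda>z. Q (f (s k)) z - g z)) \<longlonglongrightarrow> 0"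
   using Q unfolding compact_ops_def by blast
  define e1 where "e1 = e / (2 powr p * 2)"
  have e1: "0 < e1" using e by (simp add: e1_def)
  have e1c: "0 \<le> e1 powr (1 / p)" "(e1 powr (1 / p)) powr p = e1" "0 < e1 powr (1 / p)" using e1 p by (auto simp: powr_powr)
  obtain k0 where k0: "\<And>k. k0 \<le> k ==> Np (outer (r k) \<cdot> g) \<le> ennreal e1"
   using outer_Np_small[OF bergman_spaceD(1)[OF g] e1] unfolding r_def by blast
  have "eventually (\<lambda>k. lpnorm (\<lambda>z. Q (f (s k)) z - g z) < ereal (e1 powr (1 / p))) sequentially"
   using lim by (rule order_tendstoD) (use e1c in simp)
  then obtain k1 where k1: "\<And>k. k1 \<le> k ==> lpnorm (\<lambda>z. Q (f (s k)) z - g z) < ereal (e1 powr (1 / p))"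
   by (auto simp: eventually_sequentially)
  define k where "k = max k0 k1"
  have sk: "k0 \<le> s k" using seq_suble[OF s, of k] by (simp add: k_def)
  have d: "Np (\<lambda>z. Q (f (s k)) z - g z) \<le> ennreal e1"
   using Lp_norm_le_iff[OF e1c(1), of "\<lambda>z. Q (f (s k)) z - g z"] k1[of k] e1c(2) by (auto simp: k_def)
  note [measurable] = bergman_spaceD(4)[OF bounded_opsD(1)[OF Qb f(1)]] bergman_spaceD(4)[OF g]
  have "Np (outer (r (s k)) \<cdot> Q (f (s k))) = Np (\<lambda>z. outer (r (s k)) z * (Q (f (s k)) z - g z) + outer (r (s k)) z * g z)"
   by (simp add: algebra_simps)
  also have "\<dots> \<le> ennreal (2 powr p) * (Np (\<lambda>z. outer (r (s k)) z * (Q (f (s k)) z - g z)) + Np (outer (r (s k)) \<cdot> g))"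
   by (intro Np_add_le) measurable
  also have "\<dots> \<le> ennreal (2 powr p) * (ennreal e1 + ennreal e1)"
   by (intro mult_left_mono add_mono k0[OF sk] order.trans[OF Np_cut_le(1) d]) simp
  also have "\<dots> = ennreal e" using e1 by (simp add: e1_def flip: ennreal_plus ennreal_mult)
  finally show False using f(3)[of "s k"] by simp
 qed
 then obtain k where k: "opnorm (mult_op (indicator (ball 0 1 - ball 0 (r k))) \<circ> Q) \<le> ereal c" ..
 show ?thesis
  using that[of "r k"] k unfolding op_norm_outer_le[OF Qb c(1)] c(2) by (auto simp: r_def)
qed

lemma c_le_ess:
 assumes S: "S \<in> Bops"
 shows "c_quantity p \<alpha> S \<le> ereal 4 * ess_norm p \<alpha> S"
proof (rule ereal_le_scale[OF _ ess_norm_nonneg])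
 fix t :: real assume t: "0 < t" "ess_norm p \<alpha> S < ereal t"
 then obtain Q where Q: "Q \<in> compact_ops p \<alpha>" "opnorm (\<lambda>f z. S f z - Q f z) < ereal t"
  by (auto simp: ess_norm_def INF_less_iff)
 have Qb: "Q \<in> Bops" using Q by (simp add: compact_ops_def)
 have h: "homogeneous_op (\<lambda>f z. S f z - Q f z)"
  unfolding homogeneous_op_def
 proof (intro ballI conjI allI)
  fix f assume f: "f \<in> Ap"
  note [measurable] = bergman_spaceD(4)[OF bounded_opsD(1)[OF S f]] bergman_spaceD(4)[OF bounded_opsD(1)[OF Qb f]]
  show "(\<lambda>z. S f z - Q f z) \<in> borel_fun" by measurable
  show "(\<lambda>z. S (\<lambda>z. c * f z) z - Q (\<lambda>z. c * f z) z) = (\<lambda>z. c * (S f z - Q f z))" for c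
   by (simp add: bounded_opsD(4)[OF S f] bounded_opsD(4)[OF Qb f] algebra_simps)
 qed
 have SQ: "Np (\<lambda>z. S f z - Q f z) \<le> ennreal (t powr p) * Np f" if "f \<in> Ap" for f
  using op_norm_le_iff[OF _ h, of t] Q(2) t that by auto
 obtain r where r: "r < 1" "\<And>f. f \<in> Ap ==> Np (outer r \<cdot> Q f) \<le> ennreal (t powr p) * Np f"
  using compact_ops_outer_small[OF Q(1), of "t powr p"] t by (metis powr_gt_zero less_irrefl)
 show "c_quantity p \<alpha> S \<le> ereal (4 * t)"
 proof (rule c_quantity_leI[OF S r(1)])
  fix f assume f: "f \<in> Ap"
  note [measurable] = bergman_spaceD(4)[OF bounded_opsD(1)[OF S f]] bergman_spaceD(4)[OF bounded_opsD(1)[OF Qb f]]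
  have "Np (outer r \<cdot> S f) = Np (\<lambda>z. outer r z * (S f z - Q f z) + outer r z * Q f z)"
   by (simp add: algebra_simps)
  also have "\<dots> \<le> ennreal (2 powr p) * (Np (\<lambda>z. outer r z * (S f z - Q f z)) + Np (outer r \<cdot> Q f))"
   by (intro Np_add_le) measurable
  finally show "Np (outer r \<cdot> S f) \<le> ennreal ((4 * t) powr p) * Np f"
  proof (rule two_terms[OF _ order.trans[OF Np_cut_le(1) SQ[OF f]] r(2)[OF f]])
   have "(4 * t) powr p = (2 * 2) powr p * t powr p" using t by (subst powr_mult) auto
   also have "\<dots> = 2 powr p * (2 powr p * t powr p)" by (subst powr_mult) auto
   also have "2 powr p * (2 powr p * t powr p) \<ge> 2 powr p * (2 powr 1 * t powr p)"
    using p by (intro mult_left_mono mult_right_mono powr_mono) auto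
   finally show "2 powr p * (t powr p + t powr p) \<le> (4 * t) powr p" by simp
  qed auto
 qed (use t in simp)
qed simp

lemma norm_integral_mult_le:
 assumes g: "g \<in> lp" and K: "0 \<le> K" "Np g \<le> ennreal K" and F: "\<And>w. norm w < 1 ==> norm (F w) \<le> d" and d: "0 \<le> d"
 shows "norm (\<integral>w. g w * F w \<partial>vol) \<le> d * K powr (1 / p)"
proof -
 note [measurable] = Lp_D(1)[OF g]
 define q where "q = p / (p - 1)"
 have q: "1 < q" "1 / p + 1 / q = 1" using p by (auto simp: q_def field_simps)
 have "ennreal (norm (\<integral>w. g w * F w \<partial>vol) powr p) \<le> ennreal (1 powr (p / q)) * (\<integral>\<^sup>+w. ennreal ((d * norm (g w)) powr p) \<partial>vol)"
 proof (rule norm_integral_Holder[OF p q])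
  show "AE w in vol. norm (g w * F w) \<le> 1 * (d * norm (g w))"
   using AE_vol
  proof eventually_elim
   case (elim w)
   show ?case using mult_right_mono[OF F[OF elim], of "norm (g w)"] by (simp add: norm_mult mult.commute)
  qed
 qed (use emeasure_bergman_UNIV[OF \<alpha>, where 'n='n] d in auto)
 also have "\<dots> = ennreal (d powr p) * Np g" using d by (simp add: Np_def powr_mult ennreal_mult'' nn_integral_cmult)
 also have "\<dots> \<le> ennreal (d powr p * K)" using mult_left_mono[OF K(2), of "ennreal (d powr p)"] K(1) by (simp add: ennreal_mult'')
 finally have "norm (\<integral>w. g w * F w \<partial>vol) powr p \<le> d powr p * K" using K(1) by (simp add: ennreal_le_iff)
 then have "(norm (\<integral>w. g w * F w \<partial>vol) powr p) powr (1 / p) \<le> (d powr p * K) powr (1 / p)" using p by (intro powr_mono2) auto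
 then show ?thesis using p d K(1) by (simp add: powr_powr powr_mult)
qed

lemma continuous_bkern:
 assumes r: "r < 1"
 shows "continuous_on (cball 0 r \<times> cball 0 1) (\<lambda>x :: (complex^'n) \<times> (complex^'n). bkern l (fst x) (snd x))"
proof -
 have re: "0 < Re (1 - herm (fst x) (snd x))" if "x \<in> cball 0 r \<times> cball 0 1" for x :: "(complex^'n) \<times> (complex^'n)"
  using that r by (intro Re_one_minus_herm_pos) auto
 have c: "continuous_on (cball 0 r \<times> cball 0 1) (\<lambda>x :: (complex^'n) \<times> (complex^'n). 1 - herm (fst x) (snd x))"
  unfolding herm_def by (intro continuous_intros)
 have "continuous_on (cball 0 r \<times> cball 0 1) (\<lambda>x :: (complex^'n) \<times> (complex^'n). 1 / exp (of_real l * ln (1 - herm (fst x) (snd x))))"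
  by (intro continuous_intros continuous_on_Ln c) (use re in \<open>auto simp: complex_nonpos_Reals_iff not_le dest!: re\<close>)
 moreover have "1 / exp (of_real l * ln (1 - herm (fst x) (snd x))) = bkern l (fst x) (snd x)" if "x \<in> cball 0 r \<times> cball 0 1" for x :: "(complex^'n) \<times> (complex^'n)"
  using re[OF that] by (auto simp: bkern_def powr_def)
 ultimately show ?thesis by (subst continuous_on_cong[OF refl]) auto
qed

text \<open>Arzela--Ascoli on the closed ball of radius \<open>r\<close>. Bounds and equicontinuity
  follow from the reproducing formula by Hoelder's inequality, the latter from uniform continuity of
  the kernel. The total mass being 1, uniform convergence gives convergence in L^p of the cut
  functions.\<close>

lemma bergman_normal_family:
 fixes g :: "nat => complex^'n => complex"
 assumes g: "\<And>k. g k \<in> Ap" and K: "0 \<le> K" "\<And>k. Np (g k) \<le> ennreal K"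
  and r: "0 \<le> r" "r < 1"
 obtains s :: "nat => nat" and h where "strict_mono s" "h \<in> lp"
  "\<And>e. 0 < e ==> \<exists>N. \<forall>k\<ge>N. Np (\<lambda>z. inner_cut r z * g (s k) z - h z) \<le> ennreal e"
proof -
 define l where "l = real CARD('n) + 1 + \<alpha>"
 have l: "0 \<le> l" using \<alpha> by (simp add: l_def)
 define K1 where "K1 = K powr (1 / p)"
 have K10: "0 \<le> K1" by (simp add: K1_def)
 note gm [measurable] = bergman_spaceD(4)[OF g]
 have rep: "g k u = (\<integral>w. g k w * bkern l u w \<partial>vol)" if "norm u < 1" for k u
 proof -
  have "g k u = bproj (g k) u" by (simp add: bergman_projection_reproduces[OF g])
  then show ?thesis using that by (simp add: bker_op_def l_def)
 qed
 have ki: "integrable vol (\<lambda>w. g k w * bkern l u w)" if "norm u < 1" for k u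
  using integrable_bker[OF near_id_id bergman_spaceD(1)[OF g] that l] .
 note diffle = norm_integral_mult_le[OF bergman_spaceD(1)[OF g] K, folded K1_def]
 obtain h0 and s :: "nat => nat" where h0: "continuous_on (cball 0 r) h0" and s: "strict_mono s"
  and lim: "\<And>e. 0 < e ==> \<exists>N. \<forall>n x. N \<le> n \<and> x \<in> cball 0 r --> norm (g (s n) x - h0 x) < e"
 proof (rule Arzela_Ascoli[of "cball (0 :: complex^'n) r" g "((1 - r\<^sup>2) / 2) powr (- l) * K1"])
  have r2: "0 < 1 - r\<^sup>2" using r by (simp add: abs_square_less_1)
  show "norm (g n x) \<le> ((1 - r\<^sup>2) / 2) powr (- l) * K1" if x: "x \<in> cball 0 r" for n x
  proof -
   have x1: "norm x < 1" using x r by simp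
   show ?thesis
    unfolding rep[OF x1]
   proof (rule diffle)
    fix w :: "complex^'n" assume w: "norm w < 1"
    have "(norm x)\<^sup>2 \<le> r\<^sup>2" using x by (intro power_mono) auto
    then have hx: "1 - r\<^sup>2 \<le> hgt x" by (simp add: hgt_def)
    have "norm (bkern l x w) \<le> (hgt x / 2) powr (- l)" using w l by (intro norm_bkern_le x1) auto
    also have "\<dots> \<le> ((1 - r\<^sup>2) / 2) powr (- l)" using r2 hx l by (intro powr_mono2') auto
    finally show "norm (bkern l x w) \<le> ((1 - r\<^sup>2) / 2) powr (- l)" .
   qed auto
  qed
  have "uniformly_continuous_on (cball 0 r \<times> cball 0 1) (\<lambda>x :: (complex^'n) \<times> (complex^'n). bkern l (fst x) (snd x))"
   by (intro compact_uniformly_continuous continuous_bkern r compact_Times compact_cball)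
  note uc = this[unfolded uniformly_continuous_on_def, rule_format]
  show "\<exists>d>0. \<forall>n y. y \<in> cball 0 r \<and> norm (x - y) < d --> norm (g n x - g n y) < e" if x: "x \<in> cball 0 r" and e: "0 < e" for x e
  proof -
   have e': "0 < e / (K1 + 1)" using e K10 by simp
   obtain d where d: "0 < d" "\<And>x x' :: (complex^'n) \<times> (complex^'n). x \<in> cball 0 r \<times> cball 0 1 ==> x' \<in> cball 0 r \<times> cball 0 1 ==> dist x' x < d ==>
     dist (bkern l (fst x') (snd x')) (bkern l (fst x) (snd x)) < e / (K1 + 1)"
    using uc[OF e'] by blast
   show ?thesis
   proof (intro exI[of _ d] conjI d(1) allI impI)
    fix n and y :: "complex^'n" assume "y \<in> cball 0 r \<and> norm (x - y) < d"
    then have y: "y \<in> cball 0 r" "norm (x - y) < d" by auto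
    have xy: "norm x < 1" "norm y < 1" using x y r by auto
    have "g n x - g n y = (\<integral>w. g n w * (bkern l x w - bkern l y w) \<partial>vol)"
     unfolding rep[OF xy(1)] rep[OF xy(2)] right_diff_distrib using ki[OF xy(1)] ki[OF xy(2)] by simp
    also have "norm \<dots> \<le> e / (K1 + 1) * K1"
    proof (rule diffle)
     fix w :: "complex^'n" assume w: "norm w < 1"
     have "dist (x, w) (y, w) < d" using y by (simp add: dist_Pair_Pair dist_norm)
     then show "norm (bkern l x w - bkern l y w) \<le> e / (K1 + 1)"
      using d(2)[of "(y, w)" "(x, w)"] x y w by (simp add: dist_norm)
    qed (use e' in auto)
    also have "\<dots> < e" using e K10 by (simp add: field_simps)
    finally show "norm (g n x - g n y) < e" .
   qed
  qed
 qed ((rule that; assumption) | simp)+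
 define h where "h z = indicator (ball 0 r) z *\<^sub>R h0 z" for z
 have "continuous_on (ball 0 r) h0" using h0 by (rule continuous_on_subset) auto
 then have hm [measurable]: "h \<in> borel_fun"
  unfolding h_def[abs_def] by (intro borel_measurable_continuous_on_indicator) auto
 have conv: "\<exists>N. \<forall>k\<ge>N. Np (\<lambda>z. inner_cut r z * g (s k) z - h z) \<le> ennreal e" if e: "0 < e" for e
 proof -
  define d where "d = e powr (1 / p)"
  have d: "0 < d" "d powr p = e" using e p by (auto simp: d_def powr_powr)
  obtain N where N: "\<And>k x. N \<le> k ==> x \<in> cball 0 r ==> norm (g (s k) x - h0 x) < d" using lim[OF d(1)] by blast
  have "Np (\<lambda>z. inner_cut r z * g (s k) z - h z) \<le> ennreal e" if k: "N \<le> k" for k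
  proof -
   have "Np (\<lambda>z. inner_cut r z * g (s k) z - h z) \<le> (\<integral>\<^sup>+z. ennreal (d powr p) \<partial>vol)"
    unfolding Np_def
   proof (intro nn_integral_mono ennreal_leI powr_mono2)
    fix z :: "complex^'n"
    show "norm (inner_cut r z * g (s k) z - h z) \<le> d"
     using N[OF k, of z] d by (cases "norm z < r") (auto simp: inner_cut_def h_def)
   qed (use p in auto)
   also have "\<dots> = ennreal e" using emeasure_bergman_UNIV[OF \<alpha>, where 'n='n] d by simp
   finally show ?thesis .
  qed
  then show ?thesis by blast
 qed
 have "h \<in> lp"
 proof -
  obtain N where N: "\<And>k. N \<le> k ==> Np (\<lambda>z. inner_cut r z * g (s k) z - h z) \<le> ennreal 1" using conv[of 1] by auto
  have "(\<lambda>z. inner_cut r z * g (s N) z - h z) \<in> lp"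
   by (rule Lp_I) (use N[of N] in \<open>auto intro: le_less_trans\<close>)
  from Lp_diff[OF cut_Lp(2)[OF bergman_spaceD(1)[OF g]] this, of r "s N"] show ?thesis by simp
 qed
 then show ?thesis using that s conv by blast
qed

lemma ess_le_c:
 obtains K where "0 < K" "\<And>S :: (complex^'n => complex) => (complex^'n => complex). S \<in> Bops ==>
  ess_norm p \<alpha> S \<le> ereal K * c_quantity p \<alpha> S"
proof -
 note bP = bounded_map_bproj
 obtain C where C: "1 \<le> C" "\<And>g. g \<in> lp ==> Np (bproj g) \<le> ennreal C * Np g"
  using bounded_map_bound[OF bP] by blast
 have PA: "bproj g \<in> Ap" if "g \<in> lp" for g
  by (rule bker_op_bergman[OF near_id_id that])
 define K where "K = C powr (1 / p)"
 have K: "0 < K" "K powr p = C" using C p by (auto simp: K_def powr_powr)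
 show ?thesis
 proof (rule that[OF K(1)])
  fix S assume S: "S \<in> Bops"
  obtain B where B: "1 \<le> B" "\<And>f. f \<in> Ap ==> Np (S f) \<le> ennreal B * Np f" using bounded_ops_Np[OF S] by blast
  have SA: "S f \<in> Ap" if "f \<in> Ap" for f by (rule bounded_opsD(1)[OF S that])
  show "ess_norm p \<alpha> S \<le> ereal K * c_quantity p \<alpha> S"
  proof (rule ereal_le_scale[OF _ c_quantity_nonneg[OF S] K(1)])
   fix t :: real assume t: "0 < t" "c_quantity p \<alpha> S < ereal t"
   obtain r1 where r1: "r1 < 1" "\<And>r' f. r1 \<le> r' ==> f \<in> Ap ==> Np (outer r' \<cdot> S f) \<le> ennreal (t powr p) * Np f"
    using c_quantity_lessD[OF S t(2,1)] by blast
   define r where "r = max r1 0"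
   have r: "0 \<le> r" "r < 1" "r1 \<le> r" using r1 by (auto simp: r_def)
   define Q where "Q f = bproj (inner_cut r \<cdot> S f)" for f
   have iL: "(inner_cut r \<cdot> S f) \<in> lp" and oL: "(outer r \<cdot> S f) \<in> lp" if "f \<in> Ap" for f
    using cut_Lp[OF bergman_spaceD(1)[OF SA[OF that]]] by auto
   have Qb: "Q \<in> Bops"
   proof (rule bounded_opsI[where K="C * B"])
    show "Q f \<in> Ap" if "f \<in> Ap" for f unfolding Q_def by (rule PA[OF iL[OF that]])
    show "Q (\<lambda>z. c * f z + g z) = (\<lambda>z. c * Q f z + Q g z)" if f: "f \<in> Ap" and g: "g \<in> Ap" for f g c
     using bounded_mapD(2)[OF bP iL[OF f] iL[OF g], of c] unfolding Q_def bounded_opsD(2)[OF S f g] by (simp add: algebra_simps)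
    show "Np (Q f) \<le> ennreal (C * B) * Np f" if "f \<in> Ap" for f
     unfolding Q_def by (rule ennreal_mult_le_trans[OF C(2)[OF iL[OF that]] order.trans[OF Np_cut_le(2) B(2)[OF that]]]) (use B C in auto)
   qed (use B C in auto)
   have Qc: "Q \<in> compact_ops p \<alpha>"
    unfolding compact_ops_def
   proof (intro CollectI conjI Qb allI impI)
    fix f :: "nat => complex^'n => complex" assume "\<forall>k. f k \<in> Ap \<and> lpnorm (f k) \<le> 1"
    then have f: "f k \<in> Ap" "Np (f k) \<le> 1" for k
     using Lp_norm_le_iff[of 1 "f k"] by (auto simp: one_ereal_def)
    have NB: "Np (S (f k)) \<le> ennreal B" for k
    proof -
     have "Np (S (f k)) \<le> ennreal B * Np (f k)" by (rule B(2)[OF f(1)])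
     also have "\<dots> \<le> ennreal B * 1" by (intro mult_left_mono f) simp
     finally show ?thesis by simp
    qed
    have B0: "0 \<le> B" using B(1) by simp
    obtain s :: "nat => nat" and h where s: "strict_mono s" and h: "h \<in> lp"
     and conv: "\<And>e. 0 < e ==> \<exists>N. \<forall>k\<ge>N. Np (\<lambda>z. inner_cut r z * S (f (s k)) z - h z) \<le> ennreal e"
     by (rule bergman_normal_family[where g="\<lambda>k. S (f k)", OF SA[OF f(1)] B0 NB r(1,2)]) (rule that, assumption+)
    \<comment> \<open>The limit \<open>h\<close> of the cut functions is only in L^p. Its projection
      is the limit in the Bergman space, by continuity of the projection.\<close>
    have "(\<lambda>k. lpnorm (\<lambda>z. Q (f (s k)) z - bproj h z)) \<longlonglongrightarrow> 0"
    proof (rule order_tendstoI)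
     show "eventually (\<lambda>k. a < lpnorm (\<lambda>z. Q (f (s k)) z - bproj h z)) sequentially" if "a < 0" for a
      using that Lp_norm_nonneg by (intro always_eventually allI) (rule less_le_trans)
     fix a :: ereal assume "0 < a"
     then obtain d where d: "0 < d" "ereal d < a" using ereal_dense2[of 0 a] by auto
     obtain N where N: "\<And>k. N \<le> k ==> Np (\<lambda>z. inner_cut r z * S (f (s k)) z - h z) \<le> ennreal (d powr p / C)"
      using conv[of "d powr p / C"] d C by auto
     have "lpnorm (\<lambda>z. Q (f (s k)) z - bproj h z) \<le> ereal d" if k: "N \<le> k" for k
     proof -
      have eq: "(\<lambda>z. Q (f (s k)) z - bproj h z) = bproj (\<lambda>z. inner_cut r z * S (f (s k)) z - h z)"
       unfolding Q_def by (rule bounded_mapD(4)[OF bP h iL[OF f(1)], symmetric])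
      note dL = Lp_diff[OF iL[OF f(1)] h, of "s k"]
      have "Np (\<lambda>z. Q (f (s k)) z - bproj h z) \<le> ennreal C * Np (\<lambda>z. inner_cut r z * S (f (s k)) z - h z)"
       unfolding eq by (rule C(2)[OF dL])
      also have "\<dots> \<le> ennreal C * ennreal (d powr p / C)" by (intro mult_left_mono N k) simp
      also have "\<dots> = ennreal (d powr p)" using C by (simp flip: ennreal_mult)
      finally show ?thesis
       using bergman_spaceD(4)[OF PA[OF dL]] d unfolding Lp_norm_le_iff[OF less_imp_le[OF d(1)]] eq by simp
     qed
     then show "eventually (\<lambda>k. lpnorm (\<lambda>z. Q (f (s k)) z - bproj h z) < a) sequentially"
      using d(2) by (auto simp: eventually_sequentially intro: le_less_trans)
    qed
    then show "\<exists>s g. strict_mono s \<and> g \<in> Ap \<and> (\<lambda>k. lpnorm (\<lambda>z. Q (f (s k)) z - g z)) \<longlonglongrightarrow> 0"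
     using s PA[OF h] by blast
   qed
   have eq: "(\<lambda>z. S f z - Q f z) = bproj (outer r \<cdot> S f)" if f: "f \<in> Ap" for f
   proof -
    have "S f = bproj (S f)" by (simp add: bergman_projection_reproduces[OF SA[OF f]])
    also have "\<dots> = bproj (\<lambda>z. inner_cut r z * S f z + outer r z * S f z)" by (simp flip: cut_split_fun)
    also have "\<dots> = (\<lambda>z. Q f z + bproj (outer r \<cdot> S f) z)"
     unfolding Q_def by (rule bounded_mapD(3)[OF bP iL[OF f] oL[OF f]])
    finally have sum: "S f z = Q f z + bproj (outer r \<cdot> S f) z" for z by (rule fun_cong)
    show ?thesis
    proof
     show "S f z - Q f z = bproj (outer r \<cdot> S f) z" for z
      unfolding diff_eq_eq by (rule trans[OF sum add.commute])
    qed
   qed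
   have hom: "homogeneous_op (\<lambda>f z. S f z - Q f z)"
    unfolding homogeneous_op_def
   proof (intro ballI conjI allI)
    fix f and c assume f: "f \<in> Ap"
    show "(\<lambda>z. S f z - Q f z) \<in> borel_fun" unfolding eq[OF f] by (rule bergman_spaceD(4)[OF PA[OF oL[OF f]]])
    show "(\<lambda>z. S (\<lambda>z. c * f z) z - Q (\<lambda>z. c * f z) z) = (\<lambda>z. c * (S f z - Q f z))"
     by (simp add: bounded_opsD(4)[OF S f] bounded_opsD(4)[OF Qb f] algebra_simps)
   qed
   have "opnorm (\<lambda>f z. S f z - Q f z) \<le> ereal (K * t)"
   proof (subst op_norm_le_iff[OF _ hom], use K t in simp, intro ballI)
    fix f assume f: "f \<in> Ap"
    show "Np (\<lambda>z. S f z - Q f z) \<le> ennreal ((K * t) powr p) * Np f"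
     unfolding eq[OF f]
     by (rule ennreal_mult_le_trans[OF C(2)[OF oL[OF f]] r1(2)[OF r(3) f]]) (use C K t in \<open>auto simp: powr_mult\<close>)
   qed
   then show "ess_norm p \<alpha> S \<le> ereal (K * t)" unfolding ess_norm_def using Qc by (intro INF_lower2)
  qed
 qed
qed

end

section \<open>Assembling the comparisons\<close>

lemma ereal_scale_mono:
 fixes x y :: ereal
 assumes "x \<le> ereal a * y" "a \<le> b" "0 \<le> y"
 shows "x \<le> ereal b * y"
 using assms(1) by (rule order.trans) (intro ereal_mult_right_mono, use assms in auto)

theorem theorem5p3:
 fixes p \<alpha> :: real
 assumes "1 < p" and "-1 < \<alpha>"
 shows "\<exists>C :: real. 0 < C \<and>
  (\<forall>\<rho> (D :: nat \<Rightarrow> (complex^'n) set) w. admissible_lattice p \<alpha> \<rho> D w \<longrightarrow>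
   (\<forall>S \<in> toeplitz_algebra p \<alpha>.
    let quantities = {a_quantity p \<alpha> (lattice_measure \<alpha> D w) S, b_quantity p \<alpha> S,
             c_quantity p \<alpha> S, ess_norm p \<alpha> S}
    in \<forall>x \<in> quantities. \<forall>y \<in> quantities. x \<le> ereal C * y))"
proof -
 interpret bergman p \<alpha> "TYPE('n)" by unfold_locales (rule assms)+
 show ?thesis
 proof (rule c_le_a, rule c_le_b, rule ess_le_c, goal_cases)
  case (1 Ka Kb Ke)
  \<comment> \<open>The constant 4 is that of \<open>a_le_c\<close> and \<open>c_le_ess\<close>, and
    it also covers the constant 1 of \<open>b_le_c\<close>. Since any two quantities are compared
    through \<open>c\<close>, the final constant is the product \<open>K * K\<close>.\<close>
  define K where "K = Max {4, Ka, Kb, Ke}"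
  have K: "4 \<le> K" "Ka \<le> K" "Kb \<le> K" "Ke \<le> K" by (auto simp: K_def)
  show ?thesis
  proof (intro exI[of _ "K * K"] conjI allI impI ballI)
   show "0 < K * K" using K by simp
   fix \<rho> and D :: "nat => (complex^'n) set" and w and S :: "(complex^'n => complex) => (complex^'n => complex)"
   assume L: "admissible_lattice p \<alpha> \<rho> D w" and ST: "S \<in> toeplitz_algebra p \<alpha>"
   interpret bergman_lattice p \<alpha> "TYPE('n)" \<rho> D w by unfold_locales (rule L)
   have S: "S \<in> bounded_ops p \<alpha>" using toeplitz_algebra_tame[OF ST] by simp
   define Y where "Y = {a_quantity p \<alpha> (lattice_measure \<alpha> D w) S, b_quantity p \<alpha> S, c_quantity p \<alpha> S, ess_norm p \<alpha> S}"
   note nn = a_quantity_nonneg[of S] b_quantity_nonneg[of S] c_quantity_nonneg[OF S] ess_norm_nonneg[of S]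
   have below: "x \<le> ereal K * c_quantity p \<alpha> S" if "x \<in> Y" for x
    using that ereal_scale_mono[OF a_le_c[OF ST] K(1) nn(3)] ereal_scale_mono[OF b_le_c[OF S] _ nn(3), of K]
     ereal_scale_mono[OF _ _ nn(3), of "c_quantity p \<alpha> S" 1 K] ereal_scale_mono[OF 1(6)[OF S] K(4) nn(3)] K(1)
    by (auto simp: Y_def simp flip: one_ereal_def)
   have above: "c_quantity p \<alpha> S \<le> ereal K * y" if "y \<in> Y" for y
    using that ereal_scale_mono[OF 1(2)[OF L ST] K(2) nn(1)] ereal_scale_mono[OF 1(4)[OF L ST] K(3) nn(2)]
     ereal_scale_mono[OF _ _ nn(3), of "c_quantity p \<alpha> S" 1 K] ereal_scale_mono[OF c_le_ess[OF S] K(1) nn(4)] K(1)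
    by (auto simp: Y_def simp flip: one_ereal_def)
   have "x \<le> ereal (K * K) * y" if x: "x \<in> Y" and y: "y \<in> Y" for x y
   proof -
    have "x \<le> ereal K * c_quantity p \<alpha> S" by (rule below[OF x])
    also have "\<dots> \<le> ereal K * (ereal K * y)" using K by (intro ereal_mult_left_mono above y) auto
    finally show ?thesis by (simp flip: mult.assoc)
   qed
   then show "let quantities = {a_quantity p \<alpha> (lattice_measure \<alpha> D w) S, b_quantity p \<alpha> S, c_quantity p \<alpha> S, ess_norm p \<alpha> S}
     in \<forall>x \<in> quantities. \<forall>y \<in> quantities. x \<le> ereal (K * K) * y"
    unfolding Let_def Y_def[symmetric] by blast
  qed
 qed
qed

end
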